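(* Let $(\Gamma,d_0)$ be a compact metric space with $d_0\le1$. Let $\Xi$ be a point process on $\Gamma$ with finite nonzero mean measure $\lambda$ and $\mathrm{Var}(|\Xi|)<\infty$, such that $\mathrm{Var}(|\Xi|)\ge\mathbb E|\Xi|$ and $\Xi$ satisfies the type-I local dependence with type-I neighbourhoods $\{A_x\},\{B_x\}$. Let $u>0$, let $\mathcal G=\{G_1,\dots,G_k\}$ be a Borel partition of $\Gamma$ with designated centers $t_1,\dots,t_k$, and let $$\nu(dx)=\frac{\lambda(dx)}{|\lambda|},\qquad b=\frac{\mathrm{Var}(|\Xi|)-\mathbb E|\Xi|}{\mathrm{Var}(|\Xi|)},\qquad a=(1-b)|\lambda|.$$ Then $$d_2(\mathcal L\Xi,\boldsymbol\pi_{a,b;0;\nu})\le 2d_0(\mathcal G)+\int_\Gamma\mathbb E\Big[(1+b)\big(\epsilon_{1,y}(\Xi_y)+\epsilon_{1,y}(\Xi)\big)+b\,\bar r_y(\Xi)\,\Xi_y(A_y)+b\,\epsilon_{2,y}(\Xi_y)\Big]\lambda(dy).$$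
   Context: $\mathcal H$ is the set of finite nonnegative-integer-valued Borel measures (configurations) on $\Gamma$, $|\xi|$ is the total mass of $\xi$, and $\mathcal H$ carries the smallest $\sigma$-algebra $\mathscr B(\mathcal H)$ making $\xi\mapsto\xi(C)$ measurable for all Borel $C\subset\Gamma$. A point process is an $\mathcal H$-valued random element; $\lambda(dx)=\mathbb E\,\Xi(dx)$. $\xi|_B$ denotes the restriction, $\xi|_B(C)=\xi(B\cap C)$. $\mathcal L$ denotes distribution. Metrics: for $\xi=\sum_{i=1}^n\delta_{x_i}$, $\eta=\sum_{i=1}^n\delta_{y_i}$ with $n\ge1$, $d_1(\xi,\eta)=\min_\sigma\frac1n\sum_{i}d_0(x_i,y_{\sigma(i)})$ over permutations; $d_1=1$ if total masses differ; $d_1=0$ if both are empty. $d_2(\mathbf P,\mathbf Q)=\sup_{f\in\mathcal F}|\mathbf P(f)-\mathbf Q(f)|$, where $\mathcal F$ is the set of $f:\mathcal H\to\mathbb R$ with $|f(\xi)-f(\eta)|\le d_1(\xi,\eta)$ for all $\xi,\eta$. Polynomial birth-death point process: for $a>0$, $0\le b<1$, $\beta\ge0$ and a probability measure $\nu$ on $\Gamma$, $\boldsymbol\pi_{a,b;\beta;\nu}=\mathcal L(\sum_{i=1}^Z\delta_{U_i})$, where $Z$ has the invariant distribution of the birth-death process on $\{0,1,2,\dots\}$ with birth rates $\alpha_k=a+bk$ and death rates $\beta_k=k+\beta k(k-1)$, independent of the i.i.d. $U_i\sim\nu$. Reduced Palm processes $\{\Xi_x\}$ of $\Xi$: $\mathbb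 E\int_\Gamma f(x,\Xi-\delta_x)\,\Xi(dx)=\int_\Gamma\mathbb E f(x,\Xi_x)\,\lambda(dx)$ for all measurable $f:\Gamma\times\mathcal H\to[0,\infty)$. Type-I neighbourhood: a family $\{A_x:x\in\Gamma\}$ of Borel sets with $x\in A_x$ such that $(x,\xi)\mapsto(x,\xi|_{A_x^c})$ is product measurable. $\Xi$ satisfies the type-I local dependence if there exist type-I neighbourhoods $\{A_x\},\{B_x\}$ with $A_x\subset B_x$ such that, for all $x\in\Gamma$: $\mathcal L(\Xi_x|_{A_x^c})=\mathcal L(\Xi|_{A_x^c})$; $\Xi|_{B_x^c}$ is independent of $\Xi|_{A_x}$; and $\Xi_x|_{B_x^c}$ is independent of $\Xi_x|_{A_x}$. Partition: the center $t_i\in\Gamma$ (not necessarily in $G_i$) is chosen so that $\sup_{s\in G_i}d_0(s,t_i)$ is as small as possible; $d_0(\mathcal G)=\max_{1\le i\le k}\sup_{s\in G_i}d_0(s,t_i)$; and $\mathscr M_{\mathcal G}\circ\eta=\sum_{i=1}^k\eta(G_i)\delta_{t_i}$ for $\eta\in\mathcal H$. Let $\mathcal F_{TV}$ be the set of indicator functions of sets in $\mathscr B(\mathcal H)$. For $\Psi$ equal to $\Xi$ or $\Xi_x$ define the random variable $$r_x(\Psi)=4\,\mathbb P\Big(\Psi(B_x^c)+1\le\tfrac au\,\Big|\,\Psi|_{B_x}\Big)+\frac{4u+10}{a}\max_{1\le j\le k}\sup_{f\in\mathcal F_{TV}}\Big|\mathbb E\big[f(\mathscr M_{\mathcal G}\circ(\Psi|_{B_x^c}))-f(\mathscr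 M_{\mathcal G}\circ(\Psi|_{B_x^c})+\delta_{t_j})\,\big|\,\Psi|_{B_x}\big]\Big|$$ (conditional quantities are computed with regular conditional distributions), and let the number $\bar r_x(\Psi)$ be given by the same formula with the conditional probability and expectations replaced by unconditional ones. Put $$\epsilon_{1,x}(\Psi)=r_x(\Psi)\Psi(A_x)\Psi(B_x\setminus A_x)+\tfrac12\bar r_x(\Psi)[\Psi(A_x)+1]\Psi(A_x)+\Psi(A_x)\,\mathbb E[r_x(\Xi)\Xi(B_x)],$$ $$\epsilon_{2,x}(\Psi)=r_x(\Psi)\Psi(B_x\setminus A_x)+\bar r_x(\Psi)+\mathbb E[r_x(\Xi)\Xi(B_x)].$$ *)

theory Defs
  imports "HOL-Probability.Probability"
begin

section \<open>Configurations\<close>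

text \<open>Finiteness needs no separate clause: the values of \<^term>\<open>of_nat :: nat \<Rightarrow> ennreal\<close> are finite.\<close>

definition configs :: "'a::metric_space measure set" where
  "configs = {\<xi>. sets \<xi> = sets borel \<and> (\<forall>C\<in>sets borel. emeasure \<xi> C \<in> range (of_nat :: nat \<Rightarrow> ennreal))}"

definition config_algebra :: "'a::metric_space measure measure" where
  "config_algebra = sigma configs
     {{\<xi> \<in> configs. emeasure \<xi> C \<in> S} | C S. C \<in> sets borel \<and> S \<in> sets borel}"

definition mass :: "'a measure \<Rightarrow> real" where
  "mass \<xi> = measure \<xi> UNIV"

definition restr :: "'a measure \<Rightarrow> 'a set \<Rightarrow> 'a measure" where
  "restr \<xi> B = density \<xi> (indicator B)"

text \<open>The sum of the Dirac measures at \<open>x 0, \<dots>, x (n - 1)\<close>, as the image of the counting measure.\<close>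

definition points :: "nat \<Rightarrow> (nat \<Rightarrow> 'a::metric_space) \<Rightarrow> 'a measure" where
  "points n x = distr (count_space {..<n}) borel x"

definition add_point :: "'a::metric_space measure \<Rightarrow> 'a \<Rightarrow> 'a measure" where
  "add_point \<xi> x = measure_of UNIV (sets borel) (\<lambda>C. emeasure \<xi> C + indicator C x)"

text \<open>If \<open>\<xi>\<close> has no atom at \<open>x\<close>, the set function below need not be a measure and
  \<^const>\<open>measure_of\<close> may return the zero measure. This only happens for \<open>x\<close> in a \<open>\<xi>\<close>-null set.\<close>

definition del_point :: "'a::metric_space measure \<Rightarrow> 'a \<Rightarrow> 'a measure" where
  "del_point \<xi> x = measure_of UNIV (sets borel) (\<lambda>C. emeasure \<xi> C - indicator C x)"

section \<open>Metrics\<close>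

text \<open>The set of costs is finite and nonempty, and it does not depend on the enumerations
  \<open>x\<close>, \<open>y\<close> of the points, so that the infimum is the minimum over the permutations \<open>\<sigma>\<close>.\<close>

definition d1 :: "'a::metric_space measure \<Rightarrow> 'a measure \<Rightarrow> real" where
  "d1 \<xi> \<eta> =
    (if mass \<xi> \<noteq> mass \<eta> then 1
     else if mass \<xi> = 0 then 0
     else Inf {(\<Sum>i<n. dist (x i) (y (\<sigma> i))) / real n | n x y \<sigma>.
                 \<xi> = points n x \<and> \<eta> = points n y \<and> \<sigma> permutes {..<n}})"

definition lip_d1 :: "('a::metric_space measure \<Rightarrow> real) set" where
  "lip_d1 = {f. \<forall>\<xi>\<in>configs. \<forall>\<eta>\<in>configs. \<bar>f \<xi> - f \<eta>\<bar> \<le> d1 \<xi> \<eta>}"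

definition d2 :: "'a::metric_space measure measure \<Rightarrow> 'a measure measure \<Rightarrow> real" where
  "d2 P Q = (SUP f\<in>lip_d1. \<bar>(\<integral>\<xi>. f \<xi> \<partial>P) - (\<integral>\<xi>. f \<xi> \<partial>Q)\<bar>)"

section \<open>Polynomial birth-death point processes\<close>

text \<open>Generator matrix of the birth-death process with birth rates \<open>\<alpha>\<close> and death rates \<open>\<delta>\<close>
  (it is understood that \<open>\<delta> 0 = 0\<close>).\<close>

definition bd_generator :: "(nat \<Rightarrow> real) \<Rightarrow> (nat \<Rightarrow> real) \<Rightarrow> nat \<Rightarrow> nat \<Rightarrow> real" where
  "bd_generator \<alpha> \<delta> i j =
    (if j = Suc i then \<alpha> i else if i = Suc j then \<delta> i else if i = j then - (\<alpha> i + \<delta> i) else 0)"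

text \<open>Invariance of a distribution \<open>p\<close> under the process with generator \<open>Q\<close>: \<open>p Q = 0\<close>.\<close>

definition bd_invariant :: "(nat \<Rightarrow> real) \<Rightarrow> (nat \<Rightarrow> real) \<Rightarrow> nat pmf \<Rightarrow> bool" where
  "bd_invariant \<alpha> \<delta> p \<longleftrightarrow> (\<forall>j. (\<lambda>i. pmf p i * bd_generator \<alpha> \<delta> i j) sums 0)"

definition pbd_pmf :: "real \<Rightarrow> real \<Rightarrow> real \<Rightarrow> nat pmf" where
  "pbd_pmf a b \<beta> = (THE p. bd_invariant (\<lambda>k. a + b * real k)
                                 (\<lambda>k. real k + \<beta> * real k * (real k - 1)) p)"

definition pbd_process ::
  "real \<Rightarrow> real \<Rightarrow> real \<Rightarrow> 'a::metric_space measure \<Rightarrow> 'a measure measure" where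
  "pbd_process a b \<beta> \<nu> =
     distr (measure_pmf (pbd_pmf a b \<beta>) \<Otimes>\<^sub>M PiM (UNIV :: nat set) (\<lambda>_. \<nu>)) config_algebra
       (\<lambda>(z, U). points z U)"

section \<open>Point processes, Palm processes and local dependence\<close>

definition point_process :: "'w measure \<Rightarrow> ('w \<Rightarrow> 'a::metric_space measure) \<Rightarrow> bool" where
  "point_process P \<Psi> \<longleftrightarrow> prob_space P \<and> \<Psi> \<in> measurable P config_algebra"

definition mean_measure :: "'w measure \<Rightarrow> ('w \<Rightarrow> 'a::metric_space measure) \<Rightarrow> 'a measure" where
  "mean_measure P \<Psi> = measure_of UNIV (sets borel) (\<lambda>C. \<integral>\<^sup>+\<omega>. emeasure (\<Psi> \<omega>) C \<partial>P)"

text \<open>The requirement that \<open>x \<mapsto> \<L>(\<Psi> x)\<close> be a probability kernel is what makes the right-hand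
  side of the defining identity meaningful for every measurable \<open>f\<close>.\<close>

definition reduced_palm ::
  "'w measure \<Rightarrow> ('w \<Rightarrow> 'a::metric_space measure) \<Rightarrow> ('a \<Rightarrow> 'w \<Rightarrow> 'a measure) \<Rightarrow> bool" where
  "reduced_palm P \<Xi> \<Psi> \<longleftrightarrow>
     (\<forall>x. point_process P (\<Psi> x)) \<and>
     (\<lambda>x. distr P config_algebra (\<Psi> x)) \<in> measurable borel (prob_algebra config_algebra) \<and>
     (\<forall>f :: 'a \<times> 'a measure \<Rightarrow> real.
        f \<in> borel_measurable (borel \<Otimes>\<^sub>M config_algebra) \<longrightarrow> (\<forall>z. 0 \<le> f z) \<longrightarrow>
        (\<integral>\<^sup>+\<omega>. (\<integral>\<^sup>+x. ennreal (f (x, del_point (\<Xi> \<omega>) x)) \<partial>\<Xi> \<omega>) \<partial>P) =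
        (\<integral>\<^sup>+x. (\<integral>\<^sup>+\<omega>. ennreal (f (x, \<Psi> x \<omega>)) \<partial>P) \<partial>mean_measure P \<Xi>))"

definition type_I_nbhd :: "('a::metric_space \<Rightarrow> 'a set) \<Rightarrow> bool" where
  "type_I_nbhd A \<longleftrightarrow>
     (\<forall>x. A x \<in> sets borel \<and> x \<in> A x) \<and>
     (\<lambda>(x, \<xi>). (x, restr \<xi> (- A x)))
        \<in> measurable (borel \<Otimes>\<^sub>M config_algebra) (borel \<Otimes>\<^sub>M config_algebra)"

text \<open>Type-I local dependence of \<open>\<Xi>\<close>, with reduced Palm processes \<open>\<Psi>\<close>, witnessed by the
  neighbourhoods \<open>A\<close> and \<open>B\<close>.\<close>

definition type_I_dependence ::
  "'w measure \<Rightarrow> ('w \<Rightarrow> 'a::metric_space measure) \<Rightarrow> ('a \<Rightarrow> 'w \<Rightarrow> 'a measure)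
     \<Rightarrow> ('a \<Rightarrow> 'a set) \<Rightarrow> ('a \<Rightarrow> 'a set) \<Rightarrow> bool" where
  "type_I_dependence P \<Xi> \<Psi> A B \<longleftrightarrow>
     type_I_nbhd A \<and> type_I_nbhd B \<and> (\<forall>x. A x \<subseteq> B x) \<and>
     (\<forall>x. distr P config_algebra (\<lambda>\<omega>. restr (\<Psi> x \<omega>) (- A x)) =
          distr P config_algebra (\<lambda>\<omega>. restr (\<Xi> \<omega>) (- A x)) \<and>
          prob_space.indep_var P config_algebra (\<lambda>\<omega>. restr (\<Xi> \<omega>) (- B x))
                                 config_algebra (\<lambda>\<omega>. restr (\<Xi> \<omega>) (A x)) \<and>
          prob_space.indep_var P config_algebra (\<lambda>\<omega>. restr (\<Psi> x \<omega>) (- B x))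
                                 config_algebra (\<lambda>\<omega>. restr (\<Psi> x \<omega>) (A x)))"

text \<open>\<open>\<kappa>\<close> is a regular conditional distribution of \<open>X\<close> given \<open>Y\<close>.\<close>

definition reg_cond_distr ::
  "'w measure \<Rightarrow> 'b measure \<Rightarrow> ('w \<Rightarrow> 'b) \<Rightarrow> 'c measure \<Rightarrow> ('w \<Rightarrow> 'c) \<Rightarrow> ('c \<Rightarrow> 'b measure) \<Rightarrow> bool"
  where
  "reg_cond_distr P M X N Y \<kappa> \<longleftrightarrow>
     \<kappa> \<in> measurable N (prob_algebra M) \<and>
     (\<forall>S\<in>sets M. \<forall>T\<in>sets N.
        emeasure P {\<omega> \<in> space P. X \<omega> \<in> S \<and> Y \<omega> \<in> T} =
        (\<integral>\<^sup>+y. emeasure (\<kappa> y) S * indicator T y \<partial>distr P N Y))"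

section \<open>Partitions and the error terms\<close>

definition borel_partition :: "nat \<Rightarrow> (nat \<Rightarrow> 'a::metric_space set) \<Rightarrow> bool" where
  "borel_partition k G \<longleftrightarrow>
     (\<forall>i\<in>{1..k}. G i \<in> sets borel \<and> G i \<noteq> {}) \<and> disjoint_family_on G {1..k} \<and>
     (\<Union>i\<in>{1..k}. G i) = UNIV"

definition radius :: "'a::metric_space set \<Rightarrow> 'a \<Rightarrow> real" where
  "radius S t = (SUP s\<in>S. dist s t)"

definition centers :: "nat \<Rightarrow> (nat \<Rightarrow> 'a::metric_space set) \<Rightarrow> (nat \<Rightarrow> 'a) \<Rightarrow> bool" where
  "centers k G t \<longleftrightarrow> (\<forall>i\<in>{1..k}. \<forall>t'. radius (G i) (t i) \<le> radius (G i) t')"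

definition mesh :: "nat \<Rightarrow> (nat \<Rightarrow> 'a::metric_space set) \<Rightarrow> (nat \<Rightarrow> 'a) \<Rightarrow> real" where
  "mesh k G t = Max ((\<lambda>i. radius (G i) (t i)) ` {1..k})"

definition coarsen ::
  "nat \<Rightarrow> (nat \<Rightarrow> 'a::metric_space set) \<Rightarrow> (nat \<Rightarrow> 'a) \<Rightarrow> 'a measure \<Rightarrow> 'a measure" where
  "coarsen k G t \<eta> =
     measure_of UNIV (sets borel) (\<lambda>C. \<Sum>i=1..k. emeasure \<eta> (G i) * indicator C (t i))"

definition F_TV :: "('a::metric_space measure \<Rightarrow> real) set" where
  "F_TV = {indicator S | S. S \<in> sets config_algebra}"

text \<open>The value of \<open>r\<^sub>x(\<Psi>)\<close> when the (conditional) law of \<open>\<Psi>\<close> is \<open>\<mu>\<close>; here \<open>B = B\<^sub>x\<close>. Inserting a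
  regular conditional distribution of \<open>\<Psi>\<close> given \<open>\<Psi>|\<^bsub>B\<^esub>\<close> gives the random variable \<open>r\<^sub>x(\<Psi>)\<close>,
  inserting the law of \<open>\<Psi>\<close> gives its unconditional counterpart.\<close>

definition r_of_law ::
  "real \<Rightarrow> real \<Rightarrow> nat \<Rightarrow> (nat \<Rightarrow> 'a::metric_space set) \<Rightarrow> (nat \<Rightarrow> 'a) \<Rightarrow> 'a set
     \<Rightarrow> 'a measure measure \<Rightarrow> real" where
  "r_of_law a u k G t B \<mu> =
     4 * measure \<mu> {\<eta> \<in> space \<mu>. measure \<eta> (- B) + 1 \<le> a / u} +
     (4 * u + 10) / a *
       Max ((\<lambda>j. SUP f\<in>F_TV.
               \<bar>\<integral>\<eta>. f (coarsen k G t (restr \<eta> (- B)))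
                    - f (add_point (coarsen k G t (restr \<eta> (- B))) (t j)) \<partial>\<mu>\<bar>) ` {1..k})"

text \<open>Values of the error terms at a realization \<open>\<psi>\<close> of \<open>\<Psi>\<close>, where \<open>r\<close> is the corresponding
  value of \<open>r\<^sub>x(\<Psi>)\<close>, \<open>rbar\<close> its unconditional counterpart, \<open>m = E[r\<^sub>x(\<Xi>) \<Xi>(B\<^sub>x)]\<close>, \<open>A = A\<^sub>x\<close>
  and \<open>B = B\<^sub>x\<close>.\<close>

definition eps1 :: "real \<Rightarrow> real \<Rightarrow> real \<Rightarrow> 'a set \<Rightarrow> 'a set \<Rightarrow> 'a measure \<Rightarrow> real" where
  "eps1 r rbar m A B \<psi> =
     r * measure \<psi> A * measure \<psi> (B - A) + 1 / 2 * rbar * (measure \<psi> A + 1) * measure \<psi> A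
     + measure \<psi> A * m"

definition eps2 :: "real \<Rightarrow> real \<Rightarrow> real \<Rightarrow> 'a set \<Rightarrow> 'a set \<Rightarrow> 'a measure \<Rightarrow> real" where
  "eps2 r rbar m A B \<psi> = r * measure \<psi> (B - A) + rbar + m"

end

(* The method is Stein's, applied to configurations moved to the centers t_1, ..., t_k, which are
   finite multisets. Let gen be the generator of the process on multisets in which points with law
   nu are added at rate a + b|M| and every point dies at rate 1; the approximating law is invariant
   for it. For a test function f we use the bounded solution h of the resolvent equation
   rho h - gen h = f and not the Stein equation itself. It exists for every rho > 0, its first and
   second differences are bounded uniformly in rho, and rho h disappears as rho tends to 0.

   The bounds are |Dh| <= 1/(1-b), |D^2 h| <= 2 and |D^2 h(M)| <= 5/a + 2/(|M|+1). They follow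
   from a maximum principle for suprema over configurations of given size. The third bound
   exceeds (2u+5)/a only if |M|+1 <= a/u, hence r_x bounds the change of E D^2 h(M) when one point
   is added to the configuration M outside B_x.

   Palm calculus turns E gen h(Xi) into the integral over lambda(dy) of
     b E[g(Xi_y + delta_y) - g(Xi)] - E[Dh(Xi_y; y) - Dh(Xi; y)],
   where g is the nu-average of Dh. The points in B_y - A_y are removed conditionally on the
   configuration in B_y, and those in A_y by independence, so that the same process outside A_y
   remains for Xi and Xi_y. All second differences that appear on the way are replaced by one
   constant K, whose total coefficient b - (1-b)(E|Xi_y| - E|Xi|) integrates to zero because
   b = (Var|Xi| - E|Xi|) / Var|Xi|. *)

theory Submission
  imports Defs "HOL-Library.Multiset"
begin

text \<open>The resolvent is used because \<open>\<rho> * h\<close> is bounded a priori: suprema of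
  differences of \<open>h\<close> are finite from the start, and the maximum principle needs a
  positive \<open>\<rho>\<close>. No process has to be constructed, and a supersolution that does
  not contain \<open>\<rho>\<close> gives a bound that does not either. Taking suprema over all
  configurations of one size turns equations on multisets into inequalities on numbers, for which
  explicit supersolutions exist. For \<open>b > 0\<close> an added point has offspring, so second
  differences are taken with respect to two finite families of points; two single points do not give
  a closed system. Moving to the centers costs the mesh twice, once for each law. In return the
  multisets that occur form a countable set: every function of them is measurable, conditioning
  becomes summation, and a total variation distance is a supremum over countably many test sets.
  Conditional and unconditional laws both occur in the bound, so each smoothness estimate is proved
  for an arbitrary law of configurations.\<close>

section \<open>A maximum principle\<close>

text \<open>Since \<open>w\<close> is bounded and \<open>V\<close> has finite sublevel sets, a
  positive supremum of \<open>w - \<epsilon> * V\<close> is attained. At a maximum point every rate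
  multiplies a nonpositive increment, while \<open>sub\<close> and \<open>super\<close> bound
  \<open>\<rho>\<close> times the maximum by that sum. \<open>sub\<close> is required only where
  \<open>w\<close> is positive, so states at which \<open>w \<le> 0\<close> is known can be
  ignored.\<close>

lemma max_principle:
  fixes w V :: "'s \<Rightarrow> real" and rate :: "nat \<Rightarrow> 's \<Rightarrow> real" and tr :: "nat \<Rightarrow> 's \<Rightarrow> 's"
  assumes rho: "\<rho> > 0" and bdd: "\<And>s. w s \<le> C" and V_nonneg: "\<And>s. 0 \<le> V s"
    and fin: "\<And>R. finite {s. V s \<le> R}"
    and rate: "\<And>e s. 0 \<le> rate e s"
    and super: "\<And>s. (\<Sum>e<K. rate e s * (V (tr e s) - V s)) \<le> \<rho> * V s"
    and sub: "\<And>s. 0 < w s \<Longrightarrow> \<rho> * w s \<le> (\<Sum>e<K. rate e s * (w (tr e s) - w s))"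
  shows "w s0 \<le> 0"
proof (rule ccontr)
  assume "\<not> w s0 \<le> 0"
  then have pos: "w s0 > 0" by simp
  \<comment> \<open>So small that half of \<open>w s0\<close> survives at \<open>s0\<close>; the
    summand 1 covers \<open>V s0 = 0\<close>.\<close>
  define \<epsilon> where "\<epsilon> = w s0 / (2 * (V s0 + 1))"
  have V1: "V s0 + 1 > 0" using V_nonneg[of s0] by linarith
  have \<epsilon>: "\<epsilon> > 0" unfolding \<epsilon>_def using pos V1 by simp
  define \<phi> where "\<phi> s = w s - \<epsilon> * V s" for s
  have "\<epsilon> * V s0 \<le> \<epsilon> * (V s0 + 1)" using \<epsilon> by simp
  also have "\<dots> = w s0 / 2" unfolding \<epsilon>_def using V1 by (simp add: field_simps)
  finally have \<phi>0: "\<phi> s0 > 0" unfolding \<phi>_def using pos by linarith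
  define S where "S = {s. V s \<le> C / \<epsilon>}"
  have inS: "s \<in> S" if "\<phi> s > 0" for s
  proof -
    have "\<epsilon> * V s < C" using that bdd[of s] unfolding \<phi>_def by linarith
    then show ?thesis unfolding S_def using \<epsilon> by (simp add: field_simps)
  qed
  have "finite S" "S \<noteq> {}" using fin inS[OF \<phi>0] unfolding S_def by auto
  then obtain s1 where s1: "s1 \<in> S" "\<And>s. s \<in> S \<Longrightarrow> \<phi> s \<le> \<phi> s1"
  proof -
    have "Max (\<phi> ` S) \<in> \<phi> ` S" using \<open>finite S\<close> \<open>S \<noteq> {}\<close> by simp
    then obtain s1 where s1: "s1 \<in> S" "Max (\<phi> ` S) = \<phi> s1" by auto
    then have "\<phi> s \<le> \<phi> s1" if "s \<in> S" for s using Max_ge[of "\<phi> ` S" "\<phi> s"] that \<open>finite S\<close> by simp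
    with s1(1) show ?thesis using that by blast
  qed
  have \<phi>1: "\<phi> s1 > 0" using s1(2)[OF inS[OF \<phi>0]] \<phi>0 by linarith
  have max: "\<phi> s \<le> \<phi> s1" for s using s1(2)[of s] inS[of s] \<phi>1 by linarith
  have "w s1 > 0" using \<phi>1 V_nonneg[of s1] \<epsilon> unfolding \<phi>_def
    by (smt (verit) mult_nonneg_nonneg)
  have "\<rho> * \<phi> s1 = \<rho> * w s1 - \<epsilon> * (\<rho> * V s1)" unfolding \<phi>_def by (simp add: algebra_simps)
  also have "\<dots> \<le> (\<Sum>e<K. rate e s1 * (w (tr e s1) - w s1)) - \<epsilon> * (\<Sum>e<K. rate e s1 * (V (tr e s1) - V s1))"
    using sub[OF \<open>w s1 > 0\<close>] mult_left_mono[OF super[of s1], of \<epsilon>] \<epsilon> by linarith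
  also have "\<dots> = (\<Sum>e<K. rate e s1 * (\<phi> (tr e s1) - \<phi> s1))"
    unfolding \<phi>_def sum_distrib_left sum_subtractf[symmetric]
    by (intro sum.cong refl) (simp add: algebra_simps)
  also have "\<dots> \<le> 0"
    by (intro sum_nonpos mult_nonneg_nonpos rate) (simp add: max)
  finally show False using \<phi>1 rho by (simp add: mult_le_0_iff)
qed

text \<open>The Lyapunov function is \<open>n + c / \<rho>\<close>: its drift
  \<open>p n - q n\<close> is at most \<open>c\<close>, which \<open>\<rho>\<close> times the
  function dominates. At 0 the truncated \<open>n - 1\<close> is harmless because
  \<open>q 0 = 0\<close>.\<close>

lemma max_principle_nat:
  fixes w p q :: "nat \<Rightarrow> real"
  assumes rho: "\<rho> > 0" and bdd: "\<And>n. w n \<le> C"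
    and p: "\<And>n. 0 \<le> p n" and q: "\<And>n. 0 \<le> q n" and pq: "\<And>n. p n \<le> q n + c" and c: "c \<ge> 0"
    and q0: "q 0 = 0"
    and sub: "\<And>n. 0 < w n \<Longrightarrow> \<rho> * w n \<le> p n * (w (Suc n) - w n) + q n * (w (n - 1) - w n)"
  shows "w n \<le> 0"
proof -
  define rate where "rate e n = (if e = 0 then p n else q n)" for e n :: nat
  define tr where "tr e n = (if e = 0 then Suc n else n - 1)" for e n :: nat
  have two: "(\<Sum>e<2. g e) = g 0 + g (1::nat)" for g :: "nat \<Rightarrow> real" by (simp add: numeral_2_eq_2)
  show ?thesis
  proof (rule max_principle[where K = 2 and V = "\<lambda>n. real n + c / \<rho>" and rate = rate and tr = tr, OF rho bdd])
    show "finite {s. real s + c / \<rho> \<le> R}" for R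
    proof (rule finite_subset)
      show "{s. real s + c / \<rho> \<le> R} \<subseteq> {..nat \<lceil>R - c / \<rho>\<rceil>}" by (auto; linarith)
    qed simp
    fix n
    show "0 \<le> real n + c / \<rho>" using c rho by simp
    show "0 \<le> rate e n" for e unfolding rate_def using p q by simp
    have "q n * (real (n - 1) - real n) = - q n" using q0 by (cases n) auto
    moreover have "\<rho> * (real n + c / \<rho>) = \<rho> * real n + c" using rho by (simp add: field_simps)
    moreover have "0 \<le> \<rho> * real n" using rho by simp
    ultimately show "(\<Sum>e<2. rate e n * (real (tr e n) + c / \<rho> - (real n + c / \<rho>))) \<le> \<rho> * (real n + c / \<rho>)"
      using pq[of n] unfolding two rate_def tr_def by simp
    show "\<rho> * w n \<le> (\<Sum>e<2. rate e n * (w (tr e n) - w n))" if "0 < w n"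
      using sub[OF that] unfolding two rate_def tr_def by simp
  qed
qed

section \<open>Sums over multisets\<close>

lemma abs_sum_mset_le:
  fixes g :: "'a \<Rightarrow> real"
  assumes "\<And>x. x \<in># M \<Longrightarrow> \<bar>g x\<bar> \<le> k x"
  shows "\<bar>\<Sum>x\<in>#M. g x\<bar> \<le> (\<Sum>x\<in>#M. k x)"
  using assms by (induction M) (auto intro: order_trans[OF abs_triangle_ineq] add_mono)

lemma sum_mset_diff_real:
  fixes g k :: "'a \<Rightarrow> real"
  shows "(\<Sum>x\<in>#M. g x - k x) = (\<Sum>x\<in>#M. g x) - (\<Sum>x\<in>#M. k x)"
  by (induction M) auto

lemma sum_mset_const_real: "(\<Sum>x\<in>#M. c) = real (size M) * (c::real)"
  by (induction M) (auto simp: algebra_simps)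

lemma sum_mset_cong':
  "(\<And>x. x \<in># M \<Longrightarrow> g x = k x) \<Longrightarrow> (\<Sum>x\<in>#M. g x) = (\<Sum>x\<in>#M. k x)"
  by (metis image_mset_cong)

lemma sum_del_union:
  fixes \<phi> :: "'a multiset \<Rightarrow> real"
  shows "(\<Sum>z\<in>#M + A. \<phi> (M + A - {#z#})) = (\<Sum>z\<in>#M. \<phi> (M - {#z#} + A)) + (\<Sum>z\<in>#A. \<phi> (M + (A - {#z#})))"
proof -
  have "(\<Sum>z\<in>#M. \<phi> (M + A - {#z#})) = (\<Sum>z\<in>#M. \<phi> (M - {#z#} + A))"
  proof (rule sum_mset_cong')
    fix z assume "z \<in># M"
    from diff_union_single_conv[OF this, of A] show "\<phi> (M + A - {#z#}) = \<phi> (M - {#z#} + A)"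
      by (simp only: add.commute[of M A] add.commute[of "M - {#z#}" A])
  qed
  moreover have "(\<Sum>z\<in>#A. \<phi> (M + A - {#z#})) = (\<Sum>z\<in>#A. \<phi> (M + (A - {#z#})))"
    by (rule sum_mset_cong') (simp only: diff_union_single_conv)
  ultimately show ?thesis by (simp only: image_mset_union sum_mset.union)
qed

lemma sum_del_add_mset:
  fixes \<phi> :: "'a multiset \<Rightarrow> real"
  shows "(\<Sum>z\<in>#add_mset x M. \<phi> (add_mset x M - {#z#})) = \<phi> M + (\<Sum>z\<in>#M. \<phi> (add_mset x (M - {#z#})))"
  using sum_del_union[of \<phi> M "{#x#}"] by simp

section \<open>The Stein equation\<close>

text \<open>\<open>w i\<close> is the probability that a point with law \<open>\<nu>\<close> moves
  to the center \<open>t i\<close>. \<open>f_osc\<close> and \<open>f_loc\<close> are what the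
  Lipschitz condition for \<open>d1\<close> gives on multisets when distances are at most 1:
  replacing one of \<open>n + 1\<close> points moves a configuration by at most
  \<open>1 / (n + 1)\<close>.\<close>

locale stein =
  fixes a b :: real and I :: "'i set" and t :: "'i \<Rightarrow> 'a" and w :: "'i \<Rightarrow> real"
    and f :: "'a multiset \<Rightarrow> real"
  assumes a: "a > 0" and b0: "0 \<le> b" and b1: "b < 1"
    and finI: "finite I" and w: "\<And>i. 0 \<le> w i" and w1: "(\<Sum>i\<in>I. w i) = 1"
    and f_osc: "\<And>M N. \<bar>f M - f N\<bar> \<le> 1"
    and f_loc: "\<And>x y M. \<bar>f (add_mset x M) - f (add_mset y M)\<bar> \<le> 1 / (real (size M) + 1)"
begin

definition av :: "('a \<Rightarrow> real) \<Rightarrow> real" where "av \<phi> = (\<Sum>i\<in>I. w i * \<phi> (t i))"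

lemma av_const [simp]: "av (\<lambda>_. c) = c"
  unfolding av_def using w1 by (simp flip: sum_distrib_right)

lemma av_diff: "av (\<lambda>x. \<phi> x - \<psi> x) = av \<phi> - av \<psi>"
  unfolding av_def by (simp add: right_diff_distrib sum_subtractf)

lemma av_add: "av (\<lambda>x. \<phi> x + \<psi> x) = av \<phi> + av \<psi>"
  unfolding av_def by (simp add: distrib_left sum.distrib)

lemma av_mono: "(\<And>x. \<phi> x \<le> \<psi> x) \<Longrightarrow> av \<phi> \<le> av \<psi>"
  unfolding av_def by (intro sum_mono mult_left_mono w)

lemma av_abs: "(\<And>x. \<bar>\<phi> x\<bar> \<le> c) \<Longrightarrow> \<bar>av \<phi>\<bar> \<le> c"
  using av_mono[of \<phi> "\<lambda>_. c"] av_mono[of "\<lambda>_. - c" \<phi>] by (force simp: abs_le_iff minus_le_iff)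

definition gen :: "('a multiset \<Rightarrow> real) \<Rightarrow> 'a multiset \<Rightarrow> real" where
  "gen h M = (a + b * real (size M)) * (av (\<lambda>x. h (add_mset x M)) - h M)
     + (\<Sum>z\<in>#M. h (M - {#z#}) - h M)"

section \<open>Existence of a bounded solution of the resolvent equation\<close>

definition top_f :: real where "top_f = Sup (range f)"

lemma f_bounds: "f M \<le> top_f" "top_f - 1 \<le> f M"
proof -
  have "f N \<le> f {#} + 1" for N using f_osc[of N "{#}"] by linarith
  then have "bdd_above (range f)" by (intro bdd_aboveI[of _ "f {#} + 1"]) auto
  then show "f M \<le> top_f" unfolding top_f_def by (rule cSUP_upper[rotated]) simp
  have "f N \<le> f M + 1" for N using f_osc[of N M] by linarith
  then have "top_f \<le> f M + 1" unfolding top_f_def by (intro cSUP_least) auto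
  then show "top_f - 1 \<le> f M" by simp
qed

text \<open>The two bounds are recorded with the solution because they make every supremum of
  differences finite, before any estimate uniform in \<open>\<rho>\<close> is available.\<close>

lemma resolvent_exists:
  assumes rho: "\<rho> > 0"
  obtains h where "\<And>M. \<rho> * h M - gen h M = f M" "\<And>M. \<rho> * h M \<le> top_f" "\<And>M. top_f - 1 \<le> \<rho> * h M"
proof -
  define D where "D M = \<rho> + (a + b * real (size M)) + real (size M)" for M :: "'a multiset"
  have D: "D M > 0" for M unfolding D_def using rho a b0 by (simp add: add_pos_nonneg)
  \<comment> \<open>The equation is \<open>h = T h\<close> with \<open>T\<close> monotone, so iterating \<open>T\<close> from the constant
    supersolution \<open>top_f / \<rho>\<close> gives a decreasing sequence.\<close>
  define T where "T h M = (f M + (a + b * real (size M)) * av (\<lambda>x. h (add_mset x M)) + (\<Sum>z\<in>#M. h (M - {#z#}))) / D M"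
    for h M
  have al: "a + b * real (size M) \<ge> 0" for M :: "'a multiset" using a b0 by simp
  have T_mono: "T h M \<le> T h' M" if "\<And>M. h M \<le> h' M" for h h' M
    unfolding T_def using that D[of M] al[of M]
    by (intro divide_right_mono add_mono mult_left_mono av_mono sum_mset_mono) auto
  have T_const: "T (\<lambda>_. c) M = (f M + (D M - \<rho>) * c) / D M" for c M
    unfolding T_def by (simp add: sum_mset_const_real D_def algebra_simps)
  define H where "H n = (T ^^ n) (\<lambda>_. top_f / \<rho>)" for n
  have H_Suc: "H (Suc n) = T (H n)" for n unfolding H_def by simp
  have dec: "H (Suc n) M \<le> H n M" for n M
  proof (induction n arbitrary: M)
    case 0
    have "f M + (D M - \<rho>) * (top_f / \<rho>) \<le> D M * (top_f / \<rho>)"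
      using f_bounds(1)[of M] rho by (simp add: field_simps)
    then show ?case unfolding H_Suc H_def using D[of M] by (simp add: T_const divide_le_eq mult.commute)
  next
    case (Suc n)
    show ?case using T_mono[of "H (Suc n)" "H n" M, OF Suc] by (simp only: H_Suc)
  qed
  have low: "(top_f - 1) / \<rho> \<le> H n M" for n M
  proof (induction n arbitrary: M)
    case 0 show ?case unfolding H_def using rho by (simp add: divide_right_mono)
  next
    case (Suc n)
    have "(top_f - 1) / \<rho> \<le> T (\<lambda>_. (top_f - 1) / \<rho>) M"
    proof -
      have "D M * ((top_f - 1) / \<rho>) \<le> f M + (D M - \<rho>) * ((top_f - 1) / \<rho>)"
      proof -
        have "(D M - \<rho>) * ((top_f - 1) / \<rho>) = D M * ((top_f - 1) / \<rho>) - (top_f - 1)"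
          using rho by (simp only: left_diff_distrib) simp
        then show ?thesis using f_bounds(2)[of M] by linarith
      qed
      then show ?thesis unfolding T_const using D[of M] by (simp add: le_divide_eq mult.commute)
    qed
    also have "\<dots> \<le> T (H n) M" by (rule T_mono) (rule Suc)
    finally show ?case by (simp add: H_Suc)
  qed
  have up: "H n M \<le> top_f / \<rho>" for n M
  proof (induction n)
    case 0 show ?case by (simp add: H_def)
  next
    case (Suc n) then show ?case using dec[of n M] by linarith
  qed
  have "\<exists>l. (\<lambda>n. H n M) \<longlonglongrightarrow> l" for M
  proof -
    have "decseq (\<lambda>n. H n M)" by (rule decseq_SucI) (rule dec)
    then obtain l where "(\<lambda>n. H n M) \<longlonglongrightarrow> l"
      using decseq_convergent[of "\<lambda>n. H n M" "(top_f - 1) / \<rho>"] low by metis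
    then show ?thesis by blast
  qed
  then have "\<exists>h. \<forall>M. (\<lambda>n. H n M) \<longlonglongrightarrow> h M" by (intro choice allI)
  then obtain h where h: "\<And>M. (\<lambda>n. H n M) \<longlonglongrightarrow> h M" by blast
  \<comment> \<open>\<open>I\<close> and all multisets are finite, so \<open>T\<close> consists of
    finite sums and passes to the pointwise limit.\<close>
  have sum_lim: "(\<lambda>n. \<Sum>z\<in>#N. H n (\<phi> z)) \<longlonglongrightarrow> (\<Sum>z\<in>#N. h (\<phi> z))" for N and \<phi> :: "'a \<Rightarrow> 'a multiset"
    by (induction N) (auto intro!: tendsto_add h)
  have "(\<lambda>n. T (H n) M) \<longlonglongrightarrow> T h M" for M
    unfolding T_def av_def using D[of M] by (intro tendsto_intros h sum_lim) auto
  then have hT: "h M = T h M" for M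
    using LIMSEQ_Suc[OF h[of M]] unfolding H_Suc by (rule LIMSEQ_unique[rotated])
  have hD: "h M * D M = f M + (a + b * real (size M)) * av (\<lambda>x. h (add_mset x M)) + (\<Sum>z\<in>#M. h (M - {#z#}))" for M
  proof -
    have "T h M * D M = f M + (a + b * real (size M)) * av (\<lambda>x. h (add_mset x M)) + (\<Sum>z\<in>#M. h (M - {#z#}))"
      using D[of M] unfolding T_def by simp
    then show ?thesis using hT[of M] by simp
  qed
  have "\<rho> * h M - gen h M = f M" for M
    using hD[of M] unfolding gen_def D_def by (simp add: sum_mset_diff_real sum_mset_const_real algebra_simps)
  moreover have "h M \<le> top_f / \<rho>" "(top_f - 1) / \<rho> \<le> h M" for M
    using LIMSEQ_le_const2[OF h[of M]] LIMSEQ_le_const[OF h[of M]] up low by blast+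
  then have "\<rho> * h M \<le> top_f" "top_f - 1 \<le> \<rho> * h M" for M
    using rho by (simp_all add: field_simps)
  ultimately show thesis by (intro that[of h])
qed

end

section \<open>First differences and exchanges of one point\<close>

locale resolvent = stein +
  fixes \<rho> :: real and h :: "'b multiset \<Rightarrow> real"
  assumes rho: "\<rho> > 0" and eq: "\<And>M. \<rho> * h M - gen h M = f M"
    and hi: "\<And>M. \<rho> * h M \<le> top_f" and lo: "\<And>M. top_f - 1 \<le> \<rho> * h M"
begin

text \<open>The difference is \<open>gen h M\<close>: the generator is bounded by the oscillation of
  \<open>f\<close>, independently of \<open>\<rho>\<close>.\<close>

lemma residual_le_1: "\<bar>\<rho> * h M - f M\<bar> \<le> 1"
  using hi[of M] lo[of M] f_bounds[of M] by linarith

text \<open>An a priori bound that explodes as \<open>\<rho>\<close> tends to 0. It makes the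
  suprema of differences bounded, as the maximum principle demands.\<close>

lemma h_diff: "\<bar>h M - h N\<bar> \<le> 1 / \<rho>"
proof -
  have "\<bar>\<rho> * h M - \<rho> * h N\<bar> \<le> 1" using hi[of M] lo[of M] hi[of N] lo[of N] by linarith
  then have "\<bar>\<rho> * (h M - h N)\<bar> \<le> 1" by (simp add: right_diff_distrib)
  then show ?thesis using rho by (simp add: abs_mult le_divide_eq mult.commute)
qed

lemma h_bounded: "\<bar>h M\<bar> \<le> (\<bar>top_f\<bar> + 1) / \<rho>"
proof -
  have "\<bar>\<rho> * h M\<bar> \<le> \<bar>top_f\<bar> + 1" using hi[of M] lo[of M] by linarith
  then show ?thesis using rho by (simp add: abs_mult le_divide_eq mult.commute)
qed

text \<open>\<open>s n\<close> will be a supremum of differences over configurations with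
  \<open>n\<close> points beside a distinguished one, hence the birth rate
  \<open>a + b * (n + 1)\<close>. \<open>k\<close> is the net rate at which the difference is
  destroyed by the death of the distinguished point. \<open>super\<close> does not contain
  \<open>\<rho>\<close>, so the bound \<open>L\<close> is uniform in it.\<close>

lemma killed_bound:
  fixes s L c :: "nat \<Rightarrow> real"
  assumes k: "0 \<le> k" and bdd: "\<And>n. s n \<le> C" and L: "\<And>n. 0 \<le> L n"
    and sub: "\<And>n. (\<rho> + (a + b * (real n + 1)) + real n + k) * s n
      \<le> c n + (a + b * (real n + 1)) * s (Suc n) + real n * s (n - 1)"
    and super: "\<And>n. c n + (a + b * (real n + 1)) * (L (Suc n) - L n) + real n * (L (n - 1) - L n) - k * L n \<le> 0"
  shows "s n \<le> L n"
proof -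
  have "s n - L n \<le> 0"
  proof (rule max_principle_nat[where p = "\<lambda>n. a + b * (real n + 1)" and q = real and c = "a + b", OF rho])
    show "s n - L n \<le> C" for n using bdd[of n] L[of n] by linarith
    show "0 \<le> a + b * (real n + 1)" for n using a b0 by simp
    show "a + b * (real n + 1) \<le> real n + (a + b)" for n
      using mult_right_mono[of b 1 "real n"] b1 by (simp add: algebra_simps)
    show "\<rho> * (s n - L n) \<le> (a + b * (real n + 1)) * (s (Suc n) - L (Suc n) - (s n - L n)) + real n * (s (n - 1) - L (n - 1) - (s n - L n))"
      if "0 < s n - L n" for n
    proof -
      have "0 \<le> \<rho> * L n" "0 \<le> k * (s n - L n)" using rho L k that by simp_all
      then show ?thesis using sub[of n] super[of n] that by (simp add: algebra_simps)
    qed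
  qed (use a b0 in auto)
  then show ?thesis by simp
qed

lemma h_eq_add_mset:
  "(\<rho> + (a + b * (real (size M) + 1)) + real (size M) + 1) * h (add_mset x M)
     = f (add_mset x M) + (a + b * (real (size M) + 1)) * av (\<lambda>u. h (add_mset x (add_mset u M)))
       + h M + (\<Sum>z\<in>#M. h (add_mset x (M - {#z#})))"
proof -
  have "(\<Sum>z\<in>#add_mset x M. h (add_mset x M - {#z#}) - h (add_mset x M))
    = h M + (\<Sum>z\<in>#M. h (add_mset x (M - {#z#}))) - (real (size M) + 1) * h (add_mset x M)"
    unfolding sum_mset_diff_real sum_del_add_mset sum_mset_const_real by simp
  then show ?thesis
    using eq[of "add_mset x M"] unfolding gen_def
    by (simp only: size_add_mset of_nat_Suc add_mset_commute[of _ x M]) (simp add: algebra_simps)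
qed

lemma h_eq:
  "(\<rho> + (a + b * real (size M)) + real (size M)) * h M
     = f M + (a + b * real (size M)) * av (\<lambda>u. h (add_mset u M)) + (\<Sum>z\<in>#M. h (M - {#z#}))"
  using eq[of M] unfolding gen_def sum_mset_diff_real sum_mset_const_real by (simp add: algebra_simps)

text \<open>When the exchanged point itself dies, \<open>h M\<close> remains on both sides and
  cancels: the difference is killed at rate 1. Births have the same rate on both sides because the
  sizes agree, and the source is at most \<open>1 / (n + 1)\<close> by \<open>f_loc\<close>.\<close>

lemma loc_bound:
  fixes L :: "nat \<Rightarrow> real"
  assumes L: "\<And>n. 0 \<le> L n"
    and super: "\<And>n. 1 / (real n + 1) + (a + b * (real n + 1)) * (L (Suc n) - L n) + real n * (L (n - 1) - L n) - L n \<le> 0"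
  shows "\<bar>h (add_mset x M) - h (add_mset y M)\<bar> \<le> L (size M)"
proof -
  define S where "S n = {(M :: 'b multiset, x :: 'b, y :: 'b) | M x y. size M = n}" for n
  define \<phi> where "\<phi> = (\<lambda>(M, x, y). \<bar>h (add_mset x M) - h (add_mset y M)\<bar>)"
  define s where "s n = (SUP z\<in>S n. \<phi> z)" for n
  have \<phi>_le: "\<phi> z \<le> 1 / \<rho>" for z unfolding \<phi>_def by (auto split: prod.split simp: h_diff)
  have ne: "S n \<noteq> {}" for n unfolding S_def using size_replicate_mset[of n x] by blast
  have upper: "\<bar>h (add_mset x M) - h (add_mset y M)\<bar> \<le> s (size M)" for x y M
  proof -
    have "\<phi> (M, x, y) \<le> s (size M)" unfolding s_def
      by (rule cSUP_upper) (auto simp: S_def intro: bdd_aboveI[of _ "1 / \<rho>"] \<phi>_le)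
    then show ?thesis by (simp add: \<phi>_def)
  qed
  have "s n \<le> L n" for n
  proof (rule killed_bound[where c = "\<lambda>n. 1 / (real n + 1)" and C = "1 / \<rho>" and k = 1])
    show "1 / (real n + 1) + (a + b * (real n + 1)) * (L (Suc n) - L n) + real n * (L (n - 1) - L n) - 1 * L n \<le> 0" for n
      using super[of n] by simp
    show "0 \<le> L n" for n by (rule L)
    show "s n \<le> 1 / \<rho>" for n unfolding s_def by (rule cSUP_least[OF ne \<phi>_le])
    fix n
    let ?p = "a + b * (real n + 1)"
    define R where "R = 1 / (real n + 1) + ?p * s (Suc n) + real n * s (n - 1)"
    have p: "0 \<le> ?p" using a b0 by simp
    have D: "\<rho> + ?p + real n + 1 > 0" using rho p by linarith
    have "\<phi> z \<le> R / (\<rho> + ?p + real n + 1)" if "z \<in> S n" for z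
    proof -
      obtain M x y where z: "z = (M, x, y)" and n: "size M = n" using \<open>z \<in> S n\<close> unfolding S_def by auto
      let ?d = "h (add_mset x M) - h (add_mset y M)"
      have "(\<rho> + ?p + real n + 1) * ?d = (f (add_mset x M) - f (add_mset y M))
        + ?p * av (\<lambda>u. h (add_mset x (add_mset u M)) - h (add_mset y (add_mset u M)))
        + (\<Sum>z\<in>#M. h (add_mset x (M - {#z#})) - h (add_mset y (M - {#z#})))"
        using h_eq_add_mset[of M x] h_eq_add_mset[of M y] unfolding av_diff sum_mset_diff_real right_diff_distrib n
        by linarith
      moreover have "\<bar>f (add_mset x M) - f (add_mset y M)\<bar> \<le> 1 / (real n + 1)" using f_loc[of x M y] n by simp
      moreover have "\<bar>av (\<lambda>u. h (add_mset x (add_mset u M)) - h (add_mset y (add_mset u M)))\<bar> \<le> s (Suc n)"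
        by (rule av_abs) (use upper[of x "add_mset _ M" y] n in simp)
      then have "\<bar>?p * av (\<lambda>u. h (add_mset x (add_mset u M)) - h (add_mset y (add_mset u M)))\<bar> \<le> ?p * s (Suc n)"
        using p by (simp add: abs_mult mult_left_mono)
      moreover have "\<bar>\<Sum>z\<in>#M. h (add_mset x (M - {#z#})) - h (add_mset y (M - {#z#}))\<bar> \<le> (\<Sum>z\<in>#M. s (n - 1))"
        by (rule abs_sum_mset_le) (use upper n in \<open>metis size_Diff_singleton\<close>)
      ultimately have "\<bar>(\<rho> + ?p + real n + 1) * ?d\<bar> \<le> R"
        unfolding R_def sum_mset_const_real n by linarith
      then show ?thesis using D unfolding z \<phi>_def by (simp add: abs_mult le_divide_eq mult.commute)
    qed
    then have "s n \<le> R / (\<rho> + ?p + real n + 1)" unfolding s_def by (intro cSUP_least[OF ne])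
    then show "(\<rho> + ?p + real n + 1) * s n \<le> 1 / (real n + 1) + ?p * s (Suc n) + real n * s (n - 1)"
      using D unfolding R_def by (simp add: le_divide_eq mult.commute)
  qed simp
  then show ?thesis using upper[of x M y] by (meson order_trans)
qed

lemma loc_le_1: "\<bar>h (add_mset x M) - h (add_mset y M)\<bar> \<le> 1"
  using loc_bound[of "\<lambda>_. 1"] by (simp add: divide_le_eq_1)

lemma am_gm_ratio: "0 < x \<Longrightarrow> 0 < y \<Longrightarrow> 2 \<le> x / y + y / (x::real)"
proof -
  assume x: "0 < x" and y: "0 < y"
  have "2 * (x * y) \<le> x * x + y * y" using zero_le_power2[of "x - y"] by (simp add: power2_eq_square algebra_simps)
  then show ?thesis using x y by (simp add: field_simps power2_eq_square)
qed

text \<open>The constant \<open>5 / 8\<close>: a function \<open>L n = q / (n + 1) + q / a\<close> satisfies the hypothesis of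
  \<open>loc_bound\<close> if \<open>q * (2 - 1 / a) \<ge> 1\<close>, by the inequality of the means. For \<open>a < 5 / 2\<close> the
  uniform bound on second differences is already at most \<open>5 / a\<close>.\<close>

lemma loc_nonuniform:
  assumes a52: "a \<ge> 5 / 2"
  shows "\<bar>h (add_mset x M) - h (add_mset y M)\<bar> \<le> 5 / 8 * (1 / (real (size M) + 1) + 1 / a)"
proof (rule loc_bound[where L = "\<lambda>n. 5 / 8 * (1 / (real n + 1) + 1 / a)"])
  show "0 \<le> 5 / 8 * (1 / (real n + 1) + 1 / a)" for n using a by simp
  fix n
  let ?n = "real n + 1"
  have n: "?n > 0" by simp
  \<comment> \<open>The deaths contribute at most the first summand of the killing term and are
    cancelled by it. The births and the second summand, \<open>5 / 8 / a\<close>, then have to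
    balance the source, which is \<open>k2\<close>.\<close>
  have e1: "real n * (5 / 8 * (1 / (real (n - 1) + 1) + 1 / a) - 5 / 8 * (1 / ?n + 1 / a)) \<le> 5 / 8 / ?n"
  proof (cases n)
    case (Suc m)
    then have n1: "real (n - 1) + 1 = real n" and "real n > 0" by auto
    have "real n * (5 / 8 * (1 / real n + 1 / a) - 5 / 8 * (1 / ?n + 1 / a)) = 5 / 8 * (real n * (1 / real n) - real n / ?n)"
      by (simp only: right_diff_distrib distrib_left) simp
    also have "\<dots> = 5 / 8 / ?n" using \<open>real n > 0\<close> by (simp add: field_simps)
    finally show ?thesis unfolding n1 by simp
  qed auto
  have e2: "5 / 8 * (1 / (real (Suc n) + 1) + 1 / a) - 5 / 8 * (1 / ?n + 1 / a) = - 5 / 8 / (?n * (?n + 1))"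
  proof -
    have "1 / (x + 1) - 1 / x = - 1 / (x * (x + 1))" if "x > 0" for x :: real using that by (simp add: field_simps)
    from this[OF n] have 1: "1 / (real (Suc n) + 1) = 1 / ?n - 1 / (?n * (?n + 1))" by (simp add: add.commute)
    have "5 / 8 * (p - q + r) - 5 / 8 * (p + r) = - (5 / 8) * q" for p q r :: real by argo
    from this[of "1 / ?n" "1 / (?n * (?n + 1))" "1 / a"] show ?thesis unfolding 1 by simp
  qed
  have k2: "1 / x \<le> 5 / 8 * a / (x * (x + 1)) + 5 / 8 / a" if x: "x > 0" for x :: real
  proof -
    have "5 / 2 \<le> 5 / 4 * (a / (x + 1) + (x + 1) / a)"
    proof -
      have "2 \<le> a / (x + 1) + (x + 1) / a" using am_gm_ratio[OF a, of "x + 1"] x by linarith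
      then show ?thesis by argo
    qed
    moreover have "1 / a \<le> 2 / 5" using a52 a by (simp add: divide_le_eq)
    moreover have "(x + 1) / a = x / a + 1 / a" by (simp add: add_divide_distrib)
    ultimately have "1 \<le> 5 / 8 * (a / (x + 1)) + 5 / 8 * (x / a)" by argo
    then have "1 / x \<le> (5 / 8 * (a / (x + 1)) + 5 / 8 * (x / a)) / x" using x by (simp add: divide_right_mono)
    also have "\<dots> = 5 / 8 * a / (x * (x + 1)) + 5 / 8 / a"
      using x a by (simp add: add_divide_distrib mult.commute)
    finally show ?thesis .
  qed
  have "(a + b * ?n) * (- 5 / 8 / (?n * (?n + 1))) \<le> a * (- 5 / 8 / (?n * (?n + 1)))"
    by (rule mult_right_mono_neg) (use b0 n in \<open>auto simp: divide_nonpos_nonneg\<close>)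
  show "1 / ?n + (a + b * ?n) * (5 / 8 * (1 / (real (Suc n) + 1) + 1 / a) - 5 / 8 * (1 / ?n + 1 / a))
     + real n * (5 / 8 * (1 / (real (n - 1) + 1) + 1 / a) - 5 / 8 * (1 / ?n + 1 / a))
     - 5 / 8 * (1 / ?n + 1 / a) \<le> 0"
  proof -
    have fin: "1 / x + Y + Z - 5 / 8 * (1 / x + 1 / a) \<le> 0"
      if "1 / x \<le> p + 5 / 8 / a" "Y \<le> - p" "Z \<le> 5 / 8 / x" for x p Y Z :: real
      using that by argo
    have "a * (- 5 / 8 / (?n * (?n + 1))) = - (5 / 8 * a / (?n * (?n + 1)))" by simp
    with \<open>(a + b * ?n) * (- 5 / 8 / (?n * (?n + 1))) \<le> _\<close>
    show ?thesis unfolding e2 by (intro fin[OF k2[OF n] _ e1]) simp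
  qed
qed

text \<open>The extra point dies at rate 1 but also gives birth at rate \<open>b\<close>, and such a
  birth creates an additional first difference. The net killing rate is therefore
  \<open>1 - b\<close>, and with source 1 the constant \<open>1 / (1 - b)\<close> is a
  supersolution.\<close>

lemma first_diff_bound: "\<bar>h (add_mset x M) - h M\<bar> \<le> 1 / (1 - b)"
proof -
  define S where "S n = {(M :: 'b multiset, x :: 'b) | M x. size M = n}" for n
  define \<phi> where "\<phi> = (\<lambda>(M, x). \<bar>h (add_mset x M) - h M\<bar>)"
  define s where "s n = (SUP z\<in>S n. \<phi> z)" for n
  have \<phi>_le: "\<phi> z \<le> 1 / \<rho>" for z unfolding \<phi>_def by (auto split: prod.split simp: h_diff)
  have ne: "S n \<noteq> {}" for n unfolding S_def using size_replicate_mset[of n x] by blast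
  have upper: "\<bar>h (add_mset x M) - h M\<bar> \<le> s (size M)" for x M
  proof -
    have "\<phi> (M, x) \<le> s (size M)" unfolding s_def
      by (rule cSUP_upper) (auto simp: S_def intro: bdd_aboveI[of _ "1 / \<rho>"] \<phi>_le)
    then show ?thesis by (simp add: \<phi>_def)
  qed
  have "s n \<le> 1 / (1 - b)" for n
  proof (rule killed_bound[where c = "\<lambda>n. 1" and C = "1 / \<rho>" and L = "\<lambda>_. 1 / (1 - b)" and k = "1 - b"])
    show "s n \<le> 1 / \<rho>" for n unfolding s_def by (rule cSUP_least[OF ne \<phi>_le])
    show "0 \<le> 1 / (1 - b)" using b1 by simp
    show "1 + (a + b * (real n + 1)) * (1 / (1 - b) - 1 / (1 - b)) + real n * (1 / (1 - b) - 1 / (1 - b)) - (1 - b) * (1 / (1 - b)) \<le> 0" for n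
      using b1 by simp
    fix n
    let ?p = "a + b * (real n + 1)"
    define R where "R = 1 + ?p * s (Suc n) + real n * s (n - 1)"
    have p: "0 \<le> ?p" using a b0 by simp
    have D: "\<rho> + ?p + real n + (1 - b) > 0" using rho p b1 by linarith
    have "\<phi> z \<le> R / (\<rho> + ?p + real n + (1 - b))" if "z \<in> S n" for z
    proof -
      obtain M x where z: "z = (M, x)" and n: "size M = n" using \<open>z \<in> S n\<close> unfolding S_def by auto
      let ?d = "h (add_mset x M) - h M"
      let ?A1 = "av (\<lambda>u. h (add_mset x (add_mset u M)) - h (add_mset u M))"
      let ?A2 = "av (\<lambda>u. h (add_mset u (add_mset x M)) - h (add_mset x M))"
      have A2: "?A2 = av (\<lambda>u. h (add_mset x (add_mset u M))) - h (add_mset x M)"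
        unfolding av_diff av_const by (simp only: add_mset_commute[of _ x M])
      have "(\<rho> + ?p + real n + (1 - b)) * ?d = (f (add_mset x M) - f M) + (a + b * real n) * ?A1 + b * ?A2
        + (\<Sum>z\<in>#M. h (add_mset x (M - {#z#})) - h (M - {#z#}))"
        using h_eq_add_mset[of M x] h_eq[of M] unfolding A2 unfolding av_diff sum_mset_diff_real n
        by (simp add: algebra_simps)
      moreover have "\<bar>f (add_mset x M) - f M\<bar> \<le> 1" by (rule f_osc)
      moreover have "\<bar>?A1\<bar> \<le> s (Suc n)" "\<bar>?A2\<bar> \<le> s (Suc n)"
        by (rule av_abs, use upper[of x "add_mset _ M"] upper[of _ "add_mset x M"] n in simp)+
      then have "\<bar>(a + b * real n) * ?A1\<bar> \<le> (a + b * real n) * s (Suc n)" "\<bar>b * ?A2\<bar> \<le> b * s (Suc n)"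
        using a b0 by (simp_all add: abs_mult mult_left_mono mult_nonneg_nonneg)
      moreover have "\<bar>\<Sum>z\<in>#M. h (add_mset x (M - {#z#})) - h (M - {#z#})\<bar> \<le> (\<Sum>z\<in>#M. s (n - 1))"
        by (rule abs_sum_mset_le) (use upper n in \<open>metis size_Diff_singleton\<close>)
      ultimately have "\<bar>(\<rho> + ?p + real n + (1 - b)) * ?d\<bar> \<le> 1 + (a + b * real n) * s (Suc n) + b * s (Suc n) + real n * s (n - 1)"
        unfolding sum_mset_const_real n by linarith
      also have "\<dots> = R" unfolding R_def by (simp add: algebra_simps)
      finally show ?thesis using D unfolding z \<phi>_def by (simp add: abs_mult le_divide_eq mult.commute)
    qed
    then have "s n \<le> R / (\<rho> + ?p + real n + (1 - b))" unfolding s_def by (intro cSUP_least[OF ne])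
    then show "(\<rho> + ?p + real n + (1 - b)) * s n \<le> 1 + ?p * s (Suc n) + real n * s (n - 1)"
      using D unfolding R_def by (simp add: le_divide_eq mult.commute)
  qed (use b1 in simp)
  then show ?thesis using upper[of x M] by (meson order_trans)
qed

end

section \<open>Second differences: a bound uniform in the size\<close>

lemma abs_add_le: "\<bar>x\<bar> \<le> p \<Longrightarrow> \<bar>y\<bar> \<le> q \<Longrightarrow> \<bar>x + y\<bar> \<le> p + (q :: real)"
  by linarith

context resolvent begin

text \<open>\<open>A\<close> and \<open>B\<close> are arbitrary multisets because births caused by
  the added points enlarge them; with single points the equations would not close.\<close>

definition D2 :: "'b multiset \<Rightarrow> 'b multiset \<Rightarrow> 'b multiset \<Rightarrow> real" where
  "D2 M A B = h (M + A + B) - h (M + A) - h (M + B) + h M"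

lemma gen_union:
  "gen h (M + A) = (a + b * (real (size M) + real (size A))) * (av (\<lambda>u. h (add_mset u M + A)) - h (M + A))
     + (\<Sum>z\<in>#M. h (M - {#z#} + A) - h (M + A)) + (\<Sum>z\<in>#A. h (M + (A - {#z#})) - h (M + A))"
  unfolding gen_def using sum_del_union[of "\<lambda>N. h N - h (M + A)" M A] by simp

text \<open>Every point of \<open>M\<close>, \<open>A\<close> and \<open>B\<close> dies at rate 1
  and causes births at rate \<open>b\<close>; the immigration rate \<open>a\<close> belongs to
  \<open>M\<close>. Attributing each newborn point to the part of its parent makes the second
  difference solve an equation on triples of multisets.\<close>

lemma D2_equation:
  "\<rho> * D2 M A B = (f (M + A + B) - f (M + A) - f (M + B) + f M)
     + (a + b * real (size M)) * (av (\<lambda>u. D2 (add_mset u M) A B) - D2 M A B)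
     + b * real (size A) * (av (\<lambda>u. D2 M (add_mset u A) B) - D2 M A B)
     + b * real (size B) * (av (\<lambda>u. D2 M A (add_mset u B)) - D2 M A B)
     + (\<Sum>z\<in>#M. D2 (M - {#z#}) A B - D2 M A B)
     + (\<Sum>z\<in>#A. D2 M (A - {#z#}) B - D2 M A B)
     + (\<Sum>z\<in>#B. D2 M A (B - {#z#}) - D2 M A B)"
proof -
  define m i j where "m = real (size M)" and "i = real (size A)" and "j = real (size B)"
  have 1: "\<rho> * h (M + A + B) = f (M + A + B) + (a + b * (m + i + j)) * (av (\<lambda>u. h (add_mset u (M + A + B))) - h (M + A + B))
     + (\<Sum>z\<in>#M. h (M - {#z#} + A + B) - h (M + A + B))
     + (\<Sum>z\<in>#A. h (M + (A - {#z#}) + B) - h (M + A + B))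
     + (\<Sum>z\<in>#B. h (M + A + (B - {#z#})) - h (M + A + B))"
    using eq[of "M + A + B"] gen_union[of "M + A" B] sum_del_union[of "\<lambda>N. h (N + B) - h (M + A + B)" M A]
    unfolding m_def i_def j_def by simp
  have 2: "\<rho> * h (M + A) = f (M + A) + (a + b * (m + i)) * (av (\<lambda>u. h (add_mset u (M + A))) - h (M + A))
     + (\<Sum>z\<in>#M. h (M - {#z#} + A) - h (M + A)) + (\<Sum>z\<in>#A. h (M + (A - {#z#})) - h (M + A))"
    using eq[of "M + A"] gen_union[of M A] unfolding m_def i_def by simp
  have 3: "\<rho> * h (M + B) = f (M + B) + (a + b * (m + j)) * (av (\<lambda>u. h (add_mset u (M + B))) - h (M + B))
     + (\<Sum>z\<in>#M. h (M - {#z#} + B) - h (M + B)) + (\<Sum>z\<in>#B. h (M + (B - {#z#})) - h (M + B))"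
    using eq[of "M + B"] gen_union[of M B] unfolding m_def j_def by simp
  have 4: "\<rho> * h M = f M + (a + b * m) * (av (\<lambda>u. h (add_mset u M)) - h M) + (\<Sum>z\<in>#M. h (M - {#z#}) - h M)"
    using eq[of M] unfolding gen_def m_def by simp
  show ?thesis
    unfolding m_def[symmetric] i_def[symmetric] j_def[symmetric]
    using 1 2 3 4 unfolding D2_def av_diff av_add sum_mset_diff_real sum_mset.distrib
    by (simp add: algebra_simps)
qed

text \<open>\<open>Q2\<close> is chosen so that, for \<open>b = 1\<close>, it solves the equation of \<open>D2_equation\<close> exactly, with
  source term \<open>2\<close>. Since \<open>Q2\<close> increases in both arguments, it is a supersolution for \<open>b < 1\<close>.\<close>

definition Q2 :: "nat \<Rightarrow> nat \<Rightarrow> real" where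
  "Q2 i j = 2 * (\<Sum>l<i. \<Sum>m<j. 1 / (real (l + m) + 1))"

lemma Q2_nonneg: "0 \<le> Q2 i j"
  unfolding Q2_def by (intro mult_nonneg_nonneg sum_nonneg) auto

lemma Q2_sym: "Q2 i j = Q2 j i"
  unfolding Q2_def by (subst sum.swap) (simp add: add.commute)

lemma Q2_Suc: "Q2 (Suc i) j - Q2 i j = 2 * (\<Sum>m<j. 1 / (real (i + m) + 1))"
  unfolding Q2_def by (simp add: algebra_simps)

text \<open>The inner sums for consecutive \<open>i\<close> differ by a telescoping sum. Adding the
  same identity with \<open>i\<close> and \<open>j\<close> exchanged gives \<open>-2\<close>, which
  balances the source.\<close>

lemma Q2_second_difference:
  assumes "0 < i"
  shows "real i * (Q2 (Suc i) j - Q2 i j) + real i * (Q2 (i - 1) j - Q2 i j) = - 2 * real j / (real i + real j)"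
proof -
  obtain k where k: "i = Suc k" using assms by (cases i) auto
  have tele: "(\<Sum>m<j. 1 / (real (Suc k + m) + 1)) - (\<Sum>m<j. 1 / (real (k + m) + 1))
     = 1 / (real (k + j) + 1) - 1 / (real k + 1)"
    by (induction j) (auto simp: algebra_simps)
  have "(Q2 (Suc i) j - Q2 i j) + (Q2 (i - 1) j - Q2 i j) = 2 * (1 / (real (k + j) + 1) - 1 / (real k + 1))"
    using Q2_Suc[of i j] Q2_Suc[of k j] tele unfolding k by simp
  also have "\<dots> = 2 * (1 / (real i + real j) - 1 / real i)" unfolding k by (simp add: add.commute add.left_commute)
  finally have "real i * (Q2 (Suc i) j - Q2 i j) + real i * (Q2 (i - 1) j - Q2 i j)
     = real i * (2 * (1 / (real i + real j) - 1 / real i))"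
    by (simp only: distrib_left[symmetric])
  also have "\<dots> = 2 * (real i / (real i + real j)) - 2"
    using assms by (simp add: right_diff_distrib)
  also have "real i / (real i + real j) = 1 - real j / (real i + real j)"
    using assms by (simp add: field_simps)
  finally show ?thesis by simp
qed

lemma Q2_super:
  assumes "0 < i" "0 < j"
  shows "2 + b * real i * (Q2 (Suc i) j - Q2 i j) + real i * (Q2 (i - 1) j - Q2 i j)
     + b * real j * (Q2 i (Suc j) - Q2 i j) + real j * (Q2 i (j - 1) - Q2 i j) \<le> 0"
proof -
  have mono: "b * real i * (Q2 (Suc i) j - Q2 i j) \<le> real i * (Q2 (Suc i) j - Q2 i j)" for i j
  proof -
    have "0 \<le> Q2 (Suc i) j - Q2 i j" unfolding Q2_Suc by (intro mult_nonneg_nonneg sum_nonneg) auto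
    then show ?thesis using b1 by (intro mult_right_mono mult_left_le_one_le) (auto simp: b0)
  qed
  have "2 * real j / (real i + real j) + 2 * real i / (real j + real i) = 2"
    using assms by (simp add: add.commute[of "real j"] add_divide_distrib[symmetric] field_simps)
  then show ?thesis
    using mono[of i j] mono[of j i] Q2_second_difference[OF assms(1), of j] Q2_second_difference[OF assms(2), of i]
    unfolding Q2_sym[of j i] Q2_sym[of "Suc j" i] Q2_sym[of "j - 1" i] by simp
qed

text \<open>The maximum principle runs on the triples of sizes. If \<open>A\<close> or
  \<open>B\<close> is empty the second difference vanishes, so the inequality matters only for
  positive \<open>i\<close> and \<open>j\<close>. The source is at most 2, two oscillations of
  \<open>f\<close>. The Lyapunov function is the total size plus \<open>a / \<rho>\<close>; its
  drift is \<open>a - (1 - b) * (n + i + j)\<close>.\<close>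

lemma D2_bound: "\<bar>D2 M A B\<bar> \<le> Q2 (size A) (size B)"
proof -
  define S where "S = (\<lambda>(n, i, j). {(M :: 'b multiset, A :: 'b multiset, B :: 'b multiset) | M A B. size M = n \<and> size A = i \<and> size B = j})"
  define \<phi> where "\<phi> = (\<lambda>(M, A, B). \<bar>D2 M A B\<bar>)"
  define s where "s z = (SUP x\<in>S z. \<phi> x)" for z
  have D2_le: "\<bar>D2 M A B\<bar> \<le> 2 / \<rho>" for M A B
    unfolding D2_def using h_diff[of "M + A + B" "M + A"] h_diff[of "M + B" M] by (simp add: abs_le_iff; linarith)
  have \<phi>_le: "\<phi> x \<le> 2 / \<rho>" for x unfolding \<phi>_def by (auto split: prod.split simp: D2_le)
  have ne: "S z \<noteq> {}" for z
  proof -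
    obtain n i j where z: "z = (n, i, j)" by (cases z)
    have "(replicate_mset n undefined, replicate_mset i undefined, replicate_mset j undefined) \<in> S z"
      unfolding S_def z by simp
    then show ?thesis by blast
  qed
  have upper: "\<bar>D2 M A B\<bar> \<le> s (size M, size A, size B)" for M A B
  proof -
    have "\<phi> (M, A, B) \<le> s (size M, size A, size B)" unfolding s_def
      by (rule cSUP_upper) (auto simp: S_def intro: bdd_aboveI[of _ "2 / \<rho>"] \<phi>_le)
    then show ?thesis by (simp add: \<phi>_def)
  qed
  have s0: "s (n, i, j) = 0" if "i = 0 \<or> j = 0" for n i j
  proof -
    have "\<phi> x = 0" if "x \<in> S (n, i, j)" for x
      using that \<open>i = 0 \<or> j = 0\<close> unfolding S_def \<phi>_def D2_def by auto
    then have "\<phi> ` S (n, i, j) = {0}" using ne[of "(n, i, j)"] by force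
    then show ?thesis unfolding s_def by simp
  qed
  \<comment> \<open>Births and deaths in each of the three parts, with immigration counted in the
    first.\<close>
  define rate :: "nat \<Rightarrow> nat \<times> nat \<times> nat \<Rightarrow> real" where "rate e = (\<lambda>(n, i, j).
    if e = 0 then a + b * real n else if e = 1 then real n else if e = 2 then b * real i else if e = 3 then real i
    else if e = 4 then b * real j else real j)" for e
  define tr :: "nat \<Rightarrow> nat \<times> nat \<times> nat \<Rightarrow> nat \<times> nat \<times> nat" where "tr e = (\<lambda>(n, i, j).
    if e = 0 then (Suc n, i, j) else if e = 1 then (n - 1, i, j) else if e = 2 then (n, Suc i, j)
    else if e = 3 then (n, i - 1, j) else if e = 4 then (n, i, Suc j) else (n, i, j - 1))" for e
  have six: "(\<Sum>e<6. g e) = g 0 + g (1::nat) + g 2 + g 3 + g 4 + g 5" for g :: "nat \<Rightarrow> real"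
    by (simp add: eval_nat_numeral)
  have sub: "\<rho> * s (n, i, j) \<le> 2 + (a + b * real n) * (s (Suc n, i, j) - s (n, i, j)) + real n * (s (n - 1, i, j) - s (n, i, j))
     + b * real i * (s (n, Suc i, j) - s (n, i, j)) + real i * (s (n, i - 1, j) - s (n, i, j))
     + b * real j * (s (n, i, Suc j) - s (n, i, j)) + real j * (s (n, i, j - 1) - s (n, i, j))" for n i j
  proof -
    define R where "R = 2 + (a + b * real n) * s (Suc n, i, j) + b * real i * s (n, Suc i, j) + b * real j * s (n, i, Suc j)
     + real n * s (n - 1, i, j) + real i * s (n, i - 1, j) + real j * s (n, i, j - 1)"
    define D where "D = \<rho> + (a + b * real n) + real n + b * real i + real i + b * real j + real j"
    have D: "D > 0" unfolding D_def using rho a b0 by (simp add: add_pos_nonneg)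
    have "\<phi> x \<le> R / D" if "x \<in> S (n, i, j)" for x
    proof -
      obtain M A B where x: "x = (M, A, B)" by (cases x)
      have sz: "size M = n" "size A = i" "size B = j" using that unfolding S_def x by auto
      have eqD: "D * D2 M A B = (f (M + A + B) - f (M + A) - f (M + B) + f M)
        + (a + b * real n) * av (\<lambda>u. D2 (add_mset u M) A B)
        + b * real i * av (\<lambda>u. D2 M (add_mset u A) B)
        + b * real j * av (\<lambda>u. D2 M A (add_mset u B))
        + (\<Sum>z\<in>#M. D2 (M - {#z#}) A B) + (\<Sum>z\<in>#A. D2 M (A - {#z#}) B) + (\<Sum>z\<in>#B. D2 M A (B - {#z#}))"
        using D2_equation[of M A B] unfolding D_def sum_mset_diff_real sum_mset_const_real sz
        by (simp add: algebra_simps)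
      have 1: "\<bar>f (M + A + B) - f (M + A) - f (M + B) + f M\<bar> \<le> 2"
        using f_osc[of "M + A + B" "M + A"] f_osc[of "M + B" M] by linarith
      have "\<bar>av (\<lambda>u. D2 (add_mset u M) A B)\<bar> \<le> s (Suc n, i, j)"
        by (rule av_abs) (use upper[of "add_mset _ M" A B] sz in simp)
      then have 2: "\<bar>(a + b * real n) * av (\<lambda>u. D2 (add_mset u M) A B)\<bar> \<le> (a + b * real n) * s (Suc n, i, j)"
        using a b0 by (simp add: abs_mult mult_left_mono)
      have "\<bar>av (\<lambda>u. D2 M (add_mset u A) B)\<bar> \<le> s (n, Suc i, j)"
        by (rule av_abs) (use upper[of M "add_mset _ A" B] sz in simp)
      then have 3: "\<bar>b * real i * av (\<lambda>u. D2 M (add_mset u A) B)\<bar> \<le> b * real i * s (n, Suc i, j)"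
        using a b0 by (simp add: abs_mult mult_left_mono)
      have "\<bar>av (\<lambda>u. D2 M A (add_mset u B))\<bar> \<le> s (n, i, Suc j)"
        by (rule av_abs) (use upper[of M A "add_mset _ B"] sz in simp)
      then have 4: "\<bar>b * real j * av (\<lambda>u. D2 M A (add_mset u B))\<bar> \<le> b * real j * s (n, i, Suc j)"
        using a b0 by (simp add: abs_mult mult_left_mono)
      have 5: "\<bar>\<Sum>z\<in>#M. D2 (M - {#z#}) A B\<bar> \<le> (\<Sum>z\<in>#M. s (n - 1, i, j))"
        by (rule abs_sum_mset_le) (use upper sz in \<open>metis size_Diff_singleton\<close>)
      have 6: "\<bar>\<Sum>z\<in>#A. D2 M (A - {#z#}) B\<bar> \<le> (\<Sum>z\<in>#A. s (n, i - 1, j))"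
        by (rule abs_sum_mset_le) (use upper sz in \<open>metis size_Diff_singleton\<close>)
      have 7: "\<bar>\<Sum>z\<in>#B. D2 M A (B - {#z#})\<bar> \<le> (\<Sum>z\<in>#B. s (n, i, j - 1))"
        by (rule abs_sum_mset_le) (use upper sz in \<open>metis size_Diff_singleton\<close>)
      have "\<bar>D * D2 M A B\<bar> \<le> R"
        unfolding eqD R_def by (intro abs_add_le 1 2 3 4 5[unfolded sum_mset_const_real sz]
          6[unfolded sum_mset_const_real sz] 7[unfolded sum_mset_const_real sz])
      then show ?thesis using D unfolding x \<phi>_def by (simp add: abs_mult le_divide_eq mult.commute)
    qed
    then have "s (n, i, j) \<le> R / D" unfolding s_def by (intro cSUP_least[OF ne])
    then have "D * s (n, i, j) \<le> R" using D by (simp add: le_divide_eq mult.commute)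
    then show ?thesis unfolding R_def D_def by (simp add: algebra_simps)
  qed
  define W where "W = (\<lambda>(n :: nat, i, j). s (n, i, j) - Q2 i j)"
  have "W z \<le> 0" for z
  proof (rule max_principle[where K = 6 and rate = rate and tr = tr and \<rho> = \<rho> and C = "2 / \<rho>"
        and V = "\<lambda>(n, i, j). real (n + i + j) + a / \<rho>"])
    fix z :: "nat \<times> nat \<times> nat"
    obtain n i j where z: "z = (n, i, j)" by (cases z)
    show "W z \<le> 2 / \<rho>"
    proof -
      have "s z \<le> 2 / \<rho>" unfolding s_def by (rule cSUP_least[OF ne \<phi>_le])
      then show ?thesis unfolding W_def z using Q2_nonneg[of i j] by simp
    qed
    show "0 \<le> (case z of (n :: nat, i :: nat, j :: nat) \<Rightarrow> real (n + i + j) + a / \<rho>)" unfolding z using a rho by simp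
    show "0 \<le> rate e z" for e unfolding rate_def z using a b0 by simp
    have d: "real k * (real (k - 1) - real k) = - real k" for k by (cases k) auto
    have d1: "real (k - 1) = (if k = 0 then 0 else real k - 1)" for k by (cases k) auto
    have "(\<Sum>e<6. rate e z * ((case tr e z of (n, i, j) \<Rightarrow> real (n + i + j) + a / \<rho>) - (case z of (n :: nat, i :: nat, j :: nat) \<Rightarrow> real (n + i + j) + a / \<rho>)))
      = a - (1 - b) * (real n + real i + real j)"
      unfolding six rate_def tr_def z using d[of n] d[of i] d[of j] by (simp add: algebra_simps)
    also have "\<dots> \<le> \<rho> * (case z of (n :: nat, i :: nat, j :: nat) \<Rightarrow> real (n + i + j) + a / \<rho>)"
    proof -
      have "\<rho> * (real (n + i + j) + a / \<rho>) = \<rho> * real (n + i + j) + a" using rho by (simp add: distrib_left)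
      moreover have "0 \<le> \<rho> * real (n + i + j)" "0 \<le> (1 - b) * (real n + real i + real j)" using rho b1 by simp_all
      ultimately show ?thesis unfolding z by simp
    qed
    finally show "(\<Sum>e<6. rate e z * ((case tr e z of (n, i, j) \<Rightarrow> real (n + i + j) + a / \<rho>) - (case z of (n :: nat, i :: nat, j :: nat) \<Rightarrow> real (n + i + j) + a / \<rho>)))
      \<le> \<rho> * (case z of (n :: nat, i :: nat, j :: nat) \<Rightarrow> real (n + i + j) + a / \<rho>)" .
    show "\<rho> * W z \<le> (\<Sum>e<6. rate e z * (W (tr e z) - W z))" if "0 < W z"
    proof -
      have "\<not> (i = 0 \<or> j = 0)"
        using that s0[of i j n] Q2_nonneg[of i j] unfolding W_def z by fastforce
      then have ij: "0 < i" "0 < j" by simp_all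
      have "0 \<le> \<rho> * Q2 i j" using rho Q2_nonneg by simp
      have e: "r * (p - q - (p' - q')) = r * (p - p') - r * (q - q')" for r p q p' q' :: real
        by (simp add: algebra_simps)
      have rates: "rate 0 z = a + b * real n" "rate 1 z = real n" "rate 2 z = b * real i" "rate 3 z = real i"
        "rate 4 z = b * real j" "rate 5 z = real j"
        and trs: "tr 0 z = (Suc n, i, j)" "tr 1 z = (n - 1, i, j)" "tr 2 z = (n, Suc i, j)" "tr 3 z = (n, i - 1, j)"
        "tr 4 z = (n, i, Suc j)" "tr 5 z = (n, i, j - 1)"
        unfolding rate_def tr_def z by simp_all
      have fin: "\<rho> * (s (n, i, j) - Q2 i j) \<le> (x1 - y1 * (Q2 i j - Q2 i j)) + (x2 - y2 * (Q2 i j - Q2 i j)) + (x3 - y3) + (x4 - y4) + (x5 - y5) + (x6 - y6)"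
        if "\<rho> * s (n, i, j) \<le> 2 + x1 + x2 + x3 + x4 + x5 + x6" "2 + y3 + y4 + y5 + y6 \<le> 0" for x1 x2 x3 x4 x5 x6 y1 y2 y3 y4 y5 y6
        using that \<open>0 \<le> \<rho> * Q2 i j\<close> by (simp add: right_diff_distrib)
      show ?thesis
        unfolding six rates trs unfolding z W_def case_prod_conv e
        by (rule fin[OF sub Q2_super[OF ij]])
    qed
  next
    fix R :: real
    have "{z. (case z of (n :: nat, i :: nat, j :: nat) \<Rightarrow> real (n + i + j) + a / \<rho>) \<le> R}
      \<subseteq> {..nat \<lceil>R\<rceil>} \<times> {..nat \<lceil>R\<rceil>} \<times> {..nat \<lceil>R\<rceil>}"
    proof
      fix z :: "nat \<times> nat \<times> nat"
      obtain n i j where z: "z = (n, i, j)" by (cases z)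
      assume "z \<in> {z. (case z of (n :: nat, i :: nat, j :: nat) \<Rightarrow> real (n + i + j) + a / \<rho>) \<le> R}"
      then have "real (n + i + j) + a / \<rho> \<le> R" unfolding z by simp
      moreover have "0 \<le> a / \<rho>" using a rho by simp
      ultimately have "n + i + j \<le> nat \<lceil>R\<rceil>" by linarith
      then show "z \<in> {..nat \<lceil>R\<rceil>} \<times> {..nat \<lceil>R\<rceil>} \<times> {..nat \<lceil>R\<rceil>}" unfolding z by simp
    qed
    then show "finite {z. (case z of (n :: nat, i :: nat, j :: nat) \<Rightarrow> real (n + i + j) + a / \<rho>) \<le> R}"
      by (rule finite_subset) simp
  qed (rule rho)
  from this[of "(size M, size A, size B)"] upper[of M A B] show ?thesis unfolding W_def by simp
qed

lemma second_diff_le_2: "\<bar>D2 M {#x#} {#y#}\<bar> \<le> 2"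
  using D2_bound[of M "{#x#}" "{#y#}"] by (simp add: Q2_def)

end

section \<open>Second differences: a bound that decreases with the size\<close>

lemma sum_mset_indicator:
  "(\<Sum>z\<in>#M. if P z then 1 else (0 :: real)) = real (size (filter_mset P M))"
  by (induction M) auto

lemma size_diff_remove_le:
  "size (X - (M - {#z#})) \<le> size (X - M) + (if count M z \<le> count X z then 1 else 0)"
proof (cases "count M z \<le> count X z")
  case True
  have "X - (M - {#z#}) \<subseteq># add_mset z (X - M)" by (auto simp: subseteq_mset_def)
  then show ?thesis using True size_mset_mono by fastforce
next
  case False
  then have "X - (M - {#z#}) = X - M" by (intro multiset_eqI) auto
  then show ?thesis using False by simp
qed

text \<open>Removing \<open>z\<close> from \<open>M\<close> enlarges \<open>X - M\<close> only if
  \<open>z\<close> is not in excess in \<open>M\<close>. The points of \<open>M\<close> not in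
  excess form a submultiset of both \<open>M\<close> and \<open>X\<close>, whence the
  minimum.\<close>

lemma sum_size_diff_remove_le:
  "(\<Sum>z\<in>#M. real (size (X - (M - {#z#})))) \<le> real (size M) * real (size (X - M)) + real (min (size M) (size X))"
proof -
  let ?P = "\<lambda>z. count M z \<le> count X z"
  have "(\<Sum>z\<in>#M. real (size (X - (M - {#z#})))) \<le> (\<Sum>z\<in>#M. real (size (X - M)) + (if ?P z then 1 else 0))"
    by (rule sum_mset_mono) (use size_diff_remove_le[of X M] in \<open>smt (verit) of_nat_add of_nat_le_iff of_nat_1 of_nat_0\<close>)
  also have "\<dots> = real (size M) * real (size (X - M)) + real (size (filter_mset ?P M))"
    by (simp add: sum_mset.distrib sum_mset_const_real sum_mset_indicator)
  also have "size (filter_mset ?P M) \<le> min (size M) (size X)"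
  proof -
    have "filter_mset ?P M \<subseteq># X" by (auto simp: subseteq_mset_def)
    then show ?thesis using size_mset_mono size_filter_mset_lesseq[of ?P M] by fastforce
  qed
  finally show ?thesis by simp
qed

context resolvent begin

lemma swap_path:
  assumes "size M = size X" and "size X = Suc n"
    and L: "\<And>x y K. size K = n \<Longrightarrow> \<bar>h (add_mset x K) - h (add_mset y K)\<bar> \<le> L"
  shows "\<bar>h M - h X\<bar> \<le> L * real (size (X - M))"
  using assms(1)
proof (induction "size (X - M)" arbitrary: M)
  case 0
  then have "X \<subseteq># M" by (simp add: Diff_eq_empty_iff_mset)
  then have "X = M" using 0(2) by (metis mset_subset_size nless_le subset_mset.le_less)
  then show ?case using 0 by simp
next
  case (Suc k)
  then obtain y where y: "y \<in># X - M" by (metis size_eq_Suc_imp_elem)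
  have "size (M - X) = size (X - M)"
    using Suc.prems by (metis add_diff_cancel_left' diff_intersect_left_idem inter_subset_eq_union size_Diff_submset subset_mset.inf_commute subset_mset.inf_le1)
  then obtain x where x: "x \<in># M - X" using Suc(2) by (metis size_eq_Suc_imp_elem)
  have cx: "count X x < count M x" and cy: "count M y < count X y" using x y by (simp_all add: in_diff_count)
  define K where "K = M - {#x#}"
  have "x \<in># M" using x by (rule in_diffD)
  then have M: "M = add_mset x K" unfolding K_def by simp
  have K: "size K = n" using Suc.prems assms(2) M by simp
  let ?M' = "add_mset y K"
  have "add_mset y (X - ?M') = X - M"
  proof (rule multiset_eqI)
    fix z show "count (add_mset y (X - ?M')) z = count (X - M) z"
      using cx cy unfolding M by (cases "z = x"; cases "z = y") auto
  qed
  then have sz: "size (X - M) = Suc (size (X - ?M'))" by (metis size_add_mset)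
  have IH: "\<bar>h ?M' - h X\<bar> \<le> L * real (size (X - ?M'))"
    by (rule Suc.hyps(1)) (use sz Suc.hyps(2) Suc.prems M in simp_all)
  have "\<bar>h M - h X\<bar> \<le> L + L * real (size (X - ?M'))"
    using IH L[OF K, of x y] unfolding M by linarith
  then show ?case unfolding sz by (simp add: distrib_left)
qed

text \<open>\<open>s\<close> bounds the cost of moving from size \<open>m\<close> to the size of \<open>X\<close>. Once that size is reached,
  the points outside \<open>X\<close> are exchanged one at a time, each at cost \<open>L\<close>.\<close>

lemma passage_bounds:
  assumes X: "size X = Suc n" and L0: "0 \<le> L"
    and L: "\<And>x y K. size K = n \<Longrightarrow> \<bar>h (add_mset x K) - h (add_mset y K)\<bar> \<le> L"
  obtains s where "\<And>M. \<bar>h M - h X\<bar> \<le> s (size M) + L * real (size (X - M))"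
    and "\<And>m. s m \<le> 1 / \<rho>" and "s (Suc n) \<le> 0"
    and "\<And>m. (a + b * real m + real m) * s m \<le> 1 + (a + b * real m) * s (Suc m) + real m * s (m - 1) + L * real (min m (Suc n))"
proof -
  \<comment> \<open>The cost of the exchanges still to be made is subtracted before the supremum is
    taken, so that \<open>s\<close> satisfies a recursion in the size alone. This cost grows only
    when a point is removed, which yields the term \<open>L * real (min m (Suc n))\<close>.\<close>
  define \<phi> where "\<phi> M = \<bar>h M - h X\<bar> - L * real (size (X - M))" for M
  define s where "s m = (SUP M\<in>{M. size M = m}. \<phi> M)" for m
  have \<phi>_le: "\<phi> M \<le> 1 / \<rho>" for M
    using h_diff[of M X] mult_nonneg_nonneg[OF L0, of "real (size (X - M))"] unfolding \<phi>_def by linarith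
  have ne: "{M :: 'b multiset. size M = m} \<noteq> {}" for m using size_replicate_mset[of m undefined] by blast
  have upper: "\<phi> M \<le> s (size M)" for M unfolding s_def
    by (rule cSUP_upper) (auto intro: bdd_aboveI[of _ "1 / \<rho>"] \<phi>_le)
  have 1: "\<bar>h M - h X\<bar> \<le> s (size M) + L * real (size (X - M))" for M
    using upper[of M] unfolding \<phi>_def by linarith
  have 2: "s m \<le> 1 / \<rho>" for m unfolding s_def by (rule cSUP_least[OF ne \<phi>_le])
  have 3: "s (Suc n) \<le> 0" unfolding s_def
    by (rule cSUP_least[OF ne]) (use swap_path[OF _ X L] X in \<open>auto simp: \<phi>_def\<close>)
  have 4: "(a + b * real m + real m) * s m \<le> 1 + (a + b * real m) * s (Suc m) + real m * s (m - 1) + L * real (min m (Suc n))" for m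
  proof -
    let ?\<alpha> = "a + b * real m"
    define R where "R = 1 + ?\<alpha> * s (Suc m) + real m * s (m - 1) + L * real (min m (Suc n))"
    have al: "0 \<le> ?\<alpha>" and D: "0 < ?\<alpha> + real m" using a b0 by (simp_all add: add_pos_nonneg)
    have "\<phi> M \<le> R / (?\<alpha> + real m)" if "size M = m" for M
    proof -
      let ?d = "real (size (X - M))"
      have "(?\<alpha> + real m) * (h M - h X) = (f M - \<rho> * h M) + ?\<alpha> * av (\<lambda>u. h (add_mset u M) - h X)
          + (\<Sum>z\<in>#M. h (M - {#z#}) - h X)"
        using h_eq[of M] unfolding av_diff av_const sum_mset_diff_real sum_mset_const_real that
        by (simp add: algebra_simps)
      moreover have "\<bar>f M - \<rho> * h M\<bar> \<le> 1" using residual_le_1[of M] by linarith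
      moreover have "\<bar>?\<alpha> * av (\<lambda>u. h (add_mset u M) - h X)\<bar> \<le> ?\<alpha> * (s (Suc m) + L * ?d)"
      proof -
        have "\<bar>av (\<lambda>u. h (add_mset u M) - h X)\<bar> \<le> s (Suc m) + L * ?d"
        proof (rule av_abs)
          fix u
          have "size (X - add_mset u M) \<le> size (X - M)"
            by (rule size_mset_mono) (auto simp: subseteq_mset_def)
          then have "L * real (size (X - add_mset u M)) \<le> L * ?d" using L0 by (simp add: mult_left_mono)
          then show "\<bar>h (add_mset u M) - h X\<bar> \<le> s (Suc m) + L * ?d"
            using 1[of "add_mset u M"] that by simp
        qed
        then show ?thesis using al by (simp add: abs_mult mult_left_mono)
      qed
      moreover have "\<bar>\<Sum>z\<in>#M. h (M - {#z#}) - h X\<bar> \<le> real m * s (m - 1) + (real m * (L * ?d) + L * real (min m (Suc n)))"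
      proof -
        have "\<bar>\<Sum>z\<in>#M. h (M - {#z#}) - h X\<bar> \<le> (\<Sum>z\<in>#M. s (m - 1) + L * real (size (X - (M - {#z#}))))"
          by (rule abs_sum_mset_le) (use 1 that in \<open>metis size_Diff_singleton\<close>)
        also have "\<dots> = real m * s (m - 1) + L * (\<Sum>z\<in>#M. real (size (X - (M - {#z#}))))"
          by (simp add: sum_mset.distrib sum_mset_const_real sum_mset_distrib_left that)
        also have "\<dots> \<le> real m * s (m - 1) + L * (real m * ?d + real (min m (Suc n)))"
          using sum_size_diff_remove_le[of X M] L0 unfolding that X by (intro add_left_mono mult_left_mono)
        finally show ?thesis by (simp add: algebra_simps)
      qed
      ultimately have "\<bar>(?\<alpha> + real m) * (h M - h X)\<bar>
        \<le> 1 + ?\<alpha> * (s (Suc m) + L * ?d) + (real m * s (m - 1) + (real m * (L * ?d) + L * real (min m (Suc n))))"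
        using abs_add_le by metis
      also have "\<dots> = R + (?\<alpha> + real m) * (L * ?d)" unfolding R_def by (simp add: algebra_simps)
      finally have "(?\<alpha> + real m) * \<phi> M \<le> R"
        using D unfolding \<phi>_def right_diff_distrib[of _ "\<bar>_\<bar>"] abs_mult by simp
      then show ?thesis using D by (simp add: le_divide_eq mult.commute)
    qed
    then have "s m \<le> R / (?\<alpha> + real m)" unfolding s_def by (intro cSUP_least[OF ne]) auto
    then show ?thesis using D unfolding R_def by (simp add: le_divide_eq mult.commute)
  qed
  show thesis by (rule that[OF 1 2 3 4])
qed

text \<open>\<open>p\<close> is a cost per unit time divided by a drift. At every size
  \<open>m \<le> n\<close> the upward drift is at least \<open>\<delta>\<close>, so one step up
  costs at most \<open>p\<close>; the induction starts at size 0, where no death occurs. The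
  additional \<open>L\<close> is the exchange cost of the one point of
  \<open>add_mset x M - M\<close>.\<close>

lemma upward_bound:
  assumes n: "size M = n" and drift: "real n < a + b * real n" and L0: "0 \<le> L"
    and L: "\<And>x y K. size K = n \<Longrightarrow> \<bar>h (add_mset x K) - h (add_mset y K)\<bar> \<le> L"
  shows "(a + b * real n - real n) * \<bar>h (add_mset x M) - h M\<bar> \<le> 1 + (a + b * real n) * L"
proof -
  let ?X = "add_mset x M"
  have X: "size ?X = Suc n" using n by simp
  obtain s where s1: "\<And>M. \<bar>h M - h ?X\<bar> \<le> s (size M) + L * real (size (?X - M))"
    and s3: "s (Suc n) \<le> 0"
    and s4: "\<And>m. (a + b * real m + real m) * s m \<le> 1 + (a + b * real m) * s (Suc m) + real m * s (m - 1) + L * real (min m (Suc n))"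
    using passage_bounds[OF X L0 L] by metis
  define \<delta> where "\<delta> = a + b * real n - real n"
  define p where "p = (1 + L * real n) / \<delta>"
  have \<delta>: "\<delta> > 0" using drift unfolding \<delta>_def by simp
  have p0: "p \<ge> 0" unfolding p_def using \<delta> L0 by simp
  have step: "s m \<le> s (Suc m) + p" if "m \<le> n" for m
    using that
  proof (induction m)
    case 0
    have "a * s 0 \<le> 1 + a * s (Suc 0)" using s4[of 0] by simp
    moreover have "1 \<le> a * p"
    proof -
      have "\<delta> \<le> a" unfolding \<delta>_def using mult_right_mono[of b 1 "real n"] b1 by simp
      then have "\<delta> * p \<le> a * p" using p0 by (rule mult_right_mono)
      moreover have "\<delta> * p = 1 + L * real n" unfolding p_def using \<delta> by simp
      ultimately show ?thesis using L0 mult_nonneg_nonneg[OF L0, of "real n"] by linarith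
    qed
    ultimately have "a * s 0 \<le> a * (s (Suc 0) + p)" by (simp add: distrib_left)
    then show ?case using a by simp
  next
    case (Suc k)
    define m where "m = Suc k"
    let ?\<alpha> = "a + b * real m"
    have \<alpha>: "?\<alpha> > 0" using a b0 by (simp add: add_pos_nonneg)
    have mn: "m \<le> n" using Suc.prems m_def by simp
    have "s (m - 1) \<le> s m + p" using Suc m_def by simp
    then have 1: "real m * s (m - 1) \<le> real m * (s m + p)" by (simp add: mult_left_mono)
    have "min m (Suc n) = m" using mn by simp
    then have 2: "(?\<alpha> + real m) * s m \<le> 1 + ?\<alpha> * s (Suc m) + real m * s (m - 1) + L * real m" using s4[of m] by simp
    have "\<delta> \<le> ?\<alpha> - real m"
    proof -
      have "(1 - b) * real m \<le> (1 - b) * real n" using mn b1 by (simp add: mult_left_mono)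
      then show ?thesis unfolding \<delta>_def by (simp add: algebra_simps)
    qed
    then have "\<delta> * p \<le> (?\<alpha> - real m) * p" using p0 by (rule mult_right_mono)
    moreover have "\<delta> * p = 1 + L * real n" unfolding p_def using \<delta> by simp
    moreover have "L * real m \<le> L * real n" using mn L0 by (simp add: mult_left_mono)
    ultimately have 3: "1 + L * real m \<le> (?\<alpha> - real m) * p" by linarith
    have "(?\<alpha> + real m) * s m \<le> ?\<alpha> * s (Suc m) + real m * (s m + p) + (?\<alpha> - real m) * p" using 1 2 3 by linarith
    then have "?\<alpha> * s m \<le> ?\<alpha> * (s (Suc m) + p)" by (simp add: algebra_simps)
    then show ?case using \<alpha> unfolding m_def[symmetric] by simp
  qed
  have "\<bar>h M - h ?X\<bar> \<le> p + L"
  proof -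
    have "size (?X - M) = 1" by simp
    then show ?thesis using s1[of M] step[of n] s3 n by simp
  qed
  then have "\<delta> * \<bar>h ?X - h M\<bar> \<le> \<delta> * (p + L)" using \<delta> by (simp add: abs_minus_commute)
  also have "\<dots> = \<delta> * p + \<delta> * L" by (rule distrib_left)
  also have "\<delta> * p = 1 + L * real n" unfolding p_def using \<delta> by simp
  also have "1 + L * real n + \<delta> * L = 1 + (a + b * real n) * L" unfolding \<delta>_def by (simp add: algebra_simps)
  finally show ?thesis unfolding \<delta>_def .
qed

text \<open>There is no largest size from which an induction could start. Instead, if the step down
  from \<open>n + 2\<close> cost more than \<open>p\<close>, the same would hold at every larger
  size and \<open>s\<close> would grow linearly, against \<open>s m \<le> 1 / \<rho>\<close>. Among
  these sizes the downward drift is smallest at \<open>n + 2\<close>, which is where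
  \<open>\<delta>\<close> is taken.\<close>

lemma downward_bound:
  assumes n: "size X = Suc n" and drift: "a + b * (real n + 2) < real n + 2" and L0: "0 \<le> L"
    and L: "\<And>x y K. size K = n \<Longrightarrow> \<bar>h (add_mset x K) - h (add_mset y K)\<bar> \<le> L"
  shows "(real n + 2 - (a + b * (real n + 2))) * \<bar>h (add_mset y X) - h X\<bar> \<le> 1 + (real n + 1) * L"
proof -
  obtain s where s1: "\<And>M. \<bar>h M - h X\<bar> \<le> s (size M) + L * real (size (X - M))"
    and s2: "\<And>m. s m \<le> 1 / \<rho>" and s3: "s (Suc n) \<le> 0"
    and s4: "\<And>m. (a + b * real m + real m) * s m \<le> 1 + (a + b * real m) * s (Suc m) + real m * s (m - 1) + L * real (min m (Suc n))"
    using passage_bounds[OF n L0 L] by metis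
  define \<delta> where "\<delta> = real n + 2 - (a + b * (real n + 2))"
  define p where "p = (1 + L * (real n + 1)) / \<delta>"
  have \<delta>: "\<delta> > 0" using drift unfolding \<delta>_def by simp
  have \<delta>p: "\<delta> * p = 1 + L * (real n + 1)" unfolding p_def using \<delta> by simp
  have p0: "p > 0" unfolding p_def using \<delta> L0 by (simp add: add_pos_nonneg)
  have "s (Suc (Suc n)) \<le> s (Suc n) + p"
  proof (rule ccontr)
    assume contr: "\<not> s (Suc (Suc n)) \<le> s (Suc n) + p"
    have inc: "s (Suc n + j) + p < s (Suc (Suc n + j))" for j
    proof (induction j)
      case 0 then show ?case using contr by simp
    next
      case (Suc j)
      define m where "m = Suc n + Suc j"
      let ?\<alpha> = "a + b * real m"
      have \<alpha>: "?\<alpha> > 0" using a b0 by (simp add: add_pos_nonneg)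
      have "s (m - 1) \<le> s m - p" using Suc unfolding m_def by simp
      then have 1: "real m * s (m - 1) \<le> real m * (s m - p)" by (simp add: mult_left_mono)
      have "real m * s (m - 1) < real m * (s m - p)" using Suc unfolding m_def by (intro mult_strict_left_mono) auto
      have "min m (Suc n) = Suc n" unfolding m_def by simp
      then have 2: "(?\<alpha> + real m) * s m \<le> 1 + ?\<alpha> * s (Suc m) + real m * s (m - 1) + L * (real n + 1)"
        using s4[of m] by (simp add: add.commute)
      have "\<delta> \<le> real m - ?\<alpha>"
      proof -
        have "(1 - b) * (real n + 2) \<le> (1 - b) * real m" unfolding m_def using b1 by (intro mult_left_mono) auto
        then show ?thesis unfolding \<delta>_def by (simp add: algebra_simps)
      qed
      then have 3: "1 + L * (real n + 1) \<le> (real m - ?\<alpha>) * p" using \<delta>p mult_right_mono[of \<delta> "real m - ?\<alpha>" p] p0 by simp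
      have "(?\<alpha> + real m) * s m < ?\<alpha> * s (Suc m) + real m * (s m - p) + (real m - ?\<alpha>) * p"
        using 2 3 \<open>real m * s (m - 1) < _\<close> by linarith
      then have "?\<alpha> * (s m + p) < ?\<alpha> * s (Suc m)" by (simp add: algebra_simps)
      then show ?case using \<alpha> unfolding m_def by simp
    qed
    have "s (Suc n) + real j * p \<le> s (Suc n + j)" for j
    proof (induction j)
      case (Suc j) then show ?case using inc[of j] by (simp add: algebra_simps)
    qed simp
    then have "real j * p \<le> 1 / \<rho> - s (Suc n)" for j using s2[of "Suc n + j"] by (smt (verit))
    then show False using p0 by (metis reals_Archimedean3 not_le)
  qed
  moreover have "X - add_mset y X = {#}" by (simp add: Diff_eq_empty_iff_mset)
  ultimately have "\<bar>h (add_mset y X) - h X\<bar> \<le> p" using s1[of "add_mset y X"] s3 n by simp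
  then have "\<delta> * \<bar>h (add_mset y X) - h X\<bar> \<le> \<delta> * p" using \<delta> by simp
  then have "\<delta> * \<bar>h (add_mset y X) - h X\<bar> \<le> 1 + (real n + 1) * L" unfolding \<delta>p by (simp only: mult.commute)
  then show ?thesis unfolding \<delta>_def .
qed

lemma D2_singletons: "D2 M {#x#} {#y#} = h (add_mset y (add_mset x M)) - h (add_mset x M) - h (add_mset y M) + h M"
  unfolding D2_def by simp

text \<open>The equation at \<open>add_mset x M\<close> relates two consecutive first differences
  \<open>u\<close> and \<open>v\<close>, up to exchanges of one point. What remains beside
  \<open>u - v\<close> is a first difference multiplied by the drift \<open>\<alpha> - N\<close>.
  The passage bounds control exactly such a product when the step follows the drift:
  \<open>upward_bound\<close> for \<open>v\<close> if \<open>N \<le> \<alpha>\<close>, and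
  \<open>downward_bound\<close> for \<open>u\<close> otherwise.\<close>

lemma second_diff_nonuniform: "\<bar>D2 M {#x#} {#y#}\<bar> \<le> 5 / a + 2 / (real (size M) + 1)"
proof (cases "a \<ge> 5 / 2")
  case False
  then have "2 \<le> 5 / a" using a by (simp add: le_divide_eq)
  moreover have "0 \<le> 2 / (real (size M) + 1)" by simp
  ultimately show ?thesis using second_diff_le_2[of M x y] by linarith
next
  case True
  define n where "n = size M"
  \<comment> \<open>\<open>N\<close> and \<open>\<alpha>\<close> are the death rate and the birth
    rate at the size of \<open>add_mset x M\<close>.\<close>
  define N where "N = real n + 1"
  define \<alpha> where "\<alpha> = a + b * N"
  define L where "L = 5 / 8 * (1 / N + 1 / a)"
  have N: "N \<ge> 1" unfolding N_def by simp
  have \<alpha>: "a \<le> \<alpha>" "\<alpha> > 0" unfolding \<alpha>_def using a b0 N by (simp_all add: add_pos_nonneg)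
  have L0: "0 \<le> L" unfolding L_def using N a by simp
  have loc: "\<bar>h (add_mset x K) - h (add_mset y K)\<bar> \<le> L" if "n \<le> size K" for x y K
  proof -
    have "1 / (real (size K) + 1) \<le> 1 / N" unfolding N_def using that by (intro divide_left_mono) auto
    then show ?thesis using loc_nonuniform[OF True, of x K y] unfolding L_def by argo
  qed
  define u where "u = h (add_mset y (add_mset x M)) - h (add_mset x M)"
  define v where "v = h (add_mset x M) - h M"
  define F where "F = \<rho> * h (add_mset x M) - f (add_mset x M)"
  define e1 where "e1 = av (\<lambda>z. h (add_mset z (add_mset x M)) - h (add_mset y (add_mset x M)))"
  define e2 where "e2 = (\<Sum>z\<in>#M. h (add_mset x (M - {#z#})) - h M)"
  define e3 where "e3 = h (add_mset x M) - h (add_mset y M)"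
  have F: "\<bar>F\<bar> \<le> 1" unfolding F_def by (rule residual_le_1)
  have e1: "\<bar>e1\<bar> \<le> L" unfolding e1_def by (rule av_abs) (simp add: loc n_def)
  have e3: "\<bar>e3\<bar> \<le> L" unfolding e3_def by (simp add: loc n_def)
  have e2: "\<bar>e2\<bar> \<le> 5 / 8 * (1 + real n / a)"
  proof -
    have "\<bar>e2\<bar> \<le> (\<Sum>z\<in>#M. 5 / 8 * (1 / real n + 1 / a))"
      unfolding e2_def
    proof (rule abs_sum_mset_le)
      fix z assume z: "z \<in># M"
      then have "h M = h (add_mset z (M - {#z#}))" by simp
      moreover have "real (size (M - {#z#})) + 1 = real n"
        using z unfolding n_def by (metis Suc_eq_plus1 insert_DiffM of_nat_Suc size_add_mset add.commute)
      ultimately show "\<bar>h (add_mset x (M - {#z#})) - h M\<bar> \<le> 5 / 8 * (1 / real n + 1 / a)"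
        using loc_nonuniform[OF True, of x "M - {#z#}" z] by simp
    qed
    also have "\<dots> = 5 / 8 * (real n * (1 / real n) + real n / a)"
      unfolding sum_mset_const_real n_def by (simp add: algebra_simps)
    also have "\<dots> \<le> 5 / 8 * (1 + real n / a)" by simp
    finally show ?thesis .
  qed
  \<comment> \<open>Each of the \<open>N\<close> deaths contributes \<open>- v\<close> and the
    births \<open>\<alpha> * u\<close>; the exchanges needed for this are collected in
    \<open>e1\<close> and \<open>e2\<close>.\<close>
  have stein: "\<alpha> * (u + e1) - N * v + e2 = F"
  proof -
    have "F = gen h (add_mset x M)" unfolding F_def using eq[of "add_mset x M"] by linarith
    moreover have "av (\<lambda>z. h (add_mset z (add_mset x M))) = e1 + h (add_mset y (add_mset x M))"
      unfolding e1_def av_diff av_const by simp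
    ultimately show ?thesis
      unfolding gen_def sum_mset_diff_real sum_del_add_mset sum_mset_const_real \<alpha>_def N_def u_def v_def e2_def n_def
      by (simp add: algebra_simps)
  qed
  have D2: "D2 M {#x#} {#y#} = (u - v) + e3"
    unfolding D2_singletons u_def v_def e3_def by simp
  have ae1: "\<bar>\<alpha> * e1\<bar> \<le> \<alpha> * L" using e1 \<alpha> by (simp add: abs_mult)
  have invN: "1 / N \<le> 1 / \<alpha>" if "\<alpha> \<le> N" using that \<alpha> N by (intro divide_left_mono) auto
  have inva: "1 / \<alpha> \<le> 1 / a" using \<alpha> a by (intro divide_left_mono) auto
  show ?thesis
  proof (cases "N \<le> \<alpha>")
    case True
    have \<delta>: "\<alpha> - N \<le> a + b * real n - real n" unfolding \<alpha>_def N_def using b1 by (simp add: algebra_simps)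
    have "real n < a + b * real n" using True b1 unfolding \<alpha>_def N_def by (simp add: algebra_simps)
    from upward_bound[OF n_def[symmetric] this L0 loc, of x]
    have "(a + b * real n - real n) * \<bar>v\<bar> \<le> 1 + (a + b * real n) * L" unfolding v_def by simp
    also have "\<dots> \<le> 1 + \<alpha> * L" unfolding \<alpha>_def N_def
      using L0 b0 by (intro add_left_mono mult_right_mono mult_left_mono) auto
    finally have "(\<alpha> - N) * \<bar>v\<bar> \<le> 1 + \<alpha> * L" using mult_right_mono[OF \<delta>, of "\<bar>v\<bar>"] by simp
    then have v: "\<bar>(\<alpha> - N) * v\<bar> \<le> 1 + \<alpha> * L" using True by (simp add: abs_mult)
    have "\<alpha> * (u - v) = F - \<alpha> * e1 - e2 - (\<alpha> - N) * v" using stein by (simp add: algebra_simps)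
    then have "\<bar>\<alpha> * (u - v)\<bar> \<le> 2 + 2 * (\<alpha> * L) + 5 / 8 * (1 + real n / a)"
      using F ae1 e2 v by linarith
    then have "\<bar>u - v\<bar> \<le> (2 + 2 * (\<alpha> * L) + 5 / 8 * (1 + real n / a)) / \<alpha>"
      using \<alpha> by (simp add: abs_mult le_divide_eq mult.commute)
    also have "\<dots> = 2 * (1 / \<alpha>) + 2 * L + 5 / 8 * (1 / \<alpha> + (real n / \<alpha>) * (1 / a))"
      using \<alpha>(2) a by (simp add: field_simps)
    finally have 1: "\<bar>u - v\<bar> \<le> 2 * (1 / \<alpha>) + 2 * L + 5 / 8 * (1 / \<alpha> + (real n / \<alpha>) * (1 / a))" .
    have "real n / \<alpha> \<le> 1" using True \<alpha> N_def by (simp add: divide_le_eq)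
    then have 2: "(real n / \<alpha>) * (1 / a) \<le> 1 / a" using a mult_right_mono[of "real n / \<alpha>" 1 "1 / a"] by simp
    have 3: "1 / \<alpha> \<le> 1 / N" using True N \<alpha> by (intro divide_left_mono) auto
    \<comment> \<open>In units of 1/8 the bound consists of 21 times \<open>1 / \<alpha>\<close>, 15
      times \<open>1 / N\<close> and 20 times \<open>1 / a\<close>. One unit of
      \<open>1 / \<alpha>\<close> is charged to \<open>1 / N\<close> and the other 20 to
      \<open>1 / a\<close>: this is the origin of 2 and 5.\<close>
    have "\<bar>D2 M {#x#} {#y#}\<bar> \<le> 5 * (1 / a) + 2 * (1 / N)"
      using 1 2 3 inva e3 unfolding D2 L_def by argo
    then show ?thesis unfolding N_def n_def by simp
  next
    case False
    have \<delta>: "N - \<alpha> \<le> real n + 2 - (a + b * (real n + 2))" unfolding \<alpha>_def N_def using b1 by (simp add: algebra_simps)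
    have "a + b * (real n + 2) < real n + 2" using False \<delta> by linarith
    from downward_bound[OF _ this L0 loc, of "add_mset x M" y]
    have "(real n + 2 - (a + b * (real n + 2))) * \<bar>u\<bar> \<le> 1 + N * L" unfolding u_def N_def n_def by simp
    then have "(N - \<alpha>) * \<bar>u\<bar> \<le> 1 + N * L" using mult_right_mono[OF \<delta>, of "\<bar>u\<bar>"] by simp
    then have u: "\<bar>(N - \<alpha>) * u\<bar> \<le> 1 + N * L" using False by (simp add: abs_mult)
    have "\<alpha> * L \<le> N * L" using False L0 by (simp add: mult_right_mono)
    moreover have "N * (u - v) = F - \<alpha> * e1 - e2 + (N - \<alpha>) * u" using stein by (simp add: algebra_simps)
    ultimately have "\<bar>N * (u - v)\<bar> \<le> 2 + 2 * (N * L) + 5 / 8 * (1 + real n / a)"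
      using F ae1 e2 u by linarith
    then have "\<bar>u - v\<bar> \<le> (2 + 2 * (N * L) + 5 / 8 * (1 + real n / a)) / N"
      using N by (simp add: abs_mult le_divide_eq mult.commute)
    also have "\<dots> = 2 * (1 / N) + 2 * L + 5 / 8 * (1 / N + (real n / N) * (1 / a))"
      using N a by (simp add: field_simps)
    finally have 1: "\<bar>u - v\<bar> \<le> 2 * (1 / N) + 2 * L + 5 / 8 * (1 / N + (real n / N) * (1 / a))" .
    have "real n / N \<le> 1" using N_def by (simp add: divide_le_eq)
    then have 2: "(real n / N) * (1 / a) \<le> 1 / a" using a mult_right_mono[of "real n / N" 1 "1 / a"] by simp
    have 3: "1 / N \<le> 1 / a" using False \<alpha> a by (intro divide_left_mono) auto
    \<comment> \<open>Here there are 36 units of \<open>1 / N\<close> and 20 of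
      \<open>1 / a\<close>; of the former, 20 are charged to \<open>1 / a\<close>.\<close>
    have "\<bar>D2 M {#x#} {#y#}\<bar> \<le> 5 * (1 / a) + 2 * (1 / N)"
      using 1 2 3 e3 unfolding D2 L_def by argo
    then show ?thesis unfolding N_def n_def by simp
  qed
qed

end

section \<open>Smoothing\<close>

text \<open>\<open>g\<close> is approximated by a step function with about \<open>2 * K * c\<close>
  levels of height \<open>1 / c\<close>. Each level set contributes at most \<open>T / c\<close>, in
  total the length \<open>2 * K\<close> of the range times \<open>T\<close>; the rounding errors
  vanish as \<open>c\<close> grows.\<close>

lemma expectation_diff_le_TV:
  fixes g :: "'b \<Rightarrow> real"
  assumes "prob_space M" and X: "X \<in> measurable M (count_space UNIV)" and Y: "Y \<in> measurable M (count_space UNIV)"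
    and T: "\<And>Q. \<bar>(\<integral>\<omega>. indicator Q (X \<omega>) \<partial>M) - (\<integral>\<omega>. indicator Q (Y \<omega>) \<partial>M)\<bar> \<le> T"
    and g: "\<And>x. \<bar>g x\<bar> \<le> K"
  shows "\<bar>(\<integral>\<omega>. g (X \<omega>) \<partial>M) - (\<integral>\<omega>. g (Y \<omega>) \<partial>M)\<bar> \<le> 2 * K * T"
proof -
  interpret prob_space M by fact
  have K: "0 \<le> K" using g[of undefined] by linarith
  have T0: "0 \<le> T" using T[of "{}"] by simp
  have gm: "(\<lambda>\<omega>. k (Z \<omega>)) \<in> borel_measurable M" if "Z \<in> measurable M (count_space UNIV)" for Z and k :: "'b \<Rightarrow> real"
    by (rule measurable_compose[OF that]) simp
  have "\<bar>(\<integral>\<omega>. g (X \<omega>) \<partial>M) - (\<integral>\<omega>. g (Y \<omega>) \<partial>M)\<bar> \<le> 2 * K * T + (T + 2) * (1 / real (Suc n))" for n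
  proof -
    define c where "c = real (Suc n)"
    have c: "c \<ge> 1" unfolding c_def by simp
    define J where "J = nat \<lceil>2 * K * c\<rceil>"
    have J: "real J \<le> 2 * K * c + 1"
    proof -
      have "0 \<le> 2 * K * c" using K c by simp
      then show ?thesis unfolding J_def by linarith
    qed
    define Q where "Q i = {x. real (Suc i) \<le> (g x + K) * c}" for i
    define k where "k x = (1 / c) * (\<Sum>i<J. indicator (Q i) x) - K" for x
    have count: "(\<Sum>i<J. indicator (Q i) x) = real (nat \<lfloor>(g x + K) * c\<rfloor>)" for x
    proof -
      let ?m = "nat \<lfloor>(g x + K) * c\<rfloor>"
      have nn: "0 \<le> (g x + K) * c" using g[of x] c by (intro mult_nonneg_nonneg) auto
      have "(g x + K) * c \<le> 2 * K * c" using g[of x] c by (intro mult_right_mono) auto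
      then have mJ: "?m \<le> J" unfolding J_def by (meson ceiling_mono floor_le_ceiling nat_mono order_trans)
      have "(\<Sum>i<J. indicator (Q i) x) = (\<Sum>i<J. if i < ?m then 1 else (0::real))"
      proof (rule sum.cong[OF refl])
        fix i
        have "i < ?m \<longleftrightarrow> real (Suc i) \<le> (g x + K) * c"
          using nn by (simp add: Suc_le_eq[symmetric] le_nat_iff le_floor_iff del: Suc_le_eq of_nat_Suc)
        then show "indicator (Q i) x = (if i < ?m then 1 else (0::real))" unfolding Q_def by (simp add: indicator_def)
      qed
      also have "\<dots> = real (card ({..<J} \<inter> {i. i < ?m}))" by (simp add: sum.If_cases)
      also have "{..<J} \<inter> {i. i < ?m} = {..<?m}" using mJ by auto
      finally show ?thesis by simp
    qed
    have close: "\<bar>g x - k x\<bar> \<le> 1 / c" for x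
    proof -
      have nn: "0 \<le> (g x + K) * c" using g[of x] c by (intro mult_nonneg_nonneg) auto
      have "\<bar>(g x + K) * c - real (nat \<lfloor>(g x + K) * c\<rfloor>)\<bar> \<le> 1" using nn by linarith
      then have "\<bar>(g x - k x) * c\<bar> \<le> 1" unfolding k_def count using c by (simp add: algebra_simps)
      then show ?thesis using c by (simp add: abs_mult le_divide_eq)
    qed
    have ki: "integrable M (\<lambda>\<omega>. indicator (Q i) (Z \<omega>) :: real)" if "Z \<in> measurable M (count_space UNIV)" for Z i
      by (rule integrable_const_bound[of _ 1]) (use gm[OF that] in \<open>auto simp: indicator_def\<close>)
    have gi: "integrable M (\<lambda>\<omega>. g (Z \<omega>))" if "Z \<in> measurable M (count_space UNIV)" for Z
      by (rule integrable_const_bound[of _ K]) (use gm[OF that] g in auto)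
    have kk: "integrable M (\<lambda>\<omega>. k (Z \<omega>))" if "Z \<in> measurable M (count_space UNIV)" for Z
      unfolding k_def using ki[OF that] by auto
    have kE: "(\<integral>\<omega>. k (Z \<omega>) \<partial>M) = (1 / c) * (\<Sum>i<J. \<integral>\<omega>. indicator (Q i) (Z \<omega>) \<partial>M) - K"
      if "Z \<in> measurable M (count_space UNIV)" for Z
      unfolding k_def using ki[OF that] by (simp add: prob_space)
    have gk: "\<bar>(\<integral>\<omega>. g (Z \<omega>) \<partial>M) - (\<integral>\<omega>. k (Z \<omega>) \<partial>M)\<bar> \<le> 1 / c" if Z: "Z \<in> measurable M (count_space UNIV)" for Z
    proof -
      have "\<bar>\<integral>\<omega>. g (Z \<omega>) - k (Z \<omega>) \<partial>M\<bar> \<le> (\<integral>\<omega>. 1 / c \<partial>M)"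
        by (rule order_trans[OF integral_abs_bound integral_mono]) (use gi[OF Z] kk[OF Z] close in auto)
      then show ?thesis using gi[OF Z] kk[OF Z] by (simp add: prob_space)
    qed
    have "(\<integral>\<omega>. k (X \<omega>) \<partial>M) - (\<integral>\<omega>. k (Y \<omega>) \<partial>M)
      = (1 / c) * (\<Sum>i<J. (\<integral>\<omega>. indicator (Q i) (X \<omega>) \<partial>M) - (\<integral>\<omega>. indicator (Q i) (Y \<omega>) \<partial>M))"
      unfolding kE[OF X] kE[OF Y] sum_subtractf by (simp add: right_diff_distrib)
    also have "\<bar>\<dots>\<bar> \<le> (1 / c) * (\<Sum>i<J. T)"
      using c by (simp only: abs_mult) (intro mult_mono order_trans[OF sum_abs] sum_mono T; simp)
    also have "\<dots> \<le> (1 / c) * ((2 * K * c + 1) * T)"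
      using J T0 c by (intro mult_left_mono) (auto intro: mult_right_mono)
    also have "\<dots> = 2 * K * T + T * (1 / c)" using c by (simp add: field_simps)
    finally have "\<bar>(\<integral>\<omega>. k (X \<omega>) \<partial>M) - (\<integral>\<omega>. k (Y \<omega>) \<partial>M)\<bar> \<le> 2 * K * T + T * (1 / c)" .
    then have "\<bar>(\<integral>\<omega>. g (X \<omega>) \<partial>M) - (\<integral>\<omega>. g (Y \<omega>) \<partial>M)\<bar> \<le> 2 * K * T + T * (1 / c) + 2 * (1 / c)"
      using gk[OF X] gk[OF Y] by linarith
    then show ?thesis unfolding c_def by (simp only: distrib_right add.assoc)
  qed
  moreover have "(\<lambda>n. 2 * K * T + (T + 2) * (1 / real (Suc n))) \<longlonglongrightarrow> 2 * K * T + (T + 2) * 0"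
    by (intro tendsto_intros LIMSEQ_Suc lim_1_over_n)
  ultimately show ?thesis by (intro LIMSEQ_le_const[of "\<lambda>n. 2 * K * T + (T + 2) * (1 / real (Suc n))"]) auto
qed

section \<open>Second differences averaged over a random configuration\<close>

context resolvent begin

definition dd :: "'b \<Rightarrow> 'b \<Rightarrow> 'b multiset \<Rightarrow> real" where "dd x z M = D2 M {#x#} {#z#}"

lemma dd_bound: "\<bar>dd x z M\<bar> \<le> 2" unfolding dd_def by (rule second_diff_le_2)

lemma dd_sym: "dd x z M = dd z x M"
  unfolding dd_def D2_singletons by (simp add: add_mset_commute)

definition dh :: "'b \<Rightarrow> 'b multiset \<Rightarrow> real" where "dh z M = h (add_mset z M) - h M"

lemma dh_bound: "\<bar>dh z M\<bar> \<le> 1 / (1 - b)" unfolding dh_def by (rule first_diff_bound)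

lemma dh_add: "dh z (add_mset x M) - dh z M = dd x z M"
  unfolding dh_def dd_def D2_singletons by simp

end

text \<open>\<open>\<mu>\<close> will be a conditional or unconditional law of a configuration,
  \<open>N\<close> its coarsened part outside a neighbourhood, and \<open>T\<close> a bound for the
  effect of one additional center in total variation. In these instances \<open>r\<close> is
  \<open>r_of_law\<close> at \<open>\<mu>\<close>.\<close>

locale smoothed = resolvent +
  fixes \<mu> :: "'w measure" and N :: "'w \<Rightarrow> 'b multiset" and u T :: real
  assumes prob: "prob_space \<mu>" and N: "N \<in> measurable \<mu> (count_space UNIV)" and u: "u > 0"
    and T: "\<And>i Q. i \<in> I \<Longrightarrow> \<bar>(\<integral>\<omega>. indicator Q (N \<omega>) \<partial>\<mu>) - (\<integral>\<omega>. indicator Q (add_mset (t i) (N \<omega>)) \<partial>\<mu>)\<bar> \<le> T"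
begin

definition r :: real where
  "r = 4 * measure \<mu> {\<omega> \<in> space \<mu>. real (size (N \<omega>)) + 1 \<le> a / u} + (4 * u + 10) / a * T"

lemma meas_N: "(\<lambda>\<omega>. g (N \<omega>) :: real) \<in> borel_measurable \<mu>"
  by (rule measurable_compose[OF N]) simp

lemma int_N: "(\<And>M. \<bar>g M\<bar> \<le> K) \<Longrightarrow> integrable \<mu> (\<lambda>\<omega>. g (N \<omega>) :: real)"
  by (rule finite_measure.integrable_const_bound[of _ _ K])
    (use prob meas_N in \<open>auto intro: prob_space.finite_measure\<close>)

lemma I_nonempty: "\<exists>i. i \<in> I"
  using w1 by (metis equals0I sum.empty zero_neq_one)

lemma T_nonneg: "0 \<le> T"
  using I_nonempty T by (meson abs_ge_zero order_trans)

lemma r_nonneg: "0 \<le> r"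
  unfolding r_def using T_nonneg a u by simp

text \<open>\<open>g\<close> is cut off where the configuration is small. Adding a point only
  increases the size, so the part cut off matters only on the event that \<open>N\<close> itself is
  small, where it contributes at most \<open>2 * c\<close>. The rest is bounded by \<open>K\<close>
  and handled in total variation.\<close>

lemma truncated_shift:
  assumes i: "i \<in> I" and g: "\<And>M. \<bar>g M\<bar> \<le> c"
    and g_trunc: "\<And>M. a / u < real (size M) + 1 \<Longrightarrow> \<bar>g M\<bar> \<le> K" and K: "0 \<le> K"
  shows "\<bar>\<integral>\<omega>. g (add_mset (t i) (N \<omega>)) - g (N \<omega>) \<partial>\<mu>\<bar>
    \<le> 2 * c * measure \<mu> {\<omega> \<in> space \<mu>. real (size (N \<omega>)) + 1 \<le> a / u} + 2 * K * T"
proof -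
  interpret prob_space \<mu> by (rule prob)
  define k where "k M = (if a / u < real (size M) + 1 then g M else 0)" for M
  have c: "0 \<le> c" using g[of undefined] by linarith
  have k: "\<bar>k M\<bar> \<le> K" for M unfolding k_def using g_trunc K by simp
  define E where "E = {\<omega> \<in> space \<mu>. real (size (N \<omega>)) + 1 \<le> a / u}"
  have "(\<lambda>\<omega>. real (size (N \<omega>)) + 1) \<in> borel_measurable \<mu>" by (rule meas_N)
  then have E: "E \<in> sets \<mu>" unfolding E_def by measurable
  have Nt: "(\<lambda>\<omega>. add_mset (t i) (N \<omega>)) \<in> measurable \<mu> (count_space UNIV)"
    by (rule measurable_compose[OF N]) simp
  have ints: "integrable \<mu> (\<lambda>\<omega>. g (N \<omega>))" "integrable \<mu> (\<lambda>\<omega>. k (N \<omega>))"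
    "integrable \<mu> (\<lambda>\<omega>. g (add_mset (t i) (N \<omega>)))" "integrable \<mu> (\<lambda>\<omega>. k (add_mset (t i) (N \<omega>)))"
    using g k by (auto intro: int_N[of g] int_N[of k] int_N[of "\<lambda>M. g (add_mset (t i) M)"] int_N[of "\<lambda>M. k (add_mset (t i) M)"])
  have "\<bar>(\<integral>\<omega>. k (N \<omega>) \<partial>\<mu>) - (\<integral>\<omega>. k (add_mset (t i) (N \<omega>)) \<partial>\<mu>)\<bar> \<le> 2 * K * T"
    by (rule expectation_diff_le_TV[OF prob N Nt T[OF i] k])
  then have 1: "\<bar>\<integral>\<omega>. k (add_mset (t i) (N \<omega>)) - k (N \<omega>) \<partial>\<mu>\<bar> \<le> 2 * K * T" using ints by simp
  let ?R = "\<lambda>\<omega>. (g (add_mset (t i) (N \<omega>)) - g (N \<omega>)) - (k (add_mset (t i) (N \<omega>)) - k (N \<omega>))"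
  have R: "\<bar>?R \<omega>\<bar> \<le> 2 * c * indicator E \<omega>" if "\<omega> \<in> space \<mu>" for \<omega>
    using g[of "N \<omega>"] g[of "add_mset (t i) (N \<omega>)"] c that unfolding k_def E_def indicator_def by auto
  have iR: "integrable \<mu> ?R" using ints by simp
  have "\<bar>\<integral>\<omega>. ?R \<omega> \<partial>\<mu>\<bar> \<le> (\<integral>\<omega>. 2 * c * indicator E \<omega> \<partial>\<mu>)"
    by (rule order_trans[OF integral_abs_bound integral_mono])
      (use iR E R in \<open>auto intro!: integrable_real_indicator simp: less_top[symmetric]\<close>)
  also have "\<dots> = 2 * c * measure \<mu> E" using E by simp
  finally have 2: "\<bar>\<integral>\<omega>. ?R \<omega> \<partial>\<mu>\<bar> \<le> 2 * c * measure \<mu> E" .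
  have "(\<integral>\<omega>. g (add_mset (t i) (N \<omega>)) - g (N \<omega>) \<partial>\<mu>) = (\<integral>\<omega>. ?R \<omega> \<partial>\<mu>) + (\<integral>\<omega>. k (add_mset (t i) (N \<omega>)) - k (N \<omega>) \<partial>\<mu>)"
    using ints by simp
  then show ?thesis using 1 2 unfolding E_def by linarith
qed

lemma dd_int: "integrable \<mu> (\<lambda>\<omega>. dd x z (N \<omega> + S))"
  by (rule int_N[of "\<lambda>M. dd x z (M + S)" 2]) (rule dd_bound)

lemma level_bound:
  fixes M S :: "'b multiset"
  shows "a / u < real (size M) + 1 \<Longrightarrow> 1 / (real (size (M + S)) + 1) \<le> u / a"
proof -
  assume *: "a / u < real (size M) + 1"
  then have "a / u \<le> real (size (M + S)) + 1" by simp
  then have "1 / (real (size (M + S)) + 1) \<le> 1 / (a / u)" using a u by (intro divide_left_mono) auto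
  then show ?thesis by simp
qed

text \<open>With the bounds 2 and \<open>(2 * u + 5) / a\<close> for second differences,
  \<open>truncated_shift\<close> gives exactly \<open>r\<close>. This explains the constants 4 and
  \<open>4 * u + 10\<close>.\<close>

lemma dd_shift_1:
  assumes i: "i \<in> I"
  shows "\<bar>\<integral>\<omega>. dd x z (N \<omega> + add_mset (t i) S) - dd x z (N \<omega> + S) \<partial>\<mu>\<bar> \<le> r"
proof -
  have "\<bar>\<integral>\<omega>. dd x z (add_mset (t i) (N \<omega>) + S) - dd x z (N \<omega> + S) \<partial>\<mu>\<bar>
    \<le> 2 * 2 * measure \<mu> {\<omega> \<in> space \<mu>. real (size (N \<omega>)) + 1 \<le> a / u} + 2 * ((2 * u + 5) / a) * T"
  proof (rule truncated_shift[OF i, of "\<lambda>M. dd x z (M + S)"])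
    show "\<bar>dd x z (M + S)\<bar> \<le> (2 * u + 5) / a" if "a / u < real (size M) + 1" for M
      using second_diff_nonuniform[of "M + S" x z] level_bound[OF that, of S]
      unfolding dd_def by (simp add: add_divide_distrib)
  qed (use dd_bound a u in auto)
  also have "\<dots> = r" unfolding r_def by (simp add: field_simps)
  finally show ?thesis by simp
qed

text \<open>Moving \<open>x\<close> to \<open>x'\<close> in a second difference is the same as
  adding \<open>t i\<close> to the exchange difference \<open>g\<close>. The bounds for
  \<open>g\<close>, namely 1 and \<open>(u + 5 / 2) / a\<close>, are half of those for second
  differences, hence \<open>r / 2\<close>. By symmetry, moving both arguments costs
  \<open>r\<close>.\<close>

lemma dd_move_1:
  assumes i: "i \<in> I"
  shows "\<bar>\<integral>\<omega>. dd x (t i) (N \<omega> + S) - dd x' (t i) (N \<omega> + S) \<partial>\<mu>\<bar> \<le> r / 2"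
proof -
  define g where "g M = h (add_mset x (M + S)) - h (add_mset x' (M + S))" for M
  have eq: "dd x (t i) (M + S) - dd x' (t i) (M + S) = g (add_mset (t i) M) - g M" for M
    unfolding dd_def D2_singletons g_def by (simp add: add_mset_commute)
  have "\<bar>\<integral>\<omega>. g (add_mset (t i) (N \<omega>)) - g (N \<omega>) \<partial>\<mu>\<bar>
    \<le> 2 * 1 * measure \<mu> {\<omega> \<in> space \<mu>. real (size (N \<omega>)) + 1 \<le> a / u} + 2 * ((u + 5 / 2) / a) * T"
  proof (rule truncated_shift[OF i])
    show 1: "\<bar>g M\<bar> \<le> 1" for M unfolding g_def by (rule loc_le_1)
    show "\<bar>g M\<bar> \<le> (u + 5 / 2) / a" if "a / u < real (size M) + 1" for M
    proof (cases "a \<ge> 5 / 2")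
      case True
      have "\<bar>g M\<bar> \<le> 5 / 8 * (1 / (real (size (M + S)) + 1) + 1 / a)"
        unfolding g_def by (rule loc_nonuniform[OF True])
      also have "\<dots> \<le> 5 / 8 * (u / a + 1 / a)" using level_bound[OF that, of S] by simp
      also have "\<dots> \<le> (u + 5 / 2) / a"
      proof -
        have "0 \<le> u / a" "0 \<le> 1 / a" using u a by simp_all
        moreover have "(u + 5 / 2) / a = u / a + 5 / 2 * (1 / a)" by (simp add: add_divide_distrib)
        ultimately show ?thesis by argo
      qed
      finally show ?thesis .
    next
      case False
      then have "1 \<le> (u + 5 / 2) / a" using a u by (simp add: le_divide_eq)
      then show ?thesis using 1[of M] by linarith
    qed
  qed (use a u in auto)
  also have "\<dots> = r / 2" unfolding r_def by (simp add: add_divide_distrib distrib_left distrib_right)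
  finally show ?thesis unfolding eq .
qed

lemma dd_move:
  assumes "i \<in> I" "i' \<in> I" "j \<in> I" "j' \<in> I"
  shows "\<bar>\<integral>\<omega>. dd (t i) (t j) (N \<omega> + S) - dd (t i') (t j') (N \<omega> + S) \<partial>\<mu>\<bar> \<le> r"
proof -
  have 1: "\<bar>\<integral>\<omega>. dd (t i) (t j) (N \<omega> + S) - dd (t i') (t j) (N \<omega> + S) \<partial>\<mu>\<bar> \<le> r / 2"
    by (rule dd_move_1[OF assms(3)])
  have 2: "\<bar>\<integral>\<omega>. dd (t j) (t i') (N \<omega> + S) - dd (t j') (t i') (N \<omega> + S) \<partial>\<mu>\<bar> \<le> r / 2"
    by (rule dd_move_1[OF assms(2)])
  have "(\<integral>\<omega>. dd (t i) (t j) (N \<omega> + S) - dd (t i') (t j') (N \<omega> + S) \<partial>\<mu>)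
    = (\<integral>\<omega>. dd (t i) (t j) (N \<omega> + S) - dd (t i') (t j) (N \<omega> + S) \<partial>\<mu>)
      + (\<integral>\<omega>. dd (t j) (t i') (N \<omega> + S) - dd (t j') (t i') (N \<omega> + S) \<partial>\<mu>)"
    using dd_int unfolding dd_sym[of "t j"] dd_sym[of "t j'"] by simp
  then show ?thesis using 1 2 by linarith
qed

lemma dd_shift:
  assumes "set_mset Q \<subseteq> t ` I"
  shows "\<bar>\<integral>\<omega>. dd x z (N \<omega> + (S + Q)) - dd x z (N \<omega> + S) \<partial>\<mu>\<bar> \<le> r * real (size Q)"
  using assms
proof (induction Q)
  case (add y Q)
  then obtain i where i: "i \<in> I" and y: "y = t i" by auto
  have 1: "\<bar>\<integral>\<omega>. dd x z (N \<omega> + (S + Q)) - dd x z (N \<omega> + S) \<partial>\<mu>\<bar> \<le> r * real (size Q)" using add by simp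
  have 2: "\<bar>\<integral>\<omega>. dd x z (N \<omega> + add_mset (t i) (S + Q)) - dd x z (N \<omega> + (S + Q)) \<partial>\<mu>\<bar> \<le> r"
    by (rule dd_shift_1[OF i])
  have "S + add_mset y Q = add_mset (t i) (S + Q)" by (simp add: y)
  moreover have "r * real (size (add_mset y Q)) = r + r * real (size Q)" by (simp add: algebra_simps)
  ultimately show ?case using 1 2 dd_int[of x z "S + Q"] dd_int[of x z S] dd_int[of x z "add_mset (t i) (S + Q)"]
    by (simp only: Bochner_Integration.integral_diff)
qed simp

lemma dh_int: "integrable \<mu> (\<lambda>\<omega>. dh z (N \<omega> + S))"
  by (rule int_N[of "\<lambda>M. dh z (M + S)" "1 / (1 - b)"]) (rule dh_bound)

text \<open>The points of \<open>P\<close> are added one at a time. Each produces a second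
  difference, whose change under adding \<open>Q\<close> costs \<open>r\<close> per point of
  \<open>Q\<close>. The points of \<open>Q\<close> are centers because \<open>T\<close> controls the
  addition of centers.\<close>

lemma dh_cross:
  assumes "set_mset Q \<subseteq> t ` I"
  shows "\<bar>\<integral>\<omega>. (dh z (N \<omega> + (P + Q)) - dh z (N \<omega> + Q)) - (dh z (N \<omega> + P) - dh z (N \<omega>)) \<partial>\<mu>\<bar>
    \<le> r * real (size P) * real (size Q)"
proof (induction P)
  case (add x P)
  let ?A = "\<lambda>\<omega>. (dh z (N \<omega> + (P + Q)) - dh z (N \<omega> + Q)) - (dh z (N \<omega> + P) - dh z (N \<omega>))"
  let ?B = "\<lambda>\<omega>. dd x z (N \<omega> + (P + Q)) - dd x z (N \<omega> + P)"
  have e: "(dh z (N \<omega> + (add_mset x P + Q)) - dh z (N \<omega> + Q)) - (dh z (N \<omega> + add_mset x P) - dh z (N \<omega>)) = ?A \<omega> + ?B \<omega>" for \<omega>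
    using dh_add[of z x "N \<omega> + (P + Q)"] dh_add[of z x "N \<omega> + P"] by simp
  have iA: "integrable \<mu> ?A" using dh_int[of z] dh_int[of z "{#}"] by simp
  have iB: "integrable \<mu> ?B" using dd_int by simp
  have "\<bar>\<integral>\<omega>. (dh z (N \<omega> + (add_mset x P + Q)) - dh z (N \<omega> + Q)) - (dh z (N \<omega> + add_mset x P) - dh z (N \<omega>)) \<partial>\<mu>\<bar>
    = \<bar>(\<integral>\<omega>. ?A \<omega> \<partial>\<mu>) + (\<integral>\<omega>. ?B \<omega> \<partial>\<mu>)\<bar>"
    unfolding e by (simp only: Bochner_Integration.integral_add[OF iA iB])
  also have "\<dots> \<le> r * real (size P) * real (size Q) + r * real (size Q)"
    using add dd_shift[OF assms, of x z P] by linarith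
  finally show ?case by (simp add: algebra_simps)
qed simp

text \<open>The \<open>n\<close>-th point of \<open>P\<close> meets \<open>n - 1\<close> earlier ones, at cost \<open>r\<close> each, and moving both
  locations to \<open>t v\<close>, \<open>t v'\<close> costs another \<open>r\<close>.\<close>

lemma dh_linear:
  assumes "set_mset P \<subseteq> t ` I" "l \<in> I" "v \<in> I" "v' \<in> I"
  shows "\<bar>\<integral>\<omega>. dh (t l) (N \<omega> + P) - dh (t l) (N \<omega>) - real (size P) * dd (t v) (t v') (N \<omega>) \<partial>\<mu>\<bar>
    \<le> r * (real (size P) * (real (size P) + 1) / 2)"
  using assms(1)
proof (induction P)
  case (add x P)
  then obtain i where i: "i \<in> I" and x: "x = t i" by auto
  let ?A = "\<lambda>\<omega>. dh (t l) (N \<omega> + P) - dh (t l) (N \<omega>) - real (size P) * dd (t v) (t v') (N \<omega>)"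
  let ?B = "\<lambda>\<omega>. dd x (t l) (N \<omega> + ({#} + P)) - dd x (t l) (N \<omega> + {#})"
  let ?C = "\<lambda>\<omega>. dd (t i) (t l) (N \<omega> + {#}) - dd (t v) (t v') (N \<omega> + {#})"
  have e: "dh (t l) (N \<omega> + add_mset x P) - dh (t l) (N \<omega>) - real (size (add_mset x P)) * dd (t v) (t v') (N \<omega>) = ?A \<omega> + ?B \<omega> + ?C \<omega>" for \<omega>
    using dh_add[of "t l" x "N \<omega> + P"] by (simp add: x algebra_simps)
  have iA: "integrable \<mu> ?A" using dh_int[of "t l"] dh_int[of "t l" "{#}"] dd_int[of _ _ "{#}"] by simp
  have iB: "integrable \<mu> ?B" by (intro Bochner_Integration.integrable_diff dd_int)
  have iC: "integrable \<mu> ?C" by (intro Bochner_Integration.integrable_diff dd_int)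
  have "\<bar>\<integral>\<omega>. dh (t l) (N \<omega> + add_mset x P) - dh (t l) (N \<omega>) - real (size (add_mset x P)) * dd (t v) (t v') (N \<omega>) \<partial>\<mu>\<bar>
    = \<bar>(\<integral>\<omega>. ?A \<omega> \<partial>\<mu>) + (\<integral>\<omega>. ?B \<omega> \<partial>\<mu>) + (\<integral>\<omega>. ?C \<omega> \<partial>\<mu>)\<bar>"
    unfolding e by (simp only: Bochner_Integration.integral_add[OF Bochner_Integration.integrable_add[OF iA iB] iC]
      Bochner_Integration.integral_add[OF iA iB])
  also have "\<dots> \<le> r * (real (size P) * (real (size P) + 1) / 2) + r * real (size P) + r"
    by (intro abs_add_le add.IH dd_shift dd_move i assms(2-4)) (use add.prems in auto)
  also have "\<dots> = r * (real (size (add_mset x P)) * (real (size (add_mset x P)) + 1) / 2)"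
    by (simp add: field_simps)
  finally show ?case .
qed simp

end

section \<open>The invariant law of the birth-death process\<close>

context stein begin

text \<open>The mean over \<open>n\<close> independent points drawn from the centers with weights
  \<open>w\<close>. The recursion stands in for a product measure, so that identities with
  \<open>gen\<close> follow by induction on \<open>n\<close>.\<close>

primrec iid :: "nat \<Rightarrow> ('a multiset \<Rightarrow> real) \<Rightarrow> real" where
  "iid 0 \<phi> = \<phi> {#}"
| "iid (Suc n) \<phi> = av (\<lambda>x. iid n (\<lambda>M. \<phi> (add_mset x M)))"

lemma iid_cong: "(\<And>M. size M = n \<Longrightarrow> \<phi> M = \<psi> M) \<Longrightarrow> iid n \<phi> = iid n \<psi>"
proof (induction n arbitrary: \<phi> \<psi>)
  case (Suc n)
  have "iid n (\<lambda>M. \<phi> (add_mset x M)) = iid n (\<lambda>M. \<psi> (add_mset x M))" for x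
    by (rule Suc.IH) (simp add: Suc.prems)
  then show ?case by simp
qed simp

lemma iid_add: "iid n (\<lambda>M. \<phi> M + \<psi> M) = iid n \<phi> + iid n \<psi>"
  by (induction n arbitrary: \<phi> \<psi>) (simp_all add: av_add)

lemma av_scale: "av (\<lambda>x. c * \<phi> x) = c * av \<phi>"
  unfolding av_def by (simp add: sum_distrib_left mult.left_commute)

lemma iid_scale: "iid n (\<lambda>M. c * \<phi> M) = c * iid n \<phi>"
  by (induction n arbitrary: \<phi>) (simp_all add: av_scale)

lemma iid_diff: "iid n (\<lambda>M. \<phi> M - \<psi> M) = iid n \<phi> - iid n \<psi>"
  by (induction n arbitrary: \<phi> \<psi>) (simp_all add: av_diff)

lemma iid_const: "iid n (\<lambda>M. c) = c"
  by (induction n) simp_all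

lemma iid_mono: "(\<And>M. size M = n \<Longrightarrow> \<phi> M \<le> \<psi> M) \<Longrightarrow> iid n \<phi> \<le> iid n \<psi>"
proof (induction n arbitrary: \<phi> \<psi>)
  case (Suc n)
  have "iid n (\<lambda>M. \<phi> (add_mset x M)) \<le> iid n (\<lambda>M. \<psi> (add_mset x M))" for x
    by (rule Suc.IH) (simp add: Suc.prems)
  then show ?case by (simp add: av_mono)
qed simp

lemma iid_abs: "(\<And>M. size M = n \<Longrightarrow> \<bar>\<phi> M\<bar> \<le> c) \<Longrightarrow> \<bar>iid n \<phi>\<bar> \<le> c"
  using iid_mono[of n \<phi> "\<lambda>_. c"] iid_mono[of n "\<lambda>_. - c" \<phi>] unfolding iid_const by (force simp: abs_le_iff minus_le_iff)

lemma iid_av: "iid n (\<lambda>M. av (\<lambda>x. \<phi> (add_mset x M))) = iid (Suc n) \<phi>"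
proof (induction n arbitrary: \<phi>)
  case (Suc n)
  have "iid (Suc n) (\<lambda>M. av (\<lambda>x. \<phi> (add_mset x M)))
    = av (\<lambda>y. iid n (\<lambda>M. av (\<lambda>x. \<phi> (add_mset y (add_mset x M)))))"
    by (simp add: add_mset_commute)
  also have "\<dots> = av (\<lambda>y. iid (Suc n) (\<lambda>M. \<phi> (add_mset y M)))" by (simp only: Suc[of "\<lambda>M. \<phi> (add_mset _ M)"])
  finally show ?case by simp
qed simp

lemma iid_del: "iid n (\<lambda>M. \<Sum>z\<in>#M. \<phi> (M - {#z#})) = real n * iid (n - 1) \<phi>"
proof (induction n arbitrary: \<phi>)
  case (Suc n)
  have "iid (Suc n) (\<lambda>M. \<Sum>z\<in>#M. \<phi> (M - {#z#}))
    = av (\<lambda>x. iid n \<phi> + iid n (\<lambda>M. \<Sum>z\<in>#M. \<phi> (add_mset x (M - {#z#}))))"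
    unfolding iid.simps sum_del_add_mset iid_add ..
  also have "\<dots> = av (\<lambda>x. iid n \<phi> + real n * iid (n - 1) (\<lambda>M. \<phi> (add_mset x M)))"
    by (simp only: Suc[of "\<lambda>M. \<phi> (add_mset _ M)"])
  also have "\<dots> = iid n \<phi> + real n * av (\<lambda>x. iid (n - 1) (\<lambda>M. \<phi> (add_mset x M)))"
    unfolding av_add av_scale by simp
  also have "\<dots> = iid n \<phi> + real n * iid n \<phi>" by (cases n) simp_all
  finally show ?case by (simp add: algebra_simps)
qed simp

text \<open>Given their number, independent points remain independent after a birth or a death.
  Averaging therefore reduces \<open>gen\<close> to the generator of the number of points, which
  lifts invariance from that number to the point process.\<close>

lemma iid_gen:
  "iid n (gen h) = (a + b * real n) * (iid (Suc n) h - iid n h) + real n * (iid (n - 1) h - iid n h)"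
proof -
  have "iid n (gen h) = iid n (\<lambda>M. (a + b * real n) * (av (\<lambda>x. h (add_mset x M)) - h M)
     + ((\<Sum>z\<in>#M. h (M - {#z#})) - real n * h M))"
    by (rule iid_cong) (simp add: gen_def sum_mset_diff_real sum_mset_const_real)
  then show ?thesis
    unfolding iid_add iid_diff iid_scale iid_av iid_del by (simp add: right_diff_distrib)
qed

lemma iid_Suc_diff:
  assumes "\<And>x M. \<bar>h (add_mset x M) - h M\<bar> \<le> C"
  shows "\<bar>iid (Suc n) h - iid n h\<bar> \<le> C"
proof -
  have "iid (Suc n) h - iid n h = av (\<lambda>x. iid n (\<lambda>M. h (add_mset x M) - h M))"
    unfolding iid.simps iid_diff av_diff by simp
  also have "\<bar>\<dots>\<bar> \<le> C" by (intro av_abs iid_abs assms)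
  finally show ?thesis .
qed

text \<open>By detailed balance the partial sums telescope to the term \<open>c m\<close> for the
  edge between \<open>m\<close> and \<open>m + 1\<close>. It tends to 0 because first differences
  are bounded and \<open>n * pmf p n\<close> is summable.\<close>

lemma expectation_gen_zero:
  fixes p :: "nat pmf"
  assumes bal: "\<And>n. pmf p n * (a + b * real n) = pmf p (Suc n) * (real n + 1)"
    and mom: "summable (\<lambda>n. real n * pmf p n)"
    and C: "\<And>x M. \<bar>h (add_mset x M) - h M\<bar> \<le> C" and G: "\<And>M. \<bar>gen h M\<bar> \<le> G"
  shows "(\<integral>n. iid n (gen h) \<partial>measure_pmf p) = 0"
proof -
  define c where "c n = pmf p n * (a + b * real n) * (iid (Suc n) h - iid n h)" for n
  have "(\<Sum>n<Suc m. pmf p n * iid n (gen h)) = c m" for m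
  proof (induction m)
    case 0 then show ?case by (simp add: c_def iid_gen)
  next
    case (Suc m)
    have "pmf p (Suc m) * iid (Suc m) (gen h) = c (Suc m) + pmf p (Suc m) * (real m + 1) * (iid m h - iid (Suc m) h)"
      unfolding iid_gen[of "Suc m"] c_def by (simp add: algebra_simps)
    also have "\<dots> = c (Suc m) - c m" unfolding bal[symmetric] c_def by (simp add: algebra_simps)
    finally show ?case using Suc by simp
  qed
  moreover have "c \<longlonglongrightarrow> 0"
  proof (rule Lim_null_comparison)
    have "(\<lambda>n. C * (real (Suc n) * pmf p (Suc n))) \<longlonglongrightarrow> C * 0"
      by (intro tendsto_intros LIMSEQ_Suc summable_LIMSEQ_zero mom)
    then show "(\<lambda>n. C * (real (Suc n) * pmf p (Suc n))) \<longlonglongrightarrow> 0" by simp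
    show "\<forall>\<^sub>F n in sequentially. norm (c n) \<le> C * (real (Suc n) * pmf p (Suc n))"
    proof (intro always_eventually allI)
      fix n
      have "\<bar>c n\<bar> = (real (Suc n) * pmf p (Suc n)) * \<bar>iid (Suc n) h - iid n h\<bar>"
        unfolding c_def bal by (simp add: abs_mult add.commute)
      also have "\<dots> \<le> (real (Suc n) * pmf p (Suc n)) * C"
        by (intro mult_left_mono iid_Suc_diff C) simp
      finally show "norm (c n) \<le> C * (real (Suc n) * pmf p (Suc n))" by (simp add: mult.commute)
    qed
  qed
  ultimately have "(\<lambda>m. \<Sum>n<Suc m. pmf p n * iid n (gen h)) \<longlonglongrightarrow> 0" by simp
  then have 1: "(\<lambda>n. pmf p n * iid n (gen h)) sums 0" unfolding sums_def by (subst (asm) filterlim_sequentially_Suc)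
  have "integrable (measure_pmf p) (\<lambda>n. iid n (gen h))"
    by (rule measure_pmf.integrable_const_bound[of _ G]) (auto intro!: AE_I2 iid_abs G)
  then have int: "integrable (count_space UNIV) (\<lambda>n. pmf p n * iid n (gen h))"
    unfolding measure_pmf_eq_density by (subst (asm) integrable_density) auto
  have "(\<integral>n. iid n (gen h) \<partial>measure_pmf p) = (\<integral>n. pmf p n * iid n (gen h) \<partial>count_space UNIV)"
    unfolding measure_pmf_eq_density by (subst integral_density) auto
  then show ?thesis using sums_integral_count_space_nat[OF int] 1 sums_unique2 by metis
qed

end

section \<open>Distance of a random configuration from the invariant law\<close>

lemma (in resolvent) h_growth: "\<bar>h M - h {#}\<bar> \<le> 1 / (1 - b) * real (size M)"
proof (induction M)
  case (add x M)
  then show ?case using first_diff_bound[of x M] by (simp add: distrib_left)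
qed simp

text \<open>Integrating \<open>f = \<rho> * h - gen h\<close> under both laws leaves
  \<open>\<rho>\<close> times a difference of means of \<open>h\<close>, since \<open>gen h\<close>
  has mean 0 under the invariant one. Each mean differs from \<open>h {#}\<close> by at most
  \<open>1 / (1 - b)\<close> times a mean size. This bound does not contain \<open>\<rho>\<close>,
  so the term disappears with \<open>\<rho>\<close>.\<close>

lemma (in resolvent) approximation_identity:
  fixes p :: "nat pmf"
  assumes bal: "\<And>n. pmf p n * (a + b * real n) = pmf p (Suc n) * (real n + 1)"
    and mom: "summable (\<lambda>n. real n * pmf p n)"
    and "prob_space \<mu>" and N: "N \<in> measurable \<mu> (count_space UNIV)"
    and sz: "integrable \<mu> (\<lambda>\<omega>. real (size (N \<omega>)))"
  shows "\<bar>(\<integral>\<omega>. f (N \<omega>) \<partial>\<mu>) - (\<integral>n. iid n f \<partial>measure_pmf p)\<bar>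
    \<le> \<rho> / (1 - b) * ((\<integral>\<omega>. real (size (N \<omega>)) \<partial>\<mu>) + (\<Sum>n. real n * pmf p n)) + \<bar>\<integral>\<omega>. gen h (N \<omega>) \<partial>\<mu>\<bar>"
proof -
  interpret prob_space \<mu> by fact
  have m: "(\<lambda>\<omega>. g (N \<omega>) :: real) \<in> borel_measurable \<mu>" for g by (rule measurable_compose[OF N]) simp
  have G: "\<bar>gen h M\<bar> \<le> 1" for M using eq[of M] residual_le_1[of M] by linarith
  have ih: "integrable \<mu> (\<lambda>\<omega>. h (N \<omega>))"
    by (rule integrable_const_bound[of _ "(\<bar>top_f\<bar> + 1) / \<rho>"]) (use m h_bounded in auto)
  have ig: "integrable \<mu> (\<lambda>\<omega>. gen h (N \<omega>))"
    by (rule integrable_const_bound[of _ 1]) (use m G in auto)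
  have f: "f M = \<rho> * h M - gen h M" for M using eq[of M] by linarith
  have 1: "(\<integral>\<omega>. f (N \<omega>) \<partial>\<mu>) = \<rho> * (\<integral>\<omega>. h (N \<omega>) \<partial>\<mu>) - (\<integral>\<omega>. gen h (N \<omega>) \<partial>\<mu>)"
    unfolding f using ih ig by simp
  have ph: "integrable (measure_pmf p) (\<lambda>n. iid n h)"
    by (rule measure_pmf.integrable_const_bound[of _ "(\<bar>top_f\<bar> + 1) / \<rho>"]) (auto intro!: AE_I2 iid_abs h_bounded)
  have pg: "integrable (measure_pmf p) (\<lambda>n. iid n (gen h))"
    by (rule measure_pmf.integrable_const_bound[of _ 1]) (auto intro!: AE_I2 iid_abs G)
  have "(\<integral>n. iid n f \<partial>measure_pmf p) = (\<integral>n. \<rho> * iid n h - iid n (gen h) \<partial>measure_pmf p)"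
    by (subst f[abs_def]) (simp add: iid_diff iid_scale)
  also have "\<dots> = \<rho> * (\<integral>n. iid n h \<partial>measure_pmf p) - (\<integral>n. iid n (gen h) \<partial>measure_pmf p)"
    using ph pg by simp
  also have "(\<integral>n. iid n (gen h) \<partial>measure_pmf p) = 0"
    by (rule expectation_gen_zero[OF bal mom first_diff_bound G])
  finally have 2: "(\<integral>n. iid n f \<partial>measure_pmf p) = \<rho> * (\<integral>n. iid n h \<partial>measure_pmf p)" by simp
  have 3: "\<bar>(\<integral>\<omega>. h (N \<omega>) \<partial>\<mu>) - h {#}\<bar> \<le> 1 / (1 - b) * (\<integral>\<omega>. real (size (N \<omega>)) \<partial>\<mu>)"
  proof -
    have "\<bar>\<integral>\<omega>. h (N \<omega>) - h {#} \<partial>\<mu>\<bar> \<le> (\<integral>\<omega>. 1 / (1 - b) * real (size (N \<omega>)) \<partial>\<mu>)"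
      by (rule order_trans[OF integral_abs_bound integral_mono]) (use ih sz h_growth in auto)
    then show ?thesis using ih by (simp add: prob_space)
  qed
  have 4: "\<bar>(\<integral>n. iid n h \<partial>measure_pmf p) - h {#}\<bar> \<le> 1 / (1 - b) * (\<Sum>n. real n * pmf p n)"
  proof -
    have ic: "integrable (count_space UNIV) (\<lambda>n. pmf p n * real n)"
      unfolding integrable_count_space_nat_iff using mom by (simp add: mult.commute)
    have ip: "integrable (measure_pmf p) real"
      unfolding measure_pmf_eq_density by (subst integrable_density) (use ic in auto)
    have "(\<integral>n. real n \<partial>measure_pmf p) = (\<integral>n. pmf p n * real n \<partial>count_space UNIV)"
      unfolding measure_pmf_eq_density by (subst integral_density) auto
    also have "\<dots> = (\<Sum>n. real n * pmf p n)"
      using sums_integral_count_space_nat[OF ic] by (simp add: sums_unique mult.commute)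
    finally have mean: "(\<integral>n. real n \<partial>measure_pmf p) = (\<Sum>n. real n * pmf p n)" .
    have bound: "\<bar>iid n h - h {#}\<bar> \<le> 1 / (1 - b) * real n" for n
    proof -
      have "iid n h - h {#} = iid n (\<lambda>M. h M - h {#})" unfolding iid_diff iid_const ..
      also have "\<bar>\<dots>\<bar> \<le> 1 / (1 - b) * real n" by (rule iid_abs) (use h_growth in force)
      finally show ?thesis .
    qed
    have "\<bar>\<integral>n. iid n h - h {#} \<partial>measure_pmf p\<bar> \<le> (\<integral>n. 1 / (1 - b) * real n \<partial>measure_pmf p)"
      by (rule order_trans[OF integral_abs_bound integral_mono]) (use ph ip bound in auto)
    then show ?thesis using ph mean by simp
  qed
  have "\<bar>\<rho> * ((\<integral>\<omega>. h (N \<omega>) \<partial>\<mu>) - (\<integral>n. iid n h \<partial>measure_pmf p))\<bar>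
    \<le> \<rho> * (1 / (1 - b) * ((\<integral>\<omega>. real (size (N \<omega>)) \<partial>\<mu>) + (\<Sum>n. real n * pmf p n)))"
  proof -
    have "\<bar>(\<integral>\<omega>. h (N \<omega>) \<partial>\<mu>) - (\<integral>n. iid n h \<partial>measure_pmf p)\<bar>
      \<le> 1 / (1 - b) * ((\<integral>\<omega>. real (size (N \<omega>)) \<partial>\<mu>) + (\<Sum>n. real n * pmf p n))"
      using 3 4 unfolding distrib_left by linarith
    from mult_left_mono[OF this, of \<rho>] show ?thesis using rho unfolding abs_mult by simp
  qed
  then show ?thesis unfolding 1 2 by (simp add: right_diff_distrib; linarith)
qed

text \<open>\<open>F n\<close> is the net flux from \<open>n\<close> to \<open>n + 1\<close>.
  Invariance makes consecutive fluxes equal, and as nothing lies below 0 they all vanish: this is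
  detailed balance.\<close>

lemma bd_invariant_iff:
  assumes "\<And>k. \<alpha> k \<ge> 0" "\<delta> 0 = (0::real)"
  shows "bd_invariant \<alpha> \<delta> p \<longleftrightarrow> (\<forall>n. pmf p n * \<alpha> n = pmf p (Suc n) * \<delta> (Suc n))"
proof -
  define F where "F n = pmf p n * \<alpha> n - pmf p (Suc n) * \<delta> (Suc n)" for n
  define G where "G j = (case j of 0 \<Rightarrow> - F 0 | Suc i \<Rightarrow> F i - F j)" for j
  have S: "(\<lambda>i. pmf p i * bd_generator \<alpha> \<delta> i j) sums G j" for j
  proof -
    have "(\<lambda>i. pmf p i * bd_generator \<alpha> \<delta> i j) sums (\<Sum>i\<in>{i. i = j \<or> i = Suc j \<or> Suc i = j}. pmf p i * bd_generator \<alpha> \<delta> i j)"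
    proof (rule sums_finite)
      show "finite {i. i = j \<or> i = Suc j \<or> Suc i = j}"
        by (rule finite_subset[of _ "{..Suc j}"]) auto
    qed (auto simp: bd_generator_def)
    also have "(\<Sum>i\<in>{i. i = j \<or> i = Suc j \<or> Suc i = j}. pmf p i * bd_generator \<alpha> \<delta> i j) = G j"
    proof (cases j)
      case 0
      have "{i. i = j \<or> i = Suc j \<or> Suc i = j} = {0, 1}" unfolding 0 by auto
      then show ?thesis using assms(2) unfolding G_def F_def 0 by (simp add: bd_generator_def)
    next
      case (Suc i)
      have "{k. k = j \<or> k = Suc j \<or> Suc k = j} = {i, Suc i, Suc (Suc i)}" unfolding Suc by auto
      then show ?thesis unfolding G_def F_def Suc by (simp add: bd_generator_def algebra_simps)
    qed
    finally show ?thesis .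
  qed
  have "bd_invariant \<alpha> \<delta> p \<longleftrightarrow> (\<forall>j. G j = 0)"
    unfolding bd_invariant_def using S sums_unique2 by metis
  also have "\<dots> \<longleftrightarrow> (\<forall>n. F n = 0)"
  proof
    assume G: "\<forall>j. G j = 0"
    show "\<forall>n. F n = 0"
    proof
      fix n show "F n = 0"
        by (induction n) (use G[rule_format, of 0] G[rule_format, of "Suc _"] in \<open>auto simp: G_def\<close>)
    qed
  qed (auto simp: G_def split: nat.split)
  finally show ?thesis unfolding F_def by simp
qed

text \<open>\<open>pbd_pmf\<close> is a definite description, so existence and uniqueness have to be
  established. Detailed balance is a first-order recursion whose solutions are the multiples of
  \<open>q\<close>. The ratio of successive terms of \<open>real n * q n\<close> tends to
  \<open>b < 1\<close>, which gives the normalization and the first moment.\<close>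

lemma pbd_pmf_properties:
  fixes a b :: real
  assumes a: "a > 0" and b: "0 \<le> b" "b < 1"
  shows "pmf (pbd_pmf a b 0) n * (a + b * real n) = pmf (pbd_pmf a b 0) (Suc n) * (real n + 1)"
    and "summable (\<lambda>n. real n * pmf (pbd_pmf a b 0) n)"
proof -
  define q where "q n = (\<Prod>k<n. (a + b * real k) / (real k + 1))" for n
  have q0: "q 0 = 1" and qS: "q (Suc n) = q n * ((a + b * real n) / (real n + 1))" for n
    unfolding q_def by simp_all
  have qpos: "q n > 0" for n
  proof -
    have "a + b * real k > 0" for k using a b by (intro add_pos_nonneg) auto
    then show ?thesis unfolding q_def by (intro prod_pos) simp
  qed
  have sum_nq: "summable (\<lambda>n. real n * q n)"
  proof -
    define c where "c = (1 + b) / 2"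
    \<comment> \<open>From \<open>n0\<close> on, \<open>2 * a \<le> (1 - b) * n\<close>, so the
      ratio \<open>(a + b * n) / n\<close> is at most \<open>c\<close>.\<close>
    define n0 where "n0 = nat \<lceil>2 * a / (1 - b)\<rceil> + 1"
    show ?thesis
    proof (rule summable_ratio_test[of c n0])
      show "c < 1" unfolding c_def using b by simp
      fix n assume n: "n0 \<le> n"
      have n1: "real n \<ge> 1" "2 * a / (1 - b) \<le> real n" using n unfolding n0_def by linarith+
      then have "2 * a \<le> (1 - b) * real n" using b by (simp add: divide_le_eq mult.commute)
      then have "a + b * real n \<le> c * real n" unfolding c_def by (simp add: algebra_simps)
      then have "q n * (a + b * real n) \<le> q n * (c * real n)" using qpos[of n] by (intro mult_left_mono) auto
      moreover have "real (Suc n) * q (Suc n) = q n * (a + b * real n)" unfolding qS by (simp add: field_simps)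
      ultimately show "norm (real (Suc n) * q (Suc n)) \<le> c * norm (real n * q n)"
        using qpos[of n] qpos[of "Suc n"] a b by (simp add: abs_mult mult.left_commute abs_of_nonneg del: of_nat_Suc)
    qed
  qed
  have sum_q: "summable q"
  proof (rule summable_comparison_test_ev[OF _ sum_nq])
    show "\<forall>\<^sub>F n in sequentially. norm (q n) \<le> real n * q n"
      using eventually_ge_at_top[of 1]
    proof eventually_elim
      case (elim n)
      then have "1 * q n \<le> real n * q n" using qpos[of n] by (intro mult_right_mono) auto
      then show ?case using qpos[of n] by simp
    qed
  qed
  define Z where "Z = (\<Sum>n. q n)"
  have Z: "Z > 0" unfolding Z_def by (rule suminf_pos[OF sum_q qpos])
  define p where "p = embed_pmf (\<lambda>n. q n / Z)"
  have pmf_p: "pmf p n = q n / Z" for n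
    unfolding p_def
  proof (rule pmf_embed_pmf)
    show "0 \<le> q n / Z" for n using qpos[of n] Z by simp
    have "(\<lambda>n. q n / Z) sums (Z / Z)" unfolding Z_def by (intro sums_divide summable_sums sum_q)
    then have s: "(\<lambda>n. q n / Z) sums 1" using Z by simp
    have "(\<integral>\<^sup>+ n. ennreal (q n / Z) \<partial>count_space UNIV) = (\<Sum>n. ennreal (q n / Z))"
      by (rule nn_integral_count_space_nat)
    also have "\<dots> = ennreal 1"
      by (rule suminf_ennreal_eq[OF _ s]) (use qpos Z in \<open>simp add: less_imp_le\<close>)
    finally show "(\<integral>\<^sup>+ n. ennreal (q n / Z) \<partial>count_space UNIV) = 1" by simp
  qed
  let ?I = "bd_invariant (\<lambda>k. a + b * real k) (\<lambda>k. real k + 0 * real k * (real k - 1))"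
  have I: "?I p' \<longleftrightarrow> (\<forall>n. pmf p' n * (a + b * real n) = pmf p' (Suc n) * (real n + 1))" for p'
    using a b by (subst bd_invariant_iff) (simp_all add: add.commute)
  have Ip: "?I p" unfolding I pmf_p qS
  proof
    fix n
    have "x / Z * y = x * (y / d) / Z * d" if "d \<noteq> 0" for x y d :: real using that by simp
    from this[of "real n + 1" "q n" "a + b * real n"]
    show "q n / Z * (a + b * real n) = q n * ((a + b * real n) / (real n + 1)) / Z * (real n + 1)" by simp
  qed
  have uniq: "p' = p" if "?I p'" for p'
  proof (rule pmf_eqI)
    have rec: "pmf p' n * (a + b * real n) = pmf p' (Suc n) * (real n + 1)" for n using that unfolding I by blast
    have *: "pmf p' n = pmf p' 0 * q n" for n
    proof (induction n)
      case (Suc n)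
      have "pmf p' (Suc n) = pmf p' n * (a + b * real n) / (real n + 1)" using rec[of n] by (simp add: field_simps)
      then show ?case unfolding Suc qS by simp
    qed (simp add: q0)
    have "(\<integral>\<^sup>+ n. ennreal (pmf p' n) \<partial>count_space UNIV) = 1" by (rule nn_integral_pmf_eq_1)
    then have "(\<Sum>n. ennreal (pmf p' 0 * q n)) = 1" unfolding nn_integral_count_space_nat *[symmetric] .
    moreover have "(\<Sum>n. ennreal (pmf p' 0 * q n)) = ennreal (pmf p' 0 * Z)"
      by (rule suminf_ennreal_eq) (use qpos in \<open>auto simp: Z_def less_imp_le intro!: sums_mult summable_sums sum_q\<close>)
    ultimately have "pmf p' 0 * Z = 1" by simp
    then have "pmf p' 0 = 1 / Z" using Z by (simp add: field_simps)
    then show "pmf p' n = pmf p n" for n unfolding *[of n] pmf_p by simp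
  qed
  have pbd: "pbd_pmf a b 0 = p" unfolding pbd_pmf_def
    by (rule the_equality) (rule Ip, rule uniq)
  show "pmf (pbd_pmf a b 0) n * (a + b * real n) = pmf (pbd_pmf a b 0) (Suc n) * (real n + 1)"
    using Ip unfolding I pbd by blast
  have "summable (\<lambda>n. (real n * q n) / Z)" by (intro summable_divide sum_nq)
  then show "summable (\<lambda>n. real n * pmf (pbd_pmf a b 0) n)" unfolding pbd pmf_p by simp
qed

section \<open>Configurations as finite multisets\<close>

lemma points_sets [simp]: "sets (points n x) = sets borel" and points_space [simp]: "space (points n x) = UNIV"
  unfolding points_def by simp_all

lemma emeasure_points:
  assumes "C \<in> sets borel"
  shows "emeasure (points n x) C = of_nat (card {i. i < n \<and> x i \<in> C})"
proof -
  have "emeasure (points n x) C = emeasure (count_space {..<n}) (x -` C \<inter> {..<n})"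
    unfolding points_def using assms by (subst emeasure_distr) auto
  also have "\<dots> = of_nat (card (x -` C \<inter> {..<n}))" by (rule emeasure_count_space_finite) auto
  also have "x -` C \<inter> {..<n} = {i. i < n \<and> x i \<in> C}" by auto
  finally show ?thesis .
qed

text \<open>The chosen enumeration is immaterial, since \<open>emeasure_cfg\<close> only counts
  points with multiplicity.\<close>

definition cfg :: "'a::metric_space multiset \<Rightarrow> 'a measure" where
  "cfg M = (let xs = (SOME xs. mset xs = M) in points (length xs) (nth xs))"

lemma cfg_sets [simp]: "sets (cfg M) = sets borel" and cfg_space [simp]: "space (cfg M) = UNIV"
  unfolding cfg_def by (simp_all add: Let_def)

lemma emeasure_cfg:
  assumes "C \<in> sets borel"
  shows "emeasure (cfg M) C = of_nat (size (filter_mset (\<lambda>x. x \<in> C) M))"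
proof -
  define xs where "xs = (SOME xs. mset xs = M)"
  have xs: "mset xs = M" unfolding xs_def by (rule someI_ex) (rule ex_mset)
  have "emeasure (cfg M) C = of_nat (length (filter (\<lambda>x. x \<in> C) xs))"
    unfolding cfg_def xs_def[symmetric] Let_def emeasure_points[OF assms] length_filter_conv_card ..
  then show ?thesis unfolding xs[symmetric] mset_filter[symmetric] size_mset .
qed

lemma measure_cfg: "C \<in> sets borel \<Longrightarrow> measure (cfg M) C = real (size (filter_mset (\<lambda>x. x \<in> C) M))"
  unfolding measure_def by (simp add: emeasure_cfg ennreal_of_nat_eq_real_of_nat)

lemma measure_eq_cfgI:
  "sets \<xi> = sets borel \<Longrightarrow> (\<And>C. C \<in> sets borel \<Longrightarrow> emeasure \<xi> C = of_nat (size (filter_mset (\<lambda>x. x \<in> C) M))) \<Longrightarrow> \<xi> = cfg M"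
  by (rule measure_eqI) (auto simp: emeasure_cfg)

text \<open>\<open>measure_of\<close> gives the intended measure only for a countably additive
  function. That property is inherited here from \<open>cfg M\<close>, with which
  \<open>\<mu>\<close> agrees on Borel sets.\<close>

lemma measure_of_eq_cfgI:
  assumes "\<And>C. C \<in> sets borel \<Longrightarrow> \<mu> C = of_nat (size (filter_mset (\<lambda>x. x \<in> C) M))"
  shows "measure_of UNIV (sets borel) \<mu> = cfg M"
proof -
  have "measure_of UNIV (sets borel) \<mu> = measure_of (space (cfg M)) (sets (cfg M)) (emeasure (cfg M))"
    unfolding cfg_space cfg_sets
    by (rule measure_of_eq) (auto simp: sets.sigma_sets_eq[of borel, simplified] emeasure_cfg assms)
  then show ?thesis by (simp only: measure_of_of_measure)
qed

lemma cfg_mset: "cfg (mset xs) = points (length xs) (nth xs)"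
  by (rule measure_eq_cfgI[symmetric])
    (simp_all add: emeasure_points length_filter_conv_card flip: mset_filter)

lemma points_eq_cfg: "points n x = cfg (mset (map x [0..<n]))"
proof -
  have "points n x = points (length (map x [0..<n])) (nth (map x [0..<n]))"
    by (rule measure_eqI) (auto simp: emeasure_points intro!: arg_cong[where f = card])
  then show ?thesis by (simp only: cfg_mset)
qed

lemma cfg_in_configs [simp, intro]: "cfg M \<in> configs"
  unfolding configs_def by (auto simp: emeasure_cfg)

lemma mass_cfg [simp]: "mass (cfg M) = real (size M)"
  unfolding mass_def by (subst measure_cfg) auto

lemma cfg_inject:
  fixes M N :: "'a::metric_space multiset"
  shows "cfg M = cfg N \<Longrightarrow> M = N"
proof (rule multiset_eqI)
  fix x :: 'a assume *: "cfg M = cfg N"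
  have e: "emeasure (cfg K) {x} = of_nat (count K x)" for K :: "'a multiset"
    by (subst emeasure_cfg) (simp_all add: filter_eq_replicate_mset)
  show "count M x = count N x" using e[of M] e[of N] * by simp
qed

lemma emeasure_restr:
  assumes s: "sets \<xi> = sets borel" and B: "B \<in> sets borel" and C: "C \<in> sets borel"
  shows "emeasure (restr \<xi> B) C = emeasure \<xi> (C \<inter> B)"
proof -
  have "emeasure (restr \<xi> B) C = (\<integral>\<^sup>+x. indicator B x * indicator C x \<partial>\<xi>)"
    unfolding restr_def by (rule emeasure_density) (use B C in \<open>simp_all add: s cong: measurable_cong_sets\<close>)
  also have "\<dots> = (\<integral>\<^sup>+x. indicator (C \<inter> B) x \<partial>\<xi>)" by (rule nn_integral_cong) (auto simp: indicator_def)
  also have "\<dots> = emeasure \<xi> (C \<inter> B)" by (rule nn_integral_indicator) (use B C s in auto)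
  finally show ?thesis .
qed

lemma restr_cfg: "B \<in> sets borel \<Longrightarrow> restr (cfg M) B = cfg (filter_mset (\<lambda>x. x \<in> B) M)"
proof (rule measure_eq_cfgI)
  assume B: "B \<in> sets borel"
  show "sets (restr (cfg M) B) = sets borel" unfolding restr_def by simp
  fix C :: "'a set" assume C: "C \<in> sets borel"
  have "emeasure (restr (cfg M) B) C = emeasure (cfg M) (C \<inter> B)" by (rule emeasure_restr) (simp_all add: B C)
  also have "\<dots> = of_nat (size (filter_mset (\<lambda>x. x \<in> C) (filter_mset (\<lambda>x. x \<in> B) M)))"
    using B C by (subst emeasure_cfg) (auto simp: filter_filter_mset conj_commute)
  finally show "emeasure (restr (cfg M) B) C = of_nat (size (filter_mset (\<lambda>x. x \<in> C) (filter_mset (\<lambda>x. x \<in> B) M)))" .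
qed

lemma add_point_cfg: "add_point (cfg M) x = cfg (add_mset x M)"
  unfolding add_point_def by (rule measure_of_eq_cfgI) (auto simp: emeasure_cfg indicator_def)

lemma del_point_cfg: "del_point (cfg (add_mset x M)) x = cfg M"
  unfolding del_point_def by (rule measure_of_eq_cfgI) (auto simp: emeasure_cfg indicator_def)

lemma nn_integral_cfg:
  assumes f: "f \<in> borel_measurable borel"
  shows "(\<integral>\<^sup>+x. f x \<partial>cfg M) = (\<Sum>x\<in>#M. f x)"
proof -
  have *: "(\<integral>\<^sup>+x. f x \<partial>points n x') = (\<Sum>i<n. f (x' i))" for n x'
    unfolding points_def using f by (subst nn_integral_distr) (auto simp: nn_integral_count_space_finite)
  obtain xs where xs: "mset xs = M" using ex_mset by blast
  have "(\<integral>\<^sup>+x. f x \<partial>cfg M) = (\<Sum>i<length xs. f (xs ! i))" unfolding xs[symmetric] cfg_mset * ..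
  also have "\<dots> = sum_list (map f xs)" by (simp add: sum_list_sum_nth atLeast0LessThan)
  also have "\<dots> = (\<Sum>x\<in>#M. f x)" unfolding xs[symmetric] by (simp flip: sum_mset_sum_list)
  finally show ?thesis .
qed

lemma AE_cfg: "AE x in cfg M. x \<in># M"
proof (rule AE_I[where N = "- set_mset M"])
  have s: "set_mset M \<in> sets borel" by (intro borel_closed finite_imp_closed) simp
  then show "- set_mset M \<in> sets (cfg M)" by simp
  show "emeasure (cfg M) (- set_mset M) = 0"
    using s by (subst emeasure_cfg) (auto simp: filter_mset_eq_conv)
qed auto

section \<open>Every configuration is a finite sum of point masses\<close>

lemma configs_sets: "\<xi> \<in> configs \<Longrightarrow> sets \<xi> = sets borel"
  unfolding configs_def by simp

lemma configs_nat: "\<xi> \<in> configs \<Longrightarrow> C \<in> sets borel \<Longrightarrow> \<exists>n. emeasure \<xi> C = of_nat n"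
  unfolding configs_def by auto

text \<open>If every point had a null ball around it, finitely many such balls would cover the
  compact space. So around some \<open>x\<close> all balls have positive mass, which is at least 1
  because masses are integers, and continuity from above passes this to \<open>{x}\<close>.\<close>

lemma configs_atom:
  fixes \<xi> :: "'a::metric_space measure"
  assumes "compact (UNIV :: 'a set)" and \<xi>: "\<xi> \<in> configs" and pos: "emeasure \<xi> UNIV \<noteq> 0"
  obtains x where "emeasure \<xi> {x} \<noteq> 0"
proof -
  note [measurable_cong] = configs_sets[OF \<xi>]
  have sets: "sets \<xi> = sets borel" by (rule configs_sets[OF \<xi>])
  have "\<exists>x. \<forall>e>0. emeasure \<xi> (ball x e) \<noteq> 0"
  proof (rule ccontr)
    assume "\<not> (\<exists>x. \<forall>e>0. emeasure \<xi> (ball x e) \<noteq> 0)"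
    then obtain e where e: "\<And>x. 0 < e x" "\<And>x. emeasure \<xi> (ball x (e x)) = 0" by metis
    have "UNIV \<subseteq> (\<Union>x. ball x (e x))" using e(1) by (auto intro!: bexI)
    then obtain F where F: "F \<subseteq> UNIV" "finite F" "UNIV \<subseteq> (\<Union>x\<in>F. ball x (e x))"
      using compactE_image[OF assms(1), of UNIV "\<lambda>x. ball x (e x)"] by auto
    have "emeasure \<xi> (\<Union>x\<in>F. ball x (e x)) \<le> (\<Sum>x\<in>F. emeasure \<xi> (ball x (e x)))"
      by (rule emeasure_subadditive_finite) (use F sets in auto)
    then show False using F(3) pos e(2) by (simp add: top.extremum_unique)
  qed
  then obtain x where x: "\<And>e. e > 0 \<Longrightarrow> emeasure \<xi> (ball x e) \<noteq> 0" by blast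
  have ge1: "1 \<le> emeasure \<xi> (ball x (1 / real (Suc n)))" for n
  proof -
    obtain m where m: "emeasure \<xi> (ball x (1 / real (Suc n))) = of_nat m" using configs_nat[OF \<xi>, of "ball x (1 / real (Suc n))"] by auto
    then have "m \<noteq> 0" using x[of "1 / real (Suc n)"] by (intro notI) simp
    then show ?thesis unfolding m using of_nat_mono[of 1 m] by simp
  qed
  have "(\<Inter>n. ball x (1 / real (Suc n))) = {x}"
  proof -
    have "y = x" if "\<And>n. dist x y < 1 / real (Suc n)" for y
    proof (rule ccontr)
      assume "y \<noteq> x"
      then obtain n where "1 / real (Suc n) < dist x y" using nat_approx_posE[of "dist x y"] by auto
      then show False using that[of n] by simp
    qed
    then show ?thesis by auto
  qed
  then have Int: "(\<Inter>n. ball x (1 / real (Suc n))) = {x}" .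
  have "(INF n. emeasure \<xi> (ball x (1 / real (Suc n)))) = emeasure \<xi> (\<Inter>n. ball x (1 / real (Suc n)))"
  proof (rule INF_emeasure_decseq)
    show "range (\<lambda>n. ball x (1 / real (Suc n))) \<subseteq> sets \<xi>" unfolding sets by (intro image_subsetI borel_open open_ball)
    show "decseq (\<lambda>n. ball x (1 / real (Suc n)))"
    proof (intro decseq_SucI subset_ball)
      show "1 / real (Suc (Suc n)) \<le> 1 / real (Suc n)" for n by (rule divide_left_mono) simp_all
    qed
    fix i
    obtain m where "emeasure \<xi> (ball x (1 / real (Suc i))) = of_nat m"
      using configs_nat[OF \<xi> borel_open[OF open_ball, of x "1 / real (Suc i)"]] by blast
    then show "emeasure \<xi> (ball x (1 / real (Suc i))) \<noteq> \<infinity>" by (simp only:) simp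
  qed
  moreover have "1 \<le> (INF n. emeasure \<xi> (ball x (1 / real (Suc n))))" by (rule INF_greatest) (rule ge1)
  ultimately have "1 \<le> emeasure \<xi> {x}" unfolding Int by (simp only:)
  then have "emeasure \<xi> {x} \<noteq> 0" by (metis not_one_le_zero)
  then show ?thesis using that by blast
qed

text \<open>There are finitely many atoms, and \<open>configs_atom\<close> shows that nothing remains without them.\<close>

lemma configs_eq_cfg:
  fixes \<xi> :: "'a::metric_space measure"
  assumes compact: "compact (UNIV :: 'a set)" and \<xi>: "\<xi> \<in> configs"
  obtains M where "\<xi> = cfg M"
proof -
  have sets: "sets \<xi> = sets borel" by (rule configs_sets[OF \<xi>])
  have "\<exists>n. emeasure \<xi> {x} = of_nat n" for x by (rule configs_nat[OF \<xi>]) simp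
  then obtain c where c: "\<And>x. emeasure \<xi> {x} = of_nat (c x)" by metis
  obtain m where m: "emeasure \<xi> UNIV = of_nat m" using configs_nat[OF \<xi>, of UNIV] by auto
  define A where "A = {x. c x \<noteq> 0}"
  have sumF: "emeasure \<xi> F = of_nat (\<Sum>x\<in>F. c x)" if "finite F" for F
  proof -
    have "emeasure \<xi> F = (\<Sum>x\<in>F. emeasure \<xi> {x})"
      using that sets by (intro emeasure_eq_sum_singleton) auto
    then show ?thesis by (simp add: c)
  qed
  have fin: "finite A"
  proof (rule ccontr)
    assume "infinite A"
    then obtain F where F: "F \<subseteq> A" "finite F" "card F = Suc m" using infinite_arbitrarily_large by blast
    have "card F \<le> (\<Sum>x\<in>F. c x)"
      using sum_mono[of F "\<lambda>_. 1" c] F(1) unfolding A_def by force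
    then have "of_nat (Suc m) \<le> emeasure \<xi> F" unfolding sumF[OF F(2)] F(3) by (rule of_nat_mono)
    also have "\<dots> \<le> emeasure \<xi> UNIV" by (rule emeasure_mono) (use sets in auto)
    finally show False unfolding m by simp
  qed
  have A: "A \<in> sets borel" using fin by (intro borel_closed finite_imp_closed)
  have null: "emeasure \<xi> (- A) = 0"
  proof (rule ccontr)
    assume nz: "emeasure \<xi> (- A) \<noteq> 0"
    define \<eta> where "\<eta> = density \<xi> (indicator (- A))"
    have em: "emeasure \<eta> C = emeasure \<xi> (C \<inter> - A)" if "C \<in> sets borel" for C
    proof -
      have "emeasure \<eta> C = (\<integral>\<^sup>+x. indicator (- A) x * indicator C x \<partial>\<xi>)"
        unfolding \<eta>_def by (rule emeasure_density) (use that A sets in \<open>auto cong: measurable_cong_sets\<close>)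
      also have "\<dots> = (\<integral>\<^sup>+x. indicator (C \<inter> - A) x \<partial>\<xi>)" by (rule nn_integral_cong) (auto simp: indicator_def)
      also have "\<dots> = emeasure \<xi> (C \<inter> - A)" by (rule nn_integral_indicator) (use that A sets in auto)
      finally show ?thesis .
    qed
    have "\<eta> \<in> configs" unfolding configs_def
    proof (intro CollectI conjI ballI)
      show "sets \<eta> = sets borel" unfolding \<eta>_def using sets by simp
      fix C :: "'a set" assume "C \<in> sets borel"
      then show "emeasure \<eta> C \<in> range (of_nat :: nat \<Rightarrow> ennreal)"
        using configs_nat[OF \<xi>, of "C \<inter> - A"] A by (auto simp: em)
    qed
    moreover have "emeasure \<eta> UNIV \<noteq> 0" using nz by (simp add: em)
    ultimately obtain x where x: "emeasure \<eta> {x} \<noteq> 0" using configs_atom[OF compact] by blast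
    have "emeasure \<eta> {x} = 0"
    proof (cases "x \<in> A")
      case False
      then show ?thesis using c[of x] by (simp add: em A_def)
    qed (simp add: em)
    with x show False by simp
  qed
  define M where "M = (\<Sum>x\<in>A. replicate_mset (c x) x)"
  have sizeM: "size (filter_mset (\<lambda>x. x \<in> C) M) = (\<Sum>x\<in>A \<inter> C. c x)" for C
  proof -
    have f: "filter_mset P (\<Sum>x\<in>F. g x) = (\<Sum>x\<in>F. filter_mset P (g x))" if "finite F" for P F and g :: "'a \<Rightarrow> 'a multiset"
      using that by (induction F) auto
    have s: "size (\<Sum>x\<in>F. g x) = (\<Sum>x\<in>F. size (g x))" if "finite F" for F and g :: "'a \<Rightarrow> 'a multiset"
      using that by (induction F) auto
    have r: "size (filter_mset P (replicate_mset n x)) = (if P x then n else 0)" for P n and x :: 'a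
      by (induction n) auto
    have "size (filter_mset (\<lambda>x. x \<in> C) M) = (\<Sum>x\<in>A. if x \<in> C then c x else 0)"
      unfolding M_def f[OF fin] s[OF fin]
      by (simp add: r)
    then show ?thesis using fin by (simp add: sum.inter_restrict)
  qed
  have "\<xi> = cfg M"
  proof (rule measure_eq_cfgI[OF sets])
    fix C :: "'a set" assume C: "C \<in> sets borel"
    have "emeasure \<xi> C = emeasure \<xi> ((A \<inter> C) \<union> (C \<inter> - A))" by (rule arg_cong[where f = "emeasure \<xi>"]) auto
    also have "\<dots> = emeasure \<xi> (A \<inter> C) + emeasure \<xi> (C \<inter> - A)"
      by (rule plus_emeasure[symmetric]) (use A C sets in auto)
    also have "emeasure \<xi> (C \<inter> - A) = 0"
      using emeasure_mono[of "C \<inter> - A" "- A" \<xi>] null A sets by simp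
    also have "emeasure \<xi> (A \<inter> C) = of_nat (\<Sum>x\<in>A \<inter> C. c x)" using fin by (intro sumF) simp
    finally show "emeasure \<xi> C = of_nat (size (filter_mset (\<lambda>x. x \<in> C) M))" unfolding sizeM by simp
  qed
  then show ?thesis by (rule that)
qed

section \<open>The matching metric\<close>

lemma d1_points_le:
  fixes x y :: "nat \<Rightarrow> 'a::metric_space"
  assumes "\<And>i. i < n \<Longrightarrow> dist (x i) (y i) \<le> e" and e: "0 \<le> e"
  shows "d1 (points n x) (points n y) \<le> e"
    and "n > 0 \<Longrightarrow> d1 (points n x) (points n y) \<le> (\<Sum>i<n. dist (x i) (y i)) / real n"
proof -
  have mass: "mass (points n z) = real n" for z :: "nat \<Rightarrow> 'a" unfolding points_eq_cfg by simp
  show 1: "d1 (points n x) (points n y) \<le> (\<Sum>i<n. dist (x i) (y i)) / real n" if "n > 0"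
  proof -
    let ?S = "{(\<Sum>i<m. dist (x' i) (y' (\<sigma> i))) / real m | m x' y' \<sigma>.
                 points n x = points m x' \<and> points n y = points m y' \<and> \<sigma> permutes {..<m}}"
    have "Inf ?S \<le> (\<Sum>i<n. dist (x i) (y i)) / real n"
    proof (rule cInf_lower)
      have "id permutes {..<n}" by (rule permutes_id)
      then show "(\<Sum>i<n. dist (x i) (y i)) / real n \<in> ?S" by (intro CollectI exI[of _ n] exI[of _ x] exI[of _ y] exI[of _ id]) simp
      show "bdd_below ?S" by (rule bdd_belowI[of _ 0]) (auto intro!: divide_nonneg_nonneg sum_nonneg)
    qed
    then show ?thesis unfolding d1_def mass using that by simp
  qed
  show "d1 (points n x) (points n y) \<le> e"
  proof (cases "n = 0")
    case True then show ?thesis unfolding d1_def mass using e by simp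
  next
    case False
    have "(\<Sum>i<n. dist (x i) (y i)) \<le> (\<Sum>i<n. e)" by (intro sum_mono assms) simp
    then have "(\<Sum>i<n. dist (x i) (y i)) / real n \<le> e" using False by (simp add: divide_le_eq mult.commute)
    then show ?thesis using 1 False by linarith
  qed
qed

lemma d1_image_le:
  assumes "\<And>x. dist x (g x) \<le> e" "0 \<le> e"
  shows "d1 (cfg M) (cfg (image_mset g M)) \<le> e"
proof -
  obtain xs where xs: "mset xs = M" using ex_mset by blast
  have 1: "cfg M = points (length xs) (nth xs)" unfolding xs[symmetric] cfg_mset ..
  have "cfg (image_mset g M) = points (length (map g xs)) (nth (map g xs))" unfolding xs[symmetric] mset_map[symmetric] cfg_mset ..
  then show ?thesis unfolding 1 by (simp only: length_map) (rule d1_points_le(1), use assms in auto)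
qed

lemma d1_add_mset_le:
  fixes x y :: "'a::metric_space"
  assumes "\<And>x y :: 'a. dist x y \<le> 1"
  shows "d1 (cfg (add_mset x M)) (cfg (add_mset y M)) \<le> 1 / (real (size M) + 1)"
proof -
  obtain xs where xs: "mset xs = M" using ex_mset by blast
  have c: "cfg (add_mset z M) = points (Suc (length xs)) (nth (z # xs))" for z
    unfolding xs[symmetric] mset.simps(2)[symmetric] cfg_mset by simp
  have "d1 (cfg (add_mset x M)) (cfg (add_mset y M)) \<le> (\<Sum>i<Suc (length xs). dist ((x # xs) ! i) ((y # xs) ! i)) / real (Suc (length xs))"
    unfolding c by (rule d1_points_le(2)[of _ _ _ 1]) (use assms in auto)
  also have "(\<Sum>i<Suc (length xs). dist ((x # xs) ! i) ((y # xs) ! i)) = dist x y"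
    by (subst sum.lessThan_Suc_shift) simp
  also have "dist x y / real (Suc (length xs)) \<le> 1 / (real (size M) + 1)"
    using assms[of x y] unfolding xs[symmetric] by (simp add: divide_right_mono add.commute)
  finally show ?thesis .
qed

lemma d1_le_1:
  assumes "\<And>x y :: 'a::metric_space. dist x y \<le> 1"
  shows "d1 (cfg M) (cfg (N :: 'a multiset)) \<le> 1"
proof (cases "size M = size N")
  case False then show ?thesis unfolding d1_def by simp
next
  case True
  obtain xs where xs: "mset xs = M" using ex_mset by blast
  obtain ys where ys: "mset ys = N" using ex_mset by blast
  have "length ys = length xs" using True xs ys by (metis size_mset)
  then show ?thesis unfolding xs[symmetric] ys[symmetric] cfg_mset
    by (simp only:) (rule d1_points_le(1), use assms in auto)
qed

lemma d1_cfg_nonneg: "0 \<le> d1 (cfg M) (cfg N)"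
proof (cases "size M = size N")
  case False then show ?thesis unfolding d1_def by simp
next
  case True
  obtain xs where xs: "mset xs = M" using ex_mset by blast
  obtain ys where ys: "mset ys = N" using ex_mset by blast
  have len: "length ys = length xs" using True xs ys by (metis size_mset)
  let ?S = "{(\<Sum>i<n. dist (x i) (y (\<sigma> i))) / real n | n x y \<sigma>.
    cfg M = points n x \<and> cfg N = points n y \<and> \<sigma> permutes {..<n}}"
  have "cfg M = points (length xs) (nth xs)" "cfg N = points (length xs) (nth ys)"
    unfolding xs[symmetric] ys[symmetric] cfg_mset len by simp_all
  then have "?S \<noteq> {}" using permutes_id[of "{..<length xs}"] by blast
  then have "0 \<le> Inf ?S" by (rule cInf_greatest) (auto intro!: divide_nonneg_nonneg sum_nonneg)
  then show ?thesis unfolding d1_def by simp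
qed

section \<open>Measurability\<close>

lemma space_config_algebra [simp]: "space config_algebra = configs"
  unfolding config_algebra_def by (rule space_measure_of) auto

lemma emeasure_config_measurable [measurable (raw)]:
  assumes "C \<in> sets borel"
  shows "(\<lambda>\<xi>. emeasure \<xi> C) \<in> borel_measurable config_algebra"
proof (rule measurableI)
  fix S :: "ennreal set" assume "S \<in> sets borel"
  then have "{\<xi> \<in> configs. emeasure \<xi> C \<in> S} \<in> sets config_algebra"
    unfolding config_algebra_def using assms by (intro in_measure_of) auto
  also have "{\<xi> \<in> configs. emeasure \<xi> C \<in> S} = (\<lambda>\<xi>. emeasure \<xi> C) -` S \<inter> space config_algebra" by auto
  finally show "(\<lambda>\<xi>. emeasure \<xi> C) -` S \<inter> space config_algebra \<in> sets config_algebra" .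
qed simp

lemma measure_config_measurable: "C \<in> sets borel \<Longrightarrow> (\<lambda>\<xi>. measure \<xi> C) \<in> borel_measurable config_algebra"
  unfolding measure_def by (intro borel_measurable_enn2real emeasure_config_measurable)

lemma measurable_config_algebraI:
  fixes X :: "'w \<Rightarrow> 'a::metric_space measure"
  assumes "\<And>\<omega>. \<omega> \<in> space M \<Longrightarrow> X \<omega> \<in> configs"
    and "\<And>C. C \<in> sets borel \<Longrightarrow> (\<lambda>\<omega>. emeasure (X \<omega>) C) \<in> borel_measurable M"
  shows "X \<in> measurable M config_algebra"
  unfolding config_algebra_def
proof (rule measurable_measure_of)
  show "X \<in> space M \<rightarrow> configs" using assms(1) by auto
  fix Y :: "'a measure set" assume "Y \<in> {{\<xi> \<in> configs. emeasure \<xi> C \<in> S} | C S. C \<in> sets borel \<and> S \<in> sets borel}"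
  then obtain C S where Y: "Y = {\<xi> \<in> configs. emeasure \<xi> C \<in> S}" and C: "C \<in> sets borel" and S: "S \<in> sets borel" by blast
  have "X -` Y \<inter> space M = (\<lambda>\<omega>. emeasure (X \<omega>) C) -` S \<inter> space M" unfolding Y using assms(1) by auto
  then show "X -` Y \<inter> space M \<in> sets M" using measurable_sets[OF assms(2)[OF C] S] by simp
qed auto

lemma restr_in_configs:
  assumes "\<xi> \<in> configs" "B \<in> sets borel"
  shows "restr \<xi> B \<in> configs"
  unfolding configs_def
proof (intro CollectI conjI ballI)
  show "sets (restr \<xi> B) = sets borel" unfolding restr_def using configs_sets[OF assms(1)] by simp
  fix C :: "'a set" assume "C \<in> sets borel"
  then show "emeasure (restr \<xi> B) C \<in> range (of_nat :: nat \<Rightarrow> ennreal)"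
    using configs_nat[OF assms(1), of "C \<inter> B"] assms(2) emeasure_restr[OF configs_sets[OF assms(1)] assms(2)] by auto
qed

lemma restr_measurable:
  assumes B: "B \<in> sets borel"
  shows "(\<lambda>\<xi>. restr \<xi> B) \<in> measurable config_algebra config_algebra"
proof (rule measurable_config_algebraI)
  show "restr \<xi> B \<in> configs" if "\<xi> \<in> space config_algebra" for \<xi> :: "'a measure"
    using restr_in_configs[OF _ B] that by simp
  fix C :: "'a set" assume C: "C \<in> sets borel"
  have "(\<lambda>\<xi>. emeasure \<xi> (C \<inter> B)) \<in> borel_measurable config_algebra" using B C by measurable
  then show "(\<lambda>\<xi>. emeasure (restr \<xi> B) C) \<in> borel_measurable config_algebra"
    by (subst measurable_cong) (auto simp: emeasure_restr[OF configs_sets] B C)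
qed

section \<open>Coarsening\<close>

text \<open>The inverse of \<open>cfg\<close>. It is meaningful on all of \<open>configs\<close>
  once compactness is available, by \<open>cfg_pts\<close>.\<close>

definition pts :: "'a::metric_space measure \<Rightarrow> 'a multiset" where "pts \<xi> = (THE M. cfg M = \<xi>)"

lemma pts_cfg [simp]: "pts (cfg M) = M"
  unfolding pts_def by (rule the_equality) (auto dest: cfg_inject)

text \<open>This serves both for the partition of the theorem and for arbitrarily fine auxiliary
  partitions. The point \<open>y j\<close> may lie outside \<open>C j\<close>.\<close>

locale cells =
  fixes J :: "nat set" and C :: "nat \<Rightarrow> 'a::metric_space set" and y :: "nat \<Rightarrow> 'a"
  assumes compact: "compact (UNIV :: 'a set)" and J: "finite J" and C: "\<And>j. j \<in> J \<Longrightarrow> C j \<in> sets borel"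
    and disj: "disjoint_family_on C J" and cover: "(\<Union>j\<in>J. C j) = UNIV"
begin

definition cell :: "'a \<Rightarrow> nat" where "cell x = (THE j. j \<in> J \<and> x \<in> C j)"

definition c :: "'a \<Rightarrow> 'a" where "c x = y (cell x)"

text \<open>The coarsened configuration as a multiset; \<open>coarsen_eq\<close> gives the link with
  \<open>coarsen\<close>. Its values are discrete, so every function of it is measurable.\<close>

definition crs :: "'a measure \<Rightarrow> 'a multiset" where "crs \<xi> = image_mset c (pts \<xi>)"

lemma cell_eq: "j \<in> J \<Longrightarrow> x \<in> C j \<Longrightarrow> cell x = j"
  unfolding cell_def using disj by (intro the_equality) (auto simp: disjoint_family_on_def)

lemma cell_in: "cell x \<in> J" "x \<in> C (cell x)"
  using cover cell_eq by (metis UNIV_I UN_iff)+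

lemma in_C_iff: "j \<in> J \<Longrightarrow> x \<in> C j \<longleftrightarrow> cell x = j"
  using cell_eq cell_in by blast

lemma c_in: "c x \<in> y ` J" unfolding c_def using cell_in by blast

lemma cell_measurable: "cell \<in> measurable borel (count_space UNIV)"
proof (rule measurable_count_space_eq_countable[THEN iffD2])
  show "countable (UNIV :: nat set)" by simp
  show "cell \<in> space borel \<rightarrow> UNIV \<and> (\<forall>a\<in>UNIV. cell -` {a} \<inter> space borel \<in> sets borel)"
  proof (intro conjI ballI)
    fix j
    have "cell -` {j} = (if j \<in> J then C j else {})" using cell_in in_C_iff by auto
    then show "cell -` {j} \<inter> space borel \<in> sets borel" using C by simp
  qed auto
qed

lemma c_measurable: "(\<lambda>x. F (c x)) \<in> measurable borel (count_space UNIV)"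
  unfolding c_def by (rule measurable_compose[OF cell_measurable]) simp

lemma crs_cfg [simp]: "crs (cfg M) = image_mset c M" by (simp add: crs_def)

lemma cfg_pts:
  fixes \<xi> :: "'a measure"
  shows "\<xi> \<in> configs \<Longrightarrow> cfg (pts \<xi>) = \<xi>"
  using configs_eq_cfg[OF compact, of \<xi>] by (metis pts_cfg)

lemma count_measurable:
  fixes S :: "'a set"
  assumes "S \<in> sets borel"
  shows "(\<lambda>\<xi>. size (filter_mset (\<lambda>x. x \<in> S) (pts \<xi>))) \<in> measurable config_algebra (count_space UNIV)"
proof -
  have "(\<lambda>\<xi>. nat \<lfloor>measure \<xi> S\<rfloor>) \<in> measurable config_algebra (count_space UNIV)"
    using measure_config_measurable[OF assms] by measurable
  moreover have "nat \<lfloor>measure \<xi> S\<rfloor> = size (filter_mset (\<lambda>x. x \<in> S) (pts \<xi>))" if "\<xi> \<in> space config_algebra" for \<xi> :: "'a measure"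
    using measure_cfg[OF assms, of "pts \<xi>"] cfg_pts that by simp
  ultimately show ?thesis by (subst (asm) measurable_cong) auto
qed

text \<open>The target carries the discrete sigma-algebra although it may be uncountable.
  Measurability holds because the value is built from finitely many counts, each a measurable map to
  the naturals.\<close>

lemma mset_sum_measurable:
  fixes S :: "'j \<Rightarrow> 'a set"
  assumes "finite K" "\<And>j. j \<in> K \<Longrightarrow> S j \<in> sets borel"
  shows "(\<lambda>\<xi>. \<Sum>j\<in>K. replicate_mset (size (filter_mset (\<lambda>x. x \<in> S j) (pts \<xi>))) (z j))
    \<in> measurable config_algebra (count_space (UNIV :: 'b multiset set))"
  using assms
proof (induction K)
  case (insert j K)
  let ?F = "\<lambda>\<xi>. \<Sum>j\<in>K. replicate_mset (size (filter_mset (\<lambda>x. x \<in> S j) (pts \<xi>))) (z j)"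
  have F: "?F \<in> measurable config_algebra (count_space UNIV)" using insert by simp
  have "(\<lambda>\<xi>. replicate_mset n (z j) + ?F \<xi>) \<in> measurable config_algebra (count_space UNIV)" for n
    by (rule measurable_compose[OF F]) simp
  from measurable_compose_countable[OF this count_measurable[of "S j"]] show ?case
    using insert by simp
qed simp

lemma image_c_eq: "image_mset c M = (\<Sum>j\<in>J. replicate_mset (size (filter_mset (\<lambda>x. x \<in> C j) M)) (y j))"
proof (induction M)
  case (add x M)
  have "(\<Sum>j\<in>J. replicate_mset (size (filter_mset (\<lambda>x. x \<in> C j) (add_mset x M))) (y j))
    = (\<Sum>j\<in>J. (if j = cell x then {#y j#} else {#}) + replicate_mset (size (filter_mset (\<lambda>x. x \<in> C j) M)) (y j))"
    by (intro sum.cong refl) (auto simp: in_C_iff)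
  also have "\<dots> = add_mset (c x) (\<Sum>j\<in>J. replicate_mset (size (filter_mset (\<lambda>x. x \<in> C j) M)) (y j))"
    using J cell_in(1)[of x] by (simp add: sum.distrib c_def)
  finally show ?case using add by simp
qed simp

lemma crs_measurable: "crs \<in> measurable config_algebra (count_space UNIV)"
proof -
  have "crs = (\<lambda>\<xi>. \<Sum>j\<in>J. replicate_mset (size (filter_mset (\<lambda>x. x \<in> C j) (pts \<xi>))) (y j))"
    unfolding crs_def image_c_eq ..
  then show ?thesis using mset_sum_measurable[OF J C] by simp
qed

lemma crs_set: "set_mset (crs \<xi>) \<subseteq> y ` J"
  unfolding crs_def using c_in by auto

lemma size_crs: "\<xi> \<in> configs \<Longrightarrow> real (size (crs \<xi>)) = mass \<xi>"
  unfolding crs_def size_image_mset using mass_cfg[of "pts \<xi>"] cfg_pts[of \<xi>] by simp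

lemma crs_restr: "\<xi> \<in> configs \<Longrightarrow> B \<in> sets borel \<Longrightarrow> crs (restr \<xi> B) = image_mset c (filter_mset (\<lambda>x. x \<in> B) (pts \<xi>))"
  using restr_cfg[of B "pts \<xi>"] cfg_pts[of \<xi>] by (simp add: crs_def)

lemma size_crs_restr: "\<xi> \<in> configs \<Longrightarrow> B \<in> sets borel \<Longrightarrow> real (size (crs (restr \<xi> B))) = measure \<xi> B"
  using measure_cfg[of B "pts \<xi>"] cfg_pts[of \<xi>] by (simp add: crs_restr)

lemma crs_restr_split:
  assumes "\<xi> \<in> configs" "B \<in> sets borel"
  shows "crs \<xi> = crs (restr \<xi> (- B)) + crs (restr \<xi> B)"
proof -
  have "pts \<xi> = filter_mset (\<lambda>x. x \<in> - B) (pts \<xi>) + filter_mset (\<lambda>x. x \<in> B) (pts \<xi>)"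
    using multiset_partition[of "pts \<xi>" "\<lambda>x. x \<in> B"] by (simp add: add.commute)
  then have "crs \<xi> = image_mset c (filter_mset (\<lambda>x. x \<in> - B) (pts \<xi>) + filter_mset (\<lambda>x. x \<in> B) (pts \<xi>))"
    unfolding crs_def by (simp only:)
  then show ?thesis
    unfolding crs_restr[OF assms] crs_restr[OF assms(1) borel_comp[OF assms(2)]] by (simp only: image_mset_union)
qed

lemma crs_restr_split2:
  assumes "\<xi> \<in> configs" "A \<in> sets borel" "B \<in> sets borel" "A \<subseteq> B"
  shows "crs (restr \<xi> B) = crs (restr \<xi> A) + crs (restr \<xi> (B - A))"
    and "crs (restr \<xi> (- A)) = crs (restr \<xi> (- B)) + crs (restr \<xi> (B - A))"
proof -
  have 1: "filter_mset (\<lambda>x. x \<in> B) M = filter_mset (\<lambda>x. x \<in> A) M + filter_mset (\<lambda>x. x \<in> B - A) M" for M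
    using assms(4) by (induction M) auto
  have 2: "filter_mset (\<lambda>x. x \<in> - A) M = filter_mset (\<lambda>x. x \<in> - B) M + filter_mset (\<lambda>x. x \<in> B - A) M" for M
    using assms(4) by (induction M) auto
  show "crs (restr \<xi> B) = crs (restr \<xi> A) + crs (restr \<xi> (B - A))"
    using assms 1[of "pts \<xi>"] by (simp add: crs_restr)
  show "crs (restr \<xi> (- A)) = crs (restr \<xi> (- B)) + crs (restr \<xi> (B - A))"
    using assms 2[of "pts \<xi>"] by (simp add: crs_restr)
qed

lemma restr_restr:
  assumes "\<xi> \<in> configs" "A \<in> sets borel" "B \<in> sets borel"
  shows "restr (restr \<xi> B) A = restr \<xi> (A \<inter> B)"
proof (rule measure_eqI)
  have s: "sets \<xi> = sets borel" by (rule configs_sets[OF assms(1)])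
  have r: "sets (restr \<xi> B) = sets borel" for B unfolding restr_def using s by simp
  show "sets (restr (restr \<xi> B) A) = sets (restr \<xi> (A \<inter> B))" by (simp add: restr_def)
  fix D assume "D \<in> sets (restr (restr \<xi> B) A)"
  then have "D \<in> sets borel" using s by (simp add: restr_def)
  then show "emeasure (restr (restr \<xi> B) A) D = emeasure (restr \<xi> (A \<inter> B)) D"
    using assms s r by (simp add: emeasure_restr Int_assoc)
qed

lemma coarsen_eq: "\<xi> \<in> configs \<Longrightarrow> J = {1..k} \<Longrightarrow> coarsen k C y \<xi> = cfg (crs \<xi>)"
  unfolding coarsen_def
proof (rule measure_of_eq_cfgI)
  fix S :: "'a set" assume \<xi>: "\<xi> \<in> configs" and k: "J = {1..k}" and S: "S \<in> sets borel"
  have r: "size (filter_mset P (replicate_mset n x)) = (if P x then n else 0)" for P n and x :: 'a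
    by (induction n) auto
  have f: "filter_mset P (\<Sum>x\<in>F. g x) = (\<Sum>x\<in>F. filter_mset P (g x))" if "finite F" for P F and g :: "nat \<Rightarrow> 'a multiset"
    using that by (induction F) auto
  have s: "size (\<Sum>x\<in>F. g x) = (\<Sum>x\<in>F. size (g x))" if "finite F" for F and g :: "nat \<Rightarrow> 'a multiset"
    using that by (induction F) auto
  have e: "emeasure \<xi> (C j) = of_nat (size (filter_mset (\<lambda>x. x \<in> C j) (pts \<xi>)))" if "j \<in> J" for j
    using emeasure_cfg[OF C[OF that], of "pts \<xi>"] cfg_pts[OF \<xi>] by simp
  have "of_nat (size (filter_mset (\<lambda>x. x \<in> S) (crs \<xi>)))
    = (of_nat (\<Sum>j\<in>J. if y j \<in> S then size (filter_mset (\<lambda>x. x \<in> C j) (pts \<xi>)) else 0) :: ennreal)"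
    unfolding crs_def image_c_eq f[OF J] s[OF J] r ..
  also have "\<dots> = (\<Sum>j=1..k. emeasure \<xi> (C j) * indicator S (y j))"
    unfolding of_nat_sum k[symmetric] by (intro sum.cong refl) (simp add: e indicator_def)
  finally show "(\<Sum>j=1..k. emeasure \<xi> (C j) * indicator S (y j)) = of_nat (size (filter_mset (\<lambda>x. x \<in> S) (crs \<xi>)))" ..
qed

lemma d1_crs_le:
  assumes "\<And>x. dist x (c x) \<le> e" "0 \<le> e" "\<xi> \<in> configs"
  shows "d1 \<xi> (cfg (crs \<xi>)) \<le> e"
  using d1_image_le[OF assms(1,2), of "pts \<xi>"] cfg_pts[OF assms(3)] by (simp add: crs_def)

lemma integral_c:
  fixes \<phi> :: "'a \<Rightarrow> real"
  assumes "finite_measure \<nu>" and \<nu>: "sets \<nu> = sets borel"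
  shows "(\<integral>x. \<phi> (c x) \<partial>\<nu>) = (\<Sum>j\<in>J. measure \<nu> (C j) * \<phi> (y j))"
proof -
  interpret finite_measure \<nu> by fact
  have "\<phi> (c x) = (\<Sum>j\<in>J. \<phi> (y j) * indicator (C j) x)" for x
  proof -
    have "(\<Sum>j\<in>J. \<phi> (y j) * indicator (C j) x) = (\<Sum>j\<in>J. if j = cell x then \<phi> (y j) else 0)"
      by (intro sum.cong refl) (auto simp: in_C_iff indicator_def)
    also have "\<dots> = \<phi> (c x)" using J cell_in(1)[of x] by (simp add: c_def)
    finally show ?thesis ..
  qed
  then have "(\<integral>x. \<phi> (c x) \<partial>\<nu>) = (\<integral>x. (\<Sum>j\<in>J. \<phi> (y j) * indicator (C j) x) \<partial>\<nu>)" by simp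
  also have "\<dots> = (\<Sum>j\<in>J. \<integral>x. \<phi> (y j) * indicator (C j) x \<partial>\<nu>)"
    by (rule Bochner_Integration.integral_sum)
      (use C \<nu> in \<open>auto intro!: integrable_real_indicator simp: less_top[symmetric]\<close>)
  also have "\<dots> = (\<Sum>j\<in>J. measure \<nu> (C j) * \<phi> (y j))"
    using C \<nu> by (intro sum.cong refl) (simp add: sets_eq_imp_space_eq[OF \<nu>])
  finally show ?thesis .
qed

end

section \<open>Fine partitions and the measurability of test functions\<close>

lemma compact_cells_exist:
  assumes compact: "compact (UNIV :: 'a::metric_space set)" and e: "e > 0"
  obtains J C and y :: "nat \<Rightarrow> 'a::metric_space" where "cells J C" "\<And>x. dist x (cells.c J C y x) \<le> e"
proof -
  have cov: "(UNIV :: 'a set) \<subseteq> (\<Union>x. ball x e)" using e by (auto intro!: bexI)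
  obtain F where F: "finite F" "(UNIV :: 'a set) \<subseteq> (\<Union>x\<in>F. ball x e)"
  proof (rule compactE_image[OF compact, of UNIV "\<lambda>x :: 'a. ball x e"])
    show "open (ball x e)" for x :: 'a by (rule open_ball)
    show "(UNIV :: 'a set) \<subseteq> (\<Union>x\<in>UNIV. ball x e)" by (rule cov)
    fix F assume "finite F" "(UNIV :: 'a set) \<subseteq> (\<Union>x\<in>F. ball x e)"
    then show thesis by (rule that)
  qed
  obtain xs where xs: "set xs = F" using finite_list[OF F(1)] by blast
  define y where "y = nth xs"
  define J where "J = {..<length xs}"
  define C where "C j = ball (y j) e - (\<Union>i<j. ball (y i) e)" for j
  have "(\<Union>j\<in>J. C j) = UNIV"
  proof (intro equalityI subsetI UNIV_I)
    fix z :: 'a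
    have "z \<in> (\<Union>x\<in>F. ball x e)" using F(2) by blast
    then obtain x where "x \<in> set xs" "z \<in> ball x e" unfolding xs by blast
    then obtain j0 where "j0 < length xs" "z \<in> ball (y j0) e" unfolding y_def in_set_conv_nth by blast
    define j where "j = (LEAST j. z \<in> ball (y j) e)"
    have "z \<in> ball (y j) e" unfolding j_def by (rule LeastI) fact
    moreover have "j \<le> j0" unfolding j_def by (rule Least_le) fact
    moreover have "z \<notin> ball (y i) e" if "i < j" for i using not_less_Least[of i "\<lambda>j. z \<in> ball (y j) e"] that unfolding j_def by blast
    ultimately show "z \<in> (\<Union>j\<in>J. C j)" using \<open>j0 < length xs\<close> unfolding C_def J_def by auto
  qed
  moreover have "disjoint_family_on C J"
    unfolding disjoint_family_on_def C_def
  proof (intro ballI impI equals0I)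
    fix i j z assume "i \<noteq> j" "z \<in> (ball (y i) e - (\<Union>i'<i. ball (y i') e)) \<inter> (ball (y j) e - (\<Union>i'<j. ball (y i') e))"
    then show False by (cases "i < j") auto
  qed
  moreover have "C j \<in> sets borel" for j unfolding C_def by (intro sets.Diff sets.countable_UN' borel_open open_ball) auto
  ultimately have cells: "cells J C" using compact by unfold_locales (auto simp: J_def)
  then interpret cells J C y .
  have "dist x (c x) \<le> e" for x
    using cell_in(2)[of x] unfolding C_def c_def by (auto simp: dist_commute)
  then show thesis using that[OF cells] by blast
qed

text \<open>\<open>lip_d1\<close> imposes no measurability; it follows from the Lipschitz condition.
  Along ever finer partitions \<open>f\<close> is a uniform limit of functions of the coarsened
  configuration, and these are measurable because that configuration is discrete.\<close>

lemma lip_d1_measurable: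
  fixes f :: "'a::metric_space measure \<Rightarrow> real"
  assumes compact: "compact (UNIV :: 'a set)" and f: "f \<in> lip_d1"
  shows "f \<in> borel_measurable config_algebra"
proof -
  have "\<exists>g. g \<in> borel_measurable config_algebra \<and> (\<forall>\<xi>\<in>configs. \<bar>f \<xi> - g \<xi>\<bar> \<le> 1 / real (Suc n))" for n
  proof -
    obtain J C and y :: "nat \<Rightarrow> 'a" where "cells J C" and d: "\<And>x. dist x (cells.c J C y x) \<le> 1 / real (Suc n)"
      by (rule compact_cells_exist[OF compact, of "1 / real (Suc n)"]) auto
    then interpret cells J C y by simp
    have "(\<lambda>\<xi>. f (cfg (crs \<xi>))) \<in> borel_measurable config_algebra"
      by (rule measurable_compose[OF crs_measurable]) simp
    moreover have "\<bar>f \<xi> - f (cfg (crs \<xi>))\<bar> \<le> 1 / real (Suc n)" if "\<xi> \<in> configs" for \<xi>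
    proof -
      have "\<bar>f \<xi> - f (cfg (crs \<xi>))\<bar> \<le> d1 \<xi> (cfg (crs \<xi>))" using f that cfg_in_configs unfolding lip_d1_def by blast
      also have "\<dots> \<le> 1 / real (Suc n)" by (rule d1_crs_le[OF d _ that]) simp
      finally show ?thesis .
    qed
    ultimately show ?thesis by blast
  qed
  then obtain g where g: "\<And>n. g n \<in> borel_measurable config_algebra"
    and close: "\<And>n \<xi>. \<xi> \<in> configs \<Longrightarrow> \<bar>f \<xi> - g n \<xi>\<bar> \<le> 1 / real (Suc n)" by metis
  show ?thesis
  proof (rule borel_measurable_LIMSEQ_metric[OF g])
    fix \<xi> :: "'a measure" assume "\<xi> \<in> space config_algebra"
    then have "\<bar>f \<xi> - g n \<xi>\<bar> \<le> 1 / real (Suc n)" for n using close by simp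
    then have "(\<lambda>n. g n \<xi> - f \<xi>) \<longlonglongrightarrow> 0"
      by (intro Lim_null_comparison[OF _ LIMSEQ_Suc[OF lim_1_over_n]] always_eventually) (auto simp: abs_minus_commute)
    then show "(\<lambda>n. g n \<xi>) \<longlonglongrightarrow> f \<xi>" by (simp add: LIM_zero_iff)
  qed
qed

section \<open>The smoothness term\<close>

locale part = cells "{1..k}" G t for k :: nat and G :: "nat \<Rightarrow> 'a::metric_space set" and t :: "nat \<Rightarrow> 'a"
begin

definition N :: "'a set \<Rightarrow> 'a measure \<Rightarrow> 'a multiset" where "N B \<eta> = crs (restr \<eta> (- B))"

definition TV :: "'a measure measure \<Rightarrow> 'a set \<Rightarrow> nat \<Rightarrow> real" where
  "TV \<mu> B j = (SUP f\<in>F_TV. \<bar>\<integral>\<eta>. f (coarsen k G t (restr \<eta> (- B)))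
                    - f (add_point (coarsen k G t (restr \<eta> (- B))) (t j)) \<partial>\<mu>\<bar>)"

lemma r_of_law_TV: "r_of_law a u k G t B \<mu> = 4 * measure \<mu> {\<eta> \<in> space \<mu>. measure \<eta> (- B) + 1 \<le> a / u} +
     (4 * u + 10) / a * Max (TV \<mu> B ` {1..k})"
  unfolding r_of_law_def TV_def ..

lemma k_pos: "1 \<in> {1..k}"
proof -
  have "{1..k} \<noteq> {}" using cover by (metis UN_empty empty_not_UNIV)
  then show ?thesis by auto
qed

lemma N_measurable: "B \<in> sets borel \<Longrightarrow> N B \<in> measurable config_algebra (count_space UNIV)"
  unfolding N_def by (rule measurable_compose[OF restr_measurable crs_measurable]) auto

lemma coarsen_N: "\<eta> \<in> configs \<Longrightarrow> B \<in> sets borel \<Longrightarrow> coarsen k G t (restr \<eta> (- B)) = cfg (N B \<eta>)"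
  unfolding N_def by (intro coarsen_eq restr_in_configs) auto

lemma N_set: "set_mset (N B \<eta>) \<subseteq> t ` {1..k}"
  unfolding N_def by (rule crs_set)

lemma size_N: "\<eta> \<in> configs \<Longrightarrow> B \<in> sets borel \<Longrightarrow> real (size (N B \<eta>)) = measure \<eta> (- B)"
  unfolding N_def by (rule size_crs_restr) auto

definition D where "D = {M. set_mset M \<subseteq> t ` {1..k}}"

lemma D_countable: "countable D"
proof (rule countable_subset)
  show "D \<subseteq> mset ` lists (t ` {1..k})"
  proof
    fix M assume "M \<in> D"
    obtain xs where xs: "mset xs = M" using ex_mset by blast
    then have "set xs \<subseteq> t ` {1..k}" using \<open>M \<in> D\<close> unfolding D_def by force
    then have "xs \<in> lists (t ` {1..k})" by (simp add: in_lists_conv_set subset_iff)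
    then show "M \<in> mset ` lists (t ` {1..k})" using xs by blast
  qed
  show "countable (mset ` lists (t ` {1..k}))" by (intro countable_image countable_lists countable_finite) simp
qed

text \<open>This makes every set of multisets of centers a legitimate test set for
  \<open>F_TV\<close>. As a center need not lie in its own cell, \<open>crs\<close> does not invert
  \<open>cfg\<close> on \<open>D\<close>; \<open>mt\<close> counts the atoms at the centers instead
  and does invert it.\<close>

lemma cfg_set_measurable:
  obtains S where "S \<in> sets config_algebra" "\<And>M. M \<in> D \<Longrightarrow> cfg M \<in> S \<longleftrightarrow> M \<in> Q"
proof -
  define mt where "mt \<xi> = (\<Sum>x\<in>t ` {1..k}. replicate_mset (size (filter_mset (\<lambda>z. z \<in> {x}) (pts \<xi>))) x)" for \<xi>
  have mt: "mt \<in> measurable config_algebra (count_space UNIV)"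
    unfolding mt_def by (rule mset_sum_measurable) auto
  have cfg: "mt (cfg M) = M" if "M \<in> D" for M
  proof (rule multiset_eqI)
    fix z
    have c: "count (\<Sum>x\<in>F. replicate_mset (n x) x) z = (if z \<in> F then n z else 0)" if "finite F" for F and n :: "'a \<Rightarrow> nat"
      using that by (induction F) auto
    show "count (mt (cfg M)) z = count M z"
      using that unfolding mt_def pts_cfg singleton_iff filter_eq_replicate_mset size_replicate_mset
      by (subst c) (auto simp: D_def count_eq_zero_iff)
  qed
  show thesis
  proof (rule that)
    show "mt -` Q \<inter> space config_algebra \<in> sets config_algebra" by (rule measurable_sets[OF mt]) simp
    show "M \<in> D \<Longrightarrow> cfg M \<in> mt -` Q \<inter> space config_algebra \<longleftrightarrow> M \<in> Q" for M using cfg by auto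
  qed
qed

section \<open>The smoothness term of a single law\<close>

context
  fixes \<mu> :: "'a measure measure" and B :: "'a set"
  assumes \<mu>: "prob_space \<mu>" "sets \<mu> = sets config_algebra" and B: "B \<in> sets borel"
begin

interpretation prob_space \<mu> by (rule \<mu>)

lemma space_\<mu>: "space \<mu> = configs"
  using sets_eq_imp_space_eq[OF \<mu>(2)] by simp

lemma N_meas: "N B \<in> measurable \<mu> (count_space UNIV)"
  using N_measurable[OF B] unfolding measurable_cong_sets[OF \<mu>(2) refl] .

lemma ind_N_integrable: "integrable \<mu> (\<lambda>\<eta>. indicator Q (F (N B \<eta>)) :: real)"
  by (rule integrable_const_bound[of _ 1])
    (auto intro!: measurable_compose[OF N_meas] simp: indicator_def)

definition gap :: "nat \<Rightarrow> 'a multiset set \<Rightarrow> real" where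
  "gap j Q = \<bar>(\<integral>\<eta>. indicator Q (N B \<eta>) \<partial>\<mu>) - (\<integral>\<eta>. indicator Q (add_mset (t j) (N B \<eta>)) \<partial>\<mu>)\<bar>"

lemma gap_le_1: "gap j Q \<le> 1"
proof -
  have "(0 :: real) \<le> (\<integral>\<eta>. indicator Q (F (N B \<eta>)) \<partial>\<mu>)" "(\<integral>\<eta>. indicator Q (F (N B \<eta>)) \<partial>\<mu>) \<le> (1 :: real)" for F
  proof -
    show "(0 :: real) \<le> (\<integral>\<eta>. indicator Q (F (N B \<eta>)) \<partial>\<mu>)" by simp
    have "(\<integral>\<eta>. indicator Q (F (N B \<eta>)) \<partial>\<mu>) \<le> (\<integral>\<eta>. (1 :: real) \<partial>\<mu>)"
      by (rule integral_mono[OF ind_N_integrable]) (auto simp: indicator_def)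
    then show "(\<integral>\<eta>. indicator Q (F (N B \<eta>)) \<partial>\<mu>) \<le> (1 :: real)" by (simp add: prob_space)
  qed
  from this[of "\<lambda>x. x"] this[of "add_mset (t j)"] show ?thesis unfolding gap_def by linarith
qed

lemma F_TV_gap:
  assumes j: "j \<in> {1..k}" and S: "S \<in> sets config_algebra" and Q: "\<And>M. M \<in> D \<Longrightarrow> cfg M \<in> S \<longleftrightarrow> M \<in> Q"
  shows "\<bar>\<integral>\<eta>. indicator S (coarsen k G t (restr \<eta> (- B))) - indicator S (add_point (coarsen k G t (restr \<eta> (- B))) (t j)) \<partial>\<mu>\<bar> = gap j Q"
proof -
  have "(\<integral>\<eta>. indicator S (coarsen k G t (restr \<eta> (- B))) - indicator S (add_point (coarsen k G t (restr \<eta> (- B))) (t j)) \<partial>\<mu>)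
    = (\<integral>\<eta>. indicator Q (N B \<eta>) - indicator Q (add_mset (t j) (N B \<eta>)) \<partial>\<mu> :: real)"
  proof (rule Bochner_Integration.integral_cong[OF refl])
    fix \<eta> assume "\<eta> \<in> space \<mu>"
    then have c: "coarsen k G t (restr \<eta> (- B)) = cfg (N B \<eta>)" using space_\<mu> coarsen_N[OF _ B] by simp
    have "N B \<eta> \<in> D" "add_mset (t j) (N B \<eta>) \<in> D" using N_set j unfolding D_def by auto
    then show "indicator S (coarsen k G t (restr \<eta> (- B))) - indicator S (add_point (coarsen k G t (restr \<eta> (- B))) (t j))
      = (indicator Q (N B \<eta>) - indicator Q (add_mset (t j) (N B \<eta>)) :: real)"
      unfolding c add_point_cfg indicator_def using Q by simp
  qed
  then show ?thesis
    unfolding gap_def using ind_N_integrable[of Q "\<lambda>x. x"] ind_N_integrable[of Q "add_mset (t j)"] by simp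
qed

lemma gap_le_TV:
  assumes j: "j \<in> {1..k}"
  shows "gap j Q \<le> TV \<mu> B j"
proof -
  obtain S where S: "S \<in> sets config_algebra" "\<And>M. M \<in> D \<Longrightarrow> cfg M \<in> S \<longleftrightarrow> M \<in> Q" using cfg_set_measurable[of Q] by metis
  have "gap j Q = \<bar>\<integral>\<eta>. indicator S (coarsen k G t (restr \<eta> (- B))) - indicator S (add_point (coarsen k G t (restr \<eta> (- B))) (t j)) \<partial>\<mu>\<bar>"
    using F_TV_gap[OF j S] by simp
  also have "\<dots> \<le> TV \<mu> B j" unfolding TV_def
  proof (rule cSUP_upper2[where x = "indicator S"])
    show "bdd_above ((\<lambda>f. \<bar>\<integral>\<eta>. f (coarsen k G t (restr \<eta> (- B))) - f (add_point (coarsen k G t (restr \<eta> (- B))) (t j)) \<partial>\<mu>\<bar>) ` F_TV)"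
    proof (rule bdd_aboveI2[where M = 1])
      fix f :: "'a measure \<Rightarrow> real" assume "f \<in> F_TV"
      then obtain S where f: "f = indicator S" and S: "S \<in> sets config_algebra" unfolding F_TV_def by blast
      show "\<bar>\<integral>\<eta>. f (coarsen k G t (restr \<eta> (- B))) - f (add_point (coarsen k G t (restr \<eta> (- B))) (t j)) \<partial>\<mu>\<bar> \<le> 1"
        unfolding f by (subst F_TV_gap[OF j S, of "{M. cfg M \<in> S}"]) (simp_all add: gap_le_1)
    qed
    show "indicator S \<in> F_TV" unfolding F_TV_def using S(1) by blast
  qed simp
  finally show ?thesis .
qed

text \<open>\<open>N B\<close> has values in the countable set \<open>D\<close>, so that finite test sets suffice. This makes
  \<open>r_of_law\<close> a measurable function of the law.\<close>

lemma TV_eq_countable: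
  assumes j: "j \<in> {1..k}"
  shows "TV \<mu> B j = (SUP Q\<in>{Q. finite Q \<and> Q \<subseteq> D}. gap j Q)"
proof (rule antisym)
  let ?\<F> = "{Q. finite Q \<and> Q \<subseteq> D}"
  have bdd: "bdd_above (gap j ` ?\<F>)" by (rule bdd_aboveI2[where M = 1]) (rule gap_le_1)
  show "(SUP Q\<in>?\<F>. gap j Q) \<le> TV \<mu> B j" by (rule cSUP_least) (auto intro: gap_le_TV[OF j])
  show "TV \<mu> B j \<le> (SUP Q\<in>?\<F>. gap j Q)" unfolding TV_def
  proof (rule cSUP_least)
    have "indicator {} \<in> (F_TV :: ('a measure \<Rightarrow> real) set)" unfolding F_TV_def by blast
    then show "(F_TV :: ('a measure \<Rightarrow> real) set) \<noteq> {}" by blast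
    fix f :: "'a measure \<Rightarrow> real" assume "f \<in> F_TV"
    then obtain S where f: "f = indicator S" and S: "S \<in> sets config_algebra" unfolding F_TV_def by blast
    define Q where "Q = {M \<in> D. cfg M \<in> S}"
    define F where "F n = {M \<in> Q. \<exists>i<n. M = from_nat_into D i}" for n :: nat
    have F: "F n \<in> ?\<F>" for n
    proof -
      have "F n \<subseteq> from_nat_into D ` {..<n}" unfolding F_def by auto
      then have "finite (F n)" by (rule finite_subset) simp
      then show ?thesis unfolding F_def Q_def by auto
    qed
    have lim: "(\<lambda>n. \<integral>\<eta>. indicator (F n) (H (N B \<eta>)) \<partial>\<mu>) \<longlonglongrightarrow> (\<integral>\<eta>. (indicator Q (H (N B \<eta>)) :: real) \<partial>\<mu>)" for H
    proof (rule integral_dominated_convergence[where w = "\<lambda>_. 1"])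
      show "(\<lambda>\<eta>. indicator Q (H (N B \<eta>)) :: real) \<in> borel_measurable \<mu>" using ind_N_integrable by blast
      show "(\<lambda>\<eta>. indicator (F n) (H (N B \<eta>)) :: real) \<in> borel_measurable \<mu>" for n using ind_N_integrable by blast
      show "AE \<eta> in \<mu>. (\<lambda>n. indicator (F n) (H (N B \<eta>)) :: real) \<longlonglongrightarrow> indicator Q (H (N B \<eta>))"
      proof (rule AE_I2)
        fix \<eta>
        show "(\<lambda>n. indicator (F n) (H (N B \<eta>)) :: real) \<longlonglongrightarrow> indicator Q (H (N B \<eta>))"
        proof (cases "H (N B \<eta>) \<in> Q")
          case True
          then obtain i where i: "H (N B \<eta>) = from_nat_into D i"
            using from_nat_into_surj[OF D_countable] unfolding Q_def by (metis (no_types, lifting) mem_Collect_eq)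
          have "indicator (F n) (H (N B \<eta>)) = (indicator Q (H (N B \<eta>)) :: real)" if "n > i" for n
            using True i that unfolding F_def by (auto simp: indicator_def)
          then show ?thesis by (intro tendsto_eventually) (auto intro: eventually_mono[OF eventually_gt_at_top[of i]])
        next
          case False
          then show ?thesis unfolding F_def by (simp add: indicator_def)
        qed
      qed
    qed (auto simp: indicator_def)
    have "(\<lambda>n. gap j (F n)) \<longlonglongrightarrow> gap j Q" unfolding gap_def
      using lim[of "\<lambda>x. x"] lim[of "add_mset (t j)"] by (intro tendsto_rabs tendsto_diff)
    then have "gap j Q \<le> (SUP Q\<in>?\<F>. gap j Q)"
      by (rule LIMSEQ_le_const2) (intro exI[of _ 0] allI impI cSUP_upper F bdd)
    moreover have "\<bar>\<integral>\<eta>. f (coarsen k G t (restr \<eta> (- B))) - f (add_point (coarsen k G t (restr \<eta> (- B))) (t j)) \<partial>\<mu>\<bar> = gap j Q"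
      unfolding f by (rule F_TV_gap[OF j S]) (simp add: Q_def)
    ultimately show "\<bar>\<integral>\<eta>. f (coarsen k G t (restr \<eta> (- B))) - f (add_point (coarsen k G t (restr \<eta> (- B))) (t j)) \<partial>\<mu>\<bar>
      \<le> (SUP Q\<in>?\<F>. gap j Q)" by simp
  qed
qed

lemma TV_le_1: "j \<in> {1..k} \<Longrightarrow> TV \<mu> B j \<le> 1"
  unfolding TV_eq_countable by (rule cSUP_least) (auto intro: gap_le_1)

lemma max_TV_bounds: "0 \<le> Max (TV \<mu> B ` {1..k})" "Max (TV \<mu> B ` {1..k}) \<le> 1"
proof -
  have "0 \<le> TV \<mu> B 1" using gap_le_TV[OF k_pos, of "{}"] by (simp add: gap_def)
  also have "TV \<mu> B 1 \<le> Max (TV \<mu> B ` {1..k})" using k_pos by (intro Max_ge) auto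
  finally show "0 \<le> Max (TV \<mu> B ` {1..k})" .
  show "Max (TV \<mu> B ` {1..k}) \<le> 1" using k_pos TV_le_1 by (subst Max_le_iff) auto
qed

lemma r_of_law_bounds:
  assumes "a > 0" "u > 0"
  shows "0 \<le> r_of_law a u k G t B \<mu>" "r_of_law a u k G t B \<mu> \<le> 4 + (4 * u + 10) / a"
proof -
  have "0 \<le> (4 * u + 10) / a" using assms by simp
  then have "0 \<le> (4 * u + 10) / a * Max (TV \<mu> B ` {1..k})" "(4 * u + 10) / a * Max (TV \<mu> B ` {1..k}) \<le> (4 * u + 10) / a"
    using max_TV_bounds by (blast intro: mult_nonneg_nonneg mult_left_le)+
  moreover have "measure \<mu> {\<eta> \<in> space \<mu>. measure \<eta> (- B) + 1 \<le> a / u} \<le> 1" by simp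
  ultimately show "0 \<le> r_of_law a u k G t B \<mu>" "r_of_law a u k G t B \<mu> \<le> 4 + (4 * u + 10) / a"
    unfolding r_of_law_TV using measure_nonneg[of \<mu> "{\<eta> \<in> space \<mu>. measure \<eta> (- B) + 1 \<le> a / u}"] by linarith+
qed

lemma smoothed_r_of_law:
  assumes res: "resolvent a b {1..k} t w f \<rho> h" and u: "u > 0"
  shows "smoothed a b {1..k} t w f \<rho> h \<mu> (N B) u (Max (TV \<mu> B ` {1..k}))"
    and "smoothed.r a \<mu> (N B) u (Max (TV \<mu> B ` {1..k})) = r_of_law a u k G t B \<mu>"
proof -
  interpret resolvent a b "{1..k}" t w f \<rho> h by (rule res)
  show s: "smoothed a b {1..k} t w f \<rho> h \<mu> (N B) u (Max (TV \<mu> B ` {1..k}))"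
  proof
    fix i :: nat and Q :: "'a multiset set"
    assume i: "i \<in> {1..k}"
    have "gap i Q \<le> Max (TV \<mu> B ` {1..k})"
      using gap_le_TV[OF i, of Q] i by (rule_tac order_trans[OF _ Max_ge]) auto
    then show "\<bar>(\<integral>\<eta>. indicator Q (N B \<eta>) \<partial>\<mu>) - (\<integral>\<eta>. indicator Q (add_mset (t i) (N B \<eta>)) \<partial>\<mu>)\<bar> \<le> Max (TV \<mu> B ` {1..k})"
      unfolding gap_def .
  qed (use u N_meas in auto)
  interpret S: smoothed a b "{1..k}" t w f \<rho> h \<mu> "N B" u "Max (TV \<mu> B ` {1..k})" by (rule s)
  have "{\<eta> \<in> space \<mu>. real (size (N B \<eta>)) + 1 \<le> a / u} = {\<eta> \<in> space \<mu>. measure \<eta> (- B) + 1 \<le> a / u}"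
    using size_N[OF _ B] space_\<mu> by auto
  then show "smoothed.r a \<mu> (N B) u (Max (TV \<mu> B ` {1..k})) = r_of_law a u k G t B \<mu>"
    unfolding S.r_def r_of_law_TV by simp
qed

end

lemma r_of_law_measurable:
  assumes \<kappa>: "\<kappa> \<in> measurable M (prob_algebra config_algebra)" and B: "B \<in> sets borel"
  shows "(\<lambda>x. r_of_law a u k G t B (\<kappa> x)) \<in> borel_measurable M"
proof -
  have prob: "prob_space (\<kappa> x)" "sets (\<kappa> x) = sets config_algebra" if "x \<in> space M" for x
    using measurable_space[OF \<kappa> that] unfolding space_prob_algebra by auto
  have space: "space (\<kappa> x) = configs" if "x \<in> space M" for x
    using sets_eq_imp_space_eq[OF prob(2)[OF that]] by simp
  have meas: "(\<lambda>x. measure (\<kappa> x) S) \<in> borel_measurable M" if "S \<in> sets config_algebra" for S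
    by (rule measurable_compose[OF \<kappa> measurable_measure_prob_algebra[OF that]])
  have ev: "(\<lambda>x. \<integral>\<eta>. (indicator Q (H (N B \<eta>)) :: real) \<partial>\<kappa> x) \<in> borel_measurable M" for Q and H :: "'a multiset \<Rightarrow> 'a multiset"
  proof -
    define S where "S = (\<lambda>\<eta>. H (N B \<eta>)) -` Q \<inter> space config_algebra"
    have "(\<lambda>\<eta>. H (N B \<eta>)) \<in> measurable config_algebra (count_space UNIV)"
      by (rule measurable_compose[OF N_measurable[OF B]]) simp
    then have S: "S \<in> sets config_algebra" unfolding S_def by (rule measurable_sets) simp
    have "(\<integral>\<eta>. (indicator Q (H (N B \<eta>)) :: real) \<partial>\<kappa> x) = measure (\<kappa> x) S" if x: "x \<in> space M" for x
    proof -
      have "(\<integral>\<eta>. (indicator Q (H (N B \<eta>)) :: real) \<partial>\<kappa> x) = (\<integral>\<eta>. indicator S \<eta> \<partial>\<kappa> x)"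
        by (rule Bochner_Integration.integral_cong) (auto simp: S_def indicator_def space[OF x])
      also have "\<dots> = measure (\<kappa> x) S"
      proof -
        have "S \<inter> space (\<kappa> x) = S" unfolding S_def space[OF x] by auto
        then show ?thesis by simp
      qed
      finally show ?thesis .
    qed
    then show ?thesis using meas[OF S] by (subst measurable_cong) auto
  qed
  have TVm: "(\<lambda>x. TV (\<kappa> x) B j) \<in> borel_measurable M" if j: "j \<in> {1..k}" for j
  proof -
    have "(\<lambda>x. SUP Q\<in>{Q. finite Q \<and> Q \<subseteq> D}. \<bar>(\<integral>\<eta>. (indicator Q (N B \<eta>) :: real) \<partial>\<kappa> x) - (\<integral>\<eta>. indicator Q (add_mset (t j) (N B \<eta>)) \<partial>\<kappa> x)\<bar>) \<in> borel_measurable M"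
    proof (rule borel_measurable_cSUP)
      show "countable {Q. finite Q \<and> Q \<subseteq> D}" by (rule countable_Collect_finite_subset[OF D_countable])
      show "(\<lambda>x. \<bar>(\<integral>\<eta>. (indicator Q (N B \<eta>) :: real) \<partial>\<kappa> x) - (\<integral>\<eta>. indicator Q (add_mset (t j) (N B \<eta>)) \<partial>\<kappa> x)\<bar>) \<in> borel_measurable M" for Q
        using ev[of Q "\<lambda>x. x"] ev[of Q "add_mset (t j)"] by measurable
      show "bdd_above ((\<lambda>Q. \<bar>(\<integral>\<eta>. (indicator Q (N B \<eta>) :: real) \<partial>\<kappa> x) - (\<integral>\<eta>. indicator Q (add_mset (t j) (N B \<eta>)) \<partial>\<kappa> x)\<bar>) ` {Q. finite Q \<and> Q \<subseteq> D})"
        if "x \<in> space M" for x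
        using gap_le_1[OF prob[OF that] B, of j] unfolding gap_def[OF prob[OF that] B] by (intro bdd_aboveI2[where M = 1])
    qed
    moreover have "TV (\<kappa> x) B j = (SUP Q\<in>{Q. finite Q \<and> Q \<subseteq> D}. \<bar>(\<integral>\<eta>. (indicator Q (N B \<eta>) :: real) \<partial>\<kappa> x) - (\<integral>\<eta>. indicator Q (add_mset (t j) (N B \<eta>)) \<partial>\<kappa> x)\<bar>)"
      if "x \<in> space M" for x
      unfolding TV_eq_countable[OF prob[OF that] B j] gap_def[OF prob[OF that] B] ..
    ultimately show ?thesis by (subst measurable_cong) auto
  qed
  define S where "S = {\<eta> \<in> configs. measure \<eta> (- B) + 1 \<le> a / u}"
  have "(\<lambda>\<eta>. measure \<eta> (- B) + 1) \<in> borel_measurable config_algebra"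
    using measure_config_measurable[of "- B"] B by (intro borel_measurable_add) auto
  then have "{\<eta> \<in> space config_algebra. measure \<eta> (- B) + 1 \<le> a / u} \<in> sets config_algebra" by measurable
  then have S: "S \<in> sets config_algebra" unfolding S_def by simp
  have "(\<lambda>x. 4 * measure (\<kappa> x) S + (4 * u + 10) / a * Max ((\<lambda>j. TV (\<kappa> x) B j) ` {1..k})) \<in> borel_measurable M"
    using meas[OF S] borel_measurable_Max[of "{1..k}" "\<lambda>j x. TV (\<kappa> x) B j", OF _ TVm] by measurable
  moreover have "r_of_law a u k G t B (\<kappa> x) = 4 * measure (\<kappa> x) S + (4 * u + 10) / a * Max ((\<lambda>j. TV (\<kappa> x) B j) ` {1..k})"
    if "x \<in> space M" for x
    unfolding r_of_law_TV S_def space[OF that] ..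
  ultimately show ?thesis by (subst measurable_cong) auto
qed

end

section \<open>The approximating process\<close>

text \<open>Otherwise the parameter \<open>{1..k}\<close> of the locale is rewritten to \<open>{Suc 0..k}\<close> in goals.\<close>

declare One_nat_def [simp del]

context part begin

lemma dist_c_le_mesh:
  assumes "\<And>x y :: 'a. dist x y \<le> 1"
  shows "dist x (c x) \<le> mesh k G t" "0 \<le> mesh k G t"
proof -
  show 1: "dist x (c x) \<le> mesh k G t" for x
  proof -
    have j: "cell x \<in> {1..k}" "x \<in> G (cell x)" by (rule cell_in)+
    have "dist x (t (cell x)) \<le> radius (G (cell x)) (t (cell x))"
      unfolding radius_def by (rule cSUP_upper[OF j(2)]) (use assms in \<open>auto intro: bdd_aboveI[of _ 1]\<close>)
    also have "\<dots> \<le> mesh k G t" unfolding mesh_def using j(1) by (intro Max_ge) auto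
    finally show ?thesis unfolding c_def .
  qed
  show "0 \<le> mesh k G t" using 1[of x] zero_le_dist[of x "c x"] by linarith
qed

definition iidm :: "nat \<Rightarrow> (nat \<Rightarrow> 'a) \<Rightarrow> 'a multiset" where
  "iidm z U = image_mset c (mset (map U [0..<z]))"

lemma iidm_Suc: "iidm (Suc z) U = add_mset (c (U z)) (iidm z U)"
  unfolding iidm_def by simp

lemma iidm_case_nat: "iidm (Suc z) (case_nat s U) = add_mset (c s) (iidm z U)"
  unfolding iidm_def by (simp add: map_upt_Suc del: upt_Suc)

context
  fixes \<nu> :: "'a measure"
  assumes \<nu>: "prob_space \<nu>" "sets \<nu> = sets borel"
begin

abbreviation (input) SS where "SS \<equiv> PiM (UNIV :: nat set) (\<lambda>_. \<nu>)"

lemma S_component: "(\<lambda>U. U i) \<in> measurable SS borel"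
  using measurable_component_singleton[of i UNIV "\<lambda>_. \<nu>"] unfolding measurable_cong_sets[OF refl \<nu>(2)] by simp

lemma iidm_measurable: "iidm z \<in> measurable SS (count_space UNIV)"
proof (induction z)
  case 0
  have "iidm 0 = (\<lambda>_. {#})" unfolding iidm_def by auto
  then show ?case by simp
next
  case (Suc z)
  have "(\<lambda>U. add_mset (t i) (iidm z U)) \<in> measurable SS (count_space UNIV)" for i
    by (rule measurable_compose[OF Suc]) simp
  moreover have "(\<lambda>U. cell (U z)) \<in> measurable SS (count_space UNIV)"
    by (rule measurable_compose[OF S_component cell_measurable])
  ultimately have "(\<lambda>U. add_mset (t (cell (U z))) (iidm z U)) \<in> measurable SS (count_space UNIV)"
    by (rule measurable_compose_countable)
  then show ?case unfolding iidm_Suc[abs_def] c_def .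
qed

text \<open>The law of an independent sequence is unchanged when an independent point is put in
  front (\<open>PiM_iter\<close>). This matches the recursion of \<open>iid\<close>, which adds one
  point at a time.\<close>

lemma iidm_integral:
  fixes \<phi> f :: "'a multiset \<Rightarrow> real"
  assumes st: "stein a b {1..k} (\<lambda>j. measure \<nu> (G j)) f" and \<phi>: "\<And>M. \<bar>\<phi> M\<bar> \<le> K"
  shows "(\<integral>U. \<phi> (iidm z U) \<partial>SS) = stein.iid {1..k} t (\<lambda>j. measure \<nu> (G j)) z \<phi>"
proof -
  interpret stein a b "{1..k}" t "\<lambda>j. measure \<nu> (G j)" f by (rule st)
  interpret \<nu>: prob_space \<nu> by (rule \<nu>)
  interpret Sp: prob_space SS by (rule prob_space_PiM) (rule \<nu>)
  interpret sequence_space \<nu> by unfold_locales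
  interpret PP: pair_prob_space \<nu> SS ..
  show ?thesis using \<phi>
  proof (induction z arbitrary: \<phi>)
    case 0
    have "iidm 0 U = {#}" for U unfolding iidm_def by simp
    then show ?case by (simp add: Sp.prob_space)
  next
    case (Suc z)
    have m: "(\<lambda>U. \<phi> (iidm (Suc z) U)) \<in> borel_measurable SS"
      by (rule measurable_compose[OF iidm_measurable]) simp
    have cn: "(\<lambda>(s, \<omega>). case_nat s \<omega>) \<in> measurable (\<nu> \<Otimes>\<^sub>M SS) SS"
      by measurable
    have "(\<integral>U. \<phi> (iidm (Suc z) U) \<partial>SS) = (\<integral>U. \<phi> (iidm (Suc z) U) \<partial>distr (\<nu> \<Otimes>\<^sub>M SS) SS (\<lambda>(s, \<omega>). case_nat s \<omega>))"
      by (simp only: PiM_iter)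
    also have "\<dots> = (\<integral>x. \<phi> (iidm (Suc z) (case x of (s, \<omega>) \<Rightarrow> case_nat s \<omega>)) \<partial>(\<nu> \<Otimes>\<^sub>M SS))"
      by (rule integral_distr[OF cn m])
    also have "\<dots> = (\<integral>x. (case x of (s, \<omega>) \<Rightarrow> \<phi> (add_mset (c s) (iidm z \<omega>))) \<partial>(\<nu> \<Otimes>\<^sub>M SS))"
      by (rule Bochner_Integration.integral_cong[OF refl]) (auto simp: iidm_case_nat)
    also have "\<dots> = (\<integral>s. \<integral>\<omega>. \<phi> (add_mset (c s) (iidm z \<omega>)) \<partial>SS \<partial>\<nu>)"
    proof (rule PP.integral_fst[symmetric])
      have "(\<lambda>x. \<phi> (iidm (Suc z) (case x of (s, \<omega>) \<Rightarrow> case_nat s \<omega>))) \<in> borel_measurable (\<nu> \<Otimes>\<^sub>M SS)"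
        by (rule measurable_compose[OF cn m])
      also have "(\<lambda>x. \<phi> (iidm (Suc z) (case x of (s, \<omega>) \<Rightarrow> case_nat s \<omega>))) = (\<lambda>(s, \<omega>). \<phi> (add_mset (c s) (iidm z \<omega>)))"
        by (auto simp: iidm_case_nat)
      finally show "integrable (\<nu> \<Otimes>\<^sub>M SS) (\<lambda>(s, \<omega>). \<phi> (add_mset (c s) (iidm z \<omega>)))"
        by (intro PP.P.integrable_const_bound[of _ K]) (auto simp: Suc.prems)
    qed
    also have "\<dots> = (\<integral>s. iid z (\<lambda>M. \<phi> (add_mset (c s) M)) \<partial>\<nu>)"
      by (intro Bochner_Integration.integral_cong refl Suc.IH Suc.prems)
    also have "\<dots> = av (\<lambda>x. iid z (\<lambda>M. \<phi> (add_mset x M)))"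
      unfolding av_def by (rule integral_c) (use \<nu> in \<open>auto intro: prob_space.finite_measure\<close>)
    finally show ?case by simp
  qed
qed

text \<open>\<open>pbd_process\<close> is an image measure, and \<open>distr\<close> has its
  intended meaning for measurable maps.\<close>

lemma points_measurable:
  "(\<lambda>(z, U). points z U) \<in> measurable (measure_pmf p \<Otimes>\<^sub>M SS) config_algebra"
proof (rule measurable_config_algebraI)
  show "(case zU of (z, U) \<Rightarrow> points z U) \<in> configs" for zU :: "nat \<times> (nat \<Rightarrow> 'a)"
    by (cases zU) (auto simp: points_eq_cfg)
  fix B :: "'a set" assume B: "B \<in> sets borel"
  have e: "emeasure (points z U) B = (\<Sum>i<z. indicator B (U i))" for z U
  proof -
    have "(\<Sum>i<z. indicator B (U i)) = (of_nat (\<Sum>i<z. indicator B (U i)) :: ennreal)"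
      unfolding of_nat_sum by (intro sum.cong refl) (auto simp: indicator_def)
    also have "(\<Sum>i<z. indicator B (U i)) = card {i. i < z \<and> U i \<in> B}"
    proof -
      have "(\<Sum>i<z. indicator B (U i)) = (\<Sum>i<z. if U i \<in> B then 1 else (0 :: nat))"
        by (intro sum.cong refl) (auto simp: indicator_def)
      also have "\<dots> = card ({..<z} \<inter> {i. U i \<in> B})" by (simp add: sum.If_cases)
      also have "{..<z} \<inter> {i. U i \<in> B} = {i. i < z \<and> U i \<in> B}" by auto
      finally show ?thesis .
    qed
    finally show ?thesis using emeasure_points[OF B, of z U] by simp
  qed
  have U: "(\<lambda>x. snd x i) \<in> measurable (measure_pmf p \<Otimes>\<^sub>M SS) borel" for i
    by (rule measurable_compose[OF measurable_snd S_component])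
  have "(\<lambda>x. \<Sum>i<z. indicator B (snd x i) :: ennreal) \<in> borel_measurable (measure_pmf p \<Otimes>\<^sub>M SS)" for z
    by (intro borel_measurable_sum measurable_compose[OF U borel_measurable_indicator] B)
  moreover have "fst \<in> measurable (measure_pmf p \<Otimes>\<^sub>M SS) (count_space UNIV)"
    using measurable_fst[of "measure_pmf p" SS] by (simp add: measurable_cong_sets[OF refl sets_measure_pmf_count_space])
  ultimately have "(\<lambda>x. \<Sum>i<fst x. indicator B (snd x i) :: ennreal) \<in> borel_measurable (measure_pmf p \<Otimes>\<^sub>M SS)"
    by (rule measurable_compose_countable)
  then show "(\<lambda>\<omega>. emeasure (case \<omega> of (z, U) \<Rightarrow> points z U) B) \<in> borel_measurable (measure_pmf p \<Otimes>\<^sub>M SS)"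
    by (simp add: case_prod_beta e)
qed

text \<open>For each number of points, every point is matched with the center of its cell, at a cost
  of at most the mesh. This gives one of the two mesh terms of the theorem.\<close>

lemma lip_pbd_close:
  fixes g :: "'a multiset \<Rightarrow> real"
  assumes st: "stein a b {1..k} (\<lambda>j. measure \<nu> (G j)) g" and f: "f \<in> lip_d1"
    and d1: "\<And>x y :: 'a. dist x y \<le> 1"
  shows "\<bar>(\<integral>\<xi>. f \<xi> \<partial>pbd_process a b 0 \<nu>)
     - (\<integral>n. stein.iid {1..k} t (\<lambda>j. measure \<nu> (G j)) n (\<lambda>M. f (cfg M)) \<partial>measure_pmf (pbd_pmf a b 0))\<bar> \<le> mesh k G t"
proof -
  interpret stein a b "{1..k}" t "\<lambda>j. measure \<nu> (G j)" g by (rule st)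
  interpret \<nu>: prob_space \<nu> by (rule \<nu>)
  interpret Sp: prob_space SS by (rule prob_space_PiM) (rule \<nu>)
  let ?p = "measure_pmf (pbd_pmf a b 0)"
  interpret PP: pair_prob_space ?p SS ..
  have lip: "\<bar>f (cfg M) - f (cfg M')\<bar> \<le> d1 (cfg M) (cfg M')" for M M'
    using f cfg_in_configs unfolding lip_d1_def by blast
  define K where "K = \<bar>f (cfg {#})\<bar> + 1"
  have K: "\<bar>f (cfg M)\<bar> \<le> K" for M
    using lip[of M "{#}"] d1_le_1[OF d1, of M "{#}"] unfolding K_def by linarith
  have fm: "f \<in> borel_measurable config_algebra" by (rule lip_d1_measurable[OF compact f])
  have pm: "(\<lambda>(z, U). f (points z U)) \<in> borel_measurable (?p \<Otimes>\<^sub>M SS)"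
    using measurable_compose[OF points_measurable fm] by (simp add: case_prod_beta)
  have fi: "integrable (?p \<Otimes>\<^sub>M SS) (\<lambda>(z, U). f (points z U))"
    by (rule PP.P.integrable_const_bound[of _ K, OF _ pm]) (auto simp: points_eq_cfg K)
  have "(\<integral>\<xi>. f \<xi> \<partial>pbd_process a b 0 \<nu>) = (\<integral>x. (case x of (z, U) \<Rightarrow> f (points z U)) \<partial>(?p \<Otimes>\<^sub>M SS))"
    unfolding pbd_process_def by (subst integral_distr[OF points_measurable fm])
      (auto intro!: Bochner_Integration.integral_cong)
  also have "\<dots> = (\<integral>z. \<integral>U. f (points z U) \<partial>SS \<partial>?p)"
    using PP.integral_fst[OF fi] by simp
  finally have 1: "(\<integral>\<xi>. f \<xi> \<partial>pbd_process a b 0 \<nu>) = (\<integral>z. \<integral>U. f (points z U) \<partial>SS \<partial>?p)" .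
  have fz: "(\<lambda>U. f (points z U)) \<in> borel_measurable SS" for z
    using measurable_compose_Pair1[OF _ pm, of z] by simp
  have iz: "integrable SS (\<lambda>U. f (points z U))" for z
    by (rule Sp.integrable_const_bound[of _ K, OF _ fz]) (auto simp: points_eq_cfg K)
  have jz: "integrable SS (\<lambda>U. f (cfg (iidm z U)))" for z
    by (rule Sp.integrable_const_bound[of _ K]) (auto simp: K intro!: measurable_compose[OF iidm_measurable])
  have close: "\<bar>(\<integral>U. f (points z U) \<partial>SS) - iid z (\<lambda>M. f (cfg M))\<bar> \<le> mesh k G t" for z
  proof -
    have "iid z (\<lambda>M. f (cfg M)) = (\<integral>U. f (cfg (iidm z U)) \<partial>SS)"
      by (rule iidm_integral[OF st K, symmetric])
    then have "\<bar>(\<integral>U. f (points z U) \<partial>SS) - iid z (\<lambda>M. f (cfg M))\<bar> = \<bar>\<integral>U. f (points z U) - f (cfg (iidm z U)) \<partial>SS\<bar>"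
      using iz jz by simp
    also have "\<dots> \<le> (\<integral>U. mesh k G t \<partial>SS)"
    proof (rule order_trans[OF integral_abs_bound integral_mono])
      show "\<bar>f (points z U) - f (cfg (iidm z U))\<bar> \<le> mesh k G t" for U
        unfolding points_eq_cfg iidm_def
        by (rule order_trans[OF lip d1_image_le]) (rule dist_c_le_mesh[OF d1])+
    qed (use iz jz in auto)
    also have "\<dots> = mesh k G t" by (simp add: Sp.prob_space)
    finally show ?thesis .
  qed
  have i1: "integrable ?p (\<lambda>z. \<integral>U. f (points z U) \<partial>SS)"
    using PP.integrable_fst'[OF fi] by simp
  have i2: "integrable ?p (\<lambda>z. iid z (\<lambda>M. f (cfg M)))"
    by (rule measure_pmf.integrable_const_bound[of _ K]) (auto intro!: AE_I2 iid_abs K)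
  have "\<bar>\<integral>z. (\<integral>U. f (points z U) \<partial>SS) - iid z (\<lambda>M. f (cfg M)) \<partial>?p\<bar> \<le> (\<integral>z. mesh k G t \<partial>?p)"
    by (rule order_trans[OF integral_abs_bound integral_mono]) (use i1 i2 close in auto)
  then show ?thesis unfolding 1 using i1 i2 by simp
qed

end

end

section \<open>Palm calculus\<close>

locale palm = part k G t for k :: nat and G :: "nat \<Rightarrow> 'a::metric_space set" and t :: "nat \<Rightarrow> 'a" +
  fixes P :: "'w measure" and \<Xi> :: "'w \<Rightarrow> 'a measure" and \<Psi> :: "'a \<Rightarrow> 'w \<Rightarrow> 'a measure" and lam :: "'a measure"
  assumes Xi: "point_process P \<Xi>" and lam: "lam = mean_measure P \<Xi>"
    and lam_finite: "emeasure lam UNIV < \<infinity>" and Palm: "reduced_palm P \<Xi> \<Psi>"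
begin

sublocale prob_space P using Xi unfolding point_process_def by simp

lemma Xi_meas: "\<Xi> \<in> measurable P config_algebra" using Xi unfolding point_process_def by simp

lemma Xi_configs: "\<omega> \<in> space P \<Longrightarrow> \<Xi> \<omega> \<in> configs" using measurable_space[OF Xi_meas] by simp

lemma Psi_meas: "\<Psi> x \<in> measurable P config_algebra"
  using Palm unfolding reduced_palm_def point_process_def by simp

lemma lam_sets [simp]: "sets lam = sets borel"
  unfolding lam mean_measure_def using sets.sigma_sets_eq[of borel] by simp

lemma lam_space [simp]: "space lam = UNIV"
  unfolding lam mean_measure_def by simp

lemma emeasure_lam:
  assumes B: "B \<in> sets borel"
  shows "emeasure lam B = (\<integral>\<^sup>+\<omega>. emeasure (\<Xi> \<omega>) B \<partial>P)"
proof (rule emeasure_measure_of[OF lam[unfolded mean_measure_def]])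
  show "countably_additive (sets lam) (\<lambda>B. \<integral>\<^sup>+\<omega>. emeasure (\<Xi> \<omega>) B \<partial>P)"
  proof (rule countably_additiveI)
    fix D :: "nat \<Rightarrow> 'a set" assume D: "range D \<subseteq> sets lam" "disjoint_family D" "(\<Union>i. D i) \<in> sets lam"
    have "(\<Sum>i. \<integral>\<^sup>+\<omega>. emeasure (\<Xi> \<omega>) (D i) \<partial>P) = (\<integral>\<^sup>+\<omega>. (\<Sum>i. emeasure (\<Xi> \<omega>) (D i)) \<partial>P)"
      by (rule nn_integral_suminf[symmetric])
        (use D in \<open>auto intro!: measurable_compose[OF Xi_meas emeasure_config_measurable]\<close>)
    also have "\<dots> = (\<integral>\<^sup>+\<omega>. emeasure (\<Xi> \<omega>) (\<Union>i. D i) \<partial>P)"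
      by (intro nn_integral_cong suminf_emeasure) (use D configs_sets[OF Xi_configs] in auto)
    finally show "(\<Sum>i. \<integral>\<^sup>+\<omega>. emeasure (\<Xi> \<omega>) (D i) \<partial>P) = (\<integral>\<^sup>+\<omega>. emeasure (\<Xi> \<omega>) (\<Union>i. D i) \<partial>P)" .
  qed
  show "positive (sets lam) (\<lambda>B. \<integral>\<^sup>+\<omega>. emeasure (\<Xi> \<omega>) B \<partial>P)" by (simp add: positive_def)
qed (use B in auto)

sublocale L: finite_measure lam
  by (rule finite_measureI) (use lam_finite in auto)

lemma crs_Xi: "(\<lambda>\<omega>. crs (\<Xi> \<omega>)) \<in> measurable P (count_space UNIV)"
  by (rule measurable_compose[OF Xi_meas crs_measurable])

lemma crs_Psi: "(\<lambda>\<omega>. crs (\<Psi> x \<omega>)) \<in> measurable P (count_space UNIV)"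
  by (rule measurable_compose[OF Psi_meas crs_measurable])

lemma size_Xi: "\<omega> \<in> space P \<Longrightarrow> ennreal (real (size (crs (\<Xi> \<omega>)))) = emeasure (\<Xi> \<omega>) UNIV"
  using size_crs[OF Xi_configs, of \<omega>] emeasure_cfg[of UNIV "pts (\<Xi> \<omega>)"] cfg_pts[OF Xi_configs, of \<omega>]
  by (auto simp: mass_def measure_def ennreal_of_nat_eq_real_of_nat)

lemma mean_size_nn: "(\<integral>\<^sup>+\<omega>. ennreal (real (size (crs (\<Xi> \<omega>)))) \<partial>P) = emeasure lam UNIV"
  by (subst emeasure_lam) (auto intro!: nn_integral_cong simp: size_Xi)

lemma size_Xi_meas: "(\<lambda>\<omega>. real (size (crs (\<Xi> \<omega>)))) \<in> borel_measurable P"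
  by (rule measurable_compose[OF crs_Xi]) simp

lemma size_Xi_int: "integrable P (\<lambda>\<omega>. real (size (crs (\<Xi> \<omega>))))"
  by (rule integrableI_nonneg[OF size_Xi_meas]) (use lam_finite mean_size_nn in auto)

lemma mean_size: "(\<integral>\<omega>. real (size (crs (\<Xi> \<omega>))) \<partial>P) = measure lam UNIV"
  by (subst integral_eq_nn_integral[OF size_Xi_meas]) (auto simp: mean_size_nn measure_def)

text \<open>Deleting an atom \<open>x\<close> before coarsening amounts to deleting
  \<open>c x\<close> afterwards, so the Palm identity passes to coarsened configurations.\<close>

lemma palm_nn:
  fixes g :: "'a \<Rightarrow> 'a multiset \<Rightarrow> real"
  assumes g: "\<And>x M. 0 \<le> g x M"
  shows "(\<integral>\<^sup>+\<omega>. ennreal (\<Sum>z\<in>#crs (\<Xi> \<omega>). g z (crs (\<Xi> \<omega>) - {#z#})) \<partial>P)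
    = (\<integral>\<^sup>+x. (\<integral>\<^sup>+\<omega>. ennreal (g (c x) (crs (\<Psi> x \<omega>))) \<partial>P) \<partial>lam)"
proof -
  define F where "F = (\<lambda>(x, \<eta>). g (c x) (crs \<eta>))"
  have F: "F \<in> borel_measurable (borel \<Otimes>\<^sub>M config_algebra)"
  proof -
    have "(\<lambda>z. crs (snd z)) \<in> measurable (borel \<Otimes>\<^sub>M config_algebra) (count_space UNIV)"
      by (rule measurable_compose[OF measurable_snd crs_measurable])
    then have "(\<lambda>z. g (t i) (crs (snd z))) \<in> borel_measurable (borel \<Otimes>\<^sub>M config_algebra)" for i
      by (rule measurable_compose) simp
    moreover have "(\<lambda>z. cell (fst z)) \<in> measurable (borel \<Otimes>\<^sub>M config_algebra) (count_space UNIV)"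
      by (rule measurable_compose[OF measurable_fst cell_measurable])
    ultimately have "(\<lambda>z. g (t (cell (fst z))) (crs (snd z))) \<in> borel_measurable (borel \<Otimes>\<^sub>M config_algebra)"
      by (rule measurable_compose_countable)
    then show ?thesis unfolding F_def c_def by (simp add: case_prod_beta)
  qed
  have "(\<integral>\<^sup>+\<omega>. (\<integral>\<^sup>+x. ennreal (F (x, del_point (\<Xi> \<omega>) x)) \<partial>\<Xi> \<omega>) \<partial>P) =
        (\<integral>\<^sup>+x. (\<integral>\<^sup>+\<omega>. ennreal (F (x, \<Psi> x \<omega>)) \<partial>P) \<partial>lam)"
    using Palm F g unfolding reduced_palm_def lam by (auto simp: F_def)
  moreover have "(\<integral>\<^sup>+x. ennreal (F (x, del_point (\<Xi> \<omega>) x)) \<partial>\<Xi> \<omega>) = ennreal (\<Sum>z\<in>#crs (\<Xi> \<omega>). g z (crs (\<Xi> \<omega>) - {#z#}))"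
    if "\<omega> \<in> space P" for \<omega>
  proof -
    define M where "M = pts (\<Xi> \<omega>)"
    have M: "\<Xi> \<omega> = cfg M" unfolding M_def using cfg_pts[OF Xi_configs[OF that]] by simp
    have "(\<integral>\<^sup>+x. ennreal (F (x, del_point (cfg M) x)) \<partial>cfg M) = (\<integral>\<^sup>+x. ennreal (g (c x) (image_mset c M - {#c x#})) \<partial>cfg M)"
    \<comment> \<open>The integral sees only atoms, and at an atom \<open>del_point\<close> is the
      intended configuration; elsewhere it may be a default value.\<close>
    proof (rule nn_integral_cong_AE)
      show "AE x in cfg M. ennreal (F (x, del_point (cfg M) x)) = ennreal (g (c x) (image_mset c M - {#c x#}))"
        using AE_cfg
      proof eventually_elim
        case (elim x)
        then obtain M' where M': "M = add_mset x M'" by (metis insert_DiffM)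
        show ?case unfolding M' del_point_cfg F_def by simp
      qed
    qed
    also have "\<dots> = (\<Sum>x\<in>#M. ennreal (g (c x) (image_mset c M - {#c x#})))"
      by (rule nn_integral_cfg) (rule measurable_compose[OF c_measurable[of "\<lambda>x. x"]], simp)
    also have "\<dots> = (\<Sum>z\<in>#image_mset c M. ennreal (g z (image_mset c M - {#z#})))"
      by (simp add: image_mset.compositionality comp_def)
    also have "\<dots> = ennreal (\<Sum>z\<in>#image_mset c M. g z (image_mset c M - {#z#}))"
    proof -
      have "(\<Sum>z\<in>#K. ennreal (q z)) = ennreal (\<Sum>z\<in>#K. q z) \<and> 0 \<le> (\<Sum>z\<in>#K. q z)" if "\<And>z. 0 \<le> q z" for K and q :: "'a \<Rightarrow> real"
        by (induction K) (auto simp: that ennreal_plus)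
      then show ?thesis using g by simp
    qed
    finally show ?thesis unfolding M crs_cfg .
  qed
  ultimately show ?thesis by (simp add: F_def cong: nn_integral_cong)
qed

lemma palm_mean_measurable:
  fixes g :: "'a \<Rightarrow> 'a multiset \<Rightarrow> real"
  shows "(\<lambda>x. \<integral>\<omega>. g (c x) (crs (\<Psi> x \<omega>)) \<partial>P) \<in> borel_measurable borel"
proof -
  have kern: "(\<lambda>x. distr P config_algebra (\<Psi> x)) \<in> measurable borel (prob_algebra config_algebra)"
    using Palm unfolding reduced_palm_def by blast
  have "(\<lambda>x. \<integral>\<eta>. g (t i) (crs \<eta>) \<partial>distr P config_algebra (\<Psi> x)) \<in> borel_measurable borel" for i
    by (rule measurable_compose[OF measurable_prob_algebraD[OF kern] integral_measurable_subprob_algebra])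
      (rule measurable_compose[OF crs_measurable], simp)
  then have "(\<lambda>x. \<integral>\<eta>. g (t (cell x)) (crs \<eta>) \<partial>distr P config_algebra (\<Psi> x)) \<in> borel_measurable borel"
    by (rule measurable_compose_countable[OF _ cell_measurable])
  moreover have "(\<integral>\<eta>. g (t (cell x)) (crs \<eta>) \<partial>distr P config_algebra (\<Psi> x)) = (\<integral>\<omega>. g (c x) (crs (\<Psi> x \<omega>)) \<partial>P)" for x
    unfolding c_def by (rule integral_distr[OF Psi_meas]) (rule measurable_compose[OF crs_measurable], simp)
  ultimately show ?thesis by simp
qed

text \<open>The identity for nonnegative functions extends to bounded functions of either sign by
  adding the constant \<open>K\<close>. All terms are integrable because the mean size is
  finite.\<close>

lemma palm_expectation:
  fixes g :: "'a \<Rightarrow> 'a multiset \<Rightarrow> real"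
  assumes g: "\<And>x M. \<bar>g x M\<bar> \<le> K"
  shows "(\<integral>\<omega>. (\<Sum>z\<in>#crs (\<Xi> \<omega>). g z (crs (\<Xi> \<omega>) - {#z#})) \<partial>P) = (\<integral>x. (\<integral>\<omega>. g (c x) (crs (\<Psi> x \<omega>)) \<partial>P) \<partial>lam)"
    and "integrable lam (\<lambda>x. \<integral>\<omega>. g (c x) (crs (\<Psi> x \<omega>)) \<partial>P)"
proof -
  have K: "0 \<le> K" using g[of undefined undefined] by linarith
  let ?S = "\<lambda>g \<omega>. \<Sum>z\<in>#crs (\<Xi> \<omega>). g z (crs (\<Xi> \<omega>) - {#z#})"
  have Sm: "?S g \<in> borel_measurable P" for g :: "'a \<Rightarrow> 'a multiset \<Rightarrow> real"
    by (rule measurable_compose[OF crs_Xi]) simp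
  have S_bound: "\<bar>?S g \<omega>\<bar> \<le> real (size (crs (\<Xi> \<omega>))) * K" if "\<And>x M. \<bar>g x M\<bar> \<le> K" for g K \<omega>
    unfolding sum_mset_const_real[symmetric] by (rule abs_sum_mset_le) (rule that)
  have Si: "integrable P (?S g)" if "\<And>x M. \<bar>g x M\<bar> \<le> K" for g and K :: real
    by (rule Bochner_Integration.integrable_bound[OF integrable_mult_left[OF size_Xi_int, of K] Sm])
      (unfold real_norm_def, rule AE_I2, rule order_trans[OF S_bound[OF that] abs_ge_self])
  let ?E = "\<lambda>g x. \<integral>\<omega>. g (c x) (crs (\<Psi> x \<omega>)) \<partial>P"
  have gi: "integrable P (\<lambda>\<omega>. g (c x) (crs (\<Psi> x \<omega>)))" if "\<And>x M. \<bar>g x M\<bar> \<le> K" for g x and K :: real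
    by (rule integrable_const_bound[of _ K]) (auto simp: that intro!: measurable_compose[OF crs_Psi])
  have E_bound: "\<bar>?E g x\<bar> \<le> K" if "\<And>x M. \<bar>g x M\<bar> \<le> K" for g x and K :: real
  proof -
    have gx: "integrable P (\<lambda>\<omega>. g (c x) (crs (\<Psi> x \<omega>)))" by (rule gi) (rule that)
    have "\<bar>?E g x\<bar> \<le> (\<integral>\<omega>. K \<partial>P)"
      by (rule order_trans[OF integral_abs_bound integral_mono])
        (use gx that in auto)
    then show ?thesis by (simp add: prob_space)
  qed
  have Em: "?E g \<in> borel_measurable lam" for g :: "'a \<Rightarrow> 'a multiset \<Rightarrow> real"
    using palm_mean_measurable by (simp cong: measurable_cong_sets)
  have Ei: "integrable lam (?E g)" if "\<And>x M. \<bar>g x M\<bar> \<le> K" for g and K :: real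
    by (rule L.integrable_const_bound[of _ K, OF _ Em])
      (rule AE_I2, unfold real_norm_def, rule E_bound, rule that)
  show "integrable lam (?E g)" by (rule Ei[OF g])
  have pos: "(\<integral>\<omega>. ?S g \<omega> \<partial>P) = (\<integral>x. ?E g x \<partial>lam)" if 0: "\<And>x M. 0 \<le> g x M" and K: "\<And>x M. \<bar>g x M\<bar> \<le> K" for g and K :: real
  proof -
    have S0: "0 \<le> ?S g \<omega>" for \<omega>
      using sum_mset_mono[of "crs (\<Xi> \<omega>)" "\<lambda>_. 0" "\<lambda>z. g z (crs (\<Xi> \<omega>) - {#z#})"] 0 by simp
    have E0: "0 \<le> ?E g x" for x by (rule Bochner_Integration.integral_nonneg) (rule 0)
    have "ennreal (\<integral>\<omega>. ?S g \<omega> \<partial>P) = (\<integral>\<^sup>+\<omega>. ennreal (?S g \<omega>) \<partial>P)"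
      by (rule nn_integral_eq_integral[symmetric, OF Si[OF K]]) (use S0 in auto)
    also have "\<dots> = (\<integral>\<^sup>+x. (\<integral>\<^sup>+\<omega>. ennreal (g (c x) (crs (\<Psi> x \<omega>))) \<partial>P) \<partial>lam)" by (rule palm_nn[OF 0])
    also have "\<dots> = (\<integral>\<^sup>+x. ennreal (?E g x) \<partial>lam)"
      by (intro nn_integral_cong nn_integral_eq_integral gi[OF K]) (use 0 in auto)
    also have "\<dots> = ennreal (\<integral>x. ?E g x \<partial>lam)"
      by (rule nn_integral_eq_integral[OF Ei[OF K]]) (use E0 in auto)
    finally show ?thesis
      using S0 E0 by (simp add: Bochner_Integration.integral_nonneg ennreal_inj)
  qed
  define g' where "g' x M = g x M + K" for x M
  have g'0: "0 \<le> g' x M" and g'K: "\<bar>g' x M\<bar> \<le> 2 * K" for x M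
    using g[of x M] unfolding g'_def by linarith+
  have Kb: "\<bar>K\<bar> \<le> K" using K by simp
  have "(\<integral>\<omega>. ?S g' \<omega> \<partial>P) = (\<integral>\<omega>. ?S g \<omega> + ?S (\<lambda>_ _. K) \<omega> \<partial>P)" unfolding g'_def by (simp add: sum_mset.distrib)
  also have "\<dots> = (\<integral>\<omega>. ?S g \<omega> \<partial>P) + (\<integral>\<omega>. ?S (\<lambda>_ _. K) \<omega> \<partial>P)"
    by (rule Bochner_Integration.integral_add[OF Si[OF g] Si[OF Kb]])
  finally have 1: "(\<integral>\<omega>. ?S g' \<omega> \<partial>P) = (\<integral>\<omega>. ?S g \<omega> \<partial>P) + (\<integral>\<omega>. ?S (\<lambda>_ _. K) \<omega> \<partial>P)" .
  have "?E g' x = ?E g x + ?E (\<lambda>_ _. K) x" for x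
  proof -
    have "integrable P (\<lambda>\<omega>. g (c x) (crs (\<Psi> x \<omega>)))" by (rule gi) (rule g)
    then show ?thesis unfolding g'_def by simp
  qed
  then have "(\<integral>x. ?E g' x \<partial>lam) = (\<integral>x. ?E g x + ?E (\<lambda>_ _. K) x \<partial>lam)" by simp
  also have "\<dots> = (\<integral>x. ?E g x \<partial>lam) + (\<integral>x. ?E (\<lambda>_ _. K) x \<partial>lam)"
    by (rule Bochner_Integration.integral_add[OF Ei[OF g] Ei[OF Kb]])
  finally have 2: "(\<integral>x. ?E g' x \<partial>lam) = (\<integral>x. ?E g x \<partial>lam) + (\<integral>x. ?E (\<lambda>_ _. K) x \<partial>lam)" .
  have "(\<integral>\<omega>. ?S g' \<omega> \<partial>P) = (\<integral>x. ?E g' x \<partial>lam)" by (rule pos[OF g'0 g'K])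
  moreover have "(\<integral>\<omega>. ?S (\<lambda>_ _. K) \<omega> \<partial>P) = (\<integral>x. ?E (\<lambda>_ _. K) x \<partial>lam)" by (rule pos[of "\<lambda>_ _. K", OF K Kb])
  ultimately show "(\<integral>\<omega>. ?S g \<omega> \<partial>P) = (\<integral>x. ?E g x \<partial>lam)" using 1 2 by linarith
qed

end

section \<open>Conditioning on the neighbourhood\<close>

context part begin

text \<open>Two instances occur. Either \<open>Y\<close> is the configuration in \<open>B\<close>
  and \<open>\<kappa>\<close> is the regular conditional distribution given it, or \<open>Y\<close>
  is the configuration in \<open>A\<close> and \<open>\<kappa>\<close> is constant, by independence.
  \<open>H\<close> concerns only the law of \<open>N B\<close> under \<open>\<kappa>\<close>, so the
  constant kernel may be the law of another process.\<close>

context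
  fixes P :: "'w measure" and Nv :: "'w \<Rightarrow> 'a multiset" and Y :: "'w \<Rightarrow> 'a measure"
    and \<kappa> :: "'a measure \<Rightarrow> 'a measure measure" and B :: "'a set"
  assumes P: "prob_space P" and Nv: "Nv \<in> measurable P (count_space UNIV)" and NvD: "\<And>\<omega>. Nv \<omega> \<in> D"
    and Y: "Y \<in> measurable P config_algebra"
    and \<kappa>: "\<kappa> \<in> measurable config_algebra (prob_algebra config_algebra)" and B: "B \<in> sets borel"
    and H: "\<And>T Q. T \<in> sets config_algebra \<Longrightarrow> emeasure P {\<omega> \<in> space P. Nv \<omega> \<in> Q \<and> Y \<omega> \<in> T}
      = (\<integral>\<^sup>+y. emeasure (\<kappa> y) {\<eta> \<in> configs. N B \<eta> \<in> Q} * indicator T y \<partial>distr P config_algebra Y)"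
begin

interpretation prob_space P by (rule P)

lemma kernel_prob: "\<omega> \<in> space P \<Longrightarrow> prob_space (\<kappa> (Y \<omega>))" "\<omega> \<in> space P \<Longrightarrow> sets (\<kappa> (Y \<omega>)) = sets config_algebra"
  using measurable_space[OF \<kappa> measurable_space[OF Y, of \<omega>]] unfolding space_prob_algebra by auto

text \<open>\<open>Nv\<close> takes values in the countable set \<open>D\<close>, so
  \<open>g\<close> expands into a series over single values and \<open>H\<close> applies to each
  term.\<close>

lemma kernel_nn:
  fixes g :: "'a multiset \<Rightarrow> real"
  assumes T: "T \<in> sets config_algebra"
  shows "(\<integral>\<^sup>+\<omega>. ennreal (g (Nv \<omega>)) * indicator T (Y \<omega>) \<partial>P)
    = (\<integral>\<^sup>+\<omega>. (\<integral>\<^sup>+\<eta>. ennreal (g (N B \<eta>)) \<partial>\<kappa> (Y \<omega>)) * indicator T (Y \<omega>) \<partial>P)"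
proof -
  define Q where "Q n = {M \<in> D. to_nat_on D M = n}" for n
  define al where "al n = ennreal (g (from_nat_into D n))" for n
  have expand: "ennreal (g M) = (\<Sum>n. al n * indicator (Q n) M)" if "M \<in> D" for M
  proof -
    have "(\<Sum>n. al n * indicator (Q n) M) = (\<Sum>n\<in>{to_nat_on D M}. al n * indicator (Q n) M)"
      by (rule suminf_finite) (auto simp: Q_def)
    also have "\<dots> = al (to_nat_on D M)" using that by (simp add: Q_def)
    also have "\<dots> = ennreal (g M)" unfolding al_def by (simp add: from_nat_into_to_nat_on[OF D_countable that])
    finally show ?thesis ..
  qed
  define E where "E n = {\<eta> \<in> configs. N B \<eta> \<in> Q n}" for n
  have Ec: "E n = N B -` Q n \<inter> space config_algebra" for n unfolding E_def by auto
  have E: "E n \<in> sets config_algebra" for n unfolding Ec by (rule measurable_sets[OF N_measurable[OF B]]) simp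
  have A: "{\<omega> \<in> space P. Nv \<omega> \<in> Q n \<and> Y \<omega> \<in> T} \<in> sets P" for n
  proof -
    have "{\<omega> \<in> space P. Nv \<omega> \<in> Q n \<and> Y \<omega> \<in> T} = (Nv -` Q n \<inter> space P) \<inter> (Y -` T \<inter> space P)" by auto
    also have "\<dots> \<in> sets P" by (intro sets.Int measurable_sets[OF Nv] measurable_sets[OF Y T]) simp
    finally show ?thesis .
  qed
  have em: "(\<lambda>y. emeasure (\<kappa> y) (E n)) \<in> borel_measurable config_algebra" for n
    by (rule measurable_compose[OF measurable_prob_algebraD[OF \<kappa>] measurable_emeasure_subprob_algebra[OF E]])
  have Tm: "(\<lambda>\<omega>. indicator T (Y \<omega>) :: ennreal) \<in> borel_measurable P"
    by (rule measurable_compose[OF Y]) (use T in simp)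
  have "(\<integral>\<^sup>+\<omega>. ennreal (g (Nv \<omega>)) * indicator T (Y \<omega>) \<partial>P)
    = (\<integral>\<^sup>+\<omega>. (\<Sum>n. al n * indicator {\<omega> \<in> space P. Nv \<omega> \<in> Q n \<and> Y \<omega> \<in> T} \<omega>) \<partial>P)"
  proof (rule nn_integral_cong)
    fix \<omega> assume \<omega>: "\<omega> \<in> space P"
    have "ennreal (g (Nv \<omega>)) * indicator T (Y \<omega>) = (\<Sum>n. al n * indicator (Q n) (Nv \<omega>)) * indicator T (Y \<omega>)"
      by (simp only: expand[OF NvD])
    also have "\<dots> = (\<Sum>n. al n * indicator (Q n) (Nv \<omega>) * indicator T (Y \<omega>))"
      by (rule ennreal_suminf_multc[symmetric])
    also have "\<dots> = (\<Sum>n. al n * indicator {\<omega> \<in> space P. Nv \<omega> \<in> Q n \<and> Y \<omega> \<in> T} \<omega>)"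
      by (rule suminf_cong) (simp add: \<omega> indicator_def)
    finally show "ennreal (g (Nv \<omega>)) * indicator T (Y \<omega>) = (\<Sum>n. al n * indicator {\<omega> \<in> space P. Nv \<omega> \<in> Q n \<and> Y \<omega> \<in> T} \<omega>)" .
  qed
  also have "\<dots> = (\<Sum>n. \<integral>\<^sup>+\<omega>. al n * indicator {\<omega> \<in> space P. Nv \<omega> \<in> Q n \<and> Y \<omega> \<in> T} \<omega> \<partial>P)"
    by (rule nn_integral_suminf) (use A in measurable)
  also have "\<dots> = (\<Sum>n. al n * emeasure P {\<omega> \<in> space P. Nv \<omega> \<in> Q n \<and> Y \<omega> \<in> T})"
    using A by (simp add: nn_integral_cmult_indicator)
  also have "\<dots> = (\<Sum>n. al n * (\<integral>\<^sup>+\<omega>. emeasure (\<kappa> (Y \<omega>)) (E n) * indicator T (Y \<omega>) \<partial>P))"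
    unfolding H[OF T] E_def[symmetric] using em T by (subst nn_integral_distr[OF Y]) auto
  also have "\<dots> = (\<Sum>n. \<integral>\<^sup>+\<omega>. al n * (emeasure (\<kappa> (Y \<omega>)) (E n) * indicator T (Y \<omega>)) \<partial>P)"
    by (intro suminf_cong nn_integral_cmult[symmetric] borel_measurable_times_ennreal measurable_compose[OF Y em] Tm)
  also have "\<dots> = (\<integral>\<^sup>+\<omega>. (\<Sum>n. al n * (emeasure (\<kappa> (Y \<omega>)) (E n) * indicator T (Y \<omega>))) \<partial>P)"
    by (intro nn_integral_suminf[symmetric] borel_measurable_times_ennreal measurable_compose[OF Y em] Tm borel_measurable_const)
  also have "\<dots> = (\<integral>\<^sup>+\<omega>. (\<integral>\<^sup>+\<eta>. ennreal (g (N B \<eta>)) \<partial>\<kappa> (Y \<omega>)) * indicator T (Y \<omega>) \<partial>P)"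
  proof (rule nn_integral_cong)
    fix \<omega> assume \<omega>: "\<omega> \<in> space P"
    have sp: "space (\<kappa> (Y \<omega>)) = configs" using sets_eq_imp_space_eq[OF kernel_prob(2)[OF \<omega>]] by simp
    have Es: "E n \<in> sets (\<kappa> (Y \<omega>))" for n using E kernel_prob(2)[OF \<omega>] by simp
    have ND: "N B \<eta> \<in> D" for \<eta> using N_set unfolding D_def by blast
    have "(\<integral>\<^sup>+\<eta>. ennreal (g (N B \<eta>)) \<partial>\<kappa> (Y \<omega>)) = (\<integral>\<^sup>+\<eta>. (\<Sum>n. al n * indicator (E n) \<eta>) \<partial>\<kappa> (Y \<omega>))"
    proof (rule nn_integral_cong)
      fix \<eta> assume "\<eta> \<in> space (\<kappa> (Y \<omega>))"
      then have "indicator (Q n) (N B \<eta>) = (indicator (E n) \<eta> :: ennreal)" for n by (simp add: E_def sp indicator_def)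
      then show "ennreal (g (N B \<eta>)) = (\<Sum>n. al n * indicator (E n) \<eta>)" by (simp only: expand[OF ND])
    qed
    also have "\<dots> = (\<Sum>n. \<integral>\<^sup>+\<eta>. al n * indicator (E n) \<eta> \<partial>\<kappa> (Y \<omega>))"
      by (rule nn_integral_suminf) (use Es in measurable)
    also have "\<dots> = (\<Sum>n. al n * emeasure (\<kappa> (Y \<omega>)) (E n))"
      using Es by (simp add: nn_integral_cmult_indicator)
    finally show "(\<Sum>n. al n * (emeasure (\<kappa> (Y \<omega>)) (E n) * indicator T (Y \<omega>)))
      = (\<integral>\<^sup>+\<eta>. ennreal (g (N B \<eta>)) \<partial>\<kappa> (Y \<omega>)) * indicator T (Y \<omega>)"
      by (simp only: ennreal_suminf_multc[symmetric] mult.assoc)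
  qed
  finally show ?thesis .
qed

lemma N_int:
  fixes g :: "'a multiset \<Rightarrow> real"
  assumes "\<omega> \<in> space P" "\<And>M. \<bar>g M\<bar> \<le> K"
  shows "integrable (\<kappa> (Y \<omega>)) (\<lambda>\<eta>. g (N B \<eta>))" "\<bar>\<integral>\<eta>. g (N B \<eta>) \<partial>\<kappa> (Y \<omega>)\<bar> \<le> K"
proof -
  interpret K: prob_space "\<kappa> (Y \<omega>)" by (rule kernel_prob[OF assms(1)])
  show i: "integrable (\<kappa> (Y \<omega>)) (\<lambda>\<eta>. g (N B \<eta>))"
    by (rule K.integrable_const_bound[of _ K])
      (use assms(2) in \<open>auto intro!: measurable_compose[OF N_meas[OF kernel_prob[OF assms(1)] B]]\<close>)
  have "\<bar>\<integral>\<eta>. g (N B \<eta>) \<partial>\<kappa> (Y \<omega>)\<bar> \<le> (\<integral>\<eta>. K \<partial>\<kappa> (Y \<omega>))"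
    by (rule order_trans[OF integral_abs_bound integral_mono]) (use i assms(2) in auto)
  then show "\<bar>\<integral>\<eta>. g (N B \<eta>) \<partial>\<kappa> (Y \<omega>)\<bar> \<le> K" by (simp add: K.prob_space)
qed

lemma N_integral_measurable:
  fixes g :: "'a multiset \<Rightarrow> real"
  shows "(\<lambda>\<omega>. \<integral>\<eta>. g (N B \<eta>) \<partial>\<kappa> (Y \<omega>)) \<in> borel_measurable P"
  by (rule measurable_compose[OF measurable_compose[OF Y measurable_prob_algebraD[OF \<kappa>]] integral_measurable_subprob_algebra])
    (rule measurable_compose[OF N_measurable[OF B]], simp)

lemma kernel_integral:
  fixes g :: "'a multiset \<Rightarrow> real"
  assumes T: "T \<in> sets config_algebra" and g: "\<And>M. \<bar>g M\<bar> \<le> K"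
  shows "(\<integral>\<omega>. g (Nv \<omega>) * indicator T (Y \<omega>) \<partial>P) = (\<integral>\<omega>. (\<integral>\<eta>. g (N B \<eta>) \<partial>\<kappa> (Y \<omega>)) * indicator T (Y \<omega>) \<partial>P)"
proof -
  have Tm: "(\<lambda>\<omega>. indicator T (Y \<omega>) :: real) \<in> borel_measurable P"
    by (rule measurable_compose[OF Y]) (use T in simp)
  have gm: "(\<lambda>\<omega>. g (Nv \<omega>)) \<in> borel_measurable P" for g :: "'a multiset \<Rightarrow> real"
    by (rule measurable_compose[OF Nv]) simp
  have i1: "integrable P (\<lambda>\<omega>. g (Nv \<omega>) * indicator T (Y \<omega>))" if "\<And>M. \<bar>g M\<bar> \<le> K" for g :: "'a multiset \<Rightarrow> real" and K :: real
  proof (rule integrable_const_bound[of _ K])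
    show "AE \<omega> in P. norm (g (Nv \<omega>) * indicator T (Y \<omega>)) \<le> K"
      using that abs_ge_zero order_trans[OF abs_ge_zero that] by (intro AE_I2) (auto simp: indicator_def)
    show "(\<lambda>\<omega>. g (Nv \<omega>) * indicator T (Y \<omega>)) \<in> borel_measurable P" using gm Tm by (rule borel_measurable_times)
  qed
  have i2: "integrable P (\<lambda>\<omega>. (\<integral>\<eta>. g (N B \<eta>) \<partial>\<kappa> (Y \<omega>)) * indicator T (Y \<omega>))" if "\<And>M. \<bar>g M\<bar> \<le> K" for g :: "'a multiset \<Rightarrow> real" and K :: real
  proof (rule integrable_const_bound[of _ K])
    show "AE \<omega> in P. norm ((\<integral>\<eta>. g (N B \<eta>) \<partial>\<kappa> (Y \<omega>)) * indicator T (Y \<omega>)) \<le> K"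
      using N_int(2)[of _ g K] that order_trans[OF abs_ge_zero that] by (intro AE_I2) (auto simp: indicator_def)
    show "(\<lambda>\<omega>. (\<integral>\<eta>. g (N B \<eta>) \<partial>\<kappa> (Y \<omega>)) * indicator T (Y \<omega>)) \<in> borel_measurable P"
      using N_integral_measurable Tm by (rule borel_measurable_times)
  qed
  have pos: "(\<integral>\<omega>. g (Nv \<omega>) * indicator T (Y \<omega>) \<partial>P) = (\<integral>\<omega>. (\<integral>\<eta>. g (N B \<eta>) \<partial>\<kappa> (Y \<omega>)) * indicator T (Y \<omega>) \<partial>P)"
    if 0: "\<And>M. 0 \<le> g M" and K: "\<And>M. \<bar>g M\<bar> \<le> K" for g :: "'a multiset \<Rightarrow> real" and K :: real
  proof -
    have "ennreal (\<integral>\<omega>. g (Nv \<omega>) * indicator T (Y \<omega>) \<partial>P) = (\<integral>\<^sup>+\<omega>. ennreal (g (Nv \<omega>) * indicator T (Y \<omega>)) \<partial>P)"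
      by (rule nn_integral_eq_integral[symmetric, OF i1[OF K]]) (use 0 in auto)
    also have "\<dots> = (\<integral>\<^sup>+\<omega>. ennreal (g (Nv \<omega>)) * indicator T (Y \<omega>) \<partial>P)"
      by (rule nn_integral_cong) (auto simp: indicator_def)
    also have "\<dots> = (\<integral>\<^sup>+\<omega>. (\<integral>\<^sup>+\<eta>. ennreal (g (N B \<eta>)) \<partial>\<kappa> (Y \<omega>)) * indicator T (Y \<omega>) \<partial>P)"
      by (rule kernel_nn[OF T])
    also have "\<dots> = (\<integral>\<^sup>+\<omega>. ennreal ((\<integral>\<eta>. g (N B \<eta>) \<partial>\<kappa> (Y \<omega>)) * indicator T (Y \<omega>)) \<partial>P)"
    proof (rule nn_integral_cong)
      fix \<omega> assume \<omega>: "\<omega> \<in> space P"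
      have "(\<integral>\<^sup>+\<eta>. ennreal (g (N B \<eta>)) \<partial>\<kappa> (Y \<omega>)) = ennreal (\<integral>\<eta>. g (N B \<eta>) \<partial>\<kappa> (Y \<omega>))"
        by (rule nn_integral_eq_integral[OF N_int(1)[OF \<omega> K]]) (use 0 in auto)
      then show "(\<integral>\<^sup>+\<eta>. ennreal (g (N B \<eta>)) \<partial>\<kappa> (Y \<omega>)) * indicator T (Y \<omega>) = ennreal ((\<integral>\<eta>. g (N B \<eta>) \<partial>\<kappa> (Y \<omega>)) * indicator T (Y \<omega>))"
        by (auto simp: indicator_def)
    qed
    also have "\<dots> = ennreal (\<integral>\<omega>. (\<integral>\<eta>. g (N B \<eta>) \<partial>\<kappa> (Y \<omega>)) * indicator T (Y \<omega>) \<partial>P)"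
      by (rule nn_integral_eq_integral[OF i2[OF K]])
        (auto intro!: mult_nonneg_nonneg Bochner_Integration.integral_nonneg 0)
    finally show ?thesis
      by (subst (asm) ennreal_inj) (auto intro!: Bochner_Integration.integral_nonneg mult_nonneg_nonneg 0)
  qed
  have K: "0 \<le> K" using g[of undefined] by linarith
  have g': "0 \<le> g M + K" "\<bar>g M + K\<bar> \<le> 2 * K" for M using g[of M] by linarith+
  have Kb: "\<bar>K\<bar> \<le> K" using K by simp
  have 1: "(\<integral>\<omega>. (g (Nv \<omega>) + K) * indicator T (Y \<omega>) \<partial>P)
    = (\<integral>\<omega>. g (Nv \<omega>) * indicator T (Y \<omega>) \<partial>P) + (\<integral>\<omega>. K * indicator T (Y \<omega>) \<partial>P)"
    unfolding distrib_right by (rule Bochner_Integration.integral_add[OF i1[OF g] i1[of "\<lambda>_. K", OF Kb]])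
  have 2: "(\<integral>\<omega>. (\<integral>\<eta>. g (N B \<eta>) + K \<partial>\<kappa> (Y \<omega>)) * indicator T (Y \<omega>) \<partial>P)
    = (\<integral>\<omega>. (\<integral>\<eta>. g (N B \<eta>) \<partial>\<kappa> (Y \<omega>)) * indicator T (Y \<omega>) \<partial>P) + (\<integral>\<omega>. (\<integral>\<eta>. K \<partial>\<kappa> (Y \<omega>)) * indicator T (Y \<omega>) \<partial>P)"
  proof -
    have "(\<integral>\<omega>. (\<integral>\<eta>. g (N B \<eta>) + K \<partial>\<kappa> (Y \<omega>)) * indicator T (Y \<omega>) \<partial>P)
      = (\<integral>\<omega>. (\<integral>\<eta>. g (N B \<eta>) \<partial>\<kappa> (Y \<omega>)) * indicator T (Y \<omega>) + (\<integral>\<eta>. K \<partial>\<kappa> (Y \<omega>)) * indicator T (Y \<omega>) \<partial>P)"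
    proof (rule Bochner_Integration.integral_cong[OF refl])
      fix \<omega> assume \<omega>: "\<omega> \<in> space P"
      have "(\<integral>\<eta>. g (N B \<eta>) + K \<partial>\<kappa> (Y \<omega>)) = (\<integral>\<eta>. g (N B \<eta>) \<partial>\<kappa> (Y \<omega>)) + (\<integral>\<eta>. K \<partial>\<kappa> (Y \<omega>))"
        by (rule Bochner_Integration.integral_add[OF N_int(1)[OF \<omega> g] N_int(1)[OF \<omega>, of "\<lambda>_. K", OF Kb]])
      then show "(\<integral>\<eta>. g (N B \<eta>) + K \<partial>\<kappa> (Y \<omega>)) * indicator T (Y \<omega>)
        = (\<integral>\<eta>. g (N B \<eta>) \<partial>\<kappa> (Y \<omega>)) * indicator T (Y \<omega>) + (\<integral>\<eta>. K \<partial>\<kappa> (Y \<omega>)) * indicator T (Y \<omega>)"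
        by (simp only: distrib_right)
    qed
    also have "\<dots> = (\<integral>\<omega>. (\<integral>\<eta>. g (N B \<eta>) \<partial>\<kappa> (Y \<omega>)) * indicator T (Y \<omega>) \<partial>P) + (\<integral>\<omega>. (\<integral>\<eta>. K \<partial>\<kappa> (Y \<omega>)) * indicator T (Y \<omega>) \<partial>P)"
      by (rule Bochner_Integration.integral_add[OF i2[OF g] i2[of "\<lambda>_. K", OF Kb]])
    finally show ?thesis .
  qed
  show ?thesis using pos[of "\<lambda>M. g M + K", OF g'] pos[of "\<lambda>_. K", OF K Kb] 1 2 by linarith
qed

text \<open>Neither \<open>s\<close> nor \<open>K\<close> is bounded; the proof truncates to finitely many values of \<open>z\<close>, for which
  conditioning on \<open>Y\<close> is a finite sum.\<close>

lemma conditional_bound: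
  fixes \<phi> :: "'a multiset \<times> 'a multiset \<Rightarrow> 'a multiset \<Rightarrow> real" and R :: "'a measure measure \<Rightarrow> real"
  assumes zD: "\<And>\<omega>. z (Y \<omega>) \<in> D \<times> D"
    and zm: "\<And>z0. z0 \<in> D \<times> D \<Longrightarrow> {y \<in> configs. z y = z0} \<in> sets config_algebra"
    and \<phi>: "\<And>z M. \<bar>\<phi> z M\<bar> \<le> K z"
    and bound: "\<And>\<mu> z0. prob_space \<mu> \<Longrightarrow> sets \<mu> = sets config_algebra \<Longrightarrow> z0 \<in> D \<times> D
      \<Longrightarrow> \<bar>\<integral>\<eta>. \<phi> z0 (N B \<eta>) \<partial>\<mu>\<bar> \<le> R \<mu> * s z0"
    and R: "\<And>\<mu>. prob_space \<mu> \<Longrightarrow> sets \<mu> = sets config_algebra \<Longrightarrow> 0 \<le> R \<mu> \<and> R \<mu> \<le> Rm"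
    and Rmeas: "(\<lambda>y. R (\<kappa> y)) \<in> borel_measurable config_algebra"
    and s: "\<And>z. 0 \<le> s z"
    and W: "integrable P (\<lambda>\<omega>. \<phi> (z (Y \<omega>)) (Nv \<omega>))"
  shows "ennreal \<bar>\<integral>\<omega>. \<phi> (z (Y \<omega>)) (Nv \<omega>) \<partial>P\<bar> \<le> (\<integral>\<^sup>+\<omega>. ennreal (R (\<kappa> (Y \<omega>)) * s (z (Y \<omega>))) \<partial>P)"
proof -
  define F1 where "F1 n = {M \<in> D. size M \<le> n}" for n
  define F where "F n = F1 n \<times> F1 n" for n
  have finF1: "finite (F1 n)" for n
  proof (rule finite_subset)
    show "F1 n \<subseteq> mset ` {xs. set xs \<subseteq> t ` {1..k} \<and> length xs \<le> n}"
    proof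
      fix M assume M: "M \<in> F1 n"
      obtain xs where xs: "mset xs = M" using ex_mset by blast
      have "set xs \<subseteq> t ` {1..k}" "length xs \<le> n" using M unfolding F1_def D_def xs[symmetric] by simp_all
      then show "M \<in> mset ` {xs. set xs \<subseteq> t ` {1..k} \<and> length xs \<le> n}" using xs by blast
    qed
    show "finite (mset ` {xs. set xs \<subseteq> t ` {1..k} \<and> length xs \<le> n})" by (intro finite_imageI finite_lists_length_le) simp
  qed
  have finF: "finite (F n)" and FD: "F n \<subseteq> D \<times> D" for n unfolding F_def using finF1 by (auto simp: F1_def)
  define T where "T z0 = {y \<in> configs. z y = z0}" for z0
  have T: "z0 \<in> D \<times> D \<Longrightarrow> T z0 \<in> sets config_algebra" for z0 unfolding T_def by (rule zm)
  have Yc: "\<omega> \<in> space P \<Longrightarrow> Y \<omega> \<in> configs" for \<omega> using measurable_space[OF Y] by simp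
  have Rb: "0 \<le> R (\<kappa> (Y \<omega>))" "R (\<kappa> (Y \<omega>)) \<le> Rm" if "\<omega> \<in> space P" for \<omega>
    using R[OF kernel_prob[OF that]] by auto
  have Rm0: "0 \<le> Rm" using Rb not_empty by (meson ex_in_conv order_trans)
  have RYm: "(\<lambda>\<omega>. R (\<kappa> (Y \<omega>))) \<in> borel_measurable P" by (rule measurable_compose[OF Y Rmeas])
  let ?C = "\<integral>\<^sup>+\<omega>. ennreal (R (\<kappa> (Y \<omega>)) * s (z (Y \<omega>))) \<partial>P"
  define Wn where "Wn n \<omega> = (\<Sum>z0\<in>F n. \<phi> z0 (Nv \<omega>) * indicator (T z0) (Y \<omega>))" for n \<omega>
  have Wn: "Wn n \<omega> = (if z (Y \<omega>) \<in> F n then \<phi> (z (Y \<omega>)) (Nv \<omega>) else 0)" if "\<omega> \<in> space P" for n \<omega>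
  proof -
    have "Wn n \<omega> = (\<Sum>z0\<in>F n. if z0 = z (Y \<omega>) then \<phi> z0 (Nv \<omega>) else 0)"
      unfolding Wn_def by (intro sum.cong refl) (auto simp: T_def Yc[OF that] indicator_def)
    then show ?thesis using finF by simp
  qed
  have Tm: "(\<lambda>\<omega>. indicator (T z0) (Y \<omega>) :: real) \<in> borel_measurable P" if "z0 \<in> D \<times> D" for z0
    by (rule measurable_compose[OF Y]) (use T[OF that] in simp)
  have int1: "integrable P (\<lambda>\<omega>. \<phi> z0 (Nv \<omega>) * indicator (T z0) (Y \<omega>))" if "z0 \<in> D \<times> D" for z0
  proof (rule integrable_const_bound[of _ "K z0"])
    show "AE \<omega> in P. norm (\<phi> z0 (Nv \<omega>) * indicator (T z0) (Y \<omega>)) \<le> K z0"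
      using \<phi> order_trans[OF abs_ge_zero \<phi>] by (intro AE_I2) (auto simp: indicator_def)
    show "(\<lambda>\<omega>. \<phi> z0 (Nv \<omega>) * indicator (T z0) (Y \<omega>)) \<in> borel_measurable P"
      by (rule borel_measurable_times[OF measurable_compose[OF Nv] Tm[OF that]]) simp
  qed
  have int2: "integrable P (\<lambda>\<omega>. R (\<kappa> (Y \<omega>)) * s z0 * indicator (T z0) (Y \<omega>))" if "z0 \<in> D \<times> D" for z0
  proof (rule integrable_const_bound[of _ "Rm * s z0"])
    show "AE \<omega> in P. norm (R (\<kappa> (Y \<omega>)) * s z0 * indicator (T z0) (Y \<omega>)) \<le> Rm * s z0"
      using Rb s[of z0] Rm0 by (intro AE_I2) (auto simp: indicator_def abs_mult mult_right_mono)
    show "(\<lambda>\<omega>. R (\<kappa> (Y \<omega>)) * s z0 * indicator (T z0) (Y \<omega>)) \<in> borel_measurable P"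
      using RYm Tm[OF that] by (intro borel_measurable_times borel_measurable_const)
  qed
  have one: "\<bar>\<integral>\<omega>. \<phi> z0 (Nv \<omega>) * indicator (T z0) (Y \<omega>) \<partial>P\<bar> \<le> (\<integral>\<omega>. R (\<kappa> (Y \<omega>)) * s z0 * indicator (T z0) (Y \<omega>) \<partial>P)"
    if z0: "z0 \<in> D \<times> D" for z0
  proof -
    have "\<bar>\<integral>\<omega>. (\<integral>\<eta>. \<phi> z0 (N B \<eta>) \<partial>\<kappa> (Y \<omega>)) * indicator (T z0) (Y \<omega>) \<partial>P\<bar>
      \<le> (\<integral>\<omega>. \<bar>(\<integral>\<eta>. \<phi> z0 (N B \<eta>) \<partial>\<kappa> (Y \<omega>)) * indicator (T z0) (Y \<omega>)\<bar> \<partial>P)" by (rule integral_abs_bound)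
    also have "\<dots> \<le> (\<integral>\<omega>. R (\<kappa> (Y \<omega>)) * s z0 * indicator (T z0) (Y \<omega>) \<partial>P)"
    proof (rule integral_mono_AE')
      show "integrable P (\<lambda>\<omega>. R (\<kappa> (Y \<omega>)) * s z0 * indicator (T z0) (Y \<omega>))" by (rule int2[OF z0])
      show "AE \<omega> in P. \<bar>(\<integral>\<eta>. \<phi> z0 (N B \<eta>) \<partial>\<kappa> (Y \<omega>)) * indicator (T z0) (Y \<omega>)\<bar> \<le> R (\<kappa> (Y \<omega>)) * s z0 * indicator (T z0) (Y \<omega>)"
        using bound[OF kernel_prob z0] by (intro AE_I2) (auto simp: indicator_def)
    qed (use Rb s in \<open>auto intro!: AE_I2 mult_nonneg_nonneg\<close>)
    finally show ?thesis unfolding kernel_integral[OF T[OF z0], of "\<phi> z0" "K z0", OF \<phi>] .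
  qed
  have bnd: "ennreal \<bar>\<integral>\<omega>. Wn n \<omega> \<partial>P\<bar> \<le> ?C" for n
  proof -
    have "\<bar>\<integral>\<omega>. Wn n \<omega> \<partial>P\<bar> = \<bar>\<Sum>z0\<in>F n. \<integral>\<omega>. \<phi> z0 (Nv \<omega>) * indicator (T z0) (Y \<omega>) \<partial>P\<bar>"
      unfolding Wn_def by (subst Bochner_Integration.integral_sum) (use int1 FD in auto)
    also have "\<dots> \<le> (\<Sum>z0\<in>F n. \<integral>\<omega>. R (\<kappa> (Y \<omega>)) * s z0 * indicator (T z0) (Y \<omega>) \<partial>P)"
      by (rule order_trans[OF sum_abs sum_mono]) (use one FD in auto)
    also have "\<dots> = (\<integral>\<omega>. (\<Sum>z0\<in>F n. R (\<kappa> (Y \<omega>)) * s z0 * indicator (T z0) (Y \<omega>)) \<partial>P)"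
      by (subst Bochner_Integration.integral_sum) (use int2 FD in auto)
    finally have "ennreal \<bar>\<integral>\<omega>. Wn n \<omega> \<partial>P\<bar> \<le> ennreal (\<integral>\<omega>. (\<Sum>z0\<in>F n. R (\<kappa> (Y \<omega>)) * s z0 * indicator (T z0) (Y \<omega>)) \<partial>P)"
      by (rule ennreal_leI)
    also have "\<dots> = (\<integral>\<^sup>+\<omega>. ennreal (\<Sum>z0\<in>F n. R (\<kappa> (Y \<omega>)) * s z0 * indicator (T z0) (Y \<omega>)) \<partial>P)"
    proof (rule nn_integral_eq_integral[symmetric])
      show "integrable P (\<lambda>\<omega>. \<Sum>z0\<in>F n. R (\<kappa> (Y \<omega>)) * s z0 * indicator (T z0) (Y \<omega>))"
        by (rule Bochner_Integration.integrable_sum) (use int2 FD in auto)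
      show "AE \<omega> in P. 0 \<le> (\<Sum>z0\<in>F n. R (\<kappa> (Y \<omega>)) * s z0 * indicator (T z0) (Y \<omega>))"
        using Rb s by (intro AE_I2 sum_nonneg mult_nonneg_nonneg) auto
    qed
    also have "\<dots> \<le> ?C"
    proof (intro nn_integral_mono ennreal_leI)
      fix \<omega> assume \<omega>: "\<omega> \<in> space P"
      have "(\<Sum>z0\<in>F n. R (\<kappa> (Y \<omega>)) * s z0 * indicator (T z0) (Y \<omega>)) = (\<Sum>z0\<in>F n. if z0 = z (Y \<omega>) then R (\<kappa> (Y \<omega>)) * s z0 else 0)"
        by (intro sum.cong refl) (auto simp: T_def Yc[OF \<omega>] indicator_def)
      also have "\<dots> \<le> R (\<kappa> (Y \<omega>)) * s (z (Y \<omega>))" using finF Rb[OF \<omega>] s by simp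
      finally show "(\<Sum>z0\<in>F n. R (\<kappa> (Y \<omega>)) * s z0 * indicator (T z0) (Y \<omega>)) \<le> R (\<kappa> (Y \<omega>)) * s (z (Y \<omega>))" .
    qed
    finally show ?thesis .
  qed
  \<comment> \<open>Each \<open>Wn n \<omega>\<close> is either the full integrand or 0, so the
    integrand itself dominates.\<close>
  have "(\<lambda>n. \<integral>\<omega>. Wn n \<omega> \<partial>P) \<longlonglongrightarrow> (\<integral>\<omega>. \<phi> (z (Y \<omega>)) (Nv \<omega>) \<partial>P)"
  proof (rule integral_dominated_convergence[where w = "\<lambda>\<omega>. \<bar>\<phi> (z (Y \<omega>)) (Nv \<omega>)\<bar>"])
    show "(\<lambda>\<omega>. \<phi> (z (Y \<omega>)) (Nv \<omega>)) \<in> borel_measurable P" using W by blast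
    show "integrable P (\<lambda>\<omega>. \<bar>\<phi> (z (Y \<omega>)) (Nv \<omega>)\<bar>)" using W by simp
    show "(\<lambda>\<omega>. Wn n \<omega>) \<in> borel_measurable P" for n
      unfolding Wn_def by (intro borel_measurable_sum borel_measurable_integrable int1) (use FD in auto)
    show "AE \<omega> in P. (\<lambda>n. Wn n \<omega>) \<longlonglongrightarrow> \<phi> (z (Y \<omega>)) (Nv \<omega>)"
    proof (rule AE_I2)
      fix \<omega> assume \<omega>: "\<omega> \<in> space P"
      define n0 where "n0 = max (size (fst (z (Y \<omega>)))) (size (snd (z (Y \<omega>))))"
      have "Wn n \<omega> = \<phi> (z (Y \<omega>)) (Nv \<omega>)" if "n \<ge> n0" for n
        using that zD[of \<omega>] unfolding Wn[OF \<omega>] F_def F1_def n0_def by (auto simp: mem_Times_iff)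
      then show "(\<lambda>n. Wn n \<omega>) \<longlonglongrightarrow> \<phi> (z (Y \<omega>)) (Nv \<omega>)"
        by (intro tendsto_eventually) (auto intro: eventually_mono[OF eventually_ge_at_top[of n0]])
    qed
    show "AE \<omega> in P. norm (Wn n \<omega>) \<le> \<bar>\<phi> (z (Y \<omega>)) (Nv \<omega>)\<bar>" for n
      by (intro AE_I2) (simp add: Wn)
  qed
  then have "(\<lambda>n. ennreal \<bar>\<integral>\<omega>. Wn n \<omega> \<partial>P\<bar>) \<longlonglongrightarrow> ennreal \<bar>\<integral>\<omega>. \<phi> (z (Y \<omega>)) (Nv \<omega>) \<partial>P\<bar>"
    by (intro tendsto_ennrealI tendsto_rabs)
  then show ?thesis by (rule LIMSEQ_le_const2) (use bnd in blast)
qed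

end

end

section \<open>Local dependence estimates\<close>

text \<open>\<open>\<Psi>\<close> stands for \<open>\<Xi>\<close> or for the Palm process at one
  fixed point, with neighbourhoods \<open>A\<close> and \<open>B\<close> of that point. Below,
  \<open>X\<close>, \<open>PA\<close> and \<open>QB\<close> are the coarsened parts outside
  \<open>B\<close>, in \<open>A\<close> and in \<open>B - A\<close>.\<close>

locale local_dependence = part k G t + resolvent a b "{1..k}" t w f \<rho> h
  for k :: nat and G :: "nat \<Rightarrow> 'a::metric_space set" and t :: "nat \<Rightarrow> 'a"
    and a b :: real and w :: "nat \<Rightarrow> real" and f \<rho> h +
  fixes P :: "'w measure" and \<Psi> :: "'w \<Rightarrow> 'a measure" and A B :: "'a set"
    and \<kappa> :: "'a measure \<Rightarrow> 'a measure measure" and u :: real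
  assumes P: "prob_space P" and \<Psi>: "\<Psi> \<in> measurable P config_algebra"
    and A: "A \<in> sets borel" and B: "B \<in> sets borel" and AB: "A \<subseteq> B" and u: "u > 0"
    and \<kappa>: "reg_cond_distr P config_algebra \<Psi> config_algebra (\<lambda>\<omega>. restr (\<Psi> \<omega>) B) \<kappa>"
    and indep: "prob_space.indep_var P config_algebra (\<lambda>\<omega>. restr (\<Psi> \<omega>) (- B))
                                 config_algebra (\<lambda>\<omega>. restr (\<Psi> \<omega>) A)"
    and size_int: "integrable P (\<lambda>\<omega>. real (size (crs (\<Psi> \<omega>))))"
begin

interpretation prob_space P by (rule P)

abbreviation R :: "'a measure measure \<Rightarrow> real" where "R \<equiv> r_of_law a u k G t B"

definition X :: "'w \<Rightarrow> 'a multiset" where "X \<omega> = N B (\<Psi> \<omega>)"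
definition PA :: "'w \<Rightarrow> 'a multiset" where "PA \<omega> = crs (restr (\<Psi> \<omega>) A)"
definition QB :: "'w \<Rightarrow> 'a multiset" where "QB \<omega> = crs (restr (\<Psi> \<omega>) (B - A))"

lemma res: "resolvent a b {1..k} t w f \<rho> h" by unfold_locales

lemma configs: "\<omega> \<in> space P \<Longrightarrow> \<Psi> \<omega> \<in> configs" using measurable_space[OF \<Psi>] by simp

lemma crs_restr_meas: "S \<in> sets borel \<Longrightarrow> (\<lambda>\<omega>. crs (restr (\<Psi> \<omega>) S)) \<in> measurable P (count_space UNIV)"
  by (rule measurable_compose[OF measurable_compose[OF \<Psi> restr_measurable] crs_measurable])

lemma X_meas: "X \<in> measurable P (count_space UNIV)"
  unfolding X_def[abs_def] N_def using crs_restr_meas[of "- B"] B by simp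

lemma XD: "X \<omega> \<in> D" unfolding X_def D_def using N_set by blast

lemma decompose:
  assumes "\<omega> \<in> space P"
  shows "crs (\<Psi> \<omega>) = X \<omega> + (PA \<omega> + QB \<omega>)" "crs (restr (\<Psi> \<omega>) (- A)) = X \<omega> + QB \<omega>"
    and "crs (restr (\<Psi> \<omega>) (- (B - A))) = X \<omega> + PA \<omega>" and "crs (restr (\<Psi> \<omega>) B) = PA \<omega> + QB \<omega>"
proof -
  note c = configs[OF assms]
  have BA: "B - A \<in> sets borel" using A B by simp
  show 1: "crs (restr (\<Psi> \<omega>) B) = PA \<omega> + QB \<omega>" unfolding PA_def QB_def by (rule crs_restr_split2(1)[OF c A B AB])
  show 2: "crs (\<Psi> \<omega>) = X \<omega> + (PA \<omega> + QB \<omega>)" unfolding X_def N_def 1[symmetric] by (rule crs_restr_split[OF c B])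
  show "crs (restr (\<Psi> \<omega>) (- A)) = X \<omega> + QB \<omega>" unfolding X_def N_def QB_def by (rule crs_restr_split2(2)[OF c A B AB])
  have "crs (\<Psi> \<omega>) = crs (restr (\<Psi> \<omega>) (- (B - A))) + QB \<omega>" unfolding QB_def by (rule crs_restr_split[OF c BA])
  then show "crs (restr (\<Psi> \<omega>) (- (B - A))) = X \<omega> + PA \<omega>" unfolding 2 by simp
qed

lemma sizes:
  assumes "\<omega> \<in> space P"
  shows "real (size (PA \<omega>)) = measure (\<Psi> \<omega>) A" "real (size (QB \<omega>)) = measure (\<Psi> \<omega>) (B - A)"
    and "real (size (PA \<omega> + QB \<omega>)) = measure (\<Psi> \<omega>) B"
  using size_crs_restr[OF configs[OF assms]] A B decompose(4)[OF assms, symmetric] unfolding PA_def QB_def by (auto simp del: size_union)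

lemma sum_meas:
  fixes g :: "'a multiset \<Rightarrow> real"
  shows "(\<lambda>\<omega>. g (X \<omega> + (PA \<omega> + QB \<omega>))) \<in> borel_measurable P" "(\<lambda>\<omega>. g (X \<omega> + QB \<omega>)) \<in> borel_measurable P"
    "(\<lambda>\<omega>. g (X \<omega> + PA \<omega>)) \<in> borel_measurable P" "(\<lambda>\<omega>. g (X \<omega>)) \<in> borel_measurable P"
    "(\<lambda>\<omega>. g (PA \<omega>)) \<in> borel_measurable P" "(\<lambda>\<omega>. g (QB \<omega>)) \<in> borel_measurable P"
proof -
  have c: "(\<lambda>\<omega>. g (F \<omega>)) \<in> borel_measurable P" if "F \<in> measurable P (count_space UNIV)" for F
    by (rule measurable_compose[OF that]) simp
  show "(\<lambda>\<omega>. g (X \<omega>)) \<in> borel_measurable P" by (rule c[OF X_meas])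
  show "(\<lambda>\<omega>. g (PA \<omega>)) \<in> borel_measurable P" unfolding PA_def by (rule c[OF crs_restr_meas[OF A]])
  show "(\<lambda>\<omega>. g (QB \<omega>)) \<in> borel_measurable P" unfolding QB_def by (rule c[OF crs_restr_meas]) (use A B in auto)
  show "(\<lambda>\<omega>. g (X \<omega> + (PA \<omega> + QB \<omega>))) \<in> borel_measurable P"
    using c[OF measurable_compose[OF \<Psi> crs_measurable]] by (subst measurable_cong[OF arg_cong[OF decompose(1)[symmetric]]])
  show "(\<lambda>\<omega>. g (X \<omega> + QB \<omega>)) \<in> borel_measurable P"
    using c[OF crs_restr_meas[of "- A"]] A by (subst measurable_cong[OF arg_cong[OF decompose(2)[symmetric]]]) auto
  show "(\<lambda>\<omega>. g (X \<omega> + PA \<omega>)) \<in> borel_measurable P"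
    using c[OF crs_restr_meas[of "- (B - A)"]] A B by (subst measurable_cong[OF arg_cong[OF decompose(3)[symmetric]]]) auto
qed

lemma sum_int:
  fixes g :: "'a multiset \<Rightarrow> real"
  assumes "\<And>M. \<bar>g M\<bar> \<le> K"
  shows "integrable P (\<lambda>\<omega>. g (X \<omega> + (PA \<omega> + QB \<omega>)))" "integrable P (\<lambda>\<omega>. g (X \<omega> + QB \<omega>))"
    "integrable P (\<lambda>\<omega>. g (X \<omega> + PA \<omega>))" "integrable P (\<lambda>\<omega>. g (X \<omega>))"
  by (rule integrable_const_bound[of _ K]; use assms sum_meas[of g] in auto)+

lemma PA_int: "integrable P (\<lambda>\<omega>. real (size (PA \<omega>)))"
proof (rule Bochner_Integration.integrable_bound[OF size_int sum_meas(5)[of "\<lambda>M. real (size M)"]])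
  show "AE \<omega> in P. norm (real (size (PA \<omega>))) \<le> norm (real (size (crs (\<Psi> \<omega>))))"
    by (rule AE_I2) (simp add: decompose)
qed

lemma cond_kernel:
  shows "\<kappa> \<in> measurable config_algebra (prob_algebra config_algebra)"
    and "T \<in> sets config_algebra \<Longrightarrow> emeasure P {\<omega> \<in> space P. X \<omega> \<in> Q \<and> restr (\<Psi> \<omega>) B \<in> T}
      = (\<integral>\<^sup>+y. emeasure (\<kappa> y) {\<eta> \<in> configs. N B \<eta> \<in> Q} * indicator T y \<partial>distr P config_algebra (\<lambda>\<omega>. restr (\<Psi> \<omega>) B))"
proof -
  show "\<kappa> \<in> measurable config_algebra (prob_algebra config_algebra)" using \<kappa> unfolding reg_cond_distr_def by blast
  assume T: "T \<in> sets config_algebra"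
  define S where "S = {\<eta> \<in> configs. N B \<eta> \<in> Q}"
  have "S = N B -` Q \<inter> space config_algebra" unfolding S_def by auto
  then have S: "S \<in> sets config_algebra" using measurable_sets[OF N_measurable[OF B], of Q] by simp
  have "{\<omega> \<in> space P. X \<omega> \<in> Q \<and> restr (\<Psi> \<omega>) B \<in> T} = {\<omega> \<in> space P. \<Psi> \<omega> \<in> S \<and> restr (\<Psi> \<omega>) B \<in> T}"
    unfolding S_def X_def using configs by auto
  then show "emeasure P {\<omega> \<in> space P. X \<omega> \<in> Q \<and> restr (\<Psi> \<omega>) B \<in> T}
      = (\<integral>\<^sup>+y. emeasure (\<kappa> y) {\<eta> \<in> configs. N B \<eta> \<in> Q} * indicator T y \<partial>distr P config_algebra (\<lambda>\<omega>. restr (\<Psi> \<omega>) B))"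
    unfolding S_def[symmetric] using \<kappa> S T unfolding reg_cond_distr_def by auto
qed

lemma restr_Psi_meas: "S \<in> sets borel \<Longrightarrow> (\<lambda>\<omega>. restr (\<Psi> \<omega>) S) \<in> measurable P config_algebra"
  by (rule measurable_compose[OF \<Psi> restr_measurable])

text \<open>The configurations outside \<open>B\<close> and in \<open>A\<close> are independent, so
  the law of the former given the latter is constant. It may be represented by any
  \<open>\<mu>\<close> under which \<open>N B\<close> is distributed as \<open>X\<close>.\<close>

lemma indep_kernel:
  assumes \<mu>: "\<And>Q. emeasure \<mu> {\<eta> \<in> configs. N B \<eta> \<in> Q} = emeasure P {\<omega> \<in> space P. X \<omega> \<in> Q}"
    and T: "T \<in> sets config_algebra"
  shows "emeasure P {\<omega> \<in> space P. X \<omega> \<in> Q \<and> restr (\<Psi> \<omega>) A \<in> T}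
      = (\<integral>\<^sup>+y. emeasure \<mu> {\<eta> \<in> configs. N B \<eta> \<in> Q} * indicator T y \<partial>distr P config_algebra (\<lambda>\<omega>. restr (\<Psi> \<omega>) A))"
proof -
  have S: "crs -` Q \<inter> space config_algebra \<in> sets config_algebra" by (rule measurable_sets[OF crs_measurable]) simp
  let ?U = "crs -` Q \<inter> space config_algebra"
  have rc: "\<omega> \<in> space P \<Longrightarrow> restr (\<Psi> \<omega>) (- B) \<in> configs" for \<omega> using restr_in_configs[OF configs] B by auto
  have "{\<omega> \<in> space P. X \<omega> \<in> Q \<and> restr (\<Psi> \<omega>) A \<in> T}
    = (\<lambda>\<omega>. (restr (\<Psi> \<omega>) (- B), restr (\<Psi> \<omega>) A)) -` (?U \<times> T) \<inter> space P"
    unfolding X_def N_def using rc by auto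
  then have "emeasure P {\<omega> \<in> space P. X \<omega> \<in> Q \<and> restr (\<Psi> \<omega>) A \<in> T}
    = ennreal (prob ((\<lambda>\<omega>. restr (\<Psi> \<omega>) (- B)) -` ?U \<inter> space P) * prob ((\<lambda>\<omega>. restr (\<Psi> \<omega>) A) -` T \<inter> space P))"
    unfolding indep_varD[OF indep S T, symmetric] by (simp add: emeasure_eq_measure)
  also have "(\<lambda>\<omega>. restr (\<Psi> \<omega>) (- B)) -` ?U \<inter> space P = {\<omega> \<in> space P. X \<omega> \<in> Q}"
    unfolding X_def N_def using rc by auto
  also have "ennreal (prob {\<omega> \<in> space P. X \<omega> \<in> Q} * prob ((\<lambda>\<omega>. restr (\<Psi> \<omega>) A) -` T \<inter> space P))
    = emeasure \<mu> {\<eta> \<in> configs. N B \<eta> \<in> Q} * emeasure (distr P config_algebra (\<lambda>\<omega>. restr (\<Psi> \<omega>) A)) T"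
    unfolding \<mu> using T restr_Psi_meas[OF A] by (simp add: emeasure_distr emeasure_eq_measure ennreal_mult)
  also have "\<dots> = (\<integral>\<^sup>+y. emeasure \<mu> {\<eta> \<in> configs. N B \<eta> \<in> Q} * indicator T y \<partial>distr P config_algebra (\<lambda>\<omega>. restr (\<Psi> \<omega>) A))"
    using T by (simp add: nn_integral_cmult_indicator)
  finally show ?thesis .
qed

lemma R_bounds:
  "prob_space \<mu> \<Longrightarrow> sets \<mu> = sets config_algebra \<Longrightarrow> 0 \<le> R \<mu> \<and> R \<mu> \<le> 4 + (4 * u + 10) / a"
  using r_of_law_bounds[OF _ _ B a u] by blast

lemma crs_pair_sets:
  assumes "S1 \<in> sets borel" "S2 \<in> sets borel"
  shows "{y \<in> configs. (crs (restr y S1), crs (restr y S2)) = z0} \<in> sets config_algebra"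
proof -
  have "{y \<in> configs. (crs (restr y S1), crs (restr y S2)) = z0}
    = ((\<lambda>y. crs (restr y S1)) -` {fst z0} \<inter> space config_algebra) \<inter> ((\<lambda>y. crs (restr y S2)) -` {snd z0} \<inter> space config_algebra)"
    by (cases z0) auto
  also have "\<dots> \<in> sets config_algebra"
    by (intro sets.Int measurable_sets[OF measurable_compose[OF restr_measurable crs_measurable]] assms) auto
  finally show ?thesis .
qed

lemma cond_bound:
  fixes \<phi> :: "'a multiset \<times> 'a multiset \<Rightarrow> 'a multiset \<Rightarrow> real"
  assumes \<phi>: "\<And>z M. \<bar>\<phi> z M\<bar> \<le> K z"
    and bound: "\<And>\<mu> z0. prob_space \<mu> \<Longrightarrow> sets \<mu> = sets config_algebra \<Longrightarrow> z0 \<in> D \<times> D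
      \<Longrightarrow> \<bar>\<integral>\<eta>. \<phi> z0 (N B \<eta>) \<partial>\<mu>\<bar> \<le> R \<mu> * s z0"
    and s: "\<And>z. 0 \<le> s z"
    and W: "integrable P (\<lambda>\<omega>. \<phi> (PA \<omega>, QB \<omega>) (X \<omega>))"
  shows "ennreal \<bar>\<integral>\<omega>. \<phi> (PA \<omega>, QB \<omega>) (X \<omega>) \<partial>P\<bar> \<le> (\<integral>\<^sup>+\<omega>. ennreal (R (\<kappa> (restr (\<Psi> \<omega>) B)) * s (PA \<omega>, QB \<omega>)) \<partial>P)"
proof -
  define z where "z y = (crs (restr y A), crs (restr y (B - A)))" for y
  have zY: "z (restr (\<Psi> \<omega>) B) = (PA \<omega>, QB \<omega>)" if "\<omega> \<in> space P" for \<omega>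
  proof -
    have "A \<inter> B = A" "(B - A) \<inter> B = B - A" using AB by auto
    then show ?thesis unfolding z_def PA_def QB_def using restr_restr[OF configs[OF that]] A B by simp
  qed
  have W': "integrable P (\<lambda>\<omega>. \<phi> (z (restr (\<Psi> \<omega>) B)) (X \<omega>))"
    using W by (subst Bochner_Integration.integrable_cong[OF refl]) (auto simp: zY)
  have "ennreal \<bar>\<integral>\<omega>. \<phi> (z (restr (\<Psi> \<omega>) B)) (X \<omega>) \<partial>P\<bar>
    \<le> (\<integral>\<^sup>+\<omega>. ennreal (R (\<kappa> (restr (\<Psi> \<omega>) B)) * s (z (restr (\<Psi> \<omega>) B))) \<partial>P)"
  proof (rule conditional_bound[OF P X_meas XD restr_Psi_meas[OF B] cond_kernel(1) B cond_kernel(2) _ _ \<phi> bound R_bounds _ s W'])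
    show "z (restr (\<Psi> \<omega>) B) \<in> D \<times> D" for \<omega> unfolding z_def D_def using crs_set by blast
    show "{y \<in> configs. z y = z0} \<in> sets config_algebra" for z0 unfolding z_def by (rule crs_pair_sets) (use A B in auto)
    show "(\<lambda>y. R (\<kappa> y)) \<in> borel_measurable config_algebra" by (rule r_of_law_measurable[OF cond_kernel(1) B])
  qed
  also have "(\<integral>\<omega>. \<phi> (z (restr (\<Psi> \<omega>) B)) (X \<omega>) \<partial>P) = (\<integral>\<omega>. \<phi> (PA \<omega>, QB \<omega>) (X \<omega>) \<partial>P)"
    by (rule Bochner_Integration.integral_cong) (auto simp: zY)
  also have "(\<integral>\<^sup>+\<omega>. ennreal (R (\<kappa> (restr (\<Psi> \<omega>) B)) * s (z (restr (\<Psi> \<omega>) B))) \<partial>P)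
    = (\<integral>\<^sup>+\<omega>. ennreal (R (\<kappa> (restr (\<Psi> \<omega>) B)) * s (PA \<omega>, QB \<omega>)) \<partial>P)"
    by (rule nn_integral_cong) (simp add: zY)
  finally show ?thesis .
qed

text \<open>The freedom in \<open>\<mu>\<close> matters for the Palm process: taking the law of
  \<open>\<Xi>\<close> as \<open>\<mu>\<close> produces the term
  \<open>rbar y * measure (Palm y \<omega>) (A y)\<close> of the theorem.\<close>

lemma indep_bound:
  fixes \<phi> :: "'a multiset \<Rightarrow> 'a multiset \<Rightarrow> real"
  assumes \<mu>: "prob_space \<mu>" "sets \<mu> = sets config_algebra"
    and \<mu>X: "\<And>Q. emeasure \<mu> {\<eta> \<in> configs. N B \<eta> \<in> Q} = emeasure P {\<omega> \<in> space P. X \<omega> \<in> Q}"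
    and \<phi>: "\<And>z M. \<bar>\<phi> z M\<bar> \<le> K z"
    and bound: "\<And>\<mu> p. prob_space \<mu> \<Longrightarrow> sets \<mu> = sets config_algebra \<Longrightarrow> p \<in> D
      \<Longrightarrow> \<bar>\<integral>\<eta>. \<phi> p (N B \<eta>) \<partial>\<mu>\<bar> \<le> R \<mu> * s p"
    and s: "\<And>z. 0 \<le> s z"
    and W: "integrable P (\<lambda>\<omega>. \<phi> (PA \<omega>) (X \<omega>))"
  shows "ennreal \<bar>\<integral>\<omega>. \<phi> (PA \<omega>) (X \<omega>) \<partial>P\<bar> \<le> (\<integral>\<^sup>+\<omega>. ennreal (R \<mu> * s (PA \<omega>)) \<partial>P)"
proof -
  define z where "z y = (crs y, {#} :: 'a multiset)" for y
  have k: "(\<lambda>_. \<mu>) \<in> measurable config_algebra (prob_algebra config_algebra)"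
    by (rule measurable_const) (use \<mu> in \<open>simp add: space_prob_algebra\<close>)
  have "ennreal \<bar>\<integral>\<omega>. \<phi> (fst (z (restr (\<Psi> \<omega>) A))) (X \<omega>) \<partial>P\<bar>
    \<le> (\<integral>\<^sup>+\<omega>. ennreal (R ((\<lambda>_. \<mu>) (restr (\<Psi> \<omega>) A)) * s (fst (z (restr (\<Psi> \<omega>) A)))) \<partial>P)"
  proof (rule conditional_bound[OF P X_meas XD restr_Psi_meas[OF A] k B indep_kernel[OF \<mu>X], of z "\<lambda>z. \<phi> (fst z)" "\<lambda>z. K (fst z)"])
    show "z (restr (\<Psi> \<omega>) A) \<in> D \<times> D" for \<omega> unfolding z_def D_def using crs_set by auto
    show "{y \<in> configs. z y = z0} \<in> sets config_algebra" for z0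
    proof -
      have "{y \<in> configs. z y = z0} = (if snd z0 = {#} then crs -` {fst z0} \<inter> space config_algebra else {})"
        unfolding z_def by (cases z0) auto
      then show ?thesis using measurable_sets[OF crs_measurable, of "{fst z0}"] by simp
    qed
    show "integrable P (\<lambda>\<omega>. \<phi> (fst (z (restr (\<Psi> \<omega>) A))) (X \<omega>))" using W unfolding z_def PA_def by simp
    show "\<bar>\<integral>\<eta>. \<phi> (fst z0) (N B \<eta>) \<partial>\<mu>\<bar> \<le> R \<mu> * s (fst z0)"
      if "prob_space \<mu>" "sets \<mu> = sets config_algebra" "z0 \<in> D \<times> D" for \<mu> z0
      by (rule bound[OF that(1,2)]) (use that(3) in auto)
  qed (use \<phi> R_bounds s in auto)
  then show ?thesis unfolding z_def PA_def by simp
qed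

section \<open>Smoothness estimates under one law, in terms of \<open>R\<close>\<close>

context
  fixes \<mu> :: "'a measure measure"
  assumes \<mu>: "prob_space \<mu>" "sets \<mu> = sets config_algebra"
begin

lemma D_subset: "p \<in> D \<Longrightarrow> set_mset p \<subseteq> t ` {1..k}" unfolding D_def by simp

lemma law_cross:
  assumes "p \<in> D" "q \<in> D"
  shows "\<bar>\<integral>\<eta>. (dh z (N B \<eta> + (p + q)) - dh z (N B \<eta> + q)) - (dh z (N B \<eta> + p) - dh z (N B \<eta>)) \<partial>\<mu>\<bar>
    \<le> R \<mu> * (real (size p) * real (size q))"
  using smoothed.dh_cross[OF smoothed_r_of_law(1)[OF \<mu> B res u] D_subset[OF assms(2)], of z p]
  unfolding smoothed_r_of_law(2)[OF \<mu> B res u] by (simp add: mult.assoc)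

lemma law_linear:
  assumes "p \<in> D" "l \<in> {1..k}" "v \<in> {1..k}" "v' \<in> {1..k}"
  shows "\<bar>\<integral>\<eta>. dh (t l) (N B \<eta> + p) - dh (t l) (N B \<eta>) - real (size p) * dd (t v) (t v') (N B \<eta>) \<partial>\<mu>\<bar>
    \<le> R \<mu> * (real (size p) * (real (size p) + 1) / 2)"
  using smoothed.dh_linear[OF smoothed_r_of_law(1)[OF \<mu> B res u] D_subset[OF assms(1)] assms(2-4)]
  unfolding smoothed_r_of_law(2)[OF \<mu> B res u] .

lemma law_shift:
  assumes "q \<in> D"
  shows "\<bar>\<integral>\<eta>. dd x z (N B \<eta> + (S + q)) - dd x z (N B \<eta> + S) \<partial>\<mu>\<bar> \<le> R \<mu> * real (size q)"
  using smoothed.dd_shift[OF smoothed_r_of_law(1)[OF \<mu> B res u] D_subset[OF assms], of x z S]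
  unfolding smoothed_r_of_law(2)[OF \<mu> B res u] .

lemma law_move:
  assumes "i \<in> {1..k}" "i' \<in> {1..k}" "j \<in> {1..k}" "j' \<in> {1..k}"
  shows "\<bar>\<integral>\<eta>. dd (t i) (t j) (N B \<eta>) - dd (t i') (t j') (N B \<eta>) \<partial>\<mu>\<bar> \<le> R \<mu>"
  using smoothed.dd_move[OF smoothed_r_of_law(1)[OF \<mu> B res u] assms, of "{#}"]
  unfolding smoothed_r_of_law(2)[OF \<mu> B res u] by simp

end

lemma law_prob: "prob_space (distr P config_algebra \<Psi>)" "sets (distr P config_algebra \<Psi>) = sets config_algebra"
  by (auto intro: prob_space_distr \<Psi>)

lemma law_X: "emeasure (distr P config_algebra \<Psi>) {\<eta> \<in> configs. N B \<eta> \<in> Q} = emeasure P {\<omega> \<in> space P. X \<omega> \<in> Q}"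
proof -
  have "{\<eta> \<in> configs. N B \<eta> \<in> Q} = N B -` Q \<inter> space config_algebra" by auto
  then have "{\<eta> \<in> configs. N B \<eta> \<in> Q} \<in> sets config_algebra" using measurable_sets[OF N_measurable[OF B], of Q] by simp
  then show ?thesis unfolding X_def using configs by (subst emeasure_distr[OF \<Psi>]) (auto intro!: arg_cong[where f = "emeasure P"])
qed

lemma expectation_X: "(\<integral>\<eta>. g (N B \<eta>) \<partial>distr P config_algebra \<Psi>) = (\<integral>\<omega>. g (X \<omega>) \<partial>P)" for g :: "'a multiset \<Rightarrow> real"
  unfolding X_def by (rule integral_distr[OF \<Psi>]) (rule measurable_compose[OF N_measurable[OF B]], simp)

lemma product_expectation:
  fixes g :: "'a multiset \<Rightarrow> real"
  assumes g: "\<And>M. \<bar>g M\<bar> \<le> K"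
  shows "(\<integral>\<omega>. real (size (PA \<omega>)) * g (X \<omega>) \<partial>P) = (\<integral>\<omega>. real (size (PA \<omega>)) \<partial>P) * (\<integral>\<omega>. g (X \<omega>) \<partial>P)"
    and "integrable P (\<lambda>\<omega>. real (size (PA \<omega>)) * g (X \<omega>))"
proof -
  have "indep_var borel ((\<lambda>\<eta>. g (crs \<eta>)) \<circ> (\<lambda>\<omega>. restr (\<Psi> \<omega>) (- B))) borel ((\<lambda>\<eta>. real (size (crs \<eta>))) \<circ> (\<lambda>\<omega>. restr (\<Psi> \<omega>) A))"
    by (rule indep_var_compose[OF indep]) (rule measurable_compose[OF crs_measurable], simp)+
  then have i: "indep_var borel (\<lambda>\<omega>. g (X \<omega>)) borel (\<lambda>\<omega>. real (size (PA \<omega>)))"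
    unfolding comp_def X_def N_def PA_def .
  show "integrable P (\<lambda>\<omega>. real (size (PA \<omega>)) * g (X \<omega>))"
    using indep_var_integrable[OF i sum_int(4)[OF g] PA_int] by (simp add: mult.commute)
  show "(\<integral>\<omega>. real (size (PA \<omega>)) * g (X \<omega>) \<partial>P) = (\<integral>\<omega>. real (size (PA \<omega>)) \<partial>P) * (\<integral>\<omega>. g (X \<omega>) \<partial>P)"
    using indep_var_lebesgue_integral[OF i sum_int(4)[OF g] PA_int] by (simp add: mult.commute)
qed

lemma r_meas: "(\<lambda>\<omega>. R (\<kappa> (restr (\<Psi> \<omega>) B))) \<in> borel_measurable P"
  by (rule measurable_compose[OF restr_Psi_meas[OF B] r_of_law_measurable[OF cond_kernel(1) B]])

lemma r_nonneg: "\<omega> \<in> space P \<Longrightarrow> 0 \<le> R (\<kappa> (restr (\<Psi> \<omega>) B)) \<and> R (\<kappa> (restr (\<Psi> \<omega>) B)) \<le> 4 + (4 * u + 10) / a"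
  using measurable_space[OF cond_kernel(1) measurable_space[OF restr_Psi_meas[OF B]], of \<omega>]
  unfolding space_prob_algebra by (intro R_bounds) auto

lemma rbar_nonneg: "0 \<le> R (distr P config_algebra \<Psi>)"
  using R_bounds[OF law_prob] by blast

text \<open>\<open>?W1\<close> is the interaction of \<open>PA\<close> with \<open>QB\<close>,
  estimated conditionally on the configuration in \<open>B\<close>. \<open>?W2\<close> is the error
  of linearizing in \<open>PA\<close> once \<open>QB\<close> is gone, estimated by independence. The
  linear term factors, again by independence. The two bounds are the first two summands of
  \<open>eps1\<close>.\<close>

lemma first_difference_estimate:
  assumes l: "l \<in> {1..k}" and v: "v \<in> {1..k}"
  shows "ennreal \<bar>(\<integral>\<omega>. dh (t l) (crs (\<Psi> \<omega>)) \<partial>P) - (\<integral>\<omega>. dh (t l) (crs (restr (\<Psi> \<omega>) (- A))) \<partial>P)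
      - (\<integral>\<omega>. measure (\<Psi> \<omega>) A \<partial>P) * (\<integral>\<omega>. dd (t v) (t v) (X \<omega>) \<partial>P)\<bar>
    \<le> (\<integral>\<^sup>+\<omega>. ennreal (R (\<kappa> (restr (\<Psi> \<omega>) B)) * measure (\<Psi> \<omega>) A * measure (\<Psi> \<omega>) (B - A)
        + 1 / 2 * R (distr P config_algebra \<Psi>) * (measure (\<Psi> \<omega>) A + 1) * measure (\<Psi> \<omega>) A) \<partial>P)"
proof -
  let ?W1 = "\<lambda>\<omega>. (dh (t l) (X \<omega> + (PA \<omega> + QB \<omega>)) - dh (t l) (X \<omega> + QB \<omega>)) - (dh (t l) (X \<omega> + PA \<omega>) - dh (t l) (X \<omega>))"
  let ?W2 = "\<lambda>\<omega>. dh (t l) (X \<omega> + PA \<omega>) - dh (t l) (X \<omega>) - real (size (PA \<omega>)) * dd (t v) (t v) (X \<omega>)"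
  let ?W3 = "\<lambda>\<omega>. real (size (PA \<omega>)) * dd (t v) (t v) (X \<omega>)"
  define c1 where "c1 = 1 / (1 - b)"
  have dhb: "\<bar>dh (t l) M\<bar> \<le> c1" for M unfolding c1_def by (rule dh_bound)
  note i = sum_int[of "dh (t l)", OF dhb]
  have i1: "integrable P ?W1" using i by simp
  have i3: "integrable P ?W3" by (rule product_expectation(2)[of "dd (t v) (t v)", OF dd_bound])
  have i2: "integrable P ?W2" using i i3 by simp
  have "(\<integral>\<omega>. dh (t l) (crs (\<Psi> \<omega>)) \<partial>P) = (\<integral>\<omega>. dh (t l) (X \<omega> + (PA \<omega> + QB \<omega>)) \<partial>P)"
    by (rule Bochner_Integration.integral_cong) (auto simp: decompose)
  moreover have "(\<integral>\<omega>. dh (t l) (crs (restr (\<Psi> \<omega>) (- A))) \<partial>P) = (\<integral>\<omega>. dh (t l) (X \<omega> + QB \<omega>) \<partial>P)"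
    by (rule Bochner_Integration.integral_cong) (auto simp: decompose)
  moreover have "(\<integral>\<omega>. measure (\<Psi> \<omega>) A \<partial>P) = (\<integral>\<omega>. real (size (PA \<omega>)) \<partial>P)"
    by (rule Bochner_Integration.integral_cong) (auto simp: sizes)
  ultimately have split: "(\<integral>\<omega>. dh (t l) (crs (\<Psi> \<omega>)) \<partial>P) - (\<integral>\<omega>. dh (t l) (crs (restr (\<Psi> \<omega>) (- A))) \<partial>P)
      - (\<integral>\<omega>. measure (\<Psi> \<omega>) A \<partial>P) * (\<integral>\<omega>. dd (t v) (t v) (X \<omega>) \<partial>P) = (\<integral>\<omega>. ?W1 \<omega> \<partial>P) + (\<integral>\<omega>. ?W2 \<omega> \<partial>P)"
    using i i3 product_expectation(1)[of "dd (t v) (t v)", OF dd_bound] by simp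
  have 1: "ennreal \<bar>\<integral>\<omega>. ?W1 \<omega> \<partial>P\<bar> \<le> (\<integral>\<^sup>+\<omega>. ennreal (R (\<kappa> (restr (\<Psi> \<omega>) B)) * (real (size (PA \<omega>)) * real (size (QB \<omega>)))) \<partial>P)"
  proof -
    have "ennreal \<bar>\<integral>\<omega>. (\<lambda>z M. (dh (t l) (M + (fst z + snd z)) - dh (t l) (M + snd z)) - (dh (t l) (M + fst z) - dh (t l) M)) (PA \<omega>, QB \<omega>) (X \<omega>) \<partial>P\<bar>
      \<le> (\<integral>\<^sup>+\<omega>. ennreal (R (\<kappa> (restr (\<Psi> \<omega>) B)) * (\<lambda>z. real (size (fst z)) * real (size (snd z))) (PA \<omega>, QB \<omega>)) \<partial>P)"
    proof (rule cond_bound)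
      show "\<bar>(dh (t l) (M + (fst z + snd z)) - dh (t l) (M + snd z)) - (dh (t l) (M + fst z) - dh (t l) M)\<bar> \<le> 4 * c1" for z M
        using dhb[of "M + (fst z + snd z)"] dhb[of "M + snd z"] dhb[of "M + fst z"] dhb[of M] by linarith
      show "\<bar>\<integral>\<eta>. (dh (t l) (N B \<eta> + (fst z0 + snd z0)) - dh (t l) (N B \<eta> + snd z0)) - (dh (t l) (N B \<eta> + fst z0) - dh (t l) (N B \<eta>)) \<partial>\<mu>\<bar>
        \<le> R \<mu> * (real (size (fst z0)) * real (size (snd z0)))"
        if "prob_space \<mu>" "sets \<mu> = sets config_algebra" "z0 \<in> D \<times> D" for \<mu> z0
        by (rule law_cross[OF that(1,2)]) (use that(3) in auto)
      show "integrable P (\<lambda>\<omega>. (dh (t l) (X \<omega> + (fst (PA \<omega>, QB \<omega>) + snd (PA \<omega>, QB \<omega>))) - dh (t l) (X \<omega> + snd (PA \<omega>, QB \<omega>)))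
        - (dh (t l) (X \<omega> + fst (PA \<omega>, QB \<omega>)) - dh (t l) (X \<omega>)))" using i1 by simp
    qed simp
    then show ?thesis by simp
  qed
  have 2: "ennreal \<bar>\<integral>\<omega>. ?W2 \<omega> \<partial>P\<bar> \<le> (\<integral>\<^sup>+\<omega>. ennreal (R (distr P config_algebra \<Psi>) * (real (size (PA \<omega>)) * (real (size (PA \<omega>)) + 1) / 2)) \<partial>P)"
  proof (rule indep_bound[OF law_prob law_X, of "\<lambda>p M. dh (t l) (M + p) - dh (t l) M - real (size p) * dd (t v) (t v) M" "\<lambda>p. 2 * c1 + real (size p) * 2"])
    show "\<bar>dh (t l) (M + p) - dh (t l) M - real (size p) * dd (t v) (t v) M\<bar> \<le> 2 * c1 + real (size p) * 2" for p M
    proof -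
      have "\<bar>real (size p) * dd (t v) (t v) M\<bar> \<le> real (size p) * 2"
        unfolding abs_mult using dd_bound[of "t v" "t v" M] by (intro mult_mono) auto
      then show ?thesis using dhb[of "M + p"] dhb[of M] by linarith
    qed
  qed (use law_linear l v i2 in auto)
  have "ennreal \<bar>(\<integral>\<omega>. ?W1 \<omega> \<partial>P) + (\<integral>\<omega>. ?W2 \<omega> \<partial>P)\<bar> \<le> ennreal (\<bar>\<integral>\<omega>. ?W1 \<omega> \<partial>P\<bar> + \<bar>\<integral>\<omega>. ?W2 \<omega> \<partial>P\<bar>)"
    by (intro ennreal_leI abs_triangle_ineq)
  also have "\<dots> = ennreal \<bar>\<integral>\<omega>. ?W1 \<omega> \<partial>P\<bar> + ennreal \<bar>\<integral>\<omega>. ?W2 \<omega> \<partial>P\<bar>" by (rule ennreal_plus) auto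
  also have "\<dots> \<le> (\<integral>\<^sup>+\<omega>. ennreal (R (\<kappa> (restr (\<Psi> \<omega>) B)) * (real (size (PA \<omega>)) * real (size (QB \<omega>)))) \<partial>P)
      + (\<integral>\<^sup>+\<omega>. ennreal (R (distr P config_algebra \<Psi>) * (real (size (PA \<omega>)) * (real (size (PA \<omega>)) + 1) / 2)) \<partial>P)"
    by (intro add_mono 1 2)
  also have "\<dots> = (\<integral>\<^sup>+\<omega>. ennreal (R (\<kappa> (restr (\<Psi> \<omega>) B)) * (real (size (PA \<omega>)) * real (size (QB \<omega>))))
      + ennreal (R (distr P config_algebra \<Psi>) * (real (size (PA \<omega>)) * (real (size (PA \<omega>)) + 1) / 2)) \<partial>P)"
    by (rule nn_integral_add[symmetric])
      (intro measurable_compose[OF _ measurable_ennreal] borel_measurable_times r_meas sum_meas(5)[of "\<lambda>M. real (size M)"] sum_meas(6)[of "\<lambda>M. real (size M)"]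
        sum_meas(5)[of "\<lambda>M. R (distr P config_algebra \<Psi>) * (real (size M) * (real (size M) + 1) / 2)"])+
  also have "\<dots> = (\<integral>\<^sup>+\<omega>. ennreal (R (\<kappa> (restr (\<Psi> \<omega>) B)) * measure (\<Psi> \<omega>) A * measure (\<Psi> \<omega>) (B - A)
        + 1 / 2 * R (distr P config_algebra \<Psi>) * (measure (\<Psi> \<omega>) A + 1) * measure (\<Psi> \<omega>) A) \<partial>P)"
  proof (rule nn_integral_cong)
    fix \<omega> assume \<omega>: "\<omega> \<in> space P"
    show "ennreal (R (\<kappa> (restr (\<Psi> \<omega>) B)) * (real (size (PA \<omega>)) * real (size (QB \<omega>))))
      + ennreal (R (distr P config_algebra \<Psi>) * (real (size (PA \<omega>)) * (real (size (PA \<omega>)) + 1) / 2))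
      = ennreal (R (\<kappa> (restr (\<Psi> \<omega>) B)) * measure (\<Psi> \<omega>) A * measure (\<Psi> \<omega>) (B - A)
        + 1 / 2 * R (distr P config_algebra \<Psi>) * (measure (\<Psi> \<omega>) A + 1) * measure (\<Psi> \<omega>) A)"
      unfolding sizes[OF \<omega>] using r_nonneg[OF \<omega>] rbar_nonneg
      by (subst ennreal_plus[symmetric]) (auto intro!: arg_cong[where f = ennreal] simp: mult_ac)
  qed
  finally show ?thesis unfolding split .
qed

text \<open>For \<open>\<Xi>\<close> the bound is \<open>m\<close>. It is the price for replacing a
  second difference outside the neighbourhood of \<open>y\<close>, which depends on
  \<open>y\<close>, by one of the whole configuration.\<close>

lemma removal_estimate:
  "ennreal \<bar>(\<integral>\<omega>. dd x z (crs (\<Psi> \<omega>)) \<partial>P) - (\<integral>\<omega>. dd x z (X \<omega>) \<partial>P)\<bar>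
    \<le> (\<integral>\<^sup>+\<omega>. ennreal (R (\<kappa> (restr (\<Psi> \<omega>) B)) * measure (\<Psi> \<omega>) B) \<partial>P)"
proof -
  note i = sum_int[of "dd x z", OF dd_bound]
  let ?W = "\<lambda>\<omega>. dd x z (X \<omega> + (PA \<omega> + QB \<omega>)) - dd x z (X \<omega>)"
  have "(\<integral>\<omega>. dd x z (crs (\<Psi> \<omega>)) \<partial>P) = (\<integral>\<omega>. dd x z (X \<omega> + (PA \<omega> + QB \<omega>)) \<partial>P)"
    by (rule Bochner_Integration.integral_cong) (auto simp: decompose)
  then have split: "(\<integral>\<omega>. dd x z (crs (\<Psi> \<omega>)) \<partial>P) - (\<integral>\<omega>. dd x z (X \<omega>) \<partial>P) = (\<integral>\<omega>. ?W \<omega> \<partial>P)" using i by simp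
  have "ennreal \<bar>\<integral>\<omega>. (\<lambda>pq M. dd x z (M + (fst pq + snd pq)) - dd x z M) (PA \<omega>, QB \<omega>) (X \<omega>) \<partial>P\<bar>
    \<le> (\<integral>\<^sup>+\<omega>. ennreal (R (\<kappa> (restr (\<Psi> \<omega>) B)) * (\<lambda>pq. real (size (fst pq + snd pq))) (PA \<omega>, QB \<omega>)) \<partial>P)"
  proof (rule cond_bound)
    show "\<bar>dd x z (M + (fst pq + snd pq)) - dd x z M\<bar> \<le> 4" for pq M
      using dd_bound[of x z "M + (fst pq + snd pq)"] dd_bound[of x z M] by linarith
    show "\<bar>\<integral>\<eta>. dd x z (N B \<eta> + (fst z0 + snd z0)) - dd x z (N B \<eta>) \<partial>\<mu>\<bar> \<le> R \<mu> * real (size (fst z0 + snd z0))"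
      if "prob_space \<mu>" "sets \<mu> = sets config_algebra" "z0 \<in> D \<times> D" for \<mu> z0
    proof -
      have "fst z0 + snd z0 \<in> D" using that(3) unfolding D_def by auto
      from law_shift[OF that(1,2) this, of x z "{#}"] show ?thesis by simp
    qed
    show "integrable P (\<lambda>\<omega>. dd x z (X \<omega> + (fst (PA \<omega>, QB \<omega>) + snd (PA \<omega>, QB \<omega>))) - dd x z (X \<omega>))" using i by simp
  qed simp
  also have "\<dots> = (\<integral>\<^sup>+\<omega>. ennreal (R (\<kappa> (restr (\<Psi> \<omega>) B)) * measure (\<Psi> \<omega>) B) \<partial>P)"
    by (rule nn_integral_cong) (simp only: fst_conv snd_conv sizes)
  finally show ?thesis unfolding split by simp
qed

text \<open>The three summands correspond to removing \<open>QB\<close> conditionally, removing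
  \<open>PA\<close> by independence with \<open>\<mu>\<close> as kernel, and moving both locations
  to \<open>t v\<close> under the law of \<open>\<Psi>\<close>.\<close>

lemma second_difference_estimate:
  assumes \<mu>: "prob_space \<mu>" "sets \<mu> = sets config_algebra"
    and \<mu>X: "\<And>Q. emeasure \<mu> {\<eta> \<in> configs. N B \<eta> \<in> Q} = emeasure P {\<omega> \<in> space P. X \<omega> \<in> Q}"
    and i: "i \<in> {1..k}" "j \<in> {1..k}" and v: "v \<in> {1..k}"
  shows "ennreal \<bar>(\<integral>\<omega>. dd (t i) (t j) (crs (\<Psi> \<omega>)) \<partial>P) - (\<integral>\<omega>. dd (t v) (t v) (X \<omega>) \<partial>P)\<bar>
    \<le> (\<integral>\<^sup>+\<omega>. ennreal (R (\<kappa> (restr (\<Psi> \<omega>) B)) * measure (\<Psi> \<omega>) (B - A)) \<partial>P)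
      + (\<integral>\<^sup>+\<omega>. ennreal (R \<mu> * measure (\<Psi> \<omega>) A) \<partial>P) + ennreal (R (distr P config_algebra \<Psi>))"
proof -
  let ?d = "dd (t i) (t j)"
  note ints = sum_int[of ?d, OF dd_bound] sum_int[of "dd (t v) (t v)", OF dd_bound]
  let ?W1 = "\<lambda>\<omega>. ?d (X \<omega> + (PA \<omega> + QB \<omega>)) - ?d (X \<omega> + PA \<omega>)"
  let ?W2 = "\<lambda>\<omega>. ?d (X \<omega> + PA \<omega>) - ?d (X \<omega>)"
  let ?W3 = "\<lambda>\<omega>. ?d (X \<omega>) - dd (t v) (t v) (X \<omega>)"
  have "(\<integral>\<omega>. ?d (crs (\<Psi> \<omega>)) \<partial>P) = (\<integral>\<omega>. ?d (X \<omega> + (PA \<omega> + QB \<omega>)) \<partial>P)"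
    by (rule Bochner_Integration.integral_cong) (auto simp: decompose)
  then have split: "(\<integral>\<omega>. ?d (crs (\<Psi> \<omega>)) \<partial>P) - (\<integral>\<omega>. dd (t v) (t v) (X \<omega>) \<partial>P) = (\<integral>\<omega>. ?W1 \<omega> \<partial>P) + (\<integral>\<omega>. ?W2 \<omega> \<partial>P) + (\<integral>\<omega>. ?W3 \<omega> \<partial>P)"
    using ints by simp
  have 1: "ennreal \<bar>\<integral>\<omega>. ?W1 \<omega> \<partial>P\<bar> \<le> (\<integral>\<^sup>+\<omega>. ennreal (R (\<kappa> (restr (\<Psi> \<omega>) B)) * measure (\<Psi> \<omega>) (B - A)) \<partial>P)"
  proof -
    have "ennreal \<bar>\<integral>\<omega>. (\<lambda>pq M. ?d (M + (fst pq + snd pq)) - ?d (M + fst pq)) (PA \<omega>, QB \<omega>) (X \<omega>) \<partial>P\<bar>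
      \<le> (\<integral>\<^sup>+\<omega>. ennreal (R (\<kappa> (restr (\<Psi> \<omega>) B)) * (\<lambda>pq. real (size (snd pq))) (PA \<omega>, QB \<omega>)) \<partial>P)"
    proof (rule cond_bound)
      show "\<bar>?d (M + (fst pq + snd pq)) - ?d (M + fst pq)\<bar> \<le> 4" for pq M
        using dd_bound[of "t i" "t j" "M + (fst pq + snd pq)"] dd_bound[of "t i" "t j" "M + fst pq"] by linarith
      show "\<bar>\<integral>\<eta>. ?d (N B \<eta> + (fst z0 + snd z0)) - ?d (N B \<eta> + fst z0) \<partial>\<mu>\<bar> \<le> R \<mu> * real (size (snd z0))"
        if "prob_space \<mu>" "sets \<mu> = sets config_algebra" "z0 \<in> D \<times> D" for \<mu> z0
        by (rule law_shift[OF that(1,2)]) (use that(3) in auto)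
      show "integrable P (\<lambda>\<omega>. ?d (X \<omega> + (fst (PA \<omega>, QB \<omega>) + snd (PA \<omega>, QB \<omega>))) - ?d (X \<omega> + fst (PA \<omega>, QB \<omega>)))" using ints by simp
    qed simp
    also have "\<dots> = (\<integral>\<^sup>+\<omega>. ennreal (R (\<kappa> (restr (\<Psi> \<omega>) B)) * measure (\<Psi> \<omega>) (B - A)) \<partial>P)"
      by (rule nn_integral_cong) (simp only: snd_conv sizes)
    finally show ?thesis by simp
  qed
  have 2: "ennreal \<bar>\<integral>\<omega>. ?W2 \<omega> \<partial>P\<bar> \<le> (\<integral>\<^sup>+\<omega>. ennreal (R \<mu> * measure (\<Psi> \<omega>) A) \<partial>P)"
  proof -
    have "ennreal \<bar>\<integral>\<omega>. ?W2 \<omega> \<partial>P\<bar> \<le> (\<integral>\<^sup>+\<omega>. ennreal (R \<mu> * real (size (PA \<omega>))) \<partial>P)"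
    proof (rule indep_bound[OF \<mu> \<mu>X, of "\<lambda>p M. ?d (M + p) - ?d M" "\<lambda>_. 4"])
      show "\<bar>?d (M + p) - ?d M\<bar> \<le> 4" for p M
        using dd_bound[of "t i" "t j" "M + p"] dd_bound[of "t i" "t j" M] by linarith
      show "\<bar>\<integral>\<eta>. ?d (N B \<eta> + p) - ?d (N B \<eta>) \<partial>\<mu>\<bar> \<le> R \<mu> * real (size p)"
        if "prob_space \<mu>" "sets \<mu> = sets config_algebra" "p \<in> D" for \<mu> p
        using law_shift[OF that, of "t i" "t j" "{#}"] by simp
      show "integrable P ?W2" using ints by simp
    qed auto
    also have "\<dots> = (\<integral>\<^sup>+\<omega>. ennreal (R \<mu> * measure (\<Psi> \<omega>) A) \<partial>P)" by (rule nn_integral_cong) (simp only: sizes)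
    finally show ?thesis .
  qed
  have "\<bar>\<integral>\<omega>. ?W3 \<omega> \<partial>P\<bar> \<le> R (distr P config_algebra \<Psi>)"
    using law_move[OF law_prob i(1) v i(2) v] unfolding expectation_X[of "\<lambda>M. ?d M - dd (t v) (t v) M"] .
  then have 3: "ennreal \<bar>\<integral>\<omega>. ?W3 \<omega> \<partial>P\<bar> \<le> ennreal (R (distr P config_algebra \<Psi>))" by (rule ennreal_leI)
  have "ennreal \<bar>(\<integral>\<omega>. ?W1 \<omega> \<partial>P) + (\<integral>\<omega>. ?W2 \<omega> \<partial>P) + (\<integral>\<omega>. ?W3 \<omega> \<partial>P)\<bar>
    \<le> ennreal (\<bar>\<integral>\<omega>. ?W1 \<omega> \<partial>P\<bar> + \<bar>\<integral>\<omega>. ?W2 \<omega> \<partial>P\<bar> + \<bar>\<integral>\<omega>. ?W3 \<omega> \<partial>P\<bar>)"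
    by (intro ennreal_leI abs_add_le order_refl)
  also have "\<dots> = ennreal \<bar>\<integral>\<omega>. ?W1 \<omega> \<partial>P\<bar> + ennreal \<bar>\<integral>\<omega>. ?W2 \<omega> \<partial>P\<bar> + ennreal \<bar>\<integral>\<omega>. ?W3 \<omega> \<partial>P\<bar>"
    by (simp add: ennreal_plus)
  also have "\<dots> \<le> (\<integral>\<^sup>+\<omega>. ennreal (R (\<kappa> (restr (\<Psi> \<omega>) B)) * measure (\<Psi> \<omega>) (B - A)) \<partial>P)
      + (\<integral>\<^sup>+\<omega>. ennreal (R \<mu> * measure (\<Psi> \<omega>) A) \<partial>P) + ennreal (R (distr P config_algebra \<Psi>))"
    by (intro add_mono 1 2 3)
  finally show ?thesis unfolding split .
qed

end

section \<open>The Stein identity for the Palm process\<close>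

lemma (in stein) weighted_mean_bound:
  assumes "\<And>i. i \<in> I \<Longrightarrow> ennreal \<bar>x i - K\<bar> \<le> C"
  shows "ennreal \<bar>(\<Sum>i\<in>I. w i * x i) - K\<bar> \<le> C"
proof (cases C rule: ennreal_cases)
  case (real c)
  have 1: "\<bar>x i - K\<bar> \<le> c" if "i \<in> I" for i
    using assms[OF that] real by simp
  have "(\<Sum>i\<in>I. w i * x i) - K = (\<Sum>i\<in>I. w i * (x i - K))"
    using w1 by (simp add: right_diff_distrib sum_subtractf flip: sum_distrib_right)
  also have "\<bar>\<dots>\<bar> \<le> (\<Sum>i\<in>I. w i * c)"
    by (rule order_trans[OF sum_abs sum_mono]) (use 1 w in \<open>auto simp: abs_mult intro: mult_left_mono\<close>)
  also have "\<dots> = c" using w1 by (simp flip: sum_distrib_right)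
  finally show ?thesis using real by (simp add: ennreal_leI)
qed simp

lemma ennreal_abs_add: "ennreal \<bar>x\<bar> \<le> p \<Longrightarrow> ennreal \<bar>y\<bar> \<le> q \<Longrightarrow> ennreal \<bar>x + y\<bar> \<le> p + q"
  by (rule order_trans[OF ennreal_leI[OF abs_triangle_ineq]]) (simp add: ennreal_plus add_mono)

lemma ennreal_abs_scale: "0 \<le> r \<Longrightarrow> ennreal \<bar>x\<bar> \<le> p \<Longrightarrow> ennreal \<bar>r * x\<bar> \<le> ennreal r * p"
  by (simp add: abs_mult ennreal_mult mult_left_mono)

locale palm_stein = palm k G t P \<Xi> \<Psi> lam + resolvent a b "{1..k}" t w f \<rho> h
  for k :: nat and G :: "nat \<Rightarrow> 'a::metric_space set" and t :: "nat \<Rightarrow> 'a"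
    and P :: "'w measure" and \<Xi> :: "'w \<Rightarrow> 'a measure" and \<Psi> :: "'a \<Rightarrow> 'w \<Rightarrow> 'a measure" and lam
    and a b :: real and w :: "nat \<Rightarrow> real" and f \<rho> h +
  assumes w_eq: "\<And>j. measure lam UNIV * w j = measure lam (G j)"
    and a_eq: "a = (1 - b) * measure lam UNIV"
begin

abbreviation L :: real where "L \<equiv> measure lam UNIV"

definition gh :: "'a multiset \<Rightarrow> real" where "gh M = av (\<lambda>x. dh x M)"

lemma gh_bound: "\<bar>gh M\<bar> \<le> 1 / (1 - b)" unfolding gh_def by (rule av_abs) (rule dh_bound)

lemma gen_eq: "gen h M = (a + b * real (size M)) * gh M - (\<Sum>z\<in>#M. dh z (M - {#z#}))"
proof -
  have "(\<Sum>z\<in>#M. h (M - {#z#}) - h M) = - (\<Sum>z\<in>#M. dh z (M - {#z#}))"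
  proof -
    have "(\<Sum>z\<in>#M. dh z (M - {#z#})) = (\<Sum>z\<in>#M. h M - h (M - {#z#}))"
      by (rule sum_mset_cong') (simp add: dh_def)
    then show ?thesis unfolding sum_mset_diff_real by simp
  qed
  moreover have "gh M = av (\<lambda>x. h (add_mset x M)) - h M" unfolding gh_def dh_def av_diff by simp
  ultimately show ?thesis unfolding gen_def by simp
qed

lemma Xi_int:
  fixes g :: "'a multiset \<Rightarrow> real"
  assumes "\<And>M. \<bar>g M\<bar> \<le> K"
  shows "integrable P (\<lambda>\<omega>. g (crs (\<Xi> \<omega>)))"
  by (rule integrable_const_bound[of _ K]) (auto simp: assms intro!: measurable_compose[OF crs_Xi])

lemma Psi_int:
  fixes g :: "'a multiset \<Rightarrow> real"
  assumes "\<And>M. \<bar>g M\<bar> \<le> K"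
  shows "integrable P (\<lambda>\<omega>. g (crs (\<Psi> x \<omega>)))"
  by (rule integrable_const_bound[of _ K]) (auto simp: assms intro!: measurable_compose[OF crs_Psi])

text \<open>The contribution of a point at \<open>x\<close> to the mean of \<open>gen h\<close>. It
  only compares the Palm process with \<open>\<Xi>\<close>, which is what local dependence
  controls.\<close>

definition \<Theta> :: "'a \<Rightarrow> real" where
  "\<Theta> x = b * ((\<integral>\<omega>. gh (add_mset (c x) (crs (\<Psi> x \<omega>))) \<partial>P) - (\<integral>\<omega>. gh (crs (\<Xi> \<omega>)) \<partial>P))
     - ((\<integral>\<omega>. dh (c x) (crs (\<Psi> x \<omega>)) \<partial>P) - (\<integral>\<omega>. dh (c x) (crs (\<Xi> \<omega>)) \<partial>P))"

text \<open>As \<open>a = (1 - b) * L\<close>, the birth term has mean \<open>L * g0\<close> plus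
  \<open>b\<close> times the difference of the mean of \<open>size * gh\<close> and
  \<open>L * g0\<close>. The Palm identity turns the mean of \<open>size * gh\<close> into that of
  \<open>gh\<close> after adding the point. Moreover \<open>L * g0\<close> is the
  \<open>lam\<close>-integral of the mean of \<open>dh (c x)\<close>, because \<open>w\<close>
  consists of the normalized cell masses.\<close>

lemma stein_identity: "(\<integral>\<omega>. gen h (crs (\<Xi> \<omega>)) \<partial>P) = (\<integral>x. \<Theta> x \<partial>lam)" "integrable lam \<Theta>"
proof -
  define q where "q x = (\<integral>\<omega>. dh x (crs (\<Xi> \<omega>)) \<partial>P)" for x
  define g0 where "g0 = (\<integral>\<omega>. gh (crs (\<Xi> \<omega>)) \<partial>P)"
  note ip = palm_expectation[of "\<lambda>z M. gh (add_mset z M)", OF gh_bound] palm_expectation[of dh, OF dh_bound]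
  have iq: "integrable lam (\<lambda>x. q (c x))"
  proof (rule L.integrable_const_bound[of _ "1 / (1 - b)"])
    have "\<bar>q x\<bar> \<le> 1 / (1 - b)" for x
    proof -
      have "\<bar>q x\<bar> \<le> (\<integral>\<omega>. 1 / (1 - b) \<partial>P)" unfolding q_def
        by (rule order_trans[OF integral_abs_bound integral_mono]) (use Xi_int[of "dh x", OF dh_bound] dh_bound in auto)
      then show ?thesis by (simp add: prob_space)
    qed
    then show "AE x in lam. norm (q (c x)) \<le> 1 / (1 - b)" by simp
    show "(\<lambda>x. q (c x)) \<in> borel_measurable lam"
      using measurable_compose[OF c_measurable[of "\<lambda>x. x"], of q borel] by (simp cong: measurable_cong_sets)
  qed
  have ic: "integrable lam (\<lambda>x. g0)" by simp
  show "integrable lam \<Theta>" unfolding \<Theta>_def[abs_def] q_def[symmetric] g0_def[symmetric]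
    using ip(2,4) iq ic by (intro Bochner_Integration.integrable_diff integrable_mult_right)
  have "(\<integral>x. \<Theta> x \<partial>lam) = b * ((\<integral>x. (\<integral>\<omega>. gh (add_mset (c x) (crs (\<Psi> x \<omega>))) \<partial>P) \<partial>lam) - L * g0)
     - ((\<integral>x. (\<integral>\<omega>. dh (c x) (crs (\<Psi> x \<omega>)) \<partial>P) \<partial>lam) - (\<integral>x. q (c x) \<partial>lam))"
    unfolding \<Theta>_def q_def[symmetric] g0_def[symmetric] using ip(2,4) iq ic by simp
  also have "(\<integral>x. q (c x) \<partial>lam) = L * g0"
  proof -
    have "(\<integral>x. q (c x) \<partial>lam) = (\<Sum>j=1..k. measure lam (G j) * q (t j))"
      by (rule integral_c) (auto intro: L.finite_measure_axioms)
    also have "\<dots> = L * (\<Sum>j=1..k. w j * q (t j))" unfolding w_eq[symmetric] by (simp add: sum_distrib_left mult.assoc)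
    also have "(\<Sum>j=1..k. w j * q (t j)) = g0"
      unfolding g0_def gh_def av_def q_def
      by (subst Bochner_Integration.integral_sum) (auto intro!: integrable_mult_right Xi_int[of "dh _", OF dh_bound])
    finally show ?thesis .
  qed
  also have "(\<integral>x. (\<integral>\<omega>. gh (add_mset (c x) (crs (\<Psi> x \<omega>))) \<partial>P) \<partial>lam) = (\<integral>\<omega>. real (size (crs (\<Xi> \<omega>))) * gh (crs (\<Xi> \<omega>)) \<partial>P)"
  proof (subst ip(1)[symmetric], rule Bochner_Integration.integral_cong[OF refl])
    fix \<omega>
    have "(\<Sum>z\<in>#crs (\<Xi> \<omega>). gh (add_mset z (crs (\<Xi> \<omega>) - {#z#}))) = (\<Sum>z\<in>#crs (\<Xi> \<omega>). gh (crs (\<Xi> \<omega>)))"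
      by (rule sum_mset_cong') simp
    then show "(\<Sum>z\<in>#crs (\<Xi> \<omega>). gh (add_mset z (crs (\<Xi> \<omega>) - {#z#}))) = real (size (crs (\<Xi> \<omega>))) * gh (crs (\<Xi> \<omega>))"
      by (simp add: sum_mset_const_real)
  qed
  also have "(\<integral>x. (\<integral>\<omega>. dh (c x) (crs (\<Psi> x \<omega>)) \<partial>P) \<partial>lam) = (\<integral>\<omega>. (\<Sum>z\<in>#crs (\<Xi> \<omega>). dh z (crs (\<Xi> \<omega>) - {#z#})) \<partial>P)"
    by (rule ip(3)[symmetric])
  finally have 1: "(\<integral>x. \<Theta> x \<partial>lam) = b * (\<integral>\<omega>. real (size (crs (\<Xi> \<omega>))) * gh (crs (\<Xi> \<omega>)) \<partial>P) + (1 - b) * L * g0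
    - (\<integral>\<omega>. (\<Sum>z\<in>#crs (\<Xi> \<omega>). dh z (crs (\<Xi> \<omega>) - {#z#})) \<partial>P)" by (simp add: algebra_simps)
  have i1: "integrable P (\<lambda>\<omega>. gh (crs (\<Xi> \<omega>)))" by (rule Xi_int[OF gh_bound])
  have i2: "integrable P (\<lambda>\<omega>. real (size (crs (\<Xi> \<omega>))) * gh (crs (\<Xi> \<omega>)))"
  proof (rule Bochner_Integration.integrable_bound[OF integrable_mult_left[OF size_Xi_int, of "1 / (1 - b)"]])
    show "(\<lambda>\<omega>. real (size (crs (\<Xi> \<omega>))) * gh (crs (\<Xi> \<omega>))) \<in> borel_measurable P"
      by (rule measurable_compose[OF crs_Xi, of "\<lambda>M. real (size M) * gh M"]) simp
    show "AE \<omega> in P. norm (real (size (crs (\<Xi> \<omega>))) * gh (crs (\<Xi> \<omega>))) \<le> norm (real (size (crs (\<Xi> \<omega>))) * (1 / (1 - b)))"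
      unfolding real_norm_def abs_mult
      by (intro AE_I2 mult_left_mono order_trans[OF gh_bound abs_ge_self]) simp
  qed
  have i3: "integrable P (\<lambda>\<omega>. \<Sum>z\<in>#crs (\<Xi> \<omega>). dh z (crs (\<Xi> \<omega>) - {#z#}))"
  proof (rule Bochner_Integration.integrable_bound[OF integrable_mult_left[OF size_Xi_int, of "1 / (1 - b)"]])
    show "(\<lambda>\<omega>. \<Sum>z\<in>#crs (\<Xi> \<omega>). dh z (crs (\<Xi> \<omega>) - {#z#})) \<in> borel_measurable P"
      by (rule measurable_compose[OF crs_Xi, of "\<lambda>M. \<Sum>z\<in>#M. dh z (M - {#z#})"]) simp
    have "\<bar>\<Sum>z\<in>#M. dh z (M - {#z#})\<bar> \<le> real (size M) * (1 / (1 - b))" for M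
      unfolding sum_mset_const_real[symmetric] by (rule abs_sum_mset_le) (rule dh_bound)
    then show "AE \<omega> in P. norm (\<Sum>z\<in>#crs (\<Xi> \<omega>). dh z (crs (\<Xi> \<omega>) - {#z#})) \<le> norm (real (size (crs (\<Xi> \<omega>))) * (1 / (1 - b)))"
      unfolding real_norm_def by (intro AE_I2 order_trans[OF _ abs_ge_self])
  qed
  have "(\<integral>\<omega>. gen h (crs (\<Xi> \<omega>)) \<partial>P) = (\<integral>\<omega>. a * gh (crs (\<Xi> \<omega>)) + b * (real (size (crs (\<Xi> \<omega>))) * gh (crs (\<Xi> \<omega>)))
    - (\<Sum>z\<in>#crs (\<Xi> \<omega>). dh z (crs (\<Xi> \<omega>) - {#z#})) \<partial>P)"
    unfolding gen_eq by (simp add: algebra_simps)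
  also have "\<dots> = a * g0 + b * (\<integral>\<omega>. real (size (crs (\<Xi> \<omega>))) * gh (crs (\<Xi> \<omega>)) \<partial>P)
    - (\<integral>\<omega>. (\<Sum>z\<in>#crs (\<Xi> \<omega>). dh z (crs (\<Xi> \<omega>) - {#z#})) \<partial>P)"
    unfolding g0_def using i1 i2 i3 by simp
  finally show "(\<integral>\<omega>. gen h (crs (\<Xi> \<omega>)) \<partial>P) = (\<integral>x. \<Theta> x \<partial>lam)" unfolding 1 by (simp add: a_eq)
qed

text \<open>With the size as test function the Palm identity counts ordered pairs of points,
  \<open>S\<^sup>2 - S\<close>. A finite second moment thus yields integrable Palm sizes for almost
  every \<open>x\<close>, which is why the pointwise bounds below assume integrability at
  \<open>x\<close>.\<close>

lemma palm_sizes: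
  assumes sq: "integrable P (\<lambda>\<omega>. (real (size (crs (\<Xi> \<omega>))))\<^sup>2)"
  shows "AE x in lam. integrable P (\<lambda>\<omega>. real (size (crs (\<Psi> x \<omega>))))"
    and "integrable lam (\<lambda>x. \<integral>\<omega>. real (size (crs (\<Psi> x \<omega>))) \<partial>P)"
    and "(\<integral>x. (\<integral>\<omega>. real (size (crs (\<Psi> x \<omega>))) \<partial>P) \<partial>lam) = (\<integral>\<omega>. (real (size (crs (\<Xi> \<omega>))))\<^sup>2 \<partial>P) - L"
proof -
  let ?S = "\<lambda>\<omega>. real (size (crs (\<Xi> \<omega>)))"
  let ?n = "\<lambda>x. \<integral>\<^sup>+\<omega>. ennreal (real (size (crs (\<Psi> x \<omega>)))) \<partial>P"
  have pt: "(\<Sum>z\<in>#M. real (size (M - {#z#}))) = (real (size M))\<^sup>2 - real (size M)" for M :: "'a multiset"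
  proof -
    have "(\<Sum>z\<in>#M. real (size (M - {#z#}))) = (\<Sum>z\<in>#M. real (size M) - 1)"
    proof (rule sum_mset_cong')
      fix z assume "z \<in># M"
      then obtain M' where "M = add_mset z M'" by (rule mset_add)
      then show "real (size (M - {#z#})) = real (size M) - 1" by simp
    qed
    then show ?thesis by (simp add: sum_mset_const_real power2_eq_square algebra_simps)
  qed
  have nonneg: "0 \<le> (?S \<omega>)\<^sup>2 - ?S \<omega>" for \<omega>
  proof -
    have "size (crs (\<Xi> \<omega>)) \<le> size (crs (\<Xi> \<omega>)) * size (crs (\<Xi> \<omega>))" by simp
    then have "?S \<omega> \<le> ?S \<omega> * ?S \<omega>" unfolding of_nat_mult[symmetric] of_nat_le_iff .
    then show ?thesis by (simp add: power2_eq_square)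
  qed
  have i: "integrable P (\<lambda>\<omega>. (?S \<omega>)\<^sup>2 - ?S \<omega>)" using sq size_Xi_int by simp
  have "(\<integral>\<^sup>+x. ?n x \<partial>lam) = (\<integral>\<^sup>+\<omega>. ennreal ((?S \<omega>)\<^sup>2 - ?S \<omega>) \<partial>P)"
    using palm_nn[of "\<lambda>_ M. real (size M)"] unfolding pt by simp
  also have "\<dots> = ennreal (\<integral>\<omega>. (?S \<omega>)\<^sup>2 - ?S \<omega> \<partial>P)" by (rule nn_integral_eq_integral[OF i]) (use nonneg in auto)
  finally have tot: "(\<integral>\<^sup>+x. ?n x \<partial>lam) = ennreal (\<integral>\<omega>. (?S \<omega>)\<^sup>2 - ?S \<omega> \<partial>P)" .
  have Em: "(\<lambda>x. \<integral>\<omega>. real (size (crs (\<Psi> x \<omega>))) \<partial>P) \<in> borel_measurable lam"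
    using palm_mean_measurable[of "\<lambda>_ M. real (size M)"] by (simp cong: measurable_cong_sets)
  have nm: "?n \<in> borel_measurable lam"
  proof -
    have kern: "(\<lambda>x. distr P config_algebra (\<Psi> x)) \<in> measurable borel (prob_algebra config_algebra)"
      using Palm unfolding reduced_palm_def by blast
    have szm: "(\<lambda>\<eta>. ennreal (real (size (crs \<eta>)))) \<in> borel_measurable config_algebra"
      by (rule measurable_compose[OF crs_measurable]) simp
    have "(\<lambda>x. \<integral>\<^sup>+\<eta>. ennreal (real (size (crs \<eta>))) \<partial>distr P config_algebra (\<Psi> x)) \<in> borel_measurable borel"
      by (rule measurable_compose[OF measurable_prob_algebraD[OF kern] nn_integral_measurable_subprob_algebra[OF szm]])
    moreover have "(\<integral>\<^sup>+\<eta>. ennreal (real (size (crs \<eta>))) \<partial>distr P config_algebra (\<Psi> x)) = ?n x" for x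
      by (subst nn_integral_distr[OF Psi_meas]) (use szm in simp_all)
    ultimately show ?thesis by (simp cong: measurable_cong_sets)
  qed
  have fin: "AE x in lam. ?n x \<noteq> \<infinity>"
    by (rule nn_integral_noteq_infinite[OF nm]) (simp add: tot)
  have sm: "(\<lambda>\<omega>. real (size (crs (\<Psi> x \<omega>)))) \<in> borel_measurable P" for x
    by (rule measurable_compose[OF crs_Psi]) simp
  have int: "integrable P (\<lambda>\<omega>. real (size (crs (\<Psi> x \<omega>))))" if "?n x \<noteq> \<infinity>" for x
    by (rule integrableI_nonneg[OF sm]) (use that in \<open>simp_all add: less_top\<close>)
  show "AE x in lam. integrable P (\<lambda>\<omega>. real (size (crs (\<Psi> x \<omega>))))"
    using fin by eventually_elim (rule int)
  have eq: "AE x in lam. ?n x = ennreal (\<integral>\<omega>. real (size (crs (\<Psi> x \<omega>))) \<partial>P)"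
    using fin by (rule eventually_mono) (rule nn_integral_eq_integral[OF int], simp_all)
  have tot2: "(\<integral>\<^sup>+x. ennreal (\<integral>\<omega>. real (size (crs (\<Psi> x \<omega>))) \<partial>P) \<partial>lam) = ennreal (\<integral>\<omega>. (?S \<omega>)\<^sup>2 - ?S \<omega> \<partial>P)"
    unfolding tot[symmetric] by (rule nn_integral_cong_AE, rule eventually_mono[OF eq]) (rule sym)
  show i2: "integrable lam (\<lambda>x. \<integral>\<omega>. real (size (crs (\<Psi> x \<omega>))) \<partial>P)"
    by (rule integrableI_nonneg[OF Em]) (simp_all add: tot2)
  have "ennreal (\<integral>x. (\<integral>\<omega>. real (size (crs (\<Psi> x \<omega>))) \<partial>P) \<partial>lam) = ennreal (\<integral>\<omega>. (?S \<omega>)\<^sup>2 - ?S \<omega> \<partial>P)"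
    unfolding tot2[symmetric] by (rule nn_integral_eq_integral[symmetric, OF i2]) simp
  then have "(\<integral>x. (\<integral>\<omega>. real (size (crs (\<Psi> x \<omega>))) \<partial>P) \<partial>lam) = (\<integral>\<omega>. (?S \<omega>)\<^sup>2 - ?S \<omega> \<partial>P)"
    by (subst (asm) ennreal_inj) (auto intro!: Bochner_Integration.integral_nonneg nonneg)
  then show "(\<integral>x. (\<integral>\<omega>. real (size (crs (\<Psi> x \<omega>))) \<partial>P) \<partial>lam) = (\<integral>\<omega>. (?S \<omega>)\<^sup>2 \<partial>P) - L"
    using sq size_Xi_int mean_size by simp
qed

text \<open>The correction term with factor \<open>K\<close> integrates to zero: this is the equation that determines
  \<open>b\<close> from the variance.\<close>

lemma gen_bound:
  assumes sq: "integrable P (\<lambda>\<omega>. (real (size (crs (\<Xi> \<omega>))))\<^sup>2)"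
    and balance: "b * L = (1 - b) * ((\<integral>\<omega>. (real (size (crs (\<Xi> \<omega>))))\<^sup>2 \<partial>P) - L - L\<^sup>2)"
    and bound: "\<And>x. integrable P (\<lambda>\<omega>. real (size (crs (\<Psi> x \<omega>)))) \<Longrightarrow>
      ennreal \<bar>\<Theta> x - K * (b - (1 - b) * ((\<integral>\<omega>. real (size (crs (\<Psi> x \<omega>))) \<partial>P) - L))\<bar> \<le> C x"
  shows "ennreal \<bar>\<integral>\<omega>. gen h (crs (\<Xi> \<omega>)) \<partial>P\<bar> \<le> (\<integral>\<^sup>+x. C x \<partial>lam)"
proof -
  let ?E = "\<lambda>x. \<integral>\<omega>. real (size (crs (\<Psi> x \<omega>))) \<partial>P"
  let ?Z = "\<lambda>x. K * (b - (1 - b) * (?E x - L))"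
  note ps = palm_sizes[OF sq]
  have iZ: "integrable lam ?Z" using ps(2) by (intro integrable_mult_right Bochner_Integration.integrable_diff) auto
  have "(\<integral>x. ?Z x \<partial>lam) = K * (b * L - (1 - b) * ((\<integral>x. ?E x \<partial>lam) - L * L))"
    using ps(2) by simp
  also have "\<dots> = 0" unfolding ps(3) balance by (simp add: power2_eq_square)
  finally have Z0: "(\<integral>x. ?Z x \<partial>lam) = 0" .
  have eq: "(\<integral>\<omega>. gen h (crs (\<Xi> \<omega>)) \<partial>P) = (\<integral>x. \<Theta> x - ?Z x \<partial>lam)"
    using stein_identity iZ Z0 by simp
  have "ennreal \<bar>\<integral>x. \<Theta> x - ?Z x \<partial>lam\<bar> \<le> (\<integral>\<^sup>+x. ennreal \<bar>\<Theta> x - ?Z x\<bar> \<partial>lam)"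
    using integral_norm_bound_ennreal[of lam "\<lambda>x. \<Theta> x - ?Z x"] stein_identity(2) iZ by simp
  \<comment> \<open>In the application the kernels behind \<open>C\<close> are chosen separately for
    each point, so \<open>C\<close> may fail to be measurable; \<open>nn_integral\<close> is
    monotone for such functions too.\<close>
  also have "\<dots> \<le> (\<integral>\<^sup>+x. C x \<partial>lam)"
    by (rule nn_integral_mono_AE) (rule eventually_mono[OF ps(1)], rule bound)
  finally show ?thesis unfolding eq .
qed

end

section \<open>The approximation theorem\<close>

text \<open>The error integral lives in \<open>ennreal\<close> because it may be infinite. Otherwise
  it has a real value \<open>cc\<close>, and the estimate is proved for each test function up to an
  arbitrary \<open>e\<close>, which pays for \<open>\<rho>\<close>.\<close>

theorem theorem3p2:
  fixes P :: "'w measure"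
    and \<Xi> :: "'w \<Rightarrow> 'a::metric_space measure"
    and Palm :: "'a \<Rightarrow> 'w \<Rightarrow> 'a measure"
    and A B :: "'a \<Rightarrow> 'a set"
    and a b u :: real
    and lam \<nu> :: "'a measure"
    and k :: nat and G :: "nat \<Rightarrow> 'a set" and t :: "nat \<Rightarrow> 'a"
    and \<kappa> :: "'a \<Rightarrow> 'a measure \<Rightarrow> 'a measure measure"
    and \<kappa>_Palm :: "'a \<Rightarrow> 'a measure \<Rightarrow> 'a measure measure"
    and r r_Palm :: "'a \<Rightarrow> 'w \<Rightarrow> real"
    and rbar rbar_Palm m :: "'a \<Rightarrow> real"
    and E V :: real
  assumes compact: "compact (UNIV :: 'a set)"
    and dist_le_1: "\<And>x y :: 'a. dist x y \<le> 1"
    and Xi: "point_process P \<Xi>"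
    and lam: "lam = mean_measure P \<Xi>"
    and lam_finite: "emeasure lam UNIV < \<infinity>"
    and lam_nonzero: "emeasure lam UNIV \<noteq> 0"
    and E: "E = prob_space.expectation P (\<lambda>\<omega>. mass (\<Xi> \<omega>))"
    and V: "V = prob_space.variance P (\<lambda>\<omega>. mass (\<Xi> \<omega>))"
    and V_finite: "integrable P (\<lambda>\<omega>. (mass (\<Xi> \<omega>) - E)\<^sup>2)"
    and V_ge_E: "V \<ge> E"
    and Palm: "reduced_palm P \<Xi> Palm"
    and dependence: "type_I_dependence P \<Xi> Palm A B"
    and u: "u > 0"
    and partition: "borel_partition k G"
    and centers: "centers k G t"
    and \<nu>: "\<nu> = scale_measure (1 / emeasure lam UNIV) lam"
    and b: "b = (V - E) / V"
    and a: "a = (1 - b) * measure lam UNIV"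
    and \<kappa>: "\<And>x. reg_cond_distr P config_algebra \<Xi>
                       config_algebra (\<lambda>\<omega>. restr (\<Xi> \<omega>) (B x)) (\<kappa> x)"
    and \<kappa>_Palm: "\<And>x. reg_cond_distr P config_algebra (Palm x)
                       config_algebra (\<lambda>\<omega>. restr (Palm x \<omega>) (B x)) (\<kappa>_Palm x)"
    and r: "\<And>x \<omega>. r x \<omega> = r_of_law a u k G t (B x) (\<kappa> x (restr (\<Xi> \<omega>) (B x)))"
    and r_Palm: "\<And>x \<omega>. r_Palm x \<omega> = r_of_law a u k G t (B x) (\<kappa>_Palm x (restr (Palm x \<omega>) (B x)))"
    and rbar: "\<And>x. rbar x = r_of_law a u k G t (B x) (distr P config_algebra \<Xi>)"
    and rbar_Palm: "\<And>x. rbar_Palm x = r_of_law a u k G t (B x) (distr P config_algebra (Palm x))"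
    and m: "\<And>x. m x = prob_space.expectation P (\<lambda>\<omega>. r x \<omega> * measure (\<Xi> \<omega>) (B x))"
  shows "ennreal (d2 (distr P config_algebra \<Xi>) (pbd_process a b 0 \<nu>)) \<le>
    ennreal (2 * mesh k G t) +
    (\<integral>\<^sup>+y. (\<integral>\<^sup>+\<omega>. ennreal (
        (1 + b) * (eps1 (r_Palm y \<omega>) (rbar_Palm y) (m y) (A y) (B y) (Palm y \<omega>)
                   + eps1 (r y \<omega>) (rbar y) (m y) (A y) (B y) (\<Xi> \<omega>))
        + b * rbar y * measure (Palm y \<omega>) (A y)
        + b * eps2 (r_Palm y \<omega>) (rbar_Palm y) (m y) (A y) (B y) (Palm y \<omega>)) \<partial>P) \<partial>lam)"
proof -
  interpret part k G t
    by unfold_locales (use compact partition in \<open>auto simp: borel_partition_def\<close>)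
  interpret palm k G t P \<Xi> Palm lam
    by unfold_locales (use Xi lam lam_finite Palm in auto)
  define L where "L = measure lam UNIV"
  have eL: "emeasure lam UNIV = ennreal L" unfolding L_def by (rule L.emeasure_eq_measure)
  have L: "L > 0" using lam_nonzero unfolding eL by (simp add: ennreal_eq_0_iff not_le)
  define S where "S \<omega> = real (size (crs (\<Xi> \<omega>)))" for \<omega>
  have mS: "mass (\<Xi> \<omega>) = S \<omega>" if "\<omega> \<in> space P" for \<omega>
    unfolding S_def by (rule size_crs[OF Xi_configs[OF that], symmetric])
  have S_int: "integrable P S" unfolding S_def[abs_def] by (rule size_Xi_int)
  have EL: "E = L"
    unfolding E L_def mean_size[symmetric] by (rule Bochner_Integration.integral_cong) (auto simp: mS S_def)
  have V2_int: "integrable P (\<lambda>\<omega>. (S \<omega> - L)\<^sup>2)"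
    using V_finite by (subst (asm) Bochner_Integration.integrable_cong[OF refl]) (auto simp: mS EL)
  have VS: "V = (\<integral>\<omega>. (S \<omega> - L)\<^sup>2 \<partial>P)"
    unfolding V E[symmetric] by (rule Bochner_Integration.integral_cong) (auto simp: mS EL)
  have S2: "(S \<omega>)\<^sup>2 = (S \<omega> - L)\<^sup>2 + 2 * L * S \<omega> - L\<^sup>2" for \<omega> by (simp add: power2_eq_square algebra_simps)
  have sq: "integrable P (\<lambda>\<omega>. (S \<omega>)\<^sup>2)" unfolding S2 using V2_int S_int by simp
  have ES: "(\<integral>\<omega>. S \<omega> \<partial>P) = L" unfolding S_def L_def by (rule mean_size)
  have sq_mean: "(\<integral>\<omega>. (S \<omega>)\<^sup>2 \<partial>P) = V + L\<^sup>2"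
    unfolding S2 VS using V2_int S_int ES by (simp add: prob_space power2_eq_square)
  have V: "V \<ge> L" "V > 0" using V_ge_E L unfolding EL by simp_all
  have b01: "0 \<le> b" "b < 1" unfolding b EL using V L by (simp_all add: divide_less_eq)
  have b1: "1 - b = L / V" unfolding b EL using V by (simp add: field_simps)
  have aL: "a = (1 - b) * L" unfolding a L_def ..
  have a0: "a > 0" unfolding aL using b01 L by simp
  \<comment> \<open>The bracket is \<open>V - L = b * V\<close>, and
    \<open>1 - b = L / V\<close>.\<close>
  have balance: "b * L = (1 - b) * ((\<integral>\<omega>. (S \<omega>)\<^sup>2 \<partial>P) - L - L\<^sup>2)"
    unfolding sq_mean b1 using V by (simp add: b EL)
  have "1 / emeasure lam UNIV = ennreal (1 / L)"
    unfolding eL using L by (simp add: divide_ennreal[symmetric])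
  then have \<nu>': "\<nu> = scale_measure (ennreal (1 / L)) lam" unfolding \<nu> by simp
  have \<nu>_sets: "sets \<nu> = sets borel" unfolding \<nu>' by simp
  have \<nu>_meas: "measure \<nu> X = measure lam X / L" for X
    unfolding \<nu>' using L by (subst measure_scale_measure) auto
  have \<nu>_prob: "prob_space \<nu>"
  proof (rule prob_spaceI)
    have "emeasure \<nu> (space \<nu>) = ennreal (1 / L) * ennreal L" unfolding \<nu>' by (simp add: space_scale_measure eL)
    also have "\<dots> = 1" using L by (simp add: ennreal_mult[symmetric])
    finally show "emeasure \<nu> (space \<nu>) = 1" .
  qed
  define w where "w = (\<lambda>j. measure \<nu> (G j))"
  have w0: "0 \<le> w j" for j unfolding w_def by simp
  have wsum: "(\<Sum>j\<in>{1..k}. w j) = 1"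
    using integral_c[of \<nu> "\<lambda>_. 1"] \<nu>_prob \<nu>_sets prob_space.prob_space[OF \<nu>_prob]
    unfolding w_def by (simp add: prob_space.finite_measure)
  have w_eq: "measure lam UNIV * w j = measure lam (G j)" for j
    unfolding w_def \<nu>_meas L_def[symmetric] using L by simp
  have nbhd: "A x \<in> sets borel" "B x \<in> sets borel" "A x \<subseteq> B x" for x
    using dependence unfolding type_I_dependence_def type_I_nbhd_def by auto
  have law_A: "distr P config_algebra (\<lambda>\<omega>. restr (Palm x \<omega>) (- A x)) = distr P config_algebra (\<lambda>\<omega>. restr (\<Xi> \<omega>) (- A x))" for x
    using dependence unfolding type_I_dependence_def by blast
  have ind: "indep_var config_algebra (\<lambda>\<omega>. restr (\<Xi> \<omega>) (- B x)) config_algebra (\<lambda>\<omega>. restr (\<Xi> \<omega>) (A x))"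
    "indep_var config_algebra (\<lambda>\<omega>. restr (Palm x \<omega>) (- B x)) config_algebra (\<lambda>\<omega>. restr (Palm x \<omega>) (A x))" for x
    using dependence unfolding type_I_dependence_def by blast+
  let ?RHS = "\<lambda>y. \<integral>\<^sup>+\<omega>. ennreal (
        (1 + b) * (eps1 (r_Palm y \<omega>) (rbar_Palm y) (m y) (A y) (B y) (Palm y \<omega>)
                   + eps1 (r y \<omega>) (rbar y) (m y) (A y) (B y) (\<Xi> \<omega>))
        + b * rbar y * measure (Palm y \<omega>) (A y)
        + b * eps2 (r_Palm y \<omega>) (rbar_Palm y) (m y) (A y) (B y) (Palm y \<omega>)) \<partial>P"
  have main: "\<bar>(\<integral>\<xi>. f \<xi> \<partial>distr P config_algebra \<Xi>) - (\<integral>\<xi>. f \<xi> \<partial>pbd_process a b 0 \<nu>)\<bar> \<le> 2 * mesh k G t + cc"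
    if f: "f \<in> lip_d1" and cc: "(\<integral>\<^sup>+y. ?RHS y \<partial>lam) = ennreal cc" "0 \<le> cc" for f cc
  proof (rule field_le_epsilon)
    fix e :: real assume e: "e > 0"
    define f' where "f' M = f (cfg M)" for M
    have lip: "\<bar>f (cfg M) - f (cfg M')\<bar> \<le> d1 (cfg M) (cfg M')" for M M'
      using f cfg_in_configs unfolding lip_d1_def by blast
    have st: "stein a b {1..k} w f'"
    proof
      show "\<bar>f' M - f' N\<bar> \<le> 1" for M N
        unfolding f'_def by (rule order_trans[OF lip d1_le_1[OF dist_le_1]])
      show "\<bar>f' (add_mset x M) - f' (add_mset y M)\<bar> \<le> 1 / (real (size M) + 1)" for x y M
        unfolding f'_def by (rule order_trans[OF lip d1_add_mset_le[OF dist_le_1]])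
    qed (use a0 b01 w0 wsum in auto)
    interpret stein a b "{1..k}" t w f' by (rule st)
    define M0 where "M0 = (\<integral>\<omega>. real (size (crs (\<Xi> \<omega>))) \<partial>P) + (\<Sum>n. real n * pmf (pbd_pmf a b 0) n)"
    have M0: "0 \<le> M0" unfolding M0_def
      by (intro add_nonneg_nonneg Bochner_Integration.integral_nonneg suminf_nonneg pbd_pmf_properties(2) a0 b01) auto
    \<comment> \<open>Chosen so that the resolvent error \<open>\<rho> / (1 - b) * M0\<close> is at
      most \<open>e\<close>; the summand 1 avoids division by zero.\<close>
    define \<rho> where "\<rho> = e * (1 - b) / (M0 + 1)"
    have \<rho>: "\<rho> > 0" unfolding \<rho>_def using e b01 M0 by simp
    have \<rho>e: "\<rho> / (1 - b) * M0 \<le> e"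
    proof -
      have "\<rho> / (1 - b) * M0 = e * (M0 / (M0 + 1))" unfolding \<rho>_def using b01 by simp
      also have "\<dots> \<le> e * 1" using e M0 by (intro mult_left_mono) (auto simp: divide_le_eq_1)
      finally show ?thesis by simp
    qed
    obtain h where h: "\<And>M. \<rho> * h M - gen h M = f' M" "\<And>M. \<rho> * h M \<le> top_f" "\<And>M. top_f - 1 \<le> \<rho> * h M"
      using resolvent_exists[OF \<rho>] by metis
    interpret palm_stein k G t P \<Xi> Palm lam a b w f' \<rho> h
      by unfold_locales (use h \<rho> w_eq aL[unfolded L_def] in auto)
    have one: "1 \<in> {1..k}" by (rule k_pos)
    \<comment> \<open>\<open>K\<close> must not depend on \<open>y\<close> for the correction in
      \<open>gen_bound\<close> to integrate to zero. The index 1 is an arbitrary choice of a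
      center.\<close>
    define K where "K = (\<integral>\<omega>. dd (t 1) (t 1) (crs (\<Xi> \<omega>)) \<partial>P)"
    have pw: "ennreal \<bar>\<Theta> y - K * (b - (1 - b) * ((\<integral>\<omega>. real (size (crs (Palm y \<omega>))) \<partial>P) - measure lam UNIV))\<bar> \<le> ?RHS y"
      if int: "integrable P (\<lambda>\<omega>. real (size (crs (Palm y \<omega>))))" for y
    proof -
      interpret LX: local_dependence k G t a b w f' \<rho> h P \<Xi> "A y" "B y" "\<kappa> y" u
        by unfold_locales (use Xi_meas nbhd u \<kappa> ind size_Xi_int in auto)
      interpret LP: local_dependence k G t a b w f' \<rho> h P "Palm y" "A y" "B y" "\<kappa>_Palm y" u
        by unfold_locales (use Psi_meas nbhd u \<kappa>_Palm ind int in auto)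
      let ?mP = "\<lambda>\<omega>. measure (Palm y \<omega>) (A y)" and ?mX = "\<lambda>\<omega>. measure (\<Xi> \<omega>) (A y)"
      have r': "r y \<omega> = LX.R (\<kappa> y (restr (\<Xi> \<omega>) (B y)))" for \<omega> by (rule r)
      have rP': "r_Palm y \<omega> = LX.R (\<kappa>_Palm y (restr (Palm y \<omega>) (B y)))" for \<omega> by (rule r_Palm)
      have rb: "rbar y = LX.R (distr P config_algebra \<Xi>)" "rbar_Palm y = LX.R (distr P config_algebra (Palm y))"
        by (rule rbar, rule rbar_Palm)
      have r_m: "r y \<in> borel_measurable P" "r_Palm y \<in> borel_measurable P"
        using LX.r_meas LP.r_meas unfolding r'[abs_def, symmetric] rP'[abs_def, symmetric] by simp_all
      have r0: "0 \<le> r y \<omega>" "0 \<le> r_Palm y \<omega>" if "\<omega> \<in> space P" for \<omega>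
        using LX.r_nonneg[OF that] LP.r_nonneg[OF that] unfolding r' rP' by simp_all
      have rb0: "0 \<le> rbar y" "0 \<le> rbar_Palm y" unfolding rb by (rule LX.rbar_nonneg LP.rbar_nonneg)+
      have Am: "(\<lambda>\<omega>. measure (\<Psi>' \<omega>) C) \<in> borel_measurable P" if "\<Psi>' \<in> measurable P config_algebra" "C \<in> sets borel" for \<Psi>' C
        by (rule measurable_compose[OF that(1) measure_config_measurable[OF that(2)]])
      note meas = Am[OF Xi_meas nbhd(1)] Am[OF Psi_meas nbhd(1)] Am[OF Xi_meas nbhd(2)] Am[OF Xi_meas sets.Diff[OF nbhd(2) nbhd(1)]]
        Am[OF Psi_meas sets.Diff[OF nbhd(2) nbhd(1)]]
      have m_nn: "(\<integral>\<^sup>+\<omega>. ennreal (r y \<omega> * measure (\<Xi> \<omega>) (B y)) \<partial>P) = ennreal (m y)" and m0: "0 \<le> m y"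
      proof -
        define rm where "rm = 4 + (4 * u + 10) / a"
        have "integrable P (\<lambda>\<omega>. r y \<omega> * measure (\<Xi> \<omega>) (B y))"
        proof (rule Bochner_Integration.integrable_bound[OF integrable_mult_right[OF size_Xi_int, of rm]])
          show "(\<lambda>\<omega>. r y \<omega> * measure (\<Xi> \<omega>) (B y)) \<in> borel_measurable P" using r_m(1) meas(3) by (rule borel_measurable_times)
          show "AE \<omega> in P. norm (r y \<omega> * measure (\<Xi> \<omega>) (B y)) \<le> norm (rm * real (size (crs (\<Xi> \<omega>))))"
          proof (rule AE_I2)
            fix \<omega> assume \<omega>: "\<omega> \<in> space P"
            have 1: "r y \<omega> \<le> rm" using LX.r_nonneg[OF \<omega>] unfolding r' rm_def by simp
            have 2: "measure (\<Xi> \<omega>) (B y) \<le> real (size (crs (\<Xi> \<omega>)))"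
              unfolding LX.sizes(3)[OF \<omega>, symmetric] LX.decompose(1)[OF \<omega>] by simp
            have "r y \<omega> * measure (\<Xi> \<omega>) (B y) \<le> rm * real (size (crs (\<Xi> \<omega>)))"
              using 1 2 r0(1)[OF \<omega>] by (intro mult_mono) auto
            then show "norm (r y \<omega> * measure (\<Xi> \<omega>) (B y)) \<le> norm (rm * real (size (crs (\<Xi> \<omega>))))"
              using 1 r0(1)[OF \<omega>] by (simp add: abs_mult)
          qed
        qed
        then show "(\<integral>\<^sup>+\<omega>. ennreal (r y \<omega> * measure (\<Xi> \<omega>) (B y)) \<partial>P) = ennreal (m y)"
          unfolding m by (rule nn_integral_eq_integral) (use r0 in auto)
        show "0 \<le> m y" unfolding m by (rule Bochner_Integration.integral_nonneg_AE) (use r0 in auto)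
      qed
      \<comment> \<open>The local substitute for \<open>K\<close>. Outside \<open>B y\<close> both
        processes have the same law, so one value serves for both (\<open>XP\<close>); passing from
        \<open>dX\<close> to \<open>K\<close> costs \<open>m y\<close> (\<open>dXK\<close>).\<close>
      define dX where "dX = (\<integral>\<omega>. dd (t 1) (t 1) (LX.X \<omega>) \<partial>P)"
      have law_same: "(\<integral>\<omega>. g (restr (Palm y \<omega>) (- A y)) \<partial>P) = (\<integral>\<omega>. g (restr (\<Xi> \<omega>) (- A y)) \<partial>P)"
        if g: "g \<in> borel_measurable config_algebra" for g :: "'a measure \<Rightarrow> real"
        using integral_distr[OF LP.restr_Psi_meas[of "- A y"] g] integral_distr[OF LX.restr_Psi_meas[of "- A y"] g] nbhd(1) law_A[of y]
        by auto
      have law_em: "emeasure P {\<omega> \<in> space P. restr (Palm y \<omega>) (- A y) \<in> Q} = emeasure P {\<omega> \<in> space P. restr (\<Xi> \<omega>) (- A y) \<in> Q}"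
        if Q: "Q \<in> sets config_algebra" for Q
      proof -
        have "emeasure P {\<omega> \<in> space P. restr (\<Psi>' \<omega>) (- A y) \<in> Q} = emeasure (distr P config_algebra (\<lambda>\<omega>. restr (\<Psi>' \<omega>) (- A y))) Q"
          if "(\<lambda>\<omega>. restr (\<Psi>' \<omega>) (- A y)) \<in> measurable P config_algebra" for \<Psi>'
          by (subst emeasure_distr[OF that Q]) (auto intro!: arg_cong[where f = "emeasure P"])
        from this[OF LP.restr_Psi_meas] this[OF LX.restr_Psi_meas] show ?thesis using nbhd(1) law_A[of y] by simp
      qed
      \<comment> \<open>As \<open>A y \<subseteq> B y\<close>, the part outside \<open>B y\<close>
        is a function of the part outside \<open>A y\<close>, and there the laws agree.\<close>
      have NA: "N (B y) (restr \<eta> (- A y)) = N (B y) \<eta>" if "\<eta> \<in> configs" for \<eta>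
      proof -
        have "- B y \<inter> - A y = - B y" using nbhd(3) by auto
        then show ?thesis unfolding N_def using restr_restr[OF that, of "- B y" "- A y"] nbhd by simp
      qed
      have XP: "(\<integral>\<omega>. g (LP.X \<omega>) \<partial>P) = (\<integral>\<omega>. g (LX.X \<omega>) \<partial>P)" for g :: "'a multiset \<Rightarrow> real"
      proof -
        have "(\<integral>\<omega>. g (LP.X \<omega>) \<partial>P) = (\<integral>\<omega>. g (N (B y) (restr (Palm y \<omega>) (- A y))) \<partial>P)"
          by (rule Bochner_Integration.integral_cong) (auto simp: LP.X_def NA LP.configs)
        also have "\<dots> = (\<integral>\<omega>. g (N (B y) (restr (\<Xi> \<omega>) (- A y))) \<partial>P)"
          by (rule law_same[of "\<lambda>\<eta>. g (N (B y) \<eta>)"]) (rule measurable_compose[OF N_measurable[OF nbhd(2)]], simp)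
        also have "\<dots> = (\<integral>\<omega>. g (LX.X \<omega>) \<partial>P)"
          by (rule Bochner_Integration.integral_cong) (auto simp: LX.X_def NA LX.configs)
        finally show ?thesis .
      qed
      have XPe: "emeasure (distr P config_algebra \<Xi>) {\<eta> \<in> configs. N (B y) \<eta> \<in> Q} = emeasure P {\<omega> \<in> space P. LP.X \<omega> \<in> Q}" for Q
      proof -
        let ?Q = "N (B y) -` Q \<inter> space config_algebra"
        have Q: "?Q \<in> sets config_algebra" by (rule measurable_sets[OF N_measurable[OF nbhd(2)]]) simp
        have c: "restr \<eta> (- A y) \<in> ?Q \<longleftrightarrow> N (B y) \<eta> \<in> Q" if "\<eta> \<in> configs" for \<eta>
          using NA[OF that] restr_in_configs[OF that, of "- A y"] nbhd(1) by auto
        have "emeasure P {\<omega> \<in> space P. LP.X \<omega> \<in> Q} = emeasure P {\<omega> \<in> space P. restr (Palm y \<omega>) (- A y) \<in> ?Q}"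
          using c LP.configs unfolding LP.X_def by (intro arg_cong[where f = "emeasure P"]) blast
        also have "\<dots> = emeasure P {\<omega> \<in> space P. restr (\<Xi> \<omega>) (- A y) \<in> ?Q}" by (rule law_em[OF Q])
        also have "\<dots> = emeasure P {\<omega> \<in> space P. LX.X \<omega> \<in> Q}"
          using c LX.configs unfolding LX.X_def by (intro arg_cong[where f = "emeasure P"]) blast
        finally show ?thesis unfolding LX.law_X ..
      qed
      have dXK: "ennreal \<bar>dX - K\<bar> \<le> ennreal (m y)"
        using LX.removal_estimate[of "t 1" "t 1"] unfolding K_def dX_def m_nn[symmetric] r'
        by (simp only: abs_minus_commute)
      let ?e1P = "\<integral>\<^sup>+\<omega>. ennreal (eps1 (r_Palm y \<omega>) (rbar_Palm y) (m y) (A y) (B y) (Palm y \<omega>)) \<partial>P"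
      let ?e1X = "\<integral>\<^sup>+\<omega>. ennreal (eps1 (r y \<omega>) (rbar y) (m y) (A y) (B y) (\<Xi> \<omega>)) \<partial>P"
      let ?e2P = "\<integral>\<^sup>+\<omega>. ennreal (eps2 (r_Palm y \<omega>) (rbar_Palm y) (m y) (A y) (B y) (Palm y \<omega>)) \<partial>P"
      let ?c2 = "\<integral>\<^sup>+\<omega>. ennreal (rbar y * ?mP \<omega>) \<partial>P"
      define eP where "eP = (\<integral>\<omega>. ?mP \<omega> \<partial>P)"
      define eX where "eX = (\<integral>\<omega>. ?mX \<omega> \<partial>P)"
      have eP0: "0 \<le> eP" "0 \<le> eX" unfolding eP_def eX_def by simp_all
      have iP: "integrable P ?mP" and iX: "integrable P ?mX"
        using LP.PA_int LX.PA_int by (auto simp: LP.sizes LX.sizes cong: Bochner_Integration.integrable_cong)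
      have tail: "(\<integral>\<^sup>+\<omega>. ennreal (F \<omega>) \<partial>P) + ennreal (E' * m y) = (\<integral>\<^sup>+\<omega>. ennreal (F \<omega> + g \<omega> * m y) \<partial>P)"
        if "F \<in> borel_measurable P" "\<And>\<omega>. \<omega> \<in> space P \<Longrightarrow> 0 \<le> F \<omega>" "integrable P g" "\<And>\<omega>. 0 \<le> g \<omega>" "E' = (\<integral>\<omega>. g \<omega> \<partial>P)" for F g E'
      proof -
        have "ennreal (E' * m y) = (\<integral>\<^sup>+\<omega>. ennreal (g \<omega> * m y) \<partial>P)"
          using nn_integral_eq_integral[of P "\<lambda>\<omega>. g \<omega> * m y"] that m0 by simp
        then have "(\<integral>\<^sup>+\<omega>. ennreal (F \<omega>) \<partial>P) + ennreal (E' * m y) = (\<integral>\<^sup>+\<omega>. ennreal (F \<omega>) + ennreal (g \<omega> * m y) \<partial>P)"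
          using that by (subst nn_integral_add) auto
        also have "\<dots> = (\<integral>\<^sup>+\<omega>. ennreal (F \<omega> + g \<omega> * m y) \<partial>P)"
          by (rule nn_integral_cong) (use that m0 in \<open>auto simp: ennreal_plus\<close>)
        finally show ?thesis .
      qed
      \<comment> \<open>Replacing \<open>dX\<close> by \<open>K\<close> in the linear term costs its
        coefficient times \<open>m y\<close>. This is the third summand of \<open>eps1\<close>,
        moved under the integral by \<open>tail\<close>.\<close>
      have shift: "ennreal \<bar>x - E' * K\<bar> \<le> I + ennreal (E' * m y)" if "ennreal \<bar>x - E' * dX\<bar> \<le> I" "0 \<le> E'" for x E' I
      proof -
        have "ennreal \<bar>(x - E' * dX) + E' * (dX - K)\<bar> \<le> I + ennreal E' * ennreal (m y)"
          by (intro ennreal_abs_add ennreal_abs_scale that dXK)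
        then show ?thesis using m0 that(2) by (simp add: right_diff_distrib ennreal_mult)
      qed
      have e1P: "ennreal \<bar>((\<integral>\<omega>. dh (t l) (crs (Palm y \<omega>)) \<partial>P) - (\<integral>\<omega>. dh (t l) (crs (restr (Palm y \<omega>) (- A y))) \<partial>P)) - eP * K\<bar> \<le> ?e1P"
        if l: "l \<in> {1..k}" for l
      proof -
        have "ennreal \<bar>((\<integral>\<omega>. dh (t l) (crs (Palm y \<omega>)) \<partial>P) - (\<integral>\<omega>. dh (t l) (crs (restr (Palm y \<omega>) (- A y))) \<partial>P)) - eP * K\<bar>
          \<le> (\<integral>\<^sup>+\<omega>. ennreal (r_Palm y \<omega> * ?mP \<omega> * measure (Palm y \<omega>) (B y - A y) + 1 / 2 * rbar_Palm y * (?mP \<omega> + 1) * ?mP \<omega>) \<partial>P) + ennreal (eP * m y)"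
          by (rule shift[OF _ eP0(1)])
            (use LP.first_difference_estimate[OF l one] in \<open>simp only: eP_def dX_def XP rP' rb\<close>)
        also have "\<dots> = ?e1P" unfolding eps1_def
          by (rule tail[OF _ _ iP _ eP_def]) (use meas r_m r0 rb0 in \<open>auto intro!: add_nonneg_nonneg mult_nonneg_nonneg\<close>)
        finally show ?thesis .
      qed
      have e1X: "ennreal \<bar>((\<integral>\<omega>. dh (t l) (crs (\<Xi> \<omega>)) \<partial>P) - (\<integral>\<omega>. dh (t l) (crs (restr (\<Xi> \<omega>) (- A y))) \<partial>P)) - eX * K\<bar> \<le> ?e1X"
        if l: "l \<in> {1..k}" for l
      proof -
        have "ennreal \<bar>((\<integral>\<omega>. dh (t l) (crs (\<Xi> \<omega>)) \<partial>P) - (\<integral>\<omega>. dh (t l) (crs (restr (\<Xi> \<omega>) (- A y))) \<partial>P)) - eX * K\<bar>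
          \<le> (\<integral>\<^sup>+\<omega>. ennreal (r y \<omega> * ?mX \<omega> * measure (\<Xi> \<omega>) (B y - A y) + 1 / 2 * rbar y * (?mX \<omega> + 1) * ?mX \<omega>) \<partial>P) + ennreal (eX * m y)"
          by (rule shift[OF _ eP0(2)])
            (use LX.first_difference_estimate[OF l one] in \<open>simp only: eX_def dX_def r' rb\<close>)
        also have "\<dots> = ?e1X" unfolding eps1_def
          by (rule tail[OF _ _ iX _ eX_def]) (use meas r_m r0 rb0 in \<open>auto intro!: add_nonneg_nonneg mult_nonneg_nonneg\<close>)
        finally show ?thesis .
      qed
      define q where "q l = (\<integral>\<omega>. dh (t l) (crs (Palm y \<omega>)) \<partial>P) - (\<integral>\<omega>. dh (t l) (crs (\<Xi> \<omega>)) \<partial>P)" for l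
      have qb: "ennreal \<bar>q l - (eP - eX) * K\<bar> \<le> ?e1P + ?e1X" if l: "l \<in> {1..k}" for l
      proof -
        \<comment> \<open>Outside \<open>A y\<close> the Palm process has the law of
          \<open>\<Xi>\<close>, so the two intermediate means cancel.\<close>
        have same: "(\<integral>\<omega>. dh (t l) (crs (restr (Palm y \<omega>) (- A y))) \<partial>P) = (\<integral>\<omega>. dh (t l) (crs (restr (\<Xi> \<omega>) (- A y))) \<partial>P)"
          by (rule law_same[of "\<lambda>\<eta>. dh (t l) (crs \<eta>)"]) (rule measurable_compose[OF crs_measurable], simp)
        have "ennreal \<bar>(((\<integral>\<omega>. dh (t l) (crs (Palm y \<omega>)) \<partial>P) - (\<integral>\<omega>. dh (t l) (crs (restr (Palm y \<omega>) (- A y))) \<partial>P)) - eP * K)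
          + - (((\<integral>\<omega>. dh (t l) (crs (\<Xi> \<omega>)) \<partial>P) - (\<integral>\<omega>. dh (t l) (crs (restr (\<Xi> \<omega>) (- A y))) \<partial>P)) - eX * K)\<bar> \<le> ?e1P + ?e1X"
          by (rule ennreal_abs_add[OF e1P[OF l]]) (use e1X[OF l] in \<open>simp only: abs_minus_cancel\<close>)
        then show ?thesis unfolding q_def same by (simp add: algebra_simps)
      qed
      \<comment> \<open>The mean sizes differ only by the contribution of \<open>A y\<close>. This
        identifies the coefficient of \<open>K\<close> below with the one in
        \<open>gen_bound\<close>.\<close>
      have size_diff: "(\<integral>\<omega>. real (size (crs (Palm y \<omega>))) \<partial>P) - measure lam UNIV = eP - eX"
      proof -
        have d: "real (size (crs \<eta>)) = real (size (crs (restr \<eta> (- A y)))) + measure \<eta> (A y)" if "\<eta> \<in> configs" for \<eta>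
          using crs_restr_split[OF that nbhd(1)] size_crs_restr[OF that nbhd(1)] by (metis of_nat_add size_union)
        have "(\<integral>\<omega>. real (size (crs (Palm y \<omega>))) \<partial>P) - eP = (\<integral>\<omega>. real (size (crs (Palm y \<omega>))) - ?mP \<omega> \<partial>P)"
          unfolding eP_def using int iP by simp
        also have "\<dots> = (\<integral>\<omega>. real (size (crs (restr (Palm y \<omega>) (- A y)))) \<partial>P)"
          by (rule Bochner_Integration.integral_cong) (auto simp: d LP.configs)
        also have "\<dots> = (\<integral>\<omega>. real (size (crs (restr (\<Xi> \<omega>) (- A y)))) \<partial>P)"
          by (rule law_same[of "\<lambda>\<eta>. real (size (crs \<eta>))"]) (rule measurable_compose[OF crs_measurable], simp)
        also have "\<dots> = (\<integral>\<omega>. real (size (crs (\<Xi> \<omega>))) - ?mX \<omega> \<partial>P)"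
          by (rule Bochner_Integration.integral_cong) (auto simp: d LX.configs)
        also have "\<dots> = measure lam UNIV - eX" unfolding eX_def using size_Xi_int iX by (simp add: mean_size)
        finally show ?thesis by simp
      qed
      define i where "i = cell y"
      have i: "i \<in> {1..k}" "c y = t i" unfolding i_def c_def by (rule cell_in) simp
      \<comment> \<open>The Palm points in \<open>A y\<close> are removed with the law of
        \<open>\<Xi>\<close> as kernel; hence \<open>rbar y\<close>, and not
        \<open>rbar_Palm y\<close>, multiplies their number.\<close>
      have e2P: "ennreal \<bar>(\<integral>\<omega>. dd (t i) (t j) (crs (Palm y \<omega>)) \<partial>P) - K\<bar> \<le> ?c2 + ?e2P" if j: "j \<in> {1..k}" for j
      proof -
        have "ennreal \<bar>((\<integral>\<omega>. dd (t i) (t j) (crs (Palm y \<omega>)) \<partial>P) - dX) + (dX - K)\<bar>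
          \<le> ((\<integral>\<^sup>+\<omega>. ennreal (r_Palm y \<omega> * measure (Palm y \<omega>) (B y - A y)) \<partial>P) + ?c2 + ennreal (rbar_Palm y)) + ennreal (m y)"
          using LP.second_difference_estimate[OF LX.law_prob XPe i(1) j one]
          by (intro ennreal_abs_add dXK) (simp only: dX_def XP rP' rb)
        also have "\<dots> = ?c2 + ((\<integral>\<^sup>+\<omega>. ennreal (r_Palm y \<omega> * measure (Palm y \<omega>) (B y - A y)) \<partial>P) + ennreal (rbar_Palm y + m y))"
          using rb0 m0 by (simp add: ennreal_plus add_ac)
        also have "(\<integral>\<^sup>+\<omega>. ennreal (r_Palm y \<omega> * measure (Palm y \<omega>) (B y - A y)) \<partial>P) + ennreal (rbar_Palm y + m y)
          = (\<integral>\<^sup>+\<omega>. ennreal (r_Palm y \<omega> * measure (Palm y \<omega>) (B y - A y)) + ennreal (rbar_Palm y + m y) \<partial>P)"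
          using meas r_m by (subst nn_integral_add) (auto simp: emeasure_space_1)
        also have "\<dots> = ?e2P" unfolding eps2_def
          by (rule nn_integral_cong) (use r0 rb0 m0 in \<open>auto simp: ennreal_plus[symmetric] add.assoc simp del: ennreal_plus\<close>)
        finally show ?thesis by simp
      qed
      have T1: "(\<integral>\<omega>. gh (add_mset (c y) (crs (Palm y \<omega>))) \<partial>P) - (\<integral>\<omega>. gh (crs (Palm y \<omega>)) \<partial>P)
        = (\<Sum>j\<in>{1..k}. w j * (\<integral>\<omega>. dd (t i) (t j) (crs (Palm y \<omega>)) \<partial>P))"
      proof -
        have g: "gh (add_mset (c y) M) - gh M = (\<Sum>j\<in>{1..k}. w j * dd (t i) (t j) M)" for M
          unfolding gh_def av_diff[symmetric] dh_add unfolding av_def i(2) ..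
        have "(\<integral>\<omega>. gh (add_mset (c y) (crs (Palm y \<omega>))) \<partial>P) - (\<integral>\<omega>. gh (crs (Palm y \<omega>)) \<partial>P)
          = (\<integral>\<omega>. gh (add_mset (c y) (crs (Palm y \<omega>))) - gh (crs (Palm y \<omega>)) \<partial>P)"
          using Psi_int[of "\<lambda>M. gh (add_mset (c y) M)", OF gh_bound] Psi_int[of gh, OF gh_bound] by simp
        also have "\<dots> = (\<Sum>j\<in>{1..k}. w j * (\<integral>\<omega>. dd (t i) (t j) (crs (Palm y \<omega>)) \<partial>P))"
          unfolding g by (subst Bochner_Integration.integral_sum) (auto intro!: integrable_mult_right Psi_int[of "dd _ _", OF dd_bound])
        finally show ?thesis .
      qed
      have T2: "(\<integral>\<omega>. gh (crs (Palm y \<omega>)) \<partial>P) - (\<integral>\<omega>. gh (crs (\<Xi> \<omega>)) \<partial>P) = (\<Sum>j\<in>{1..k}. w j * q j)"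
      proof -
        have "(\<integral>\<omega>. gh (crs (\<Psi>' \<omega>)) \<partial>P) = (\<Sum>j\<in>{1..k}. w j * (\<integral>\<omega>. dh (t j) (crs (\<Psi>' \<omega>)) \<partial>P))"
          if "\<And>j. integrable P (\<lambda>\<omega>. dh (t j) (crs (\<Psi>' \<omega>)))" for \<Psi>'
          unfolding gh_def av_def by (subst Bochner_Integration.integral_sum) (auto intro!: integrable_mult_right that)
        from this[of "Palm y", OF Psi_int[of "dh _", OF dh_bound]] this[of \<Xi>, OF Xi_int[of "dh _", OF dh_bound]]
        show ?thesis unfolding q_def by (simp add: right_diff_distrib sum_subtractf)
      qed
      \<comment> \<open>\<open>X1\<close> is the effect of adding the point \<open>y\<close> to the
        Palm process, \<open>X2\<close> that of passing from the Palm process to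
        \<open>\<Xi>\<close> in the average over centers, and \<open>X3\<close> the same at the
        center of \<open>y\<close>, each without its multiple of \<open>K\<close>. They enter with
        factors \<open>b\<close>, \<open>b\<close> and \<open>-1\<close>, which produces
        \<open>1 + b\<close> before \<open>eps1\<close> and \<open>b\<close> before the other
        terms.\<close>
      define X1 where "X1 = (\<Sum>j\<in>{1..k}. w j * (\<integral>\<omega>. dd (t i) (t j) (crs (Palm y \<omega>)) \<partial>P)) - K"
      define X2 where "X2 = (\<Sum>j\<in>{1..k}. w j * q j) - (eP - eX) * K"
      define X3 where "X3 = q i - (eP - eX) * K"
      have b1: "ennreal \<bar>X1\<bar> \<le> ?c2 + ?e2P" unfolding X1_def by (rule weighted_mean_bound) (rule e2P)
      have b2: "ennreal \<bar>X2\<bar> \<le> ?e1P + ?e1X" unfolding X2_def by (rule weighted_mean_bound) (rule qb)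
      have b3: "ennreal \<bar>- X3\<bar> \<le> ?e1P + ?e1X" unfolding X3_def abs_minus_cancel by (rule qb[OF i(1)])
      have "\<Theta> y - K * (b - (1 - b) * (eP - eX)) = (b * X1 + b * X2) + - X3"
      proof -
        have "\<Theta> y = b * ((X1 + K) + (X2 + (eP - eX) * K)) - (X3 + (eP - eX) * K)"
          unfolding \<Theta>_def X1_def X2_def X3_def T1[symmetric] T2[symmetric] q_def[of i] i(2) by simp
        then show ?thesis by (simp add: algebra_simps)
      qed
      then have "ennreal \<bar>\<Theta> y - K * (b - (1 - b) * ((\<integral>\<omega>. real (size (crs (Palm y \<omega>))) \<partial>P) - measure lam UNIV))\<bar>
        \<le> (ennreal b * (?c2 + ?e2P) + ennreal b * (?e1P + ?e1X)) + (?e1P + ?e1X)"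
        unfolding size_diff by (simp only:) (intro ennreal_abs_add ennreal_abs_scale b01 b1 b2 b3)
      also have "\<dots> = ennreal (1 + b) * (?e1P + ?e1X) + ennreal b * ?c2 + ennreal b * ?e2P"
        using b01 by (simp add: ennreal_plus distrib_left distrib_right add_ac)
      also have "\<dots> = ?RHS y"
      proof -
        let ?f1 = "\<lambda>\<omega>. eps1 (r_Palm y \<omega>) (rbar_Palm y) (m y) (A y) (B y) (Palm y \<omega>)"
        let ?f2 = "\<lambda>\<omega>. eps1 (r y \<omega>) (rbar y) (m y) (A y) (B y) (\<Xi> \<omega>)"
        let ?f3 = "\<lambda>\<omega>. eps2 (r_Palm y \<omega>) (rbar_Palm y) (m y) (A y) (B y) (Palm y \<omega>)"
        have fm: "?f1 \<in> borel_measurable P" "?f2 \<in> borel_measurable P" "?f3 \<in> borel_measurable P" "(\<lambda>\<omega>. rbar y * ?mP \<omega>) \<in> borel_measurable P"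
          unfolding eps1_def eps2_def using meas r_m by (auto intro!: borel_measurable_add borel_measurable_times)
        have f0: "0 \<le> ?f1 \<omega>" "0 \<le> ?f2 \<omega>" "0 \<le> ?f3 \<omega>" "0 \<le> rbar y * ?mP \<omega>" if "\<omega> \<in> space P" for \<omega>
          unfolding eps1_def eps2_def using r0[OF that] rb0 m0 by (auto intro!: add_nonneg_nonneg mult_nonneg_nonneg)
        have "?RHS y = (\<integral>\<^sup>+\<omega>. ennreal (1 + b) * (ennreal (?f1 \<omega>) + ennreal (?f2 \<omega>)) + ennreal b * ennreal (rbar y * ?mP \<omega>) + ennreal b * ennreal (?f3 \<omega>) \<partial>P)"
        proof (rule nn_integral_cong)
          fix \<omega> assume "\<omega> \<in> space P"
          note f0 = f0[OF this]
          have "b * rbar y * ?mP \<omega> = b * (rbar y * ?mP \<omega>)" by simp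
          then show "ennreal ((1 + b) * (?f1 \<omega> + ?f2 \<omega>) + b * rbar y * ?mP \<omega> + b * ?f3 \<omega>)
            = ennreal (1 + b) * (ennreal (?f1 \<omega>) + ennreal (?f2 \<omega>)) + ennreal b * ennreal (rbar y * ?mP \<omega>) + ennreal b * ennreal (?f3 \<omega>)"
            using f0 b01 by (simp only:) (simp add: ennreal_plus[symmetric] ennreal_mult[symmetric] del: ennreal_plus)
        qed
        also have "\<dots> = ennreal (1 + b) * (?e1P + ?e1X) + ennreal b * ?c2 + ennreal b * ?e2P"
          using fm by (simp add: nn_integral_add nn_integral_cmult)
        finally show ?thesis ..
      qed
      finally show ?thesis .
    qed
    have "ennreal \<bar>\<integral>\<omega>. gen h (crs (\<Xi> \<omega>)) \<partial>P\<bar> \<le> ennreal cc"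
      unfolding cc(1)[symmetric] by (rule gen_bound[OF sq[unfolded S_def] balance[unfolded S_def L_def] pw])
    then have gen_cc: "\<bar>\<integral>\<omega>. gen h (crs (\<Xi> \<omega>)) \<partial>P\<bar> \<le> cc" using cc(2) by simp
    have pmf: "pmf (pbd_pmf a b 0) n * (a + b * real n) = pmf (pbd_pmf a b 0) (Suc n) * (real n + 1)" for n
      by (rule pbd_pmf_properties(1)[OF a0 b01])
    have 1: "\<bar>(\<integral>\<omega>. f' (crs (\<Xi> \<omega>)) \<partial>P) - (\<integral>n. iid n f' \<partial>measure_pmf (pbd_pmf a b 0))\<bar> \<le> e + cc"
      using approximation_identity[OF pmf pbd_pmf_properties(2)[OF a0 b01] prob_space_axioms crs_Xi size_Xi_int] gen_cc \<rho>e
      unfolding M0_def by linarith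
    have 2: "\<bar>(\<integral>\<xi>. f \<xi> \<partial>pbd_process a b 0 \<nu>) - (\<integral>n. iid n f' \<partial>measure_pmf (pbd_pmf a b 0))\<bar> \<le> mesh k G t"
      using lip_pbd_close[OF \<nu>_prob \<nu>_sets st[unfolded w_def] f dist_le_1] unfolding w_def f'_def .
    have fm: "f \<in> borel_measurable config_algebra" by (rule lip_d1_measurable[OF compact f])
    have f'b: "\<bar>f' M\<bar> \<le> \<bar>f' {#}\<bar> + 1" for M using f_osc[of M "{#}"] by linarith
    have 3: "\<bar>(\<integral>\<xi>. f \<xi> \<partial>distr P config_algebra \<Xi>) - (\<integral>\<omega>. f' (crs (\<Xi> \<omega>)) \<partial>P)\<bar> \<le> mesh k G t"
    proof -
      have i1: "integrable P (\<lambda>\<omega>. f (\<Xi> \<omega>))"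
      proof (rule integrable_const_bound[of _ "\<bar>f' {#}\<bar> + 1", OF _ measurable_compose[OF Xi_meas fm]])
        show "AE \<omega> in P. norm (f (\<Xi> \<omega>)) \<le> \<bar>f' {#}\<bar> + 1"
        proof (rule AE_I2)
          fix \<omega> assume "\<omega> \<in> space P"
          then have "f (\<Xi> \<omega>) = f' (pts (\<Xi> \<omega>))" unfolding f'_def using cfg_pts[OF Xi_configs] by simp
          then show "norm (f (\<Xi> \<omega>)) \<le> \<bar>f' {#}\<bar> + 1" using f'b by simp
        qed
      qed
      have i2: "integrable P (\<lambda>\<omega>. f' (crs (\<Xi> \<omega>)))" by (rule Xi_int[OF f'b])
      have "\<bar>\<integral>\<omega>. f (\<Xi> \<omega>) - f' (crs (\<Xi> \<omega>)) \<partial>P\<bar> \<le> (\<integral>\<omega>. mesh k G t \<partial>P)"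
      proof (rule order_trans[OF integral_abs_bound integral_mono])
        fix \<omega> assume \<omega>: "\<omega> \<in> space P"
        have "\<bar>f (\<Xi> \<omega>) - f' (crs (\<Xi> \<omega>))\<bar> \<le> d1 (\<Xi> \<omega>) (cfg (crs (\<Xi> \<omega>)))"
          using lip[of "pts (\<Xi> \<omega>)" "crs (\<Xi> \<omega>)"] cfg_pts[OF Xi_configs[OF \<omega>]] unfolding f'_def by simp
        also have "\<dots> \<le> mesh k G t" by (rule d1_crs_le[OF dist_c_le_mesh[OF dist_le_1] Xi_configs[OF \<omega>]])
        finally show "\<bar>f (\<Xi> \<omega>) - f' (crs (\<Xi> \<omega>))\<bar> \<le> mesh k G t" .
      qed (use i1 i2 in auto)
      then show ?thesis using i1 i2 integral_distr[OF Xi_meas fm] by (simp add: prob_space)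
    qed
    show "\<bar>(\<integral>\<xi>. f \<xi> \<partial>distr P config_algebra \<Xi>) - (\<integral>\<xi>. f \<xi> \<partial>pbd_process a b 0 \<nu>)\<bar> \<le> 2 * mesh k G t + cc + e"
      using 1 2 3 by linarith
  qed
  have mesh0: "0 \<le> mesh k G t" by (rule dist_c_le_mesh(2)[OF dist_le_1])
  show ?thesis
  proof (cases "\<integral>\<^sup>+y. ?RHS y \<partial>lam" rule: ennreal_cases)
    case (real cc)
    \<comment> \<open>A constant function shows that the supremum in \<open>d2\<close> is over a
      nonempty set.\<close>
    have "(\<lambda>_. 0) \<in> (lip_d1 :: ('a measure \<Rightarrow> real) set)"
    proof -
      have "0 \<le> d1 \<xi> \<eta>" if "\<xi> \<in> configs" "\<eta> \<in> configs" for \<xi> \<eta> :: "'a measure"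
        using d1_cfg_nonneg[of "pts \<xi>" "pts \<eta>"] cfg_pts[OF that(1)] cfg_pts[OF that(2)] by simp
      then show ?thesis unfolding lip_d1_def by simp
    qed
    then have "d2 (distr P config_algebra \<Xi>) (pbd_process a b 0 \<nu>) \<le> 2 * mesh k G t + cc"
      unfolding d2_def by (intro cSUP_least main[OF _ real(2) real(1)]) auto
    then have "ennreal (d2 (distr P config_algebra \<Xi>) (pbd_process a b 0 \<nu>)) \<le> ennreal (2 * mesh k G t + cc)"
      by (rule ennreal_leI)
    also have "\<dots> = ennreal (2 * mesh k G t) + ennreal cc" using mesh0 real(1) by (intro ennreal_plus) auto
    finally show ?thesis unfolding real(2) .
  qed simp
qed

end
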